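(* Let $M$ be a noncompact connected separable metrizable $n$-manifold (possibly with boundary $\partial M$) and let $\omega$ be a good Radon measure on $M$ with $\omega(\partial M)=0$. Then there exists a continuous map $s:\mathcal{S}(M,\omega)\to\mathcal{H}_\partial(M,\omega)_1$ such that $c^\omega\circ s=\mathrm{id}_{\mathcal{S}(M,\omega)}$ and $s(0)=\mathrm{id}_M$.
   Context: Measures. A Radon measure on $M$ is a Borel measure $\mu$ with $\mu(K)<\infty$ for every compact $K\subset M$. It is good if $\mu(\{p\})=0$ for every point $p$ and $\mu(U)>0$ for every nonempty open $U$. Ends. An end of $M$ is a function $e$ assigning to each compact $K\subset M$ a connected component $e(K)$ of $M-K$ such that $e(K_1)\supset e(K_2)$ whenever $K_1\subset K_2$. $E_M$ is the set of ends. The end compactification $\overline{M}=M\cup E_M$ has the topology in which $M$ is an open subspace and the basic neighborhoods of $e\in E_M$ are $e(K)\cup\{e'\in E_M: e'(K)=e(K)\}$, $K\subset M$ compact; $E_M$ has the subspace topology. For a Borel set $C\subset M$ with compact frontier, $E_C=\{e\in E_M: e(K)\subset C\text{ for some compact }K\}$; this is a clopen subset of $E_M$, and every clopen subset of $E_M$ has this form. An end $e$ is $\omega$-finite if $\omega(e(K))<\infty$ for some compact $K$; $E_M^\omega$ is the set of $\omega$-finite ends. End charges. An end charge of $M$ is a finitely additive function $c$ from the algebra of clopen subsets of $E_M$ to $\mathbb{R}$ (i.e. $c(F\cup G)=c(F)+c(G)$ for disjoint clopen $F,G$). $\mathcal{S}(E_M)$ is the linear space of all end charges with the weakest topology making $c\mapsto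 c(F)$ continuous for every clopen $F\subset E_M$. $\mathcal{S}(M,\omega)\subset\mathcal{S}(E_M)$ is the linear subspace (with subspace topology) of those $c$ with $c(E_M)=0$ and $c(F)=0$ for every clopen $F\subset E_M$ with $F\subset E_M^\omega$. Homeomorphism groups. Groups of homeomorphisms carry the compact-open topology. A homeomorphism $h$ of $M$ is $\omega$-preserving if $\omega(h(B))=\omega(B)$ for all Borel $B$. $\mathcal{H}_\partial(M,\omega)$ is the group of $\omega$-preserving homeomorphisms of $M$ that are the identity on $\partial M$, and $\mathcal{H}_\partial(M,\omega)_1$ is the path-component of $\mathrm{id}_M$ in it. Each homeomorphism $h$ of $M$ acts on ends by $h(e)(K)=h(e(h^{-1}(K)))$. $\mathcal{H}_{E_M}(M,\omega)$ is the group of $\omega$-preserving homeomorphisms of $M$ which fix every end; it contains $\mathcal{H}_\partial(M,\omega)_1$. End charge homomorphism. For $h\in\mathcal{H}_{E_M}(M,\omega)$, the end charge $c^\omega_h=c^\omega(h)\in\mathcal{S}(M,\omega)$ is defined by $c^\omega_h(F)=\omega(C-h(C))-\omega(h(C)-C)$, where $C\subset M$ is any Borel set with compact frontier and $E_C=F$ (both terms are finite and the value is independent of $C$). The map $c^\omega:\mathcal{H}_{E_M}(M,\omega)\to\mathcal{S}(M,\omega)$ is a continuous group homomorphism. *)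

theory Defs
  imports "HOL-Analysis.Analysis"
begin

text \<open>The manifold \<open>M\<close> is the whole universe of a type \<open>'a\<close>, so \<open>M - K\<close> is \<open>- K\<close>, homeomorphisms
  are total functions \<open>'a \<Rightarrow> 'a\<close>, and the Borel sets of \<open>M\<close> are \<open>sets borel\<close>.\<close>


section \<open>Manifolds with boundary\<close>

definition half_space :: "nat \<Rightarrow> (nat \<Rightarrow> real) topology"
  where "half_space n = subtopology (Euclidean_space n) {x. 0 \<le> x 0}"

definition manifold_with_boundary :: "nat \<Rightarrow> 'a topology \<Rightarrow> bool"
  where "manifold_with_boundary n X \<longleftrightarrow>
    metrizable_space X \<and> separable_space X \<and>
    (\<forall>x\<in>topspace X. \<exists>U V. openin X U \<and> x \<in> U \<and> openin (half_space n) V \<and>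
       subtopology X U homeomorphic_space subtopology (half_space n) V)"

definition manifold_interior :: "nat \<Rightarrow> 'a topology \<Rightarrow> 'a set"
  where "manifold_interior n X =
    {x \<in> topspace X. \<exists>U V. openin X U \<and> x \<in> U \<and> openin (Euclidean_space n) V \<and>
       subtopology X U homeomorphic_space subtopology (Euclidean_space n) V}"

definition manifold_boundary :: "nat \<Rightarrow> 'a topology \<Rightarrow> 'a set"
  where "manifold_boundary n X = topspace X - manifold_interior n X"


section \<open>Measures\<close>

definition radon_measure :: "'a::topological_space measure \<Rightarrow> bool"
  where "radon_measure \<mu> \<longleftrightarrow> sets \<mu> = sets borel \<and> (\<forall>K. compact K \<longrightarrow> emeasure \<mu> K < \<infinity>)"

definition good_measure :: "'a::topological_space measure \<Rightarrow> bool"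
  where "good_measure \<mu> \<longleftrightarrow>
    (\<forall>p. emeasure \<mu> {p} = 0) \<and> (\<forall>U. open U \<and> U \<noteq> {} \<longrightarrow> emeasure \<mu> U > 0)"


section \<open>Ends\<close>

text \<open>An end is a function on the compact subsets; outside of those it is \<open>undefined\<close>, so that
  equality of ends is equality of functions.\<close>

definition ends :: "('a::topological_space set \<Rightarrow> 'a set) set"
  where "ends = {e \<in> (\<Pi>\<^sub>E K\<in>{K. compact K}. components (- K)).
    \<forall>K1 K2. compact K1 \<and> compact K2 \<and> K1 \<subseteq> K2 \<longrightarrow> e K2 \<subseteq> e K1}"

definition end_nbhd :: "('a::topological_space set \<Rightarrow> 'a set) \<Rightarrow> 'a set \<Rightarrow> ('a + ('a set \<Rightarrow> 'a set)) set"
  where "end_nbhd e K = Inl ` e K \<union> Inr ` {e' \<in> ends. e' K = e K}"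

definition end_compactification :: "('a::topological_space + ('a set \<Rightarrow> 'a set)) topology"
  where "end_compactification = topology_generated_by
    ({Inl ` U | U. open U} \<union> {end_nbhd e K | e K. e \<in> ends \<and> compact K})"

definition end_topology :: "('a::topological_space set \<Rightarrow> 'a set) topology"
  where "end_topology = pullback_topology ends Inr end_compactification"

definition clopen_ends :: "('a::topological_space set \<Rightarrow> 'a set) set set"
  where "clopen_ends = {F. openin end_topology F \<and> closedin end_topology F}"

definition ends_of :: "'a::topological_space set \<Rightarrow> ('a set \<Rightarrow> 'a set) set"
  where "ends_of C = {e \<in> ends. \<exists>K. compact K \<and> e K \<subseteq> C}"

definition finite_ends :: "'a::topological_space measure \<Rightarrow> ('a set \<Rightarrow> 'a set) set"
  where "finite_ends \<omega> = {e \<in> ends. \<exists>K. compact K \<and> emeasure \<omega> (e K) < \<infinity>}"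


section \<open>End charges\<close>

definition end_charges :: "(('a::topological_space set \<Rightarrow> 'a set) set \<Rightarrow> real) set"
  where "end_charges = {c \<in> extensional clopen_ends.
    \<forall>F\<in>clopen_ends. \<forall>G\<in>clopen_ends. F \<inter> G = {} \<longrightarrow> c (F \<union> G) = c F + c G}"

definition end_charge_topology :: "(('a::topological_space set \<Rightarrow> 'a set) set \<Rightarrow> real) topology"
  where "end_charge_topology = topology_generated_by
    {{c \<in> end_charges. c F \<in> V} | F V. F \<in> clopen_ends \<and> open V}"

definition zero_charge :: "('a::topological_space set \<Rightarrow> 'a set) set \<Rightarrow> real"
  where "zero_charge = (\<lambda>F\<in>clopen_ends. 0)"

definition charges_on ::
    "'a::topological_space measure \<Rightarrow> (('a set \<Rightarrow> 'a set) set \<Rightarrow> real) set"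
  where "charges_on \<omega> = {c \<in> end_charges. c ends = 0 \<and>
    (\<forall>F\<in>clopen_ends. F \<subseteq> finite_ends \<omega> \<longrightarrow> c F = 0)}"

definition charges_on_topology ::
    "'a::topological_space measure \<Rightarrow> (('a set \<Rightarrow> 'a set) set \<Rightarrow> real) topology"
  where "charges_on_topology \<omega> = subtopology end_charge_topology (charges_on \<omega>)"


section \<open>Homeomorphism groups\<close>

definition compact_open_topology :: "('a::topological_space \<Rightarrow> 'b::topological_space) topology"
  where "compact_open_topology = topology_generated_by
    {{f. continuous_on UNIV f \<and> f ` K \<subseteq> U} | K U. compact K \<and> open U}"

definition preserving_homeos :: "'a::topological_space measure \<Rightarrow> ('a \<Rightarrow> 'a) set"
  where "preserving_homeos \<omega> = {h. homeomorphic_map euclidean euclidean h \<and>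
    (\<forall>B\<in>sets borel. emeasure \<omega> (h ` B) = emeasure \<omega> B)}"

definition homeos_rel_boundary :: "nat \<Rightarrow> 'a::topological_space measure \<Rightarrow> ('a \<Rightarrow> 'a) set"
  where "homeos_rel_boundary n \<omega> =
    {h \<in> preserving_homeos \<omega>. \<forall>x\<in>manifold_boundary n euclidean. h x = x}"

definition homeos_rel_boundary_1 :: "nat \<Rightarrow> 'a::topological_space measure \<Rightarrow> ('a \<Rightarrow> 'a) set"
  where "homeos_rel_boundary_1 n \<omega> =
    path_component_of_set (subtopology compact_open_topology (homeos_rel_boundary n \<omega>)) id"

definition end_action ::
    "('a::topological_space \<Rightarrow> 'a) \<Rightarrow> ('a set \<Rightarrow> 'a set) \<Rightarrow> 'a set \<Rightarrow> 'a set"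
  where "end_action h e = (\<lambda>K\<in>{K. compact K}. h ` e (h -` K))"

definition end_fixing_homeos :: "'a::topological_space measure \<Rightarrow> ('a \<Rightarrow> 'a) set"
  where "end_fixing_homeos \<omega> = {h \<in> preserving_homeos \<omega>. \<forall>e\<in>ends. end_action h e = e}"


section \<open>The end charge homomorphism\<close>

text \<open>The definite description says that the value is the same for every admissible \<open>C\<close>. Both
  differences have finite measure, so the real-valued \<open>measure\<close> loses nothing.\<close>

definition end_charge_hom ::
    "'a::topological_space measure \<Rightarrow> ('a \<Rightarrow> 'a) \<Rightarrow> ('a set \<Rightarrow> 'a set) set \<Rightarrow> real"
  where "end_charge_hom \<omega> = (\<lambda>h\<in>end_fixing_homeos \<omega>. \<lambda>F\<in>clopen_ends.
    THE r. \<forall>C. C \<in> sets borel \<and> compact (frontier C) \<and> ends_of C = F \<longrightarrow>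
      r = measure \<omega> (C - h ` C) - measure \<omega> (h ` C - C))"


section \<open>Basic facts\<close>

lemma topspace_end_topology: "topspace end_topology = ends"
proof -
  have "Inr e \<in> topspace end_compactification" if "e \<in> ends" for e :: "'a set \<Rightarrow> 'a set"
  proof -
    have "Inr e \<in> end_nbhd e {}"
      using that by (simp add: end_nbhd_def)
    moreover have "end_nbhd e {} \<in> {end_nbhd e K | e K. e \<in> ends \<and> compact K}"
      using that compact_empty by blast
    ultimately show ?thesis
      unfolding end_compactification_def topology_generated_by_topspace by (meson UnI2 UnionI)
  qed
  then show ?thesis
    by (auto simp: end_topology_def topspace_pullback_topology)
qed

lemma clopen_ends_ends: "ends \<in> clopen_ends"
  using openin_topspace[of end_topology] closedin_topspace[of end_topology]
  by (simp add: clopen_ends_def topspace_end_topology)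

lemma topspace_end_charge_topology: "topspace end_charge_topology = end_charges"
proof (rule equalityI)
  show "topspace end_charge_topology \<subseteq> end_charges"
    unfolding end_charge_topology_def topology_generated_by_topspace by (rule Union_least) auto
  have "end_charges = {c \<in> end_charges. c ends \<in> UNIV}"
    by simp
  then have "end_charges \<in> {{c \<in> end_charges. c F \<in> V} | F V. F \<in> clopen_ends \<and> open V}"
    using clopen_ends_ends open_UNIV by (intro CollectI exI conjI)
  then show "end_charges \<subseteq> topspace end_charge_topology"
    unfolding end_charge_topology_def topology_generated_by_topspace by (rule Union_upper)
qed

lemma topspace_charges_on_topology: "topspace (charges_on_topology \<omega>) = charges_on \<omega>"
proof -
  have "charges_on \<omega> \<subseteq> end_charges"
    unfolding charges_on_def by (rule Collect_restrict)
  then show ?thesis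
    by (simp add: charges_on_topology_def topspace_end_charge_topology inf_absorb2)
qed

lemma clopen_ends_Un: "F \<in> clopen_ends \<Longrightarrow> G \<in> clopen_ends \<Longrightarrow> F \<union> G \<in> clopen_ends"
  by (simp add: clopen_ends_def openin_Un closedin_Un)

lemma zero_charge_in_charges_on: "zero_charge \<in> charges_on \<omega>"
  by (simp add: zero_charge_def charges_on_def end_charges_def clopen_ends_ends clopen_ends_Un)

lemma topspace_compact_open_topology:
  "topspace compact_open_topology = {f. continuous_on UNIV f}"
proof (rule equalityI)
  show "topspace compact_open_topology \<subseteq> {f::'a \<Rightarrow> 'b. continuous_on UNIV f}"
    unfolding compact_open_topology_def topology_generated_by_topspace by (rule Union_least) auto
  have "{f::'a \<Rightarrow> 'b. continuous_on UNIV f} =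
      {f. continuous_on UNIV f \<and> f ` {} \<subseteq> UNIV}"
    by simp
  then have "{f::'a \<Rightarrow> 'b. continuous_on UNIV f} \<in>
      {{f. continuous_on UNIV f \<and> f ` K \<subseteq> U} | K U. compact K \<and> open U}"
    using compact_empty open_UNIV by (intro CollectI exI conjI)
  then show "{f::'a \<Rightarrow> 'b. continuous_on UNIV f} \<subseteq> topspace compact_open_topology"
    unfolding compact_open_topology_def topology_generated_by_topspace by (rule Union_upper)
qed

lemma id_in_homeos_rel_boundary_1: "id \<in> homeos_rel_boundary_1 n \<omega>"
proof -
  have "homeomorphic_map euclidean euclidean (id :: 'a \<Rightarrow> 'a)"
    by (simp add: homeomorphic_map_id)
  then have "id \<in> topspace (subtopology compact_open_topology (homeos_rel_boundary n \<omega>))"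
    by (simp add: topspace_compact_open_topology homeos_rel_boundary_def preserving_homeos_def
        continuous_on_id)
  then show ?thesis
    by (simp add: homeos_rel_boundary_1_def path_component_of_refl)
qed

end

(* On a chart cube a good measure is carried to Lebesgue measure by the Oxtoby-Ulam theorem: two measures of equal mass are matched by a
back-and-forth subdivision into cells, where a generic bend of a cell turns the cutting slice into a null set of prescribed position. In such charts
a continuous density is pushed to another one, rel boundary and continuously in parameters, by rearranging one coordinate line after the other;
sums of these moves realize every small function of mean zero supported in a connected open set of interior points (a block).
The complements of an exhaustion by compact sets form a tree of components of infinite measure. Mass is circulated along rays of this tree:
a ray is cut at alternate vertices into groups that lie in disjoint blocks, so that two rounds of density changes move one unit of mass
through each component on the ray and restore the measure. Only boundedly many rays meet a vertex; the coefficients of the rays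
are found from the top of the tree downwards so that the total flux is the prescribed end charge, and the infinite product converges locally.
By Koenig's lemma each clopen set of ends is determined by finitely many components, hence the flux determines the end charge. *)
theory Submission
 imports Defs "HOL-Probability.Probability"
begin

text \<open>Rearranging coordinate lines prescribes densities; it does not produce
  measure-preserving motions with flux. A unit circulation is therefore a quotient of two maps with
  the same target density, one assembled from blocks at even levels, the other from blocks at odd
  levels. The sign \<open>(-1) ^ Suc (fst x)\<close> turns a conserved flow into coefficients that
  sum to zero over a vertex and its children, which is the mean-zero condition of a block, and in
  each round every bump with nonzero coefficient belongs to exactly one block. The flux through a
  component does not cancel, because only the block of its parent straddles it, and that block
  occurs in one round only. A vertex lies in at most three groups of rays, so four colours separate
  all groups whose regions overlap; groups of one colour move simultaneously and the four products
  are composed. The supports of the blocks enter the choice of the exhaustion, before any flow is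
  known; hence one support per vertex has to serve all coefficient patterns with values -1, 0, 1.
  Arbitrary real amounts are then reached by iteration in steps of size at most 1.\<close>

type_synonym pt = "nat => real"

abbreviation cont :: "('a::topological_space => 'b::topological_space) => bool" where "cont == continuous_on UNIV"
abbreviation ind :: "'a set => 'a => real" where "ind == indicator"

lemmas cont_fun = continuous_on_coordinatewise_then_product
 and cont_coord = continuous_on_product_then_coordinatewise
 and cont_comp = continuous_on_compose2
 and cont_subset = continuous_on_subset

subsection \<open>Cubes and generic bends\<close>

text \<open>Coordinates from \<open>n\<close> on vanish, so the cubes of all dimensions lie in one
  type.\<close>

definition cube :: "nat => pt set"
 where "cube n = {x. (ALL i<n. 0 <= x i & x i <= 1) & (ALL i>=n. x i = 0)}"

definition bcube :: "nat => pt set"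
 where "bcube n = {x:cube n. EX i<n. x i = 0 \<or> x i = 1}"

definition cmeas :: "nat => pt measure => bool"
 where "cmeas n mu \<longleftrightarrow> sets mu = sets borel & finite_measure mu & emeasure mu (- cube n) = 0 &
  (ALL x. emeasure mu {x} = 0) & emeasure mu (bcube n) = 0 &
  (ALL U. open U & U Int cube n ~= {} --> emeasure mu (U Int cube n) > 0)"

lemma continuous_on_coord [continuous_intros]: "continuous_on S (%x::'i => 'b::topological_space. x i)"
 by (rule cont_subset[OF continuous_on_product_coordinates]) simp

lemma cube_eq_PiE: "cube n = PiE UNIV (%i. if i < n then {0..1} else {0})"
proof (intro set_eqI iffI)
 fix x assume "x:cube n"
 thus "x:PiE UNIV (%i. if i < n then {0..1} else {0})" by (simp add: cube_def PiE_iff)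
next
 fix x assume "x:PiE UNIV (%i. if i < n then {0..1} else {0::real})"
 hence "x i:(if i < n then {0..1} else {0})" for i by (simp only: PiE_iff) blast
 thus "x:cube n" by (simp add: cube_def) (metis atLeastAtMost_iff empty_iff insert_iff linorder_not_less)
qed

lemma compact_cube: "compact (cube n)"
proof -
 have "compactin (product_topology (%i. euclidean) UNIV) (cube n)" unfolding cube_eq_PiE compactin_PiE by auto
 thus ?thesis by (simp add: euclidean_product_topology)
qed

lemma closed_cube: "closed (cube n)" by (simp add: compact_cube compact_imp_closed)

lemma closed_coord_le: "closed {x :: nat => real. x i <= t}"
 and closed_coord_ge: "closed {x :: nat => real. x i >= t}"
 and closed_coord_eq: "closed {x :: nat => real. x i = t}" by (intro closed_Collect_le closed_Collect_eq continuous_intros)+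

lemma closed_cube_bd: "closed (bcube n)"
proof -
 have "bcube n = (UN i<n. cube n Int ({x. x i = 0} Un {x. x i = 1}))" by (auto simp: bcube_def)
 thus ?thesis by (simp add: closed_UN closed_Int closed_Un closed_cube closed_coord_eq)
qed

lemma bcube_subset: "bcube n <= cube n" by (auto simp: bcube_def)

lemma cube_fun_upd: "x:cube n ==> j < n ==> 0 <= u ==> u <= 1 ==> x(j := u):cube n" by (auto simp: cube_def)

lemma dist_fun_le:
 fixes x y :: "'i::countable => 'b::metric_space"
 assumes "!!i. dist (x i) (y i) <= d"
 shows "dist x y <= 2 * d"
proof (rule LIMSEQ_le_const)
 show "(%N. 2 * d + (1/2)^N) \<longlonglongrightarrow> 2 * d" using tendsto_add[OF tendsto_const LIMSEQ_power_zero[of "1/2::real"], of "2*d"] by simp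
 have "dist x y <= 2 * d + (1/2)^N" for N proof -
  have "finite {dist (x (from_nat n)) (y (from_nat n)) |n. n <= N}" by simp
  hence "Max {dist (x (from_nat n)) (y (from_nat n)) |n. n <= N} <= d" using assms by (subst Max_le_iff) auto
  thus ?thesis using dist_fun_le_dist_first_terms[of x y N] by linarith
 qed
 thus "EX N. ALL n>=N. dist x y <= 2 * d + (1/2)^n" by blast
qed

text \<open>The measure \<open>mu\<close> read in the coordinates of the embedded copy
  \<open>f\<close> of \<open>C\<close>; since measures push forward, the inverse of \<open>f\<close>
  is used.\<close>

definition pull :: "'b::topological_space set => ('b => 'a) => 'a::topological_space measure => 'b measure"
 where "pull C f mu = distr (restrict_space mu (f ` C)) borel (the_inv_into C f)"

context
 fixes C :: "'b::topological_space set" and f :: "'b => 'a::t2_space"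
 assumes C: "compact C" and f: "continuous_on C f" "inj_on f C"
begin

lemma closed_image_cell: "closed (f ` C)" by (simp add: C compact_continuous_image compact_imp_closed f)

lemma the_inv_measurable:
 assumes "sets mu = sets borel"
 shows "the_inv_into C f:measurable (restrict_space mu (f ` C)) borel"
proof -
 have "the_inv_into C f:measurable (restrict_space borel (f ` C)) borel" by (intro borel_measurable_continuous_on_restrict continuous_on_inv_into f C)
 moreover have "sets (restrict_space mu (f ` C)) = sets (restrict_space borel (f ` C))" by (intro sets_restrict_space_cong assms)
 ultimately show ?thesis using measurable_cong_sets by blast
qed

lemma the_inv_vimage: "the_inv_into C f -` B Int f ` C = f ` (B Int C)" using f(2) by (auto simp: the_inv_into_f_f)

lemma image_borel_cell:
 assumes "B:sets borel"
 shows "f ` (B Int C):sets borel"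
proof -
 have "the_inv_into C f -` B Int f ` C:sets (restrict_space borel (f ` C))"
  using measurable_sets[OF the_inv_measurable[OF refl] assms] by (simp add: space_restrict_space)
 thus ?thesis using closed_image_cell by (simp add: the_inv_vimage sets_restrict_space_iff)
qed

lemma sets_pull [simp]: "sets (pull C f mu) = sets borel" by (simp add: pull_def)

lemma emeasure_pull:
 assumes "sets mu = sets borel" "B:sets borel"
 shows "emeasure (pull C f mu) B = emeasure mu (f ` (B Int C))"
proof -
 have sp: "space mu = UNIV" using assms(1) sets_eq_imp_space_eq by force
 have "emeasure (pull C f mu) B = emeasure (restrict_space mu (f ` C)) (the_inv_into C f -` B Int f ` C)" unfolding pull_def
  by (subst emeasure_distr[OF the_inv_measurable]) (auto simp: assms space_restrict_space sp)
 also have "... = emeasure mu (f ` (B Int C))" unfolding the_inv_vimage by (rule emeasure_restrict_space) (use closed_image_cell assms(1) in "auto simp: sp")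
 finally show ?thesis .
qed

end

text \<open>By Fubini there is a \<open>te\<close> for which almost every pair of distinct points of
  \<open>S\<close> has distinct values of \<open>Z te\<close>. A level set of positive mass would
  contain a point \<open>x\<close> such that almost every other point has a different value; as
  \<open>x\<close> itself is null, so is the level set.\<close>

lemma generic_parameter:
 fixes Z :: "real => pt => real" and be :: "pt measure"
 assumes sets: "sets be = sets borel" and fin: "finite_measure be" and atom: "!!x. emeasure be {x} = 0"
  and S: "S:sets borel"
  and Z: "(%(te, x). Z te x):borel_measurable borel"
  and cnt: "!!x x'. x:S ==> x':S ==> x ~= x' ==> countable {te. Z te x = Z te x'}"
 obtains te where "!!s. emeasure be {x:S. Z te x = s} = 0"
proof -
 interpret finite_measure be by fact
 interpret P: pair_sigma_finite be be by standard
 interpret sigma_finite_measure "be \<Otimes>\<^sub>M be"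
  by (intro sigma_finite_pair_measure) unfold_locales
 interpret Q: pair_sigma_finite lborel "be \<Otimes>\<^sub>M be" by standard
 have [measurable_cong]: "sets be = sets borel" by fact
 have sp: "space be = UNIV" using sets sets_eq_imp_space_eq by force
 have Zm: "(%(te, x). Z te x):borel_measurable (borel \<Otimes>\<^sub>M borel)" using Z by (simp add: borel_prod)
 have [measurable]: "(%w. Z (a w) (b w)):borel_measurable N"
  if [measurable]: "a:borel_measurable N" "b:borel_measurable N" for a b and N :: "'c measure"
  using measurable_compose[OF measurable_Pair[OF that] Zm] by simp
 note [measurable] = S
 have DD[measurable]: "{p. fst p = snd p}:sets (be \<Otimes>\<^sub>M be)" proof -
  have "{p :: pt \<times> pt. fst p = snd p}:sets borel" by (intro borel_closed closed_Collect_eq continuous_intros)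
  moreover have "sets (be \<Otimes>\<^sub>M be) = sets (borel :: (pt \<times> pt) measure)" using sets_pair_measure_cong[OF sets sets]
   by (simp only: borel_prod[where 'a=pt and 'b=pt])
  ultimately show ?thesis by simp
 qed
 let ?P = "%te p. ~ (fst p:S & snd p:S & fst p ~= snd p & Z te (fst p) = Z te (snd p))"
 have DD': "Measurable.pred (be \<Otimes>\<^sub>M be) (%p. fst p = snd p)" using DD by (simp add: pred_def space_pair_measure sp)
 have DD'': "Measurable.pred (lborel \<Otimes>\<^sub>M (be \<Otimes>\<^sub>M be)) (%p. fst (snd p) = snd (snd p))"
  using measurable_compose[OF measurable_snd DD'] by simp
 note [measurable] = DD' DD''
 have m: "{x:space (lborel \<Otimes>\<^sub>M (be \<Otimes>\<^sub>M be)). ?P (fst x) (snd x)}:sets (lborel \<Otimes>\<^sub>M (be \<Otimes>\<^sub>M be))"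
  by measurable
 have "AE p in be \<Otimes>\<^sub>M be. AE te in lborel. ?P te p" proof (rule AE_I2)
  fix p
  show "AE te in lborel. ?P te p" proof (cases "fst p:S & snd p:S & fst p ~= snd p")
   case True
   hence "countable {te. Z te (fst p) = Z te (snd p)}" using cnt by blast
   hence "AE te in lborel. te~:{te. Z te (fst p) = Z te (snd p)}" by (intro AE_not_in countable_imp_null_set_lborel)
   thus ?thesis by eventually_elim auto
  qed simp
 qed
 hence "AE te in lborel. AE p in be \<Otimes>\<^sub>M be. ?P te p" using Q.AE_commute[OF m] by simp
 then obtain te where th: "AE p in be \<Otimes>\<^sub>M be. ?P te p"
 proof -
  assume *: "AE te in lborel. AE p in be \<Otimes>\<^sub>M be. ?P te p"
   and **: "!!te. AE p in be \<Otimes>\<^sub>M be. ?P te p ==> thesis"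
  have "EX te. AE p in be \<Otimes>\<^sub>M be. ?P te p" proof (rule ccontr)
   assume "~ ?thesis"
   hence "AE te::real in lborel. False" using * by simp
   hence "emeasure lborel (UNIV :: real set) = 0" by (subst (asm) AE_iff_measurable[of UNIV]) auto
   thus False by simp
  qed
  thus thesis using ** by blast
 qed
 have A: "AE x in be. AE y in be. ?P te (x, y)" by (rule P.AE_pair[OF th])
 have "emeasure be {x:S. Z te x = s} = 0" for s proof (rule ccontr)
  let ?A = "{x:S. Z te x = s}"
  have Am: "?A:sets be" proof -
   have "?A = {x:space be. x:S & Z te x = s}" by (simp add: sp)
   also have "...:sets be" by measurable
   finally show ?thesis .
  qed
  assume "~ ?thesis"
  hence notAE: "~ (AE x in be. x~:?A)" using Am by (subst AE_iff_measurable[OF Am]) (auto simp: sp)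
  have "EX x. x:?A & (AE y in be. ?P te (x, y))" proof (rule ccontr)
   assume "~ (EX x. x:?A & (AE y in be. ?P te (x, y)))"
   hence "AE x in be. x~:?A" using A by (auto elim: eventually_mono)
   thus False using notAE by simp
  qed
  then obtain x where x: "x:?A" "AE y in be. ?P te (x, y)"
   by blast
  have "AE y in be. y~:{x}" by (intro AE_not_in null_setsI) (simp_all add: atom sets)
  with x(2) have "AE y in be. y~:?A" by eventually_elim (use x(1) in auto)
  thus False using notAE by simp
 qed
 thus thesis using that by blast
qed

text \<open>The Moebius map of the unit interval that fixes 0 and 1 and multiplies the odds
  \<open>u / (1 - u)\<close> by \<open>E\<close>. Thus \<open>mob (1 / E)\<close> is its inverse,
  and logarithmic odds are translated by \<open>ln E\<close>.\<close>

definition mob :: "real => real => real"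
 where "mob E u = u * E / (1 - u + u * E)"

lemma mob_den_pos:
 fixes E u :: real
 assumes "0 < E" "0 <= u" "u <= 1"
 shows "0 < 1 - u + u * E"
proof (cases "u = 0")
 case False
 hence "0 < u * E" using assms by simp
 thus ?thesis using assms by linarith
qed (use assms in simp)

lemma mob_bounds:
 assumes "0 < E" "0 <= u" "u <= 1"
 shows "0 <= mob E u" "mob E u <= 1" using mob_den_pos[OF assms] assms by (auto simp: mob_def field_simps)

lemma mob_0 [simp]: "mob E 0 = 0" and mob_1 [simp]: "E ~= 0 ==> mob E 1 = 1" and mob_one [simp]: "mob 1 u = u" by (auto simp: mob_def)

lemma mob_inverse:
 assumes "0 < E" "0 <= u" "u <= 1"
 shows "mob (1 / E) (mob E u) = u"
proof -
 have d: "0 < 1 - u + u * E" by (rule mob_den_pos[OF assms])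
 have "1 - mob E u = (1 - u) / (1 - u + u * E)" using d by (simp add: mob_def field_simps)
 moreover have "mob E u * (1 / E) = u / (1 - u + u * E)" using assms by (simp add: mob_def)
 ultimately have "mob (1 / E) (mob E u) = u / (1 - u + u * E) / (((1 - u) + u) / (1 - u + u * E))"
  unfolding mob_def[of "1/E"] by (simp only: add_divide_distrib)
 thus ?thesis using d by simp
qed

lemma mob_le_iff:
 assumes "0 < E" "0 <= u" "u <= 1" "0 <= v" "v <= 1"
 shows "mob E u <= mob E v \<longleftrightarrow> u <= v"
proof -
 have du: "0 < 1 - u + u * E" and dv: "0 < 1 - v + v * E" using mob_den_pos assms by auto
 have "mob E u <= mob E v \<longleftrightarrow> u * E * (1 - v + v * E) <= v * E * (1 - u + u * E)"
  unfolding mob_def using du dv by (simp add: divide_le_eq le_divide_eq field_simps)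
 also have "... \<longleftrightarrow> u * E <= v * E" by (simp add: algebra_simps)
 also have "... \<longleftrightarrow> u <= v" using assms by simp
 finally show ?thesis .
qed

text \<open>In logarithmic odds the map is the translation by \<open>d * (s + p)\<close>, so the
  inequality can be solved for \<open>s\<close>. The resulting bound becomes the function
  \<open>Z\<close> of \<open>cut_lemma\<close>, whose level sets are the bent slices.\<close>

lemma mob_exp_iff:
 assumes y: "0 < y" "y < 1" and t: "0 < t" "t < 1" and d: "0 < d"
 shows "y <= mob (exp (d * (s + p))) t \<longleftrightarrow> (ln (y / (1 - y)) + ln ((1 - t) / t)) / d - p <= s"
  and "mob (exp (d * (s + p))) t <= y \<longleftrightarrow> s <= (ln (y / (1 - y)) + ln ((1 - t) / t)) / d - p" proof -
 let ?E = "exp (d * (s + p))"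
 have den: "0 < 1 - t + t * ?E" by (rule mob_den_pos) (use t in auto)
 let ?q = "y / (1 - y) * ((1 - t) / t)"
 have q: "0 < ?q" using y t by simp
 have lq: "ln (y / (1 - y)) + ln ((1 - t) / t) = ln ?q" using y t by (subst ln_mult) auto
 have "y <= mob ?E t \<longleftrightarrow> y * (1 - t + t * ?E) <= t * ?E" using den by (simp add: mob_def le_divide_eq)
 also have "... \<longleftrightarrow> y * (1 - t) <= ?E * ((1 - y) * t)" by (simp add: algebra_simps)
 also have "... \<longleftrightarrow> ?q <= ?E" using y t by (simp add: divide_le_eq)
 also have "... \<longleftrightarrow> ln ?q <= d * (s + p)" using ln_le_cancel_iff[OF q exp_gt_zero[of "d * (s + p)"]] by (simp only: ln_exp)
 also have "... \<longleftrightarrow> ln ?q / d - p <= s" using d by (simp add: field_simps)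
 finally show "y <= mob ?E t \<longleftrightarrow> (ln (y / (1 - y)) + ln ((1 - t) / t)) / d - p <= s" unfolding lq .
 have "mob ?E t <= y \<longleftrightarrow> t * ?E <= y * (1 - t + t * ?E)" using den by (simp add: mob_def divide_le_eq)
 also have "... \<longleftrightarrow> ?E * ((1 - y) * t) <= y * (1 - t)" by (simp add: algebra_simps)
 also have "... \<longleftrightarrow> ?E <= ?q" using y t by (simp add: le_divide_eq)
 also have "... \<longleftrightarrow> d * (s + p) <= ln ?q" using ln_le_cancel_iff[OF exp_gt_zero[of "d * (s + p)"] q] by (simp only: ln_exp)
 also have "... \<longleftrightarrow> s <= ln ?q / d - p" using d by (simp add: field_simps)
 finally show "mob ?E t <= y \<longleftrightarrow> s <= (ln (y / (1 - y)) + ln ((1 - t) / t)) / d - p" unfolding lq .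
qed

definition cube_homeo :: "nat => (pt => nat => real) => (pt => nat => real) => bool"
 where "cube_homeo n g g' \<longleftrightarrow> continuous_on (cube n) g & continuous_on (cube n) g' &
  (ALL x:cube n. g x:cube n & g' x:cube n & g' (g x) = x & g (g' x) = x)"

definition bend :: "nat => (pt => real) => pt => nat => real"
 where "bend j W x = x(j := mob (W x) (x j))"

lemma continuous_on_bend:
 assumes "j < n" "continuous_on (cube n) W" "!!x. x:cube n ==> 0 < W x"
 shows "continuous_on (cube n) (bend j W)"
proof (rule cont_fun)
 fix i
 have "continuous_on (cube n) (%x. mob (W x) (x j))" unfolding mob_def proof (intro continuous_intros assms ballI)
  fix x assume x: "x:cube n"
  hence "0 < 1 - x j + x j * W x" by (intro mob_den_pos) (use assms in "auto simp: cube_def")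
  thus "1 - x j + x j * W x ~= 0" by simp
 qed
 thus "continuous_on (cube n) (%x. bend j W x i)" by (cases "i = j") (auto simp: bend_def intro: continuous_intros)
qed

text \<open>The factor \<open>W\<close> does not see coordinate \<open>j\<close>, so it has the same
  value before and after the bend, and the reciprocal factor undoes it.\<close>

lemma bend_homeo:
 assumes j: "j < n" and W: "continuous_on (cube n) W" "!!x. x:cube n ==> 0 < W x"
  and ind: "!!x u. W (x(j := u)) = W x"
 shows "cube_homeo n (bend j W) (bend j (%x. 1 / W x))"
proof -
 have W': "continuous_on (cube n) (%x. 1 / W x)" "!!x. x:cube n ==> 0 < 1 / W x" using W by (auto intro!: continuous_intros simp: less_imp_neq[THEN not_sym])
 have c: "0 <= x j" "x j <= 1" if "x:cube n" for x using that j by (auto simp: cube_def)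
 have "bend j W x:cube n" "bend j (%x. 1 / W x) x:cube n"
  "bend j (%x. 1 / W x) (bend j W x) = x" "bend j W (bend j (%x. 1 / W x) x) = x"
  if x: "x:cube n" for x
 proof -
  show "bend j W x:cube n" "bend j (%x. 1 / W x) x:cube n" unfolding bend_def using mob_bounds[OF W(2)[OF x] c[OF x]] mob_bounds[OF W'(2)[OF x] c[OF x]]
   by (auto intro!: cube_fun_upd x j)
  show "bend j (%x. 1 / W x) (bend j W x) = x" using mob_inverse[OF W(2)[OF x] c[OF x]] by (simp add: bend_def ind)
  show "bend j W (bend j (%x. 1 / W x) x) = x" using mob_inverse[OF W'(2)[OF x] c[OF x]] by (simp add: bend_def ind)
 qed
 thus ?thesis by (simp add: cube_homeo_def continuous_on_bend[OF j W] continuous_on_bend[OF j W'])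
qed

definition icube :: "nat => pt set"
 where "icube n = {x. (ALL i<n. 0 < x i & x i < 1) & (ALL i>=n. x i = 0)}"

lemma icube_eq: "icube n = cube n - bcube n" by (auto simp: icube_def bcube_def cube_def less_le)

lemma icube_borel [measurable]: "icube n:sets borel" unfolding icube_eq by (intro sets.Diff borel_closed closed_cube closed_cube_bd)

lemma borel_measurable_coord [measurable]: "(%x :: nat => real. x i):borel_measurable borel" by (intro borel_measurable_continuous_onI continuous_on_coord)

lemma cmeasD:
 assumes "cmeas n mu"
 shows "sets mu = sets borel" "finite_measure mu" "emeasure mu (- cube n) = 0" "emeasure mu {x} = 0"
  "emeasure mu (bcube n) = 0" "open U ==> U Int cube n ~= {} ==> emeasure mu (U Int cube n) > 0" "space mu = UNIV"
 using assms sets_eq_imp_space_eq[of mu borel] by (auto simp: cmeas_def)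

lemma countable_null_slices:
 assumes "finite_measure al" "sets al = sets borel"
 shows "countable {t. emeasure al {x :: nat => real. x j = t} ~= 0}"
proof -
 interpret finite_measure al by fact
 have m: "(%x. x j):measurable al borel" using borel_measurable_coord measurable_cong_sets[OF assms(2) refl] by blast
 interpret D: finite_measure "distr al borel (%x. x j)"
  by (rule finite_measure_distr[OF m])
 have sp: "space al = UNIV" using assms(2) sets_eq_imp_space_eq by force
 have "emeasure (distr al borel (%x. x j)) {t} = emeasure al {x. x j = t}" for t
  by (subst emeasure_distr[OF m]) (auto simp: sp intro!: arg_cong[where f="emeasure al"])
 hence "(emeasure al {x. x j = t} ~= 0) = (measure (distr al borel (%x. x j)) {t} ~= 0)" for t
  by (metis D.emeasure_eq_measure ennreal_eq_0_iff measure_le_0_iff order_refl)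
 thus ?thesis using D.countable_support by simp
qed

lemma cmeas_AE: "cmeas n mu ==> AE x in mu. x:icube n"
proof -
 assume mu: "cmeas n mu"
 note A = cmeasD[OF mu]
 have "AE x in mu. x~:bcube n" "AE x in mu. x~:- cube n" by (intro AE_not_in null_setsI A; simp add: A closed_cube_bd closed_cube borel_comp)+
 thus ?thesis by eventually_elim (auto simp: icube_eq)
qed

lemma cmeas_Int:
 assumes "cmeas n mu" "S:sets borel"
 shows "emeasure mu (S Int icube n) = emeasure mu S"
proof (rule emeasure_eq_AE)
 show "AE x in mu. (x:S Int icube n) = (x:S)" using cmeas_AE[OF assms(1)] by eventually_elim auto
qed (use assms in "auto simp: cmeasD")

text \<open>The slice \<open>x j = t\<close> stays straight for \<open>al\<close> and is bent by
  \<open>g\<close> for \<open>be\<close>. The bend has two parameters: a generic \<open>te\<close>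
  makes all bent slices null for \<open>be\<close>, and then \<open>s\<close> moves the slice
  continuously until the mass below it is right.\<close>

lemma cut_lemma:
 assumes al: "cmeas n al" and be: "cmeas n be" and eq: "emeasure al UNIV = emeasure be UNIV"
  and j: "j < n"
 obtains t g g' where "1/3 <= t" "t <= 2/3" "cube_homeo n g g'" "!!x. x:bcube n ==> g x = x"
  "emeasure al {x:cube n. x j = t} = 0"
  "emeasure be (g ` {x:cube n. x j = t}) = 0"
  "emeasure be (g ` {x:cube n. x j <= t}) = emeasure al {x:cube n. x j <= t}"
proof -
 note A = cmeasD[OF al] and B = cmeasD[OF be]
 have finA: "finite_measure al" and finB: "finite_measure be" using al be by (simp_all add: cmeas_def)
 interpret A: finite_measure al by fact
 interpret B: finite_measure be by fact
 \<comment> \<open>Only countably many slices carry mass, so the middle third contains a null one.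
   Staying in the middle third gives every later cut the contraction factor 2/3.\<close>
 have "uncountable ({1/3<..<2/3::real} - {t. emeasure al {x. x j = t} ~= 0})" using countable_null_slices[OF finA A(1)]
  by (intro uncountable_minus_countable) (simp_all add: uncountable_open_interval)
 hence "{1/3<..<2/3::real} - {t. emeasure al {x. x j = t} ~= 0} ~= {}" by (intro notI) simp
 then obtain t where t: "1/3 < t" "t < 2/3" and t0': "emeasure al {x. x j = t} = 0"
  by auto
 have t01: "0 < t" "t < 1" using t by auto
 have t0: "emeasure al {x:cube n. x j = t} = 0" proof -
  have "emeasure al {x:cube n. x j = t} <= emeasure al {x. x j = t}" by (rule emeasure_mono) (auto simp: A closed_coord_eq)
  thus ?thesis using t0' by simp
 qed
 \<comment> \<open>\<open>ta\<close> vanishes on the faces of all other directions, so the bend with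
   factor \<open>exp (ta x * (s + p te x))\<close> fixes the boundary. The term \<open>p te\<close>
   tilts the slice, and \<open>Z te x\<close> is the value of \<open>s\<close> for which the bent
   slice passes through \<open>x\<close>.\<close>
 define ta where "ta x = (PROD i:{..<n}-{j}. x i * (1 - x i))" for x :: pt
 define p where "p te x = (SUM i:{..<n}-{j}. te ^ Suc i * x i)" for te :: real and x :: pt
 define Z where "Z te x = (ln (x j / (1 - x j)) + ln ((1 - t) / t)) / ta x - p te x" for te x
 have tapos: "0 < ta x" if "x:icube n" for x unfolding ta_def using that by (intro prod_pos) (auto simp: icube_def)
 have Zm: "(%(te, x). Z te x):borel_measurable (borel \<Otimes>\<^sub>M borel)" unfolding Z_def p_def ta_def case_prod_beta
  by (intro borel_measurable_diff borel_measurable_divide borel_measurable_add borel_measurable_ln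
    borel_measurable_sum borel_measurable_prod borel_measurable_times borel_measurable_power
    borel_measurable_const measurable_compose[OF measurable_snd borel_measurable_coord]
    measurable_fst)
 have Zm': "(%(te, x). Z te x):borel_measurable borel" using Zm by (simp only: borel_prod[where 'a=real and 'b=pt])
 have cnt: "countable {te. Z te x = Z te x'}"
  if x: "x:icube n" and x': "x':icube n" and ne: "x ~= x'" for x x'
 proof (cases "EX i:{..<n}-{j}. x i ~= x' i")
  case True
  then obtain i where i: "i < n" "i ~= j" "x i ~= x' i" by auto
  \<comment> \<open>The difference of the two values of \<open>Z\<close> is a polynomial in
    \<open>te\<close> whose coefficient at \<open>te ^ Suc i\<close> is \<open>x' i - x i\<close>,
    hence nonzero; it has finitely many roots.\<close>
  define c where "c k = (case k of 0 => (ln (x j / (1 - x j)) + ln ((1 - t) / t)) / ta x - (ln (x' j / (1 - x' j)) + ln ((1 - t) / t)) / ta x'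
   | Suc i => if i ~= j then x' i - x i else 0)" for k
  have "Z te x - Z te x' = (SUM k<=n. c k * te ^ k)" for te proof -
   have "(SUM k<=n. c k * te ^ k) = c 0 + (SUM i<n. c (Suc i) * te ^ Suc i)" by (subst sum.atMost_shift) simp
   also have "(SUM i<n. c (Suc i) * te ^ Suc i) = (SUM i:{..<n}-{j}. te ^ Suc i * x' i - te ^ Suc i * x i)"
    by (rule sum.mono_neutral_cong_right) (auto simp: c_def algebra_simps)
   finally show ?thesis by (simp add: Z_def p_def c_def sum_subtractf)
  qed
  hence "{te. Z te x = Z te x'} = {te. (SUM k<=n. c k * te ^ k) = 0}" by (simp flip: right_minus_eq[of "Z _ _"])
  moreover have "c (Suc i) ~= 0" "Suc i <= n" using i by (auto simp: c_def)
  ultimately show ?thesis using polyfun_finite_roots[where n=n and c=c] by (metis (no_types, lifting) countable_finite)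
 next
  case False
  hence eq: "x i = x' i" if "i ~= j" for i using x x' that False by (cases "i < n") (auto simp: icube_def)
  hence "ta x = ta x'" "!!te. p te x = p te x'" by (simp_all add: ta_def p_def)
  have "x j ~= x' j" proof
   assume "x j = x' j"
   hence "x = x'" using eq by (metis ext)
   thus False using ne by simp
  qed
  have xj: "0 < x j" "x j < 1" "0 < x' j" "x' j < 1" using x x' j by (auto simp: icube_def)
  have "ln (x j / (1 - x j)) ~= ln (x' j / (1 - x' j))" proof
   assume "ln (x j / (1 - x j)) = ln (x' j / (1 - x' j))"
   hence "x j / (1 - x j) = x' j / (1 - x' j)" using xj by (subst (asm) ln_inj_iff) auto
   hence "x j = x' j" using xj by (simp add: field_simps)
   thus False using \<open>x j ~= x' j\<close> by simp
  qed
  hence "Z te x ~= Z te x'" for te using tapos[OF x'] by (simp add: Z_def \<open>ta x = ta x'\<close> \<open>p te x = p te x'\<close>)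
  thus ?thesis by simp
 qed
 obtain te where th: "!!s. emeasure be {x:icube n. Z te x = s} = 0" using generic_parameter[OF B(1) B(2) B(4) icube_borel Zm' cnt] by blast
 have Zte: "Z te:borel_measurable borel" using measurable_compose[OF measurable_Pair[OF measurable_const measurable_ident] Zm, of te] by simp
 have Zter: "Z te:borel_measurable (restrict_space be (icube n))" using measurable_restrict_space1[OF Zte, of "icube n"]
   measurable_cong_sets[OF sets_restrict_space_cong[OF B(1)] refl] by blast
 let ?R = "restrict_space be (icube n)"
 \<comment> \<open>The distribution function of \<open>Z te\<close> at \<open>s\<close> is the
   \<open>be\<close>-mass below the bent slice. Null level sets make it continuous, and positivity
   of \<open>al\<close> on both sides of the straight slice puts \<open>c\<close> strictly between
   its limits.\<close>
 define N where "N = distr ?R borel (Z te)"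
 have finR: "finite_measure ?R" by (rule finite_measure_restrict_space[OF B(2)]) (simp add: B)
 interpret N: finite_borel_measure N
  unfolding N_def finite_borel_measure_def finite_borel_measure_axioms_def using finite_measure.finite_measure_distr[OF finR Zter] by simp
 have Nem: "emeasure N S = emeasure be {x:icube n. Z te x:S}" if S: "S:sets borel" for S proof -
  have "emeasure N S = emeasure ?R (Z te -` S Int icube n)" unfolding N_def by (subst emeasure_distr[OF Zter S]) (simp add: space_restrict_space B)
  also have "... = emeasure be (Z te -` S Int icube n)" by (rule emeasure_restrict_space) (auto simp: B)
  also have "Z te -` S Int icube n = {x:icube n. Z te x:S}" by auto
  finally show ?thesis .
 qed
 have intUNIV: "emeasure be (icube n) = emeasure be UNIV" using cmeas_Int[OF be, of UNIV] by simp
 let ?L = "{x:cube n. x j <= t}"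
 define c where "c = measure al ?L"
 have L: "closed ?L" "closed {x:cube n. x j = t}" using closed_Int[OF closed_cube closed_coord_le] closed_Int[OF closed_cube closed_coord_eq]
  by (simp_all add: Int_def)
 have mid: "(%i. if i = j then u else if i < n then 1/2 else 0):cube n" if "0 <= u" "u <= 1" for u using that j by (auto simp: cube_def)
 have "0 < emeasure al ({x. x j < t} Int cube n)" proof (rule A(6))
  show "open {x :: nat => real. x j < t}" by (intro open_Collect_less continuous_on_coord continuous_on_const)
  have "(%i. if i = j then 0 else if i < n then 1/2 else 0):{x. x j < t} Int cube n" using mid[of 0] t01 by simp
  thus "{x. x j < t} Int cube n ~= {}" by (metis emptyE)
 qed
 also have "... <= emeasure al ?L" by (intro emeasure_mono) (use L(1) in "simp_all add: A(1) borel_closed subset_iff")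
 finally have c0: "0 < c" by (simp add: c_def A.emeasure_eq_measure)
 have gt: "0 < emeasure al ({x. t < x j} Int cube n)" proof (rule A(6))
  show "open {x :: nat => real. t < x j}" by (intro open_Collect_less continuous_on_coord continuous_on_const)
  have "(%i. if i = j then 1 else if i < n then 1/2 else 0):{x. t < x j} Int cube n" using mid[of 1] t01 by simp
  thus "{x. t < x j} Int cube n ~= {}" by (metis emptyE)
 qed
 have Gm: "{x. t < x j} Int cube n:sets al"
  unfolding A(1) by (intro sets.Int borel_open borel_closed closed_cube open_Collect_less continuous_on_coord continuous_on_const)
 have "emeasure al ?L + emeasure al ({x. t < x j} Int cube n) = emeasure al (?L Un ({x. t < x j} Int cube n))"
  by (rule plus_emeasure) (use Gm L(1) in "auto simp: A(1) borel_closed")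
 also have "... <= emeasure be UNIV" unfolding eq[symmetric] by (rule emeasure_mono) (simp_all add: A(1))
 finally have c1': "emeasure al ?L + emeasure al ({x. t < x j} Int cube n) <= emeasure be UNIV" .
 have spN: "space N = UNIV" by (simp add: N_def)
 have c1: "c < measure N (space N)" using gt Nem[of UNIV] intUNIV c1' by (simp add: c_def A.emeasure_eq_measure B.emeasure_eq_measure N.emeasure_eq_measure spN
    flip: ennreal_plus)
 have cont: "isCont (cdf N) s" for s using Nem[of "{s}"] th[of s] by (simp add: N.isCont_cdf measure_def)
 obtain a where a: "cdf N a < c" using order_tendstoD(2)[OF N.cdf_lim_at_bot c0] by (metis eventually_at_bot_linorder order_refl)
 obtain b where b: "c < cdf N b" using order_tendstoD(1)[OF N.cdf_lim_at_top c1] by (metis eventually_at_top_linorder order_refl)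
 have "a <= b" using a b N.cdf_nondecreasing[of b a] by linarith
 then obtain s where s: "cdf N s = c"
  using IVT'[of "cdf N" a c b] a b cont by (meson continuous_at_imp_continuous_on less_imp_le)
 define W where "W x = exp (ta x * (s + p te x))" for x
 have Wind: "W (x(j := u)) = W x" for x u by (simp add: W_def ta_def p_def)
 have Wc: "continuous_on (cube n) W" unfolding W_def ta_def p_def by (intro continuous_intros continuous_on_coord)
 have Wpos: "0 < W x" for x by (simp add: W_def)
 define g where "g = bend j W"
 define g' where "g' = bend j (%x. 1 / W x)"
 have hom: "cube_homeo n g g'" unfolding g_def g'_def by (intro bend_homeo j Wc Wpos Wind)
 have bd: "g x = x" if xbd: "x:bcube n" for x proof (cases "x j = 0 \<or> x j = 1")
  case True
  thus ?thesis using Wpos[of x] by (auto simp: g_def bend_def)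
 next
  case False
  moreover obtain i where "i < n" "x i = 0 \<or> x i = 1" using xbd by (auto simp: bcube_def)
  ultimately have "i < n" "i ~= j" "x i = 0 \<or> x i = 1" by auto
  hence "ta x = 0" unfolding ta_def by (intro prod_zero) auto
  thus ?thesis by (simp add: g_def bend_def W_def)
 qed
 have gj: "g x j = mob (W (g x)) (x j)" for x by (simp add: g_def bend_def Wind)
 have cj: "0 <= x j" "x j <= 1" if "x:cube n" for x using that j by (auto simp: cube_def)
 have img: "g ` {x:cube n. Q (x j)} = {y:cube n. Q (g' y j)}" for Q using hom unfolding cube_homeo_def by (auto simp: image_iff) (metis)
 have le: "g' y j <= t \<longleftrightarrow> Z te y <= s" "g' y j >= t \<longleftrightarrow> Z te y >= s" if y: "y:icube n" for y proof -
  have yc: "y:cube n" using y by (simp add: icube_eq)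
  hence gy: "g' y:cube n" "g (g' y) = y" using hom by (auto simp: cube_homeo_def)
  have y01: "0 < y j" "y j < 1" using y j by (auto simp: icube_def)
  have yj: "y j = mob (W y) (g' y j)" using gj[of "g' y"] gy by simp
  have "g' y j <= t \<longleftrightarrow> y j <= mob (W y) t" by (subst yj, subst mob_le_iff) (use Wpos cj[OF gy(1)] t01 in auto)
  also have "... \<longleftrightarrow> Z te y <= s" unfolding W_def Z_def by (rule mob_exp_iff(1)[OF y01 t01 tapos[OF y]])
  finally show "g' y j <= t \<longleftrightarrow> Z te y <= s" .
  have "g' y j >= t \<longleftrightarrow> y j >= mob (W y) t" by (subst yj, subst mob_le_iff) (use Wpos cj[OF gy(1)] t01 in auto)
  also have "... \<longleftrightarrow> Z te y >= s" unfolding W_def Z_def by (rule mob_exp_iff(2)[OF y01 t01 tapos[OF y]])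
  finally show "g' y j >= t \<longleftrightarrow> Z te y >= s" .
 qed
 have clo: "closed (g ` S)" if "closed S" "S <= cube n" for S proof -
  have "compact S" using that compact_Int_closed[OF compact_cube[of n] that(1)] by (simp add: Int_absorb1)
  thus ?thesis using hom that by (meson compact_continuous_image compact_imp_closed cont_subset cube_homeo_def)
 qed
 have gL: "closed (g ` ?L)" "closed (g ` {x:cube n. x j = t})" by (intro clo L; auto)+
 have "emeasure be (g ` {x:cube n. x j = t}) = emeasure be {x:icube n. Z te x = s}" proof -
  have "g ` {x:cube n. x j = t} Int icube n = {x:icube n. Z te x = s}" unfolding img[of "%u. u = t"] using le by (auto simp: order_eq_iff icube_eq)
  thus ?thesis using cmeas_Int[OF be, of "g ` {x:cube n. x j = t}"] gL by (simp add: borel_closed)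
 qed
 hence R1: "emeasure be (g ` {x:cube n. x j = t}) = 0" using th by simp
 have "emeasure be (g ` ?L) = emeasure be {x:icube n. Z te x:{..s}}" proof -
  have "g ` ?L Int icube n = {x:icube n. Z te x:{..s}}" unfolding img[of "%u. u <= t"] using le by (auto simp: icube_eq)
  thus ?thesis using cmeas_Int[OF be, of "g ` ?L"] gL by (simp add: borel_closed)
 qed
 also have "... = emeasure N {..s}" by (subst Nem) auto
 also have "... = emeasure al ?L" using s by (simp add: N.emeasure_eq_measure A.emeasure_eq_measure c_def cdf_def2)
 finally have R2: "emeasure be (g ` ?L) = emeasure al ?L" .
 show ?thesis by (rule that[OF _ _ hom bd t0 R1 R2]) (use t in auto)
qed

text \<open>The image of \<open>x\<close> is the common point of the sets \<open>Y x p\<close>, the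
  union of the partners of all cells of stage \<open>p\<close> that contain \<open>x\<close>. These
  are compact, decrease by refinement, and have diameter at most \<open>2 * e p\<close> because
  partners of meeting cells meet. Only the target cells have to shrink.\<close>

lemma matching_map:
 fixes A :: "nat => 'i => 'a::metric_space set" and B :: "nat => 'i => 'b::metric_space set"
 assumes fin: "!!p. finite (I p)"
  and cov: "!!p. X = (UN i:I p. A p i)"
  and cl: "!!p i. i:I p ==> compact (A p i)" "!!p i. i:I p ==> compact (B p i)"
  and ne: "!!p i. i:I p ==> B p i ~= {}"
  and match: "!!p i i'. i:I p ==> i':I p ==> A p i Int A p i' ~= {} ==> B p i Int B p i' ~= {}"
  and ref: "!!p i. i:I (Suc p) ==> EX i0:I p. A (Suc p) i <= A p i0 & B (Suc p) i <= B p i0"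
  and mesh: "!!p i y y'. i:I p ==> y:B p i ==> y':B p i ==> dist y y' <= e p"
  and e: "e \<longlonglongrightarrow> 0"
 obtains h where "continuous_on X h"
  "!!x p. x:X ==> EX i:I p. x:A p i & h x:B p i"
  "!!x y. x:X ==> (!!p. EX i:I p. x:A p i & y:B p i) ==> y = h x"
  "!!p i x y. i:I p ==> x:A p i ==> y:B p i ==> dist y (h x) <= 2 * e p"
proof -
 define Y where "Y x p = (UN i:{i:I p. x:A p i}. B p i)" for x p
 have close: "dist y y' <= 2 * e p" if y: "y:Y x p" "y':Y x p" for x y y' p proof -
  obtain i i' where i: "i:I p" "x:A p i" "y:B p i" "i':I p" "x:A p i'" "y':B p i'" using y by (auto simp: Y_def)
  have "A p i Int A p i' ~= {}" using i(2,5) by auto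
  then obtain z where "z:B p i" "z:B p i'"
   using match[OF i(1,4)] by auto
  thus ?thesis using mesh[OF i(1,3), of z] mesh[OF i(4) _ i(6), of z] dist_triangle[of y y' z] by linarith
 qed
 have "EX y. ALL p. y:Y x p" if x: "x:X" for x proof -
  have S: "Y x (Suc p) <= Y x p" for p proof
   fix y assume "y:Y x (Suc p)"
   then obtain i where i: "i:I (Suc p)" "x:A (Suc p) i" "y:B (Suc p) i"
    by (auto simp: Y_def)
   obtain i0 where "i0:I p" "A (Suc p) i <= A p i0" "B (Suc p) i <= B p i0" using ref[OF i(1)] by blast
   thus "y:Y x p" using i by (auto simp: Y_def)
  qed
  have mono: "Y x q <= Y x p" if "p <= q" for p q using lift_Suc_antimono_le[of "Y x", OF S that] .
  have cY: "compact (Y x p)" for p unfolding Y_def by (rule compact_UN) (use fin cl in auto)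
  have nY: "Y x p ~= {}" for p proof -
   obtain i where "i:I p" "x:A p i" using x cov[of p] by auto
   thus ?thesis using ne[of i p] by (auto simp: Y_def)
  qed
  have "Y x 0 Int (INT p:UNIV. Y x p) ~= {}" proof (rule compact_imp_fip_image[OF cY])
   show "closed (Y x p)" for p by (rule compact_imp_closed[OF cY])
   fix J :: "nat set" assume J: "finite J"
   have "Y x (Max (insert 0 J)) <= Y x 0 Int (INT p:J. Y x p)" using mono[OF Max_ge[of "insert 0 J"]] J by blast
   thus "Y x 0 Int (INT p:J. Y x p) ~= {}" using nY by blast
  qed
  thus ?thesis by auto
 qed
 then obtain h where h: "!!x p. x:X ==> h x:Y x p" by metis
 have h1: "EX i:I p. x:A p i & h x:B p i" if "x:X" for x p using h[OF that, of p] by (auto simp: Y_def)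
 have h2: "y = h x" if x: "x:X" and y: "!!p. EX i:I p. x:A p i & y:B p i" for x y proof -
  have "y:Y x p" for p using y[of p] by (auto simp: Y_def)
  hence "dist y (h x) <= 2 * e p" for p using close h[OF x] by blast
  moreover have "(%p. 2 * e p) \<longlonglongrightarrow> 2 * 0" by (intro tendsto_intros e)
  ultimately have "dist y (h x) <= 2 * 0" by (metis LIMSEQ_le_const)
  thus ?thesis by simp
 qed
 have h3: "dist y (h x) <= 2 * e p" if "i:I p" "x:A p i" "y:B p i" for p i x y proof (rule close)
  show "y:Y x p" using that by (auto simp: Y_def)
  have "x:X" using that cov[of p] by auto
  thus "h x:Y x p" by (rule h)
 qed
 have hc: "continuous_on X h" unfolding continuous_on_iff proof (intro ballI allI impI)
  fix x and ep :: real assume x: "x:X" and ep: "0 < ep"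
  have "eventually (%p. e p < ep / 5) sequentially" using e ep by (intro order_tendstoD) auto
  then obtain p where p: "e p < ep / 5"
   using eventually_happens' sequentially_bot by blast
  \<comment> \<open>The finitely many cells that miss \<open>x\<close> form a closed set; outside it
    every cell containing \<open>x'\<close> also contains \<open>x\<close>, and both images are
    close to one partner cell.\<close>
  let ?F = "UN i:{i:I p. x~:A p i}. A p i"
  have "closed ?F" by (rule closed_UN) (use fin cl in "auto intro: compact_imp_closed")
  hence oF: "open (- ?F)" by (simp only: open_Compl)
  have "x:- ?F" by auto
  with oF obtain d where d: "0 < d" "ball x d <= - ?F" by (rule openE)
  show "EX d>0. ALL x':X. dist x' x < d --> dist (h x') (h x) < ep" proof (intro exI conjI ballI impI)
   fix x' assume x': "x':X" "dist x' x < d"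
   hence "x'~:?F" using d(2) by (auto simp: subset_iff dist_commute)
   obtain i where i: "i:I p" "x':A p i" using x'(1) cov[of p] by auto
   hence xi: "x:A p i" using \<open>x'~:?F\<close> by auto
   obtain y where y: "y:B p i" using ne[OF i(1)] by auto
   have "dist (h x') (h x) <= 2 * e p + 2 * e p" using h3[OF i(1) i(2) y] h3[OF i(1) xi y] dist_triangle[of "h x'" "h x" y] by (simp add: dist_commute)
   thus "dist (h x') (h x) < ep" using p ep by linarith
  qed (rule d)
 qed
 show thesis by (rule that[OF hc h1 h2 h3])
qed

section \<open>The two halves of a cube cut at \<open>x j = t\<close>\<close>

definition half :: "bool => real => nat => pt => nat => real"
 where "half b t j x = x(j := if b then t + (1 - t) * x j else t * x j)"

lemma convex_bounds:
 fixes t u :: real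
 assumes t: "0 < t" "t < 1" and u: "0 <= u" "u <= 1"
 shows "0 <= t * u" "t * u <= t" "t * u < 1" "0 < t + (1 - t) * u" "t <= t + (1 - t) * u" "t + (1 - t) * u <= 1"
  "t + (1 - t) * u = 1 \<longleftrightarrow> u = 1" "t * u = 0 \<longleftrightarrow> u = 0"
proof -
 have a: "0 <= (1 - t) * u" "(1 - t) * u <= 1 - t" using mult_left_mono[of u 1 "1 - t"] t u by simp_all
 have b: "0 <= t * u" "t * u <= t" using mult_left_mono[of u 1 t] t u by simp_all
 show "0 <= t * u" "t * u <= t" using b by this
 show "t * u < 1" using b t by linarith
 show "0 < t + (1 - t) * u" "t <= t + (1 - t) * u" "t + (1 - t) * u <= 1" using a t by linarith+
 show "t + (1 - t) * u = 1 \<longleftrightarrow> u = 1" proof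
  assume "t + (1 - t) * u = 1"
  hence "(1 - t) * (u - 1) = 0" by (simp add: algebra_simps)
  thus "u = 1" using t by simp
 qed simp
 show "t * u = 0 \<longleftrightarrow> u = 0" using t by simp
qed

context
 fixes n j :: nat and t :: real
 assumes j: "j < n" and t: "0 < t" "t < 1"
begin

lemma half_coord: "x:cube n ==> 0 <= x j & x j <= 1" using j by (auto simp: cube_def)

lemma half_in_cube: "x:cube n ==> half b t j x:cube n" unfolding half_def using convex_bounds[OF t, of "x j"] half_coord[of x] by (intro cube_fun_upd j) auto

lemma continuous_on_half: "continuous_on S (half b t j)"
proof (rule cont_fun)
 fix i show "continuous_on S (%x. half b t j x i)"
  unfolding half_def by (cases "i = j"; cases b) (auto intro!: continuous_intros continuous_on_coord)
qed

lemma half_inj: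
 assumes "half b t j x = half b t j y" shows "x = y"
proof
 fix i show "x i = y i"
  using fun_cong[OF assms, of i] t by (cases "i = j"; cases b) (auto simp: half_def)
qed

lemma half_image: "half b t j ` cube n = {x:cube n. if b then t <= x j else x j <= t}"
proof (intro equalityI subsetI)
 fix y assume "y:half b t j ` cube n"
 then obtain x where x: "x:cube n" "y = half b t j x" by auto
 have "half b t j x:cube n" by (rule half_in_cube[OF x(1)])
 moreover have "if b then t <= half b t j x j else half b t j x j <= t" using convex_bounds[OF t, of "x j"] half_coord[OF x(1)] by (simp add: half_def)
 ultimately show "y:{x:cube n. if b then t <= x j else x j <= t}" using x by simp
next
 fix y assume y: "y:{x:cube n. if b then t <= x j else x j <= t}"
 hence yc: "y:cube n" by simp
 define x where "x = y(j := if b then (y j - t) / (1 - t) else y j / t)"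
 have "x:cube n" unfolding x_def using y half_coord[OF yc] t by (intro cube_fun_upd yc j) (auto simp: field_simps)
 moreover have "half b t j x = y" using t by (auto simp: half_def x_def)
 ultimately show "y:half b t j ` cube n" by (metis image_eqI)
qed

lemma half_bd:
 assumes "x:cube n" "half b t j x:bcube n" shows "x:bcube n"
proof -
 have "EX i<n. half b t j x i = 0 \<or> half b t j x i = 1" using assms(2) unfolding bcube_def by simp
 then obtain i where i: "i < n" "half b t j x i = 0 \<or> half b t j x i = 1"
  by blast
 have "x i = 0 \<or> x i = 1" proof (cases "i = j")
  case True
  have "0 < t + (1 - t) * x j" "t * x j < 1" "t + (1 - t) * x j = 1 \<longleftrightarrow> x j = 1" "t * x j = 0 \<longleftrightarrow> x j = 0"
   using convex_bounds[OF t, of "x j"] half_coord[OF assms(1)] by simp_all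
  thus ?thesis using i(2) True by (cases b) (simp_all add: half_def)
 qed (use i(2) in "simp add: half_def")
 thus ?thesis using assms(1) i(1) by (auto simp: bcube_def)
qed

text \<open>The two halves have only the cut in common, and there the parameter of each is on its
  own face \<open>x j = 1\<close> or \<open>x j = 0\<close>.\<close>

lemma half_eq_bd:
 assumes "x:cube n" "y:cube n" "half b t j x = half (~ b) t j y"
 shows "x:bcube n" "y:bcube n"
proof -
 have e: "half b t j x j = half (~ b) t j y j" using assms(3) by simp
 have "(x j = 0 \<or> x j = 1) & (y j = 0 \<or> y j = 1)" proof (cases b)
  case True
  hence "t + (1 - t) * x j = t * y j" using e by (simp add: half_def)
  moreover have "t * y j <= t" "t <= t + (1 - t) * x j"
   using convex_bounds[OF t, of "x j"] convex_bounds[OF t, of "y j"] half_coord[OF assms(1)] half_coord[OF assms(2)] by auto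
  ultimately have "t * y j = t * 1" "(1 - t) * x j = 0" by linarith+
  thus ?thesis using t by simp
 next
  case False
  hence "t + (1 - t) * y j = t * x j" using e by (simp add: half_def)
  moreover have "t * x j <= t" "t <= t + (1 - t) * y j"
   using convex_bounds[OF t, of "x j"] convex_bounds[OF t, of "y j"] half_coord[OF assms(1)] half_coord[OF assms(2)] by auto
  ultimately have "t * x j = t * 1" "(1 - t) * y j = 0" by linarith+
  thus ?thesis using t by simp
 qed
 thus "x:bcube n" "y:bcube n" using assms(1,2) j by (auto simp: bcube_def)
qed

lemma half_bd_image: "half b t j ` bcube n <= bcube n Un {x:cube n. x j = t}"
proof
 fix y assume "y:half b t j ` bcube n"
 then obtain x where x: "x:bcube n" "y = half b t j x" by auto
 hence xc: "x:cube n" by (simp add: bcube_def)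
 hence yc: "y:cube n" using half_in_cube x by simp
 have "EX i<n. x i = 0 \<or> x i = 1" using x(1) unfolding bcube_def by simp
 then obtain i where i: "i < n" "x i = 0 \<or> x i = 1"
  by blast
 have "(y i = 0 \<or> y i = 1) \<or> y j = t" using i x(2) by (cases "i = j"; cases b) (auto simp: half_def)
 thus "y:bcube n Un {x:cube n. x j = t}" using yc i(1) by (auto simp: bcube_def)
qed

text \<open>The conditions \<open>0 < inv y j\<close> and \<open>inv y j < 1\<close> keep
  \<open>W\<close> off the cut, so that within the cube it stays on one side, where the affine
  parametrization can be inverted. The point has to be interior for \<open>W\<close> to be
  nonempty.\<close>

lemma half_open:
 assumes U: "open U" and x: "x:U" "x:icube n"
 obtains W where "open W" "W Int cube n ~= {}" "W Int cube n <= half b t j ` (U Int cube n)"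
proof
 define inv where "inv y = y(j := if b then (y j - t) / (1 - t) else y j / t)" for y
 have c: "cont inv" proof (rule cont_fun)
  fix i show "cont (%y. inv y i)"
   unfolding inv_def using t by (cases "i = j"; cases b) (auto intro!: continuous_intros continuous_on_coord)
 qed
 define W where "W = inv -` U Int {y. 0 < inv y j} Int {y. inv y j < 1}"
 show "open W" unfolding W_def by (intro open_Int open_vimage U c open_Collect_less continuous_on_const
    cont_coord[OF c])
 have ih: "inv (half b t j z) = z" for z using t by (auto simp: inv_def half_def fun_eq_iff)
 have hi: "half b t j (inv z) = z" for z using t by (auto simp: inv_def half_def fun_eq_iff)
 have xc: "x:cube n" using x by (simp add: icube_eq)
 have "half b t j x:W Int cube n" using x half_in_cube[OF xc] j by (simp add: W_def ih icube_def)
 thus "W Int cube n ~= {}" by (metis emptyE)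
 show "W Int cube n <= half b t j ` (U Int cube n)" proof
  fix y assume y: "y:W Int cube n"
  have "inv y = y(j := inv y j)" by (simp add: inv_def)
  moreover have "y(j := inv y j):cube n" using y by (intro cube_fun_upd j) (auto simp: W_def)
  ultimately have "inv y:cube n" by simp
  hence "inv y:U Int cube n" using y by (simp add: W_def)
  thus "y:half b t j ` (U Int cube n)" using hi by (metis image_eqI)
 qed
qed

end

subsection \<open>The Oxtoby-Ulam theorem for the cube\<close>

definition cell :: "nat => pt measure => (pt => nat => real) => bool"
 where "cell n mu xi \<longleftrightarrow> continuous_on (cube n) xi & inj_on xi (cube n) & xi ` cube n <= cube n &
  cmeas n (pull (cube n) xi mu)"

text \<open>What straight and bent halves have in common, so that both inherit admissibility by one
  argument. The openness condition is asked at points of \<open>icube n\<close> only, because the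
  boundary carries no mass.\<close>

lemma sub_cube_measure:
 assumes al: "cmeas n al" and M: "sets M = sets borel"
  and em: "!!B. B:sets borel ==> emeasure M B = emeasure al (h ` (B Int cube n))"
  and bd: "emeasure al (h ` bcube n) = 0"
  and mb: "!!B. B:sets borel ==> h ` (B Int cube n):sets borel"
  and op: "!!U x. open U ==> x:U ==> x:icube n ==> EX W. open W & W Int cube n ~= {} & W Int cube n <= h ` (U Int cube n)"
 shows "cmeas n M"
proof -
 note A = cmeasD[OF al]
 have spM: "space M = UNIV" using M sets_eq_imp_space_eq by force
 interpret A: finite_measure al by (rule A(2))
 have mbA: "h ` (B Int cube n):sets al" if "B:sets borel" for B using mb[OF that] A(1) by simp
 have "emeasure M UNIV ~= \<infinity>" using em[of UNIV] A.emeasure_finite by simp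
 hence f: "finite_measure M" by (intro finite_measureI) (simp add: spM)
 have c: "emeasure M (- cube n) = 0" using em[of "- cube n"] by (simp add: closed_cube borel_comp)
 have p: "emeasure M {x} = 0" for x proof -
  have "emeasure M {x} <= emeasure al {h x}" unfolding em[OF borel_singleton[OF sets.empty_sets, of x]] by (rule emeasure_mono) (auto simp: A(1))
  thus ?thesis using A(4) by simp
 qed
 have b: "emeasure M (bcube n) = 0" using em[of "bcube n"] bd bcube_subset[of n] by (simp add: borel_closed closed_cube_bd Int_absorb2)
 have "0 < emeasure M (U Int cube n)" if U: "open U" "U Int cube n ~= {}" for U proof -
  have "0 < emeasure al (U Int cube n)" by (rule A(6)[OF U])
  also have "... = emeasure al (U Int cube n Int icube n)" by (rule cmeas_Int[OF al, symmetric]) (simp add: U borel_open borel_closed closed_cube)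
  finally have "U Int cube n Int icube n ~= {}" by (metis emeasure_empty less_irrefl)
  then obtain x where "x:U" "x:icube n" by auto
  from op[OF U(1) this] obtain W where W: "open W" "W Int cube n ~= {}" "W Int cube n <= h ` (U Int cube n)" by metis
  have Ub: "U Int cube n:sets borel" using U by (simp add: borel_open borel_closed closed_cube)
  have "0 < emeasure al (W Int cube n)" by (rule A(6)[OF W(1,2)])
  also have "... <= emeasure al (h ` (U Int cube n Int cube n))" by (rule emeasure_mono) (use W(3) mbA[OF Ub] in simp_all)
  also have "... = emeasure M (U Int cube n)" by (rule em[OF Ub, symmetric])
  finally show ?thesis .
 qed
 thus ?thesis unfolding cmeas_def using M f c p b by simp
qed

lemma sets_pull_eq: "sets (pull C f mu) = sets borel" by (simp add: pull_def)

lemma emeasure_pull_comp: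
 fixes f :: "pt => 'a::t2_space"
 assumes f: "continuous_on (cube n) f" "inj_on f (cube n)"
  and h: "continuous_on (cube n) h" "inj_on h (cube n)" "h ` cube n <= cube n"
  and mu: "sets mu = sets borel" and B: "B:sets borel"
 shows "emeasure (pull (cube n) (f o h) mu) B = emeasure (pull (cube n) f mu) (h ` (B Int cube n))"
proof -
 have fh: "continuous_on (cube n) (f o h)" "inj_on (f o h) (cube n)" using continuous_on_compose[OF h(1) cont_subset[OF f(1) h(3)]]
   comp_inj_on[OF h(2) inj_on_subset[OF f(2) h(3)]] by blast+
 have "h ` (B Int cube n) Int cube n = h ` (B Int cube n)" using h(3) by auto
 thus ?thesis by (simp add: emeasure_pull[OF compact_cube fh mu B]
    emeasure_pull[OF compact_cube f mu image_borel_cell[OF compact_cube h(1,2) B]] image_comp)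
qed

lemma emeasure_half_complement:
 assumes al: "finite_measure al" and A: "A:sets al" "B:sets al" and AB: "A Un B = C" and z: "emeasure al (A Int B) = 0"
 shows "emeasure al B = emeasure al C - emeasure al A"
proof -
 interpret finite_measure al by fact
 have "emeasure al A + emeasure al B = emeasure al C" using emeasure_Un_Int[OF A] AB z by simp
 thus ?thesis by (metis add.commute emeasure_finite ennreal_add_diff_cancel_right infinity_ennreal_def)
qed

text \<open>Each cell is cut in its own coordinates, where \<open>cut_lemma\<close> applies to the
  pulled-back measures: \<open>xi\<close> along the straight slice, \<open>et\<close> along the bent
  one. The lower halves have equal mass by the choice of the bend, the upper halves by
  subtraction.\<close>

lemma split_cell:
 assumes mu: "sets mu = sets borel" and nu: "sets nu = sets borel"
  and c: "cell n mu xi" "cell n nu et"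
  and eq: "emeasure (pull (cube n) xi mu) UNIV = emeasure (pull (cube n) et nu) UNIV" and j: "j < n"
 obtains t g where "1/3 <= t" "t <= 2/3" "inj_on g (cube n)" "g ` cube n = cube n"
  "!!x. x:bcube n ==> g x = x"
  "!!b. cell n mu (xi o half b t j)" "!!b. cell n nu (et o (g o half b t j))"
  "!!b. emeasure (pull (cube n) (xi o half b t j) mu) UNIV = emeasure (pull (cube n) (et o (g o half b t j)) nu) UNIV"
proof -
 define al where "al = pull (cube n) xi mu"
 define be where "be = pull (cube n) et nu"
 have xi: "continuous_on (cube n) xi" "inj_on xi (cube n)" "xi ` cube n <= cube n"
  and et: "continuous_on (cube n) et" "inj_on et (cube n)" "et ` cube n <= cube n"
  and al: "cmeas n al" and be: "cmeas n be" using c unfolding cell_def al_def be_def by simp_all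
 note A = cmeasD[OF al] and B = cmeasD[OF be]
 show thesis proof (rule cut_lemma[OF al be eq[folded al_def be_def] j])
  fix t g g' assume t: "1/3 <= t" "t <= 2/3" and g: "cube_homeo n g g'" and gbd: "!!x. x:bcube n ==> g x = x"
  and at: "emeasure al {x:cube n. x j = t} = 0"
  and bt: "emeasure be (g ` {x:cube n. x j = t}) = 0"
  and ab: "emeasure be (g ` {x:cube n. x j <= t}) = emeasure al {x:cube n. x j <= t}"
 have gc: "continuous_on (cube n) g" "continuous_on (cube n) g'"
  and gin: "!!x. x:cube n ==> g x:cube n" "!!x. x:cube n ==> g' x:cube n"
  and gg: "!!x. x:cube n ==> g' (g x) = x" "!!x. x:cube n ==> g (g' x) = x" using g unfolding cube_homeo_def by simp_all
 have ginj: "inj_on g (cube n)" using gg(1) by (metis inj_onI)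
 have gsurj: "g ` cube n = cube n" proof (intro equalityI subsetI)
  fix y assume "y:g ` cube n" thus "y:cube n" using gin(1) by (metis imageE)
 next
  fix y assume "y:cube n" thus "y:g ` cube n" using gg(2) gin(2) by (metis image_eqI)
 qed
 have t01: "0 < t" "t < 1" using t by auto
 note hin = half_in_cube[OF j t01] and himg = half_image[OF j t01]
 have hc: "continuous_on (cube n) (half b t j)" for b by (rule continuous_on_half[OF j t01])
 have hinj: "inj_on (half b t j) (cube n)" for b by (rule inj_onI) (rule half_inj[OF j t01])
 have hsub: "half b t j ` cube n <= cube n" for b using hin by (metis image_subsetI)
 have gh: "continuous_on (cube n) (g o half b t j)" "inj_on (g o half b t j) (cube n)"
  "(g o half b t j) ` cube n <= cube n" for b
 proof -
  show "continuous_on (cube n) (g o half b t j)" by (rule continuous_on_compose[OF hc cont_subset[OF gc(1) hsub]])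
  show "inj_on (g o half b t j) (cube n)" by (rule comp_inj_on[OF hinj inj_on_subset[OF ginj hsub]])
  show "(g o half b t j) ` cube n <= cube n" unfolding image_comp[symmetric] using image_mono[OF hsub, of g b] gsurj by simp
 qed
 have clS: "closed {x:cube n. x j <= t}" "closed {x:cube n. t <= x j}" "closed {x:cube n. x j = t}"
  using closed_Int[OF closed_cube closed_coord_le] closed_Int[OF closed_cube closed_coord_ge]
   closed_Int[OF closed_cube closed_coord_eq] by (simp_all add: Int_def)
 have gclo: "closed (g ` S)" if "closed S" "S <= cube n" for S proof -
  have "compact S" using that compact_Int_closed[OF compact_cube[of n] that(1)] by (simp add: Int_absorb1)
  thus ?thesis using cont_subset[OF gc(1) that(2)] by (intro compact_imp_closed compact_continuous_image)
 qed
 have sub: "{x:cube n. x j <= t} <= cube n" "{x:cube n. t <= x j} <= cube n" "{x:cube n. x j = t} <= cube n" by (simp_all add: subset_iff)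
 have gclS: "closed (g ` {x:cube n. x j <= t})" "closed (g ` {x:cube n. t <= x j})" "closed (g ` {x:cube n. x j = t})"
  by (rule gclo[OF clS(1) sub(1)], rule gclo[OF clS(2) sub(2)], rule gclo[OF clS(3) sub(3)])
 have opA: "EX W. open W & W Int cube n ~= {} & W Int cube n <= half b t j ` (U Int cube n)"
  if "open U" "x:U" "x:icube n" for U x b
  using half_open[OF j t01 that] by metis
 have bdA: "emeasure al (half b t j ` bcube n) = 0" for b proof -
  have "emeasure al (half b t j ` bcube n) <= emeasure al (bcube n Un {x:cube n. x j = t})"
   by (rule emeasure_mono[OF half_bd_image[OF j t01]]) (simp add: A(1) closed_cube_bd clS borel_closed)
  also have "... <= emeasure al (bcube n) + emeasure al {x:cube n. x j = t}" by (rule emeasure_subadditive) (simp_all add: A(1) closed_cube_bd clS borel_closed)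
  finally show ?thesis using at A(5) by simp
 qed
 have bdB: "emeasure be ((g o half b t j) ` bcube n) = 0" for b proof -
  have "g ` bcube n = bcube n" using gbd by (metis image_cong image_ident)
  hence "(g o half b t j) ` bcube n <= bcube n Un g ` {x:cube n. x j = t}"
   unfolding image_comp[symmetric] using image_mono[OF half_bd_image[OF j t01], of g b] by (simp add: image_Un)
  hence "emeasure be ((g o half b t j) ` bcube n) <= emeasure be (bcube n Un g ` {x:cube n. x j = t})"
   by (rule emeasure_mono) (simp add: B(1) closed_cube_bd gclS borel_closed)
  also have "... <= emeasure be (bcube n) + emeasure be (g ` {x:cube n. x j = t})"
   by (rule emeasure_subadditive) (simp_all add: B(1) closed_cube_bd gclS borel_closed)
  finally show ?thesis using bt B(5) by simp
 qed
 have opB: "EX W. open W & W Int cube n ~= {} & W Int cube n <= (g o half b t j) ` (U Int cube n)"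
  if U: "open U" "x:U" "x:icube n" for U x b
 proof -
  from opA[OF U, of b] obtain W where W: "open W" "W Int cube n ~= {}" "W Int cube n <= half b t j ` (U Int cube n)" by (elim exE conjE)
  from continuous_on_open_invariant[THEN iffD1, OF gc(2), rule_format, OF W(1)]
  obtain V where V: "open V" "V Int cube n = g' -` W Int cube n" by (elim exE conjE)
  have "V Int cube n = g ` (W Int cube n)" proof (intro equalityI subsetI)
   fix y assume "y:V Int cube n"
   hence y: "g' y:W" "y:cube n" unfolding V(2) by simp_all
   hence "g' y:W Int cube n" "y = g (g' y)" using gin gg by simp_all
   thus "y:g ` (W Int cube n)" by (metis image_eqI)
  next
   fix y assume "y:g ` (W Int cube n)"
   then obtain x where x: "x:W Int cube n" "y = g x" by (metis imageE)
   hence "y:g' -` W Int cube n" using gin gg by simp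
   thus "y:V Int cube n" using V(2) by simp
  qed
  moreover have "g ` (W Int cube n) <= (g o half b t j) ` (U Int cube n)" unfolding image_comp[symmetric] by (rule image_mono[OF W(3)])
  moreover have "g ` (W Int cube n) ~= {}" using W(2) by simp
  ultimately show ?thesis using V(1) by (intro exI[of _ V]) simp
 qed
 have cA: "cell n mu (xi o half b t j)" for b unfolding cell_def proof (intro conjI)
  show "continuous_on (cube n) (xi o half b t j)" by (rule continuous_on_compose[OF hc cont_subset[OF xi(1) hsub]])
  show "inj_on (xi o half b t j) (cube n)" by (rule comp_inj_on[OF hinj inj_on_subset[OF xi(2) hsub]])
  show "(xi o half b t j) ` cube n <= cube n" unfolding image_comp[symmetric] using order_trans[OF image_mono[OF hsub] xi(3)] .
  show "cmeas n (pull (cube n) (xi o half b t j) mu)"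
   by (rule sub_cube_measure[where h="half b t j", OF al _ _ bdA image_borel_cell[OF compact_cube hc hinj] opA])
    (simp_all add: sets_pull_eq emeasure_pull_comp[OF xi(1,2) hc hinj hsub mu] al_def)
 qed
 have cB: "cell n nu (et o (g o half b t j))" for b unfolding cell_def proof (intro conjI)
  show "continuous_on (cube n) (et o (g o half b t j))" by (rule continuous_on_compose[OF gh(1) cont_subset[OF et(1) gh(3)]])
  show "inj_on (et o (g o half b t j)) (cube n)" by (rule comp_inj_on[OF gh(2) inj_on_subset[OF et(2) gh(3)]])
  show "(et o (g o half b t j)) ` cube n <= cube n" unfolding image_comp[symmetric, of et] using order_trans[OF image_mono[OF gh(3)] et(3)] .
  show "cmeas n (pull (cube n) (et o (g o half b t j)) nu)"
   by (rule sub_cube_measure[where h="g o half b t j", OF be _ _ bdB image_borel_cell[OF compact_cube gh(1,2)] opB])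
    (simp_all add: sets_pull_eq emeasure_pull_comp[OF et(1,2) gh nu] be_def)
 qed
 have m: "emeasure (pull (cube n) (xi o half b t j) mu) UNIV = emeasure (pull (cube n) (et o (g o half b t j)) nu) UNIV" for b proof -
  have l: "emeasure (pull (cube n) (xi o half b t j) mu) UNIV = emeasure al (half b t j ` cube n)"
   using emeasure_pull_comp[OF xi(1,2) hc hinj hsub mu, of UNIV] by (simp add: al_def)
  have r: "emeasure (pull (cube n) (et o (g o half b t j)) nu) UNIV = emeasure be (g ` half b t j ` cube n)"
   using emeasure_pull_comp[OF et(1,2) gh nu, of UNIV] by (simp add: be_def image_comp)
  show ?thesis proof (cases b)
   case False
   thus ?thesis unfolding l r himg using ab by simp
  next
   case True
   have u: "{x:cube n. x j <= t} Un {x:cube n. t <= x j} = cube n" by force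
   have i: "{x:cube n. x j <= t} Int {x:cube n. t <= x j} = {x:cube n. x j = t}" by force
   have "emeasure al {x:cube n. t <= x j} = emeasure al (cube n) - emeasure al {x:cube n. x j <= t}"
    by (rule emeasure_half_complement[OF A(2) _ _ u]) (simp_all only: i at A(1) borel_closed clS)
   moreover have "emeasure be (g ` {x:cube n. t <= x j}) = emeasure be (cube n) - emeasure be (g ` {x:cube n. x j <= t})"
   proof (rule emeasure_half_complement[OF B(2)])
    show "g ` {x:cube n. x j <= t} Un g ` {x:cube n. t <= x j} = cube n" unfolding image_Un[symmetric] u by (rule gsurj)
    show "emeasure be (g ` {x:cube n. x j <= t} Int g ` {x:cube n. t <= x j}) = 0" unfolding inj_on_image_Int[OF ginj sub(1,2), symmetric] i by (rule bt)
   qed (simp_all only: B(1) borel_closed gclS)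
   moreover have "emeasure al (cube n) = emeasure be (cube n)"
    using eq emeasure_pull[OF compact_cube xi(1,2) mu, of UNIV] emeasure_pull[OF compact_cube xi(1,2) mu, of "cube n"]
     emeasure_pull[OF compact_cube et(1,2) nu, of UNIV] emeasure_pull[OF compact_cube et(1,2) nu, of "cube n"]
    by (simp add: al_def be_def borel_closed closed_cube)
   ultimately show ?thesis unfolding l r himg using ab True by simp
  qed
 qed
 show thesis by (rule that[OF t ginj gsurj gbd cA cB m])
 qed
qed

text \<open>Two subdivisions of the cube into \<open>2 ^ k\<close> cells that correspond in mass and
  in the way they are glued. Distinct cells may share only boundary parameters, and the same ones on
  both sides. The last clause parametrizes the boundary of the cube identically, which makes the
  limit map the identity there.\<close>

definition cells :: "nat => nat => pt measure => pt measure =>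
  (bool list => pt => nat => real) => (bool list => pt => nat => real) => bool"
 where "cells n k mu nu xi et \<longleftrightarrow>
  (ALL l. length l = k --> cell n mu (xi l) & cell n nu (et l) &
   emeasure (pull (cube n) (xi l) mu) UNIV = emeasure (pull (cube n) (et l) nu) UNIV) &
  (ALL x:cube n. EX l. length l = k & x:xi l ` cube n) &
  (ALL x:cube n. EX l. length l = k & x:et l ` cube n) &
  (ALL l l' q q'. length l = k --> length l' = k --> l ~= l' --> q:cube n --> q':cube n -->
   (xi l q = xi l' q' \<longleftrightarrow> et l q = et l' q') & (xi l q = xi l' q' --> q:bcube n & q':bcube n)) &
  (ALL x:bcube n. EX l q. length l = k & q:bcube n & x = xi l q & x = et l q)"

lemma cellsD:
 assumes "cells n k mu nu xi et"
 shows "length l = k ==> cell n mu (xi l)" "length l = k ==> cell n nu (et l)"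
  "length l = k ==> emeasure (pull (cube n) (xi l) mu) UNIV = emeasure (pull (cube n) (et l) nu) UNIV"
  "x:cube n ==> EX l. length l = k & x:xi l ` cube n"
  "x:cube n ==> EX l. length l = k & x:et l ` cube n"
  "length l = k ==> length l' = k ==> l ~= l' ==> q:cube n ==> q':cube n ==>
   xi l q = xi l' q' \<longleftrightarrow> et l q = et l' q'"
  "length l = k ==> length l' = k ==> l ~= l' ==> q:cube n ==> q':cube n ==>
   xi l q = xi l' q' ==> q:bcube n & q':bcube n"
  "x:bcube n ==> EX l q. length l = k & q:bcube n & x = xi l q & x = et l q"
 using assms unfolding cells_def by simp_all

lemma cells_swap:
 assumes c: "cells n k mu nu xi et" shows "cells n k nu mu et xi" unfolding cells_def
proof (intro conjI allI impI ballI)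
 fix l :: "bool list" assume l: "length l = k"
 show "cell n nu (et l)" "cell n mu (xi l)"
  "emeasure (pull (cube n) (et l) nu) UNIV = emeasure (pull (cube n) (xi l) mu) UNIV"
  using cellsD(1-3)[OF c l] by simp_all
next
 fix x assume x: "x:cube n"
 show "EX l. length l = k & x:et l ` cube n" "EX l. length l = k & x:xi l ` cube n" using cellsD(4,5)[OF c x] by simp_all
next
 fix l l' :: "bool list" and q q'
 assume l: "length l = k" "length l' = k" "l ~= l'" "q:cube n" "q':cube n"
 show "et l q = et l' q' \<longleftrightarrow> xi l q = xi l' q'" using cellsD(6)[OF c l] by simp
 assume "et l q = et l' q'"
 hence "xi l q = xi l' q'" using cellsD(6)[OF c l] by simp
 thus "q:bcube n" "q':bcube n" using cellsD(7)[OF c l] by simp_all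
next
 fix x assume "x:bcube n"
 from cellsD(8)[OF c this] obtain l q where "length l = k" "q:bcube n" "x = xi l q" "x = et l q" by (elim exE conjE)
 thus "EX l q. length l = k & q:bcube n & x = et l q & x = xi l q" by (intro exI conjI)
qed

text \<open>The newest cut is the head of the index list, so the tail names the parent cell. The
  \<open>xi\<close> side is described exactly because its cuts are straight; on the
  \<open>et\<close> side only inclusion is recorded, as the bends are uncontrolled.\<close>

lemma cells_step:
 assumes mu: "sets mu = sets borel" and nu: "sets nu = sets borel"
  and c: "cells n k mu nu xi et" and j: "j < n"
 shows "EX xi' et' T. cells n (Suc k) mu nu xi' et' & (ALL l. length l = k --> 1/3 <= T l & T l <= 2/3) &
  (ALL b l. length l = k --> xi' (b # l) = xi l o half b (T l) j & et' (b # l) ` cube n <= et l ` cube n)"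
proof -
 define P where "P l t g \<longleftrightarrow> 1/3 <= t & t <= 2/3 & inj_on g (cube n) & g ` cube n = cube n &
  (ALL x:bcube n. g x = x) & (ALL b. cell n mu (xi l o half b t j)) & (ALL b. cell n nu (et l o (g o half b t j))) &
  (ALL b. emeasure (pull (cube n) (xi l o half b t j) mu) UNIV = emeasure (pull (cube n) (et l o (g o half b t j)) nu) UNIV)"
  for l t g
 have "EX tg. length l = k --> P l (fst tg) (snd tg)" for l proof (cases "length l = k")
  case True
  show ?thesis proof (rule split_cell[OF mu nu cellsD(1-3)[OF c True] j])
   fix t g
   assume "1/3 <= t" "t <= 2/3" "inj_on g (cube n)" "g ` cube n = cube n"
    "!!x. x:bcube n ==> g x = x"
    "!!b. cell n mu (xi l o half b t j)" "!!b. cell n nu (et l o (g o half b t j))"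
    "!!b. emeasure (pull (cube n) (xi l o half b t j) mu) UNIV = emeasure (pull (cube n) (et l o (g o half b t j)) nu) UNIV"
   hence "P l t g" unfolding P_def by simp
   thus ?thesis by (intro exI[of _ "(t, g)"]) simp
  qed
 qed simp
 hence "ALL l. EX tg. length l = k --> P l (fst tg) (snd tg)" by (rule allI)
 from choice[OF this] obtain TG where TG: "ALL l. length l = k --> P l (fst (TG l)) (snd (TG l))" by (elim exE)
 define T where "T l = fst (TG l)" for l
 define G where "G l = snd (TG l)" for l
 have PP: "P l (T l) (G l)" if "length l = k" for l using TG that unfolding T_def G_def by simp
 have T: "1/3 <= T l & T l <= 2/3" and T01: "0 < T l" "T l < 1"
  and G: "inj_on (G l) (cube n)" "G l ` cube n = cube n" "!!x. x:bcube n ==> G l x = x"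
  and C: "!!b. cell n mu (xi l o half b (T l) j)" "!!b. cell n nu (et l o (G l o half b (T l) j))"
  "!!b. emeasure (pull (cube n) (xi l o half b (T l) j) mu) UNIV = emeasure (pull (cube n) (et l o (G l o half b (T l) j)) nu) UNIV"
  if "length l = k" for l
  using PP[OF that] unfolding P_def by simp_all
 define xi' where "xi' l = xi (tl l) o half (hd l) (T (tl l)) j" for l
 define et' where "et' l = et (tl l) o (G (tl l) o half (hd l) (T (tl l)) j)" for l
 have hin: "half b (T l) j q:cube n" if "length l = k" "q:cube n" for b l q by (rule half_in_cube[OF j T01[OF that(1)] that(2)])
 have Gin: "G l q:cube n" if "length l = k" "q:cube n" for l q using G(2)[OF that(1)] imageI[OF that(2), of "G l"] by simp
 have injxi: "inj_on (xi l) (cube n)" and injet: "inj_on (et l) (cube n)" if "length l = k" for l using cellsD(1,2)[OF c that] unfolding cell_def by simp_all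
 have hcov: "EX b. x:half b (T l) j ` cube n" if l: "length l = k" and x: "x:cube n" for l x
  using x half_image[OF j T01[OF l], of True] half_image[OF j T01[OF l], of False] by (cases "T l <= x j") (auto intro: exI[of _ True] exI[of _ False])
 have c1: "EX l. length l = Suc k & x:xi' l ` cube n" if x: "x:cube n" for x proof -
  from cellsD(4)[OF c x] obtain l where l: "length l = k" "x:xi l ` cube n" by (elim exE conjE)
  from l(2) obtain q where q: "x = xi l q" "q:cube n" by (rule imageE)
  from hcov[OF l(1) q(2)] obtain b where "q:half b (T l) j ` cube n" by (rule exE)
  then obtain r where r: "q = half b (T l) j r" "r:cube n" by (rule imageE)
  have "x = xi' (b # l) r" using q r by (simp add: xi'_def)
  hence "x:xi' (b # l) ` cube n" using r(2) by (rule image_eqI)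
  thus ?thesis using l(1) by (intro exI[of _ "b # l"]) simp
 qed
 have c2: "EX l. length l = Suc k & x:et' l ` cube n" if x: "x:cube n" for x proof -
  from cellsD(5)[OF c x] obtain l where l: "length l = k" "x:et l ` cube n" by (elim exE conjE)
  from l(2) obtain q' where q': "x = et l q'" "q':cube n" by (rule imageE)
  have "q':G l ` cube n" using q'(2) G(2)[OF l(1)] by simp
  then obtain q where q: "q' = G l q" "q:cube n" by (rule imageE)
  from hcov[OF l(1) q(2)] obtain b where "q:half b (T l) j ` cube n" by (rule exE)
  then obtain r where r: "q = half b (T l) j r" "r:cube n" by (rule imageE)
  have "x = et' (b # l) r" using q q' r by (simp add: et'_def)
  hence "x:et' (b # l) ` cube n" using r(2) by (rule image_eqI)
  thus ?thesis using l(1) by (intro exI[of _ "b # l"]) simp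
 qed
 have main: "(xi' l q = xi' l' q' \<longleftrightarrow> et' l q = et' l' q') & (xi' l q = xi' l' q' --> q:bcube n & q':bcube n)"
  if l: "length l = Suc k" "length l' = Suc k" "l ~= l'" and q: "q:cube n" "q':cube n" for l l' q q'
 proof -
  obtain b m where m: "l = b # m" "length m = k" using l(1) by (metis length_Suc_conv)
  obtain b' m' where m': "l' = b' # m'" "length m' = k" using l(2) by (metis length_Suc_conv)
  let ?r = "half b (T m) j q" and ?r' = "half b' (T m') j q'"
  have r: "?r:cube n" "?r':cube n" by (rule hin[OF m(2) q(1)], rule hin[OF m'(2) q(2)])
  have Gr: "G m ?r:cube n" "G m' ?r':cube n" by (rule Gin[OF m(2) r(1)], rule Gin[OF m'(2) r(2)])
  have e: "xi' l q = xi m ?r" "xi' l' q' = xi m' ?r'" "et' l q = et m (G m ?r)" "et' l' q' = et m' (G m' ?r')" by (simp_all add: xi'_def et'_def m m')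
  show ?thesis proof (cases "m = m'")
   case True
   hence b: "b' = (~ b)" using l(3) m m' by auto
   have "xi' l q = xi' l' q' \<longleftrightarrow> ?r = ?r'" unfolding e using inj_on_eq_iff[OF injxi[OF m(2)] r] True by simp
   moreover have "et' l q = et' l' q' \<longleftrightarrow> ?r = ?r'"
    unfolding e using inj_on_eq_iff[OF injet[OF m(2)] Gr] inj_on_eq_iff[OF G(1)[OF m(2)] r] True by simp
   moreover have "?r = ?r' ==> q:bcube n & q':bcube n" using half_eq_bd[OF j T01[OF m(2)] q, of b] True b by simp
   ultimately show ?thesis by simp
  next
   case False
   note A = cellsD(6,7)[OF c m(2) m'(2) False]
   \<comment> \<open>Different parent cells meet only at boundary parameters, where the bends
     \<open>G m\<close> and \<open>G m'\<close> are the identity. Hence bending does not disturb the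
     gluing pattern.\<close>
   have fwd: "et m (G m ?r) = et m' (G m' ?r') & q:bcube n & q':bcube n" if h: "xi m ?r = xi m' ?r'" proof -
    have bd: "?r:bcube n" "?r':bcube n" using A(2)[OF r h] by simp_all
    hence "G m ?r = ?r" "G m' ?r' = ?r'" using G(3)[OF m(2)] G(3)[OF m'(2)] by simp_all
    moreover have "q:bcube n" "q':bcube n" using half_bd[OF j T01[OF m(2)] q(1) bd(1)] half_bd[OF j T01[OF m'(2)] q(2) bd(2)] by simp_all
    ultimately show ?thesis using A(1)[OF r] h by simp
   qed
   have bwd: "xi m ?r = xi m' ?r'" if h: "et m (G m ?r) = et m' (G m' ?r')" proof -
    have h': "xi m (G m ?r) = xi m' (G m' ?r')" using A(1)[OF Gr] h by simp
    hence bd: "G m ?r:bcube n" "G m' ?r':bcube n" using A(2)[OF Gr h'] by simp_all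
    have "G m (G m ?r) = G m ?r" "G m' (G m' ?r') = G m' ?r'" using G(3)[OF m(2) bd(1)] G(3)[OF m'(2) bd(2)] by simp_all
    hence "G m ?r = ?r" "G m' ?r' = ?r'" using inj_on_eq_iff[OF G(1)[OF m(2)] Gr(1) r(1)] inj_on_eq_iff[OF G(1)[OF m'(2)] Gr(2) r(2)] by simp_all
    thus ?thesis using h' by simp
   qed
   show ?thesis unfolding e using fwd bwd by metis
  qed
 qed
 have c3: "EX l q. length l = Suc k & q:bcube n & x = xi' l q & x = et' l q" if x: "x:bcube n" for x proof -
  from cellsD(8)[OF c x] obtain l q where l: "length l = k" "q:bcube n" "x = xi l q" "x = et l q" by (elim exE conjE)
  have qc: "q:cube n" by (rule subsetD[OF bcube_subset l(2)])
  from hcov[OF l(1) qc] obtain b where "q:half b (T l) j ` cube n" by (rule exE)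
  then obtain r where r: "q = half b (T l) j r" "r:cube n" by (rule imageE)
  have "r:bcube n" using half_bd[OF j T01[OF l(1)] r(2)] l(2) r(1) by simp
  moreover have "x = xi' (b # l) r" using l(3) r(1) by (simp add: xi'_def)
  moreover have "x = et' (b # l) r" using l(4) r(1) G(3)[OF l(1,2)] by (simp add: et'_def)
  moreover have "length (b # l) = Suc k" using l(1) by simp
  ultimately show ?thesis by (intro exI conjI)
 qed
 have "cells n (Suc k) mu nu xi' et'" unfolding cells_def proof (intro conjI allI impI ballI)
  fix l :: "bool list" assume l: "length l = Suc k"
  hence tl: "length (tl l) = k" by simp
  show "cell n mu (xi' l)" "cell n nu (et' l)"
   "emeasure (pull (cube n) (xi' l) mu) UNIV = emeasure (pull (cube n) (et' l) nu) UNIV"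
   unfolding xi'_def et'_def by (rule C[OF tl])+
 qed (use c1 c2 c3 main in simp_all)
 moreover have "xi' (b # l) = xi l o half b (T l) j & et' (b # l) ` cube n <= et l ` cube n"
  if l: "length l = k" for b l
 proof
  show "xi' (b # l) = xi l o half b (T l) j" by (simp add: xi'_def)
  show "et' (b # l) ` cube n <= et l ` cube n" proof (rule image_subsetI)
   fix q assume q: "q:cube n"
   have "et' (b # l) q = et l (G l (half b (T l) j q))" by (simp add: et'_def)
   thus "et' (b # l) q:et l ` cube n" using Gin[OF l hin[OF l q]] by simp
  qed
 qed
 ultimately show ?thesis using T by (intro exI[of _ xi'] exI[of _ et'] exI[of _ T]) simp
qed

text \<open>Cuts in the middle third shrink the cut coordinate by a factor of at most 2/3. The map
  \<open>S l\<close> places the new cell in the parameter cube of its ancestor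
  \<open>drop (length js) l\<close>, so the contraction is exact there, whatever \<open>xi\<close>
  itself does.\<close>

lemma cells_iterate:
 assumes mu: "sets mu = sets borel" and nu: "sets nu = sets borel"
 shows "cells n k mu nu xi et ==> set js <= {..<n} ==>
  EX xi' et' S. cells n (length js + k) mu nu xi' et' &
   (ALL l. length l = length js + k -->
    (ALL q:cube n. xi' l q = xi (drop (length js) l) (S l q) & S l q:cube n) &
    (ALL q:cube n. ALL q':cube n. ALL i. abs (S l q i - S l q' i) <= (2/3) ^ count_list js i * abs (q i - q' i)) &
    et' l ` cube n <= et (drop (length js) l) ` cube n)"
proof (induction js arbitrary: k xi et)
 case Nil
 thus ?case by (intro exI[of _ xi] exI[of _ et] exI[of _ "%l q. q"]) simp
next
 case (Cons j js)
 have j: "j < n" and js: "set js <= {..<n}" using Cons.prems(2) by simp_all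
 from cells_step[OF mu nu Cons.prems(1) j]
 obtain xi1 et1 T where 1: "cells n (Suc k) mu nu xi1 et1" "ALL l. length l = k --> 1/3 <= T l & T l <= 2/3"
  "ALL b l. length l = k --> xi1 (b # l) = xi l o half b (T l) j & et1 (b # l) ` cube n <= et l ` cube n"
  by (elim exE conjE)
 from Cons.IH[OF 1(1) js] obtain xi2 et2 S where 2: "cells n (length js + Suc k) mu nu xi2 et2"
  "ALL l. length l = length js + Suc k -->
    (ALL q:cube n. xi2 l q = xi1 (drop (length js) l) (S l q) & S l q:cube n) &
    (ALL q:cube n. ALL q':cube n. ALL i. abs (S l q i - S l q' i) <= (2/3) ^ count_list js i * abs (q i - q' i)) &
    et2 l ` cube n <= et1 (drop (length js) l) ` cube n"
  by (elim exE conjE)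
 define S' where "S' l q = half (hd (drop (length js) l)) (T (tl (drop (length js) l))) j (S l q)" for l q
 have M1: "(ALL q:cube n. xi2 l q = xi (drop (length (j # js)) l) (S' l q) & S' l q:cube n) &
    (ALL q:cube n. ALL q':cube n. ALL i. abs (S' l q i - S' l q' i) <= (2/3) ^ count_list (j # js) i * abs (q i - q' i)) &
    et2 l ` cube n <= et (drop (length (j # js)) l) ` cube n"
  if l: "length l = length (j # js) + k" for l
 proof -
  have l': "length l = length js + Suc k" using l by simp
  hence "length (drop (length js) l) = Suc k" by simp
  then obtain b m where m: "drop (length js) l = b # m" "length m = k" by (metis length_Suc_conv)
  have dm: "drop (length (j # js)) l = m" using m(1) by (simp add: drop_Suc tl_drop) (metis list.sel(3) tl_drop)
  have S': "S' l q = half b (T m) j (S l q)" for q by (simp add: S'_def m)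
  have Tm: "1/3 <= T m" "T m <= 2/3" using 1(2) m(2) by simp_all
  hence T01: "0 < T m" "T m < 1" by simp_all
  note 22 = 2(2)[rule_format, OF l']
  have x1: "xi1 (b # m) = xi m o half b (T m) j" "et1 (b # m) ` cube n <= et m ` cube n" using 1(3)[rule_format, OF m(2)] by simp_all
  have a: "ALL q:cube n. xi2 l q = xi m (S' l q) & S' l q:cube n" proof
   fix q assume q: "q:cube n"
   have "xi2 l q = xi1 (b # m) (S l q)" "S l q:cube n" using 22 q unfolding m(1) by simp_all
   thus "xi2 l q = xi m (S' l q) & S' l q:cube n" unfolding S' x1(1) using half_in_cube[OF j T01, of "S l q" b] by simp
  qed
  have b: "abs (S' l q i - S' l q' i) <= (2/3) ^ count_list (j # js) i * abs (q i - q' i)"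
   if q: "q:cube n" "q':cube n" for q q' i
  proof -
   have B: "abs (S l q i - S l q' i) <= (2/3) ^ count_list js i * abs (q i - q' i)" using 22 q by simp
   show ?thesis proof (cases "i = j")
    case False
    thus ?thesis using B by (simp add: S' half_def)
   next
    case True
    define u where "u = (if b then 1 - T m else T m)"
    have u: "0 <= u" "u <= 2/3" using Tm by (auto simp: u_def)
    have "S' l q i - S' l q' i = u * (S l q i - S l q' i)" using True by (simp add: S' half_def u_def algebra_simps)
    hence "abs (S' l q i - S' l q' i) = u * abs (S l q i - S l q' i)" using u by (simp add: abs_mult)
    also have "... <= (2/3) * ((2/3) ^ count_list js i * abs (q i - q' i))" by (rule mult_mono[OF u(2) B]) simp_all
    finally show ?thesis using True by simp
   qed
  qed
  have d: "et2 l ` cube n <= et m ` cube n" using 22 x1(2) unfolding m(1) by (meson order_trans)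
  show ?thesis unfolding dm using a b d by simp
 qed
 have M2: "cells n (length (j # js) + k) mu nu xi2 et2" using 2(1) by simp
 show ?case by (rule exI[of _ xi2], rule exI[of _ et2], rule exI[of _ S'], rule conjI[OF M2]) (intro allI impI M1)
qed

section \<open>Subdivisions of small mesh on both sides, and their limit\<close>

definition cell_refines :: "nat => nat => (bool list => pt => nat => real) => (bool list => pt => nat => real) =>
  nat => (bool list => pt => nat => real) => (bool list => pt => nat => real) => bool"
 where "cell_refines n k xi et k' xi' et' \<longleftrightarrow> (ALL l'. length l' = k' -->
  (EX l. length l = k & xi' l' ` cube n <= xi l ` cube n & et' l' ` cube n <= et l ` cube n))"

definition meshle :: "nat => nat => real => (bool list => pt => nat => real) => bool"
 where "meshle n k e xi \<longleftrightarrow> (ALL l. length l = k --> (ALL x:xi l ` cube n. ALL y:xi l ` cube n. dist x y <= e))"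

lemma finite_bool_lists: "finite {l :: bool list. length l = k}" using finite_lists_length_eq[of "UNIV :: bool set" k] by simp

text \<open>Uniform continuity of the finitely many \<open>xi l\<close> turns small parameter boxes
  into small cells. Cutting every direction \<open>r\<close> times makes the boxes small; the bound
  \<open>d / 2\<close> absorbs the factor 2 between coordinate distances and the metric of
  \<open>pt\<close>.\<close>

lemma cells_fine1:
 assumes mu: "sets mu = sets borel" and nu: "sets nu = sets borel"
  and c: "cells n k mu nu xi et" and e: "0 < e"
 shows "EX k' xi' et'. cells n k' mu nu xi' et' & cell_refines n k xi et k' xi' et' & meshle n k' e xi'"
proof -
 have uc: "EX d>0. ALL q:cube n. ALL q':cube n. dist q' q < d --> dist (xi l q') (xi l q) < e" if l: "length l = k" for l proof -
  have "uniformly_continuous_on (cube n) (xi l)" using cellsD(1)[OF c l] unfolding cell_def by (intro compact_uniformly_continuous compact_cube) simp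
  thus ?thesis using e unfolding uniformly_continuous_on_def by simp
 qed
 define D where "D l = (SOME d. 0 < d & (ALL q:cube n. ALL q':cube n. dist q' q < d --> dist (xi l q') (xi l q) < e))" for l
 have D: "0 < D l & (ALL q:cube n. ALL q':cube n. dist q' q < D l --> dist (xi l q') (xi l q) < e)" if "length l = k" for l
  using someI_ex[OF uc[OF that]] unfolding D_def .
 define d where "d = Min (D ` {l. length l = k})"
 have ne: "{l :: bool list. length l = k} ~= {}" using length_replicate[of k True] by (metis (mono_tags, lifting) empty_Collect_eq)
 have d0: "0 < d" unfolding d_def using D finite_bool_lists[of k] ne by (subst Min_gr_iff) simp_all
 have dl: "d <= D l" if "length l = k" for l unfolding d_def using finite_bool_lists[of k] that by (intro Min_le) simp_all
 obtain r where r: "(2/3::real) ^ r < d / 2" using real_arch_pow_inv[of "d/2" "2/3"] d0 by auto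
 define js where "js = concat (replicate r [0..<n])"
 have js: "set js <= {..<n}" unfolding js_def by (induction r) auto
 have cnt: "count_list js i = r" if "i < n" for i proof -
  have "count_list [0..<n] i = 1" using that by (induction n) (auto simp: less_Suc_eq)
  thus ?thesis unfolding js_def by (induction r) simp_all
 qed
 from cells_iterate[OF mu nu c js] obtain xi' et' S where 2: "cells n (length js + k) mu nu xi' et'"
  "ALL l. length l = length js + k -->
    (ALL q:cube n. xi' l q = xi (drop (length js) l) (S l q) & S l q:cube n) &
    (ALL q:cube n. ALL q':cube n. ALL i. abs (S l q i - S l q' i) <= (2/3) ^ count_list js i * abs (q i - q' i)) &
    et' l ` cube n <= et (drop (length js) l) ` cube n"
  by (elim exE conjE)
 have "cell_refines n k xi et (length js + k) xi' et'" unfolding cell_refines_def proof (intro allI impI)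
  fix l :: "bool list" assume l: "length l = length js + k"
  have "xi' l ` cube n <= xi (drop (length js) l) ` cube n" using 2(2)[rule_format, OF l] by (intro image_subsetI) simp
  thus "EX m. length m = k & xi' l ` cube n <= xi m ` cube n & et' l ` cube n <= et m ` cube n"
   using 2(2)[rule_format, OF l] l by (intro exI[of _ "drop (length js) l"]) simp
 qed
 moreover have "meshle n (length js + k) e xi'" unfolding meshle_def proof (intro allI impI ballI)
  fix l :: "bool list" and x y assume l: "length l = length js + k" and xy: "x:xi' l ` cube n" "y:xi' l ` cube n"
  from xy(1) obtain q where q: "x = xi' l q" "q:cube n" by (rule imageE)
  from xy(2) obtain q' where q': "y = xi' l q'" "q':cube n" by (rule imageE)
  note 22 = 2(2)[rule_format, OF l]
  have m: "length (drop (length js) l) = k" using l by simp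
  have Sc: "S l q:cube n" "S l q':cube n" using 22 q(2) q'(2) by simp_all
  have "dist (S l q i) (S l q' i) <= (2/3) ^ r" for i proof (cases "i < n")
   case True
   have "abs (S l q i - S l q' i) <= (2/3) ^ count_list js i * abs (q i - q' i)" using 22 q(2) q'(2) by simp
   also have "... <= (2/3) ^ r * 1" proof -
    have "0 <= q i" "q i <= 1" "0 <= q' i" "q' i <= 1" using q(2) q'(2) True by (simp_all add: cube_def)
    hence "abs (q i - q' i) <= 1" by linarith
    thus ?thesis unfolding cnt[OF True] by (intro mult_left_mono) simp_all
   qed
   finally show ?thesis by (simp add: dist_real_def)
  next
   case False
   thus ?thesis using Sc by (simp add: cube_def)
  qed
  hence "dist (S l q) (S l q') <= 2 * (2/3) ^ r" by (rule dist_fun_le)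
  also have "... < d" using r by simp
  finally have "dist (S l q) (S l q') < D (drop (length js) l)" using dl[OF m] by simp
  hence "dist (xi (drop (length js) l) (S l q)) (xi (drop (length js) l) (S l q')) < e" using D[OF m] Sc by simp
  thus "dist x y <= e" using 22 q q' by simp
 qed
 ultimately show ?thesis using 2(1) by (intro exI[of _ "length js + k"], rule_tac exI[of _ xi'], rule_tac exI[of _ et']) simp
qed

lemma cell_refines_trans:
 assumes "cell_refines n k xi et k' xi' et'" "cell_refines n k' xi' et' k'' xi'' et''"
 shows "cell_refines n k xi et k'' xi'' et''" unfolding cell_refines_def
proof (intro allI impI)
 fix l :: "bool list" assume "length l = k''"
 with assms(2) obtain m where m: "length m = k'" "xi'' l ` cube n <= xi' m ` cube n" "et'' l ` cube n <= et' m ` cube n"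
  unfolding cell_refines_def by (elim allE[of _ l]) (simp, elim exE conjE)
 with assms(1) obtain p where p: "length p = k" "xi' m ` cube n <= xi p ` cube n" "et' m ` cube n <= et p ` cube n"
  unfolding cell_refines_def by (elim allE[of _ m]) (simp, elim exE conjE)
 show "EX p. length p = k & xi'' l ` cube n <= xi p ` cube n & et'' l ` cube n <= et p ` cube n"
  by (intro exI[of _ p] conjI p(1) order_trans[OF m(2) p(2)] order_trans[OF m(3) p(3)])
qed

lemma cell_refines_swap: "cell_refines n k xi et k' xi' et' ==> cell_refines n k et xi k' et' xi'" unfolding cell_refines_def by (simp add: conj_commute)

lemma meshle_cell_refines:
 assumes "meshle n k e xi" "cell_refines n k xi et k' xi' et'" shows "meshle n k' e xi'" unfolding meshle_def
proof (intro allI impI ballI)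
 fix l :: "bool list" and x y assume l: "length l = k'" and xy: "x:xi' l ` cube n" "y:xi' l ` cube n"
 from assms(2) l obtain p where p: "length p = k" "xi' l ` cube n <= xi p ` cube n" unfolding cell_refines_def by (elim allE[of _ l]) (simp, elim exE conjE)
 have "x:xi p ` cube n" "y:xi p ` cube n" using subsetD[OF p(2)] xy by simp_all
 thus "dist x y <= e" by (rule assms(1)[unfolded meshle_def, rule_format, OF p(1)])
qed

text \<open>After the \<open>mu\<close> cells are small the roles are exchanged. The second
  refinement keeps the first mesh bound, since its cells lie in the earlier ones.\<close>

lemma cells_fine:
 assumes mu: "sets mu = sets borel" and nu: "sets nu = sets borel"
  and c: "cells n k mu nu xi et" and e: "0 < e"
 shows "EX k' xi' et'. cells n k' mu nu xi' et' & cell_refines n k xi et k' xi' et' & meshle n k' e xi' & meshle n k' e et'"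
proof -
 from cells_fine1[OF mu nu c e] obtain k1 xi1 et1
  where 1: "cells n k1 mu nu xi1 et1" "cell_refines n k xi et k1 xi1 et1" "meshle n k1 e xi1" by (elim exE conjE)
 from cells_fine1[OF nu mu cells_swap[OF 1(1)] e] obtain k2 et2 xi2
  where 2: "cells n k2 nu mu et2 xi2" "cell_refines n k1 et1 xi1 k2 et2 xi2" "meshle n k2 e et2" by (elim exE conjE)
 note r = cell_refines_swap[OF 2(2)]
 show ?thesis by (rule exI[of _ k2], rule exI[of _ xi2], rule exI[of _ et2])
   (intro conjI cells_swap[OF 2(1)] cell_refines_trans[OF 1(2) r] meshle_cell_refines[OF 1(3) r] 2(3))
qed


lemma emeasure_cell:
 assumes mu: "sets mu = sets borel" and c: "cell n mu xi"
 shows "emeasure mu (xi ` cube n) = emeasure (pull (cube n) xi mu) UNIV"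
  "emeasure mu (xi ` icube n) = emeasure (pull (cube n) xi mu) UNIV"
  "closed (xi ` cube n)" "xi ` icube n:sets borel"
proof -
 have xi: "continuous_on (cube n) xi" "inj_on xi (cube n)" "cmeas n (pull (cube n) xi mu)" using c unfolding cell_def by simp_all
 have i: "icube n Int cube n = icube n" by (auto simp: icube_eq)
 show "emeasure mu (xi ` cube n) = emeasure (pull (cube n) xi mu) UNIV" using emeasure_pull[OF compact_cube xi(1,2) mu, of UNIV] by simp
 show "emeasure mu (xi ` icube n) = emeasure (pull (cube n) xi mu) UNIV"
  using emeasure_pull[OF compact_cube xi(1,2) mu icube_borel] cmeas_Int[OF xi(3), of UNIV] i by simp
 show "closed (xi ` cube n)" by (rule closed_image_cell[OF compact_cube xi(1,2)])
 show "xi ` icube n:sets borel" using image_borel_cell[OF compact_cube xi(1,2) icube_borel[of n]] i by simp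
qed

text \<open>At stage \<open>p\<close> the set \<open>K\<close> is covered by cells whose partners
  have the same masses, have disjoint interiors of full mass, and lie in the neighbourhood
  \<open>N p\<close> of the image of \<open>K\<close>. These neighbourhoods decrease to the
  image.\<close>

lemma cells_measure_le:
 assumes mu: "cmeas n mu" and nu: "cmeas n nu"
  and c: "!!p. cells n (k p) mu nu (xi p) (et p)"
  and h: "continuous_on (cube n) h"
  and d: "!!p l x y. length l = k p ==> x:xi p l ` cube n ==> y:et p l ` cube n ==> dist y (h x) <= 2 * (1/2) ^ p"
  and K: "compact K" "K <= cube n"
 shows "emeasure mu K <= emeasure nu (h ` K)"
proof (cases "K = {}")
 case False
 note A = cmeasD[OF mu] and B = cmeasD[OF nu]
 interpret B: finite_measure nu by (rule B(2))
 have hK: "compact (h ` K)" "h ` K ~= {}" using False K(1) cont_subset[OF h K(2)] by (simp_all add: compact_continuous_image)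
 define N where "N p = {y. infdist y (h ` K) <= 2 * (1/2) ^ p}" for p :: nat
 have Nc: "closed (N p)" for p unfolding N_def by (intro closed_Collect_le continuous_intros)
 have le: "emeasure mu K <= emeasure nu (N p)" for p proof -
  define S where "S = {l. length l = k p & xi p l ` cube n Int K ~= {}}"
  have fS: "finite S" unfolding S_def by (rule finite_subset[OF _ finite_bool_lists[of "k p"]]) (intro Collect_mono impI, elim conjE)
  have Sl: "length l = k p" if "l:S" for l using that by (simp add: S_def)
  note cA = emeasure_cell[OF A(1) cellsD(1)[OF c Sl]] and cB = emeasure_cell[OF B(1) cellsD(2)[OF c Sl]]
  have "K <= (UN l:S. xi p l ` cube n)" proof
   fix x assume x: "x:K"
   from cellsD(4)[OF c[of p] subsetD[OF K(2) x]] obtain l where l: "length l = k p" "x:xi p l ` cube n" by (elim exE conjE)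
   hence "xi p l ` cube n Int K ~= {}" using x by (metis IntI emptyE)
   hence "l:S" using l(1) by (simp add: S_def)
   thus "x:(UN l:S. xi p l ` cube n)" using l(2) by (rule UN_I)
  qed
  hence "emeasure mu K <= emeasure mu (UN l:S. xi p l ` cube n)" by (rule emeasure_mono) (unfold A(1), intro borel_closed closed_UN fS ballI cA(3))
  also have "... <= (SUM l:S. emeasure mu (xi p l ` cube n))"
   using cA(3) by (intro emeasure_subadditive_finite fS) (simp_all add: A(1) image_subset_iff borel_closed)
  also have "... = (SUM l:S. emeasure nu (et p l ` icube n))" using cA(1) cB(2) cellsD(3)[OF c Sl] by (intro sum.cong) simp_all
  also have "... = emeasure nu (UN l:S. et p l ` icube n)" proof (rule sum_emeasure)
   show "(%l. et p l ` icube n) ` S <= sets nu" using cB(4) by (simp add: B(1) image_subset_iff)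
   show "disjoint_family_on (%l. et p l ` icube n) S" unfolding disjoint_family_on_def proof (intro ballI impI)
    fix l m assume lm: "l:S" "m:S" "l ~= m"
    show "et p l ` icube n Int et p m ` icube n = {}" proof (rule ccontr)
     assume "et p l ` icube n Int et p m ` icube n ~= {}"
     then obtain y where y: "y:et p l ` icube n" "y:et p m ` icube n" by (metis IntE ex_in_conv)
     from y(1) obtain q where q: "y = et p l q" "q:icube n" by (rule imageE)
     from y(2) obtain q' where q': "y = et p m q'" "q':icube n" by (rule imageE)
     have qc: "q:cube n" "q':cube n" "q~:bcube n" using q q' by (simp_all add: icube_eq)
     have "q:bcube n" using cellsD(7)[OF cells_swap[OF c[of p]] Sl[OF lm(1)] Sl[OF lm(2)] lm(3) qc(1,2)] q q' by simp
     thus False using qc(3) by simp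
    qed
   qed
  qed (rule fS)
  also have "... <= emeasure nu (N p)" proof (rule emeasure_mono)
   show "N p:sets nu" using Nc by (simp add: B(1) borel_closed)
   show "(UN l:S. et p l ` icube n) <= N p" proof
    fix y assume "y:(UN l:S. et p l ` icube n)"
    then obtain l where l: "l:S" "y:et p l ` icube n" by (rule UN_E)
    have "y:et p l ` cube n" using l(2) image_mono[of "icube n" "cube n" "et p l"] by (auto simp: icube_eq)
    moreover obtain x where "x:xi p l ` cube n" "x:K" using l(1) unfolding S_def by (metis (mono_tags, lifting) IntE ex_in_conv mem_Collect_eq)
    ultimately have "dist y (h x) <= 2 * (1/2) ^ p" "h x:h ` K" using d[OF Sl[OF l(1)]] by simp_all
    thus "y:N p" unfolding N_def using infdist_le[of "h x" "h ` K" y] by simp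
   qed
  qed
  finally show ?thesis .
 qed
 have dec: "decseq N" unfolding decseq_def proof (intro allI impI subsetI)
  fix p q :: nat and y assume pq: "p <= q" and y: "y:N q"
  have "(1/2::real) ^ q <= (1/2) ^ p" by (rule power_decreasing[OF pq]) simp_all
  hence "2 * (1/2::real) ^ q <= 2 * (1/2) ^ p" by simp
  with y show "y:N p" unfolding N_def mem_Collect_eq by (rule order_trans)
 qed
 have "(\<Inter>p. N p) = h ` K" proof (intro equalityI subsetI)
  fix y assume "y:(\<Inter>p. N p)"
  hence "infdist y (h ` K) <= 2 * (1/2) ^ p" for p by (simp add: N_def)
  moreover have "(%p. 2 * (1/2) ^ p :: real) \<longlonglongrightarrow> 2 * 0" by (intro tendsto_intros LIMSEQ_power_zero) simp
  ultimately have "infdist y (h ` K) <= 2 * 0" by (metis LIMSEQ_le_const)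
  hence "infdist y (h ` K) = 0" using infdist_nonneg[of y "h ` K"] by linarith
  thus "y:h ` K" using in_closed_iff_infdist_zero[OF compact_imp_closed[OF hK(1)] hK(2)] by simp
 next
  fix y assume "y:h ` K"
  hence "infdist y (h ` K) = 0" by simp
  thus "y:(\<Inter>p. N p)" by (simp add: N_def)
 qed
 hence "(%p. emeasure nu (N p)) \<longlonglongrightarrow> emeasure nu (h ` K)"
  using Lim_emeasure_decseq[OF _ dec, of nu] Nc by (auto simp: B(1) borel_closed B.emeasure_finite image_subset_iff)
 thus ?thesis using le by (intro LIMSEQ_le_const) auto
qed simp

text \<open>A sequence of ever finer corresponding subdivisions has limit maps in both directions;
  each is determined by compatibility with all stages, so they are mutually inverse and fix the
  boundary. The measure inequality for compact sets, used in both directions, gives equality on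
  closed sets and hence on Borel sets.\<close>

theorem oxtoby_ulam_cube:
 assumes mu: "cmeas n mu" and nu: "cmeas n nu" and eq: "emeasure mu UNIV = emeasure nu UNIV"
 shows "EX h h'. cube_homeo n h h' & (ALL x:bcube n. h x = x) & (ALL B:sets borel. emeasure mu (B Int cube n) = emeasure nu (h ` (B Int cube n)))"
proof -
 note A = cmeasD[OF mu] and B = cmeasD[OF nu]
 have pullid: "emeasure (pull (cube n) id M) X = emeasure M X" "pull (cube n) id M = M"
  if M: "cmeas n M" and X: "X:sets borel" for M X
 proof -
  note C = cmeasD[OF M]
  have 1: "emeasure (pull (cube n) id M) Y = emeasure M Y" if Y: "Y:sets borel" for Y proof -
   have "emeasure (pull (cube n) id M) Y = emeasure M (Y Int cube n)" using emeasure_pull[OF compact_cube continuous_on_id' inj_on_id C(1) Y] by simp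
   also have "... = emeasure M (Y Int cube n Int icube n)" by (rule cmeas_Int[OF M, symmetric]) (intro sets.Int Y borel_closed closed_cube)
   also have "Y Int cube n Int icube n = Y Int icube n" by (auto simp: icube_eq)
   also have "emeasure M ... = emeasure M Y" by (rule cmeas_Int[OF M Y])
   finally show ?thesis .
  qed
  show "emeasure (pull (cube n) id M) X = emeasure M X" by (rule 1[OF X])
  show "pull (cube n) id M = M" by (rule measure_eqI) (simp_all add: sets_pull_eq C(1) 1)
 qed
 have ci: "cell n M id" if "cmeas n M" for M unfolding cell_def using pullid(2)[OF that sets.empty_sets] that by simp
 have c0: "cells n 0 mu nu (%_. id) (%_. id)" unfolding cells_def using ci[OF mu] ci[OF nu] pullid(2)[OF mu sets.empty_sets] pullid(2)[OF nu sets.empty_sets] eq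
  by simp
 define P where "P p s \<longleftrightarrow> (case s of (k, xi, et) => cells n k mu nu xi et & meshle n k ((1/2)^p) xi & meshle n k ((1/2)^p) et)"
  for p :: nat and s
 define Q where "Q s s' \<longleftrightarrow> (case s of (k, xi, et) => case s' of (k', xi', et') => cell_refines n k xi et k' xi' et')" for s s'
 have P0: "EX s. P 0 s" proof -
  from cells_fine[OF A(1) B(1) c0 zero_less_one] obtain k xi et where "cells n k mu nu xi et" "meshle n k 1 xi" "meshle n k 1 et" by (elim exE conjE)
  hence "P 0 (k, xi, et)" by (simp add: P_def)
  thus ?thesis by (rule exI)
 qed
 have PS: "EX s'. P (Suc p) s' & Q s s'" if s: "P p s" for s p proof -
  obtain k xi et where s': "s = (k, xi, et)" by (metis prod_cases3)
  hence "cells n k mu nu xi et" using s by (simp add: P_def)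
  moreover have "0 < (1/2::real) ^ Suc p" by simp
  ultimately have "EX k' xi' et'. cells n k' mu nu xi' et' & cell_refines n k xi et k' xi' et' &
    meshle n k' ((1/2) ^ Suc p) xi' & meshle n k' ((1/2) ^ Suc p) et'"
   by (rule cells_fine[OF A(1) B(1)])
  then obtain k' xi' et' where
   "cells n k' mu nu xi' et'" "cell_refines n k xi et k' xi' et'" "meshle n k' ((1/2) ^ Suc p) xi'" "meshle n k' ((1/2) ^ Suc p) et'"
   by (elim exE conjE)
  hence "P (Suc p) (k', xi', et')" "Q s (k', xi', et')" by (simp_all only: P_def Q_def s' prod.case simp_thms)
  thus ?thesis by (intro exI[of _ "(k', xi', et')"] conjI)
 qed
 have "EX f. ALL p. P p (f p) & Q (f p) (f (Suc p))" by (rule dependent_nat_choice[of P "%_. Q"]) (rule P0, rule PS)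
 then obtain f where "ALL p. P p (f p) & Q (f p) (f (Suc p))"
  by (elim exE)
 hence f: "!!p. P p (f p)" "!!p. Q (f p) (f (Suc p))" by simp_all
 define k where "k p = fst (f p)" for p
 define xi where "xi p = fst (snd (f p))" for p
 define et where "et p = snd (snd (f p))" for p
 have fp: "f p = (k p, xi p, et p)" for p by (simp add: k_def xi_def et_def)
 have c: "cells n (k p) mu nu (xi p) (et p)" and mxi: "meshle n (k p) ((1/2)^p) (xi p)" and met: "meshle n (k p) ((1/2)^p) (et p)" for p
  using f(1)[of p] unfolding P_def fp by simp_all
 have r: "cell_refines n (k p) (xi p) (et p) (k (Suc p)) (xi (Suc p)) (et (Suc p))" for p using f(2)[of p] unfolding Q_def fp by simp
 define I where "I p = {l :: bool list. length l = k p}" for p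
 have I: "finite (I p)" for p unfolding I_def by (rule finite_bool_lists)
 have cne: "cube n ~= {}" proof -
  have "(%_. 0):cube n" by (simp add: cube_def)
  thus ?thesis by (metis emptyE)
 qed
 have H: "EX h. continuous_on (cube n) h &
  (ALL x:cube n. ALL p. EX i:I p. x:X p i ` cube n & h x:Y p i ` cube n) &
  (ALL x:cube n. ALL y. (ALL p. EX i:I p. x:X p i ` cube n & y:Y p i ` cube n) --> y = h x) &
  (ALL p. ALL i:I p. ALL x:X p i ` cube n. ALL y:Y p i ` cube n. dist y (h x) <= 2 * (1/2)^p)"
  if c: "!!p. cells n (k p) M N (X p) (Y p)" and m: "!!p. meshle n (k p) ((1/2)^p) (Y p)"
   and r: "!!p. cell_refines n (k p) (X p) (Y p) (k (Suc p)) (X (Suc p)) (Y (Suc p))" for M N X Y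
 proof (rule matching_map[where X="cube n" and I=I and A="%p i. X p i ` cube n" and B="%p i. Y p i ` cube n" and e="%p. (1/2)^p"])
  have X: "continuous_on (cube n) (X p i)" "X p i ` cube n <= cube n" and Y: "continuous_on (cube n) (Y p i)"
   if "i:I p" for p i
   using cellsD(1,2)[OF c[of p], of i] that unfolding cell_def I_def by simp_all
  show "finite (I p)" for p by (rule I)
  show "cube n = (UN i:I p. X p i ` cube n)" for p proof (intro equalityI subsetI)
   fix x assume "x:cube n"
   from cellsD(4)[OF c[of p] this] show "x:(UN i:I p. X p i ` cube n)" unfolding I_def by (elim exE conjE) (rule UN_I, simp_all)
  next
   fix x assume "x:(UN i:I p. X p i ` cube n)"
   then obtain i where "i:I p" "x:X p i ` cube n" by (rule UN_E)
   thus "x:cube n" using X(2) by (metis subsetD)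
  qed
  show "compact (X p i ` cube n)" "compact (Y p i ` cube n)" "Y p i ` cube n ~= {}" if "i:I p" for p i
   using X[OF that] Y[OF that] cne by (simp_all add: compact_continuous_image compact_cube)
  show "Y p i ` cube n Int Y p i' ` cube n ~= {}"
   if i: "i:I p" "i':I p" and ne: "X p i ` cube n Int X p i' ` cube n ~= {}" for p i i'
  proof (cases "i = i'")
   case True
   thus ?thesis using cne by simp
  next
   case False
   from ne obtain x where x: "x:X p i ` cube n" "x:X p i' ` cube n" by (metis IntE ex_in_conv)
   from x(1) obtain q where q: "x = X p i q" "q:cube n" by (rule imageE)
   from x(2) obtain q' where q': "x = X p i' q'" "q':cube n" by (rule imageE)
   have "Y p i q = Y p i' q'" using cellsD(6)[OF c[of p] _ _ False q(2) q'(2)] i q q' by (simp add: I_def)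
   hence "Y p i q:Y p i ` cube n Int Y p i' ` cube n" using imageI[OF q(2), of "Y p i"] imageI[OF q'(2), of "Y p i'"] by simp
   thus ?thesis by (metis emptyE)
  qed
  show "EX i0:I p. X (Suc p) i ` cube n <= X p i0 ` cube n & Y (Suc p) i ` cube n <= Y p i0 ` cube n"
   if "i:I (Suc p)" for p i
   using r[of p] that unfolding cell_refines_def I_def by simp
  show "dist y y' <= (1/2)^p" if "i:I p" "y:Y p i ` cube n" "y':Y p i ` cube n" for p i y y'
   using m[of p, unfolded meshle_def, rule_format, OF _ that(2,3)] that(1) by (simp add: I_def)
  show "(%p. (1/2)^p :: real) \<longlonglongrightarrow> 0" by (rule LIMSEQ_power_zero) simp
 next
  fix h assume a1: "continuous_on (cube n) h"
   and a2: "!!x p. x:cube n ==> EX i:I p. x:X p i ` cube n & h x:Y p i ` cube n"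
   and a3: "!!x y. x:cube n ==> (!!p. EX i:I p. x:X p i ` cube n & y:Y p i ` cube n) ==> y = h x"
   and a4: "!!p i x y. i:I p ==> x:X p i ` cube n ==> y:Y p i ` cube n ==> dist y (h x) <= 2 * (1/2)^p"
  have b2: "ALL x:cube n. ALL p. EX i:I p. x:X p i ` cube n & h x:Y p i ` cube n" by (intro ballI allI a2)
  have b3: "ALL x:cube n. ALL y. (ALL p. EX i:I p. x:X p i ` cube n & y:Y p i ` cube n) --> y = h x" proof (intro ballI allI impI)
   fix x y assume x: "x:cube n" and y: "ALL p. EX i:I p. x:X p i ` cube n & y:Y p i ` cube n"
   show "y = h x" by (rule a3[OF x]) (rule spec[OF y])
  qed
  have b4: "ALL p. ALL i:I p. ALL x:X p i ` cube n. ALL y:Y p i ` cube n. dist y (h x) <= 2 * (1/2)^p" by (intro allI ballI) (rule a4)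
  show ?thesis by (rule exI[of _ h], rule conjI[OF a1 conjI[OF b2 conjI[OF b3 b4]]])
 qed
 from H[OF c met r] obtain h where h: "continuous_on (cube n) h"
  "ALL x:cube n. ALL p. EX i:I p. x:xi p i ` cube n & h x:et p i ` cube n"
  "ALL x:cube n. ALL y. (ALL p. EX i:I p. x:xi p i ` cube n & y:et p i ` cube n) --> y = h x"
  "ALL p. ALL i:I p. ALL x:xi p i ` cube n. ALL y:et p i ` cube n. dist y (h x) <= 2 * (1/2)^p"
  by (elim exE conjE)
 from H[OF cells_swap[OF c] mxi cell_refines_swap[OF r]] obtain h' where h': "continuous_on (cube n) h'"
  "ALL x:cube n. ALL p. EX i:I p. x:et p i ` cube n & h' x:xi p i ` cube n"
  "ALL x:cube n. ALL y. (ALL p. EX i:I p. x:et p i ` cube n & y:xi p i ` cube n) --> y = h' x"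
  "ALL p. ALL i:I p. ALL x:et p i ` cube n. ALL y:xi p i ` cube n. dist y (h' x) <= 2 * (1/2)^p"
  by (elim exE conjE)
 have sub: "xi p i ` cube n <= cube n" "et p i ` cube n <= cube n" if "i:I p" for p i
  using cellsD(1,2)[OF c[of p], of i] that unfolding cell_def I_def by simp_all
 have hin: "h x:cube n" if x: "x:cube n" for x proof -
  from h(2)[rule_format, OF x, of 0] obtain i where i: "i:I 0" "h x:et 0 i ` cube n" by (elim bexE conjE)
  show ?thesis by (rule subsetD[OF sub(2)[OF i(1)] i(2)])
 qed
 have h'in: "h' x:cube n" if x: "x:cube n" for x proof -
  from h'(2)[rule_format, OF x, of 0] obtain i where i: "i:I 0" "h' x:xi 0 i ` cube n" by (elim bexE conjE)
  show ?thesis by (rule subsetD[OF sub(1)[OF i(1)] i(2)])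
 qed
 have h'h: "h' (h x) = x" if x: "x:cube n" for x proof (rule sym, rule h'(3)[rule_format, OF hin[OF x]])
  fix p
  from h(2)[rule_format, OF x, of p] show "EX i:I p. h x:et p i ` cube n & x:xi p i ` cube n" by (elim bexE conjE) (rule bexI, rule conjI)
 qed
 have hh': "h (h' x) = x" if x: "x:cube n" for x proof (rule sym, rule h(3)[rule_format, OF h'in[OF x]])
  fix p
  from h'(2)[rule_format, OF x, of p] show "EX i:I p. h' x:xi p i ` cube n & x:et p i ` cube n" by (elim bexE conjE) (rule bexI, rule conjI)
 qed
 have hom: "cube_homeo n h h'" unfolding cube_homeo_def using h(1) h'(1) hin h'in h'h hh' by simp
 have hbd: "h x = x" if x: "x:bcube n" for x proof (rule sym, rule h(3)[rule_format, OF subsetD[OF bcube_subset x]])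
  fix p
  from cellsD(8)[OF c[of p] x] obtain l q where l: "length l = k p" "q:bcube n" "x = xi p l q" "x = et p l q" by (elim exE conjE)
  have qc: "q:cube n" by (rule subsetD[OF bcube_subset l(2)])
  have "l:I p" using l(1) by (simp add: I_def)
  moreover have "x:xi p l ` cube n" using imageI[OF qc, of "xi p l"] l(3) by simp
  moreover have "x:et p l ` cube n" using imageI[OF qc, of "et p l"] l(4) by simp
  ultimately show "EX i:I p. x:xi p i ` cube n & x:et p i ` cube n" by (intro bexI conjI)
 qed
 have inj: "inj_on h (cube n)" using h'h by (metis inj_onI)
 have le1: "emeasure mu K <= emeasure nu (h ` K)" if "compact K" "K <= cube n" for K
  by (rule cells_measure_le[OF mu nu c h(1) h(4)[rule_format, unfolded I_def mem_Collect_eq] that])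
 have le2: "emeasure nu K <= emeasure mu (h' ` K)" if "compact K" "K <= cube n" for K
  by (rule cells_measure_le[OF nu mu cells_swap[OF c] h'(1) h'(4)[rule_format, unfolded I_def mem_Collect_eq] that])
 define M where "M = pull (cube n) h nu"
 have M: "emeasure M X = emeasure nu (h ` (X Int cube n))" if "X:sets borel" for X unfolding M_def by (rule emeasure_pull[OF compact_cube h(1) inj B(1) that])
 have muc: "emeasure mu (X Int cube n) = emeasure mu X" if "X:sets borel" for X
  using pullid(1)[OF mu that] emeasure_pull[OF compact_cube continuous_on_id' inj_on_id A(1) that] by simp
 have F: "emeasure mu X = emeasure M X" if X: "closed X" for X proof -
  have K: "compact (X Int cube n)" using compact_Int_closed[OF compact_cube X] by (simp add: Int_commute)
  have s: "X Int cube n <= cube n" by simp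
  have hK: "compact (h ` (X Int cube n))" by (rule compact_continuous_image[OF cont_subset[OF h(1) s] K])
  have hs: "h ` (X Int cube n) <= cube n" using hin by (intro image_subsetI) simp
  have "h' ` h ` (X Int cube n) = (%x. x) ` (X Int cube n)" unfolding image_image by (rule image_cong) (simp_all add: h'h)
  hence "emeasure nu (h ` (X Int cube n)) = emeasure mu (X Int cube n)" using le1[OF K s] le2[OF hK hs] by simp
  thus ?thesis using M[of X] muc[of X] X by (simp add: borel_closed)
 qed
 have "mu = M" proof (rule measure_eqI_generator_eq[where E="Collect closed" and \<Omega>=UNIV and A="%_. UNIV"])
  show "Int_stable (Collect closed)" by (auto intro: Int_stableI closed_Int)
  show "sets mu = sigma_sets UNIV (Collect closed)" "sets M = sigma_sets UNIV (Collect closed)" unfolding A(1) M_def sets_pull_eq borel_eq_closed by simp_all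
  show "emeasure mu UNIV ~= \<infinity>" using finite_measure.emeasure_finite[OF A(2)] by simp
 qed (use F in auto)
 hence "ALL B:sets borel. emeasure mu (B Int cube n) = emeasure nu (h ` (B Int cube n))" using M muc by simp
 with hom hbd show ?thesis by (intro exI[of _ h] exI[of _ h'] conjI ballI) simp_all
qed

subsection \<open>Lebesgue measure and moves along coordinate lines\<close>

definition U01 :: "real measure" where "U01 = uniform_measure lborel {0..1}"

lemma sets_U01 [simp, measurable_cong]: "sets U01 = sets borel" by (simp add: U01_def)

lemma prob_space_U01: "prob_space U01" unfolding U01_def by (rule prob_space_uniform_measure) auto

lemma nn_integral_U01: "f:borel_measurable borel ==> (\<integral>\<^sup>+t. f t \<partial>U01) = (\<integral>\<^sup>+t. f t * indicator {0..1} t \<partial>lborel)"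
 unfolding U01_def by (subst nn_integral_uniform_measure) (auto simp: divide_ennreal_def)

lemma AE_U01: "AE t in U01. 0 <= t & t <= 1" unfolding U01_def by (rule AE_uniform_measureI) auto

lemma fun_upd_continuous: "continuous_on S (%p :: pt \<times> real. (fst p)(k := snd p))"
proof (rule cont_fun)
 fix i show "continuous_on S (%p :: pt \<times> real. ((fst p)(k := snd p)) i)"
  by (cases "i = k") (auto intro!: continuous_intros cont_coord[OF continuous_on_fst[OF continuous_on_id]])
qed

lemma fun_upd_measurable [measurable]: "(%p :: pt \<times> real. (fst p)(k := snd p)):measurable (borel \<Otimes>\<^sub>M borel) borel"
 using borel_measurable_continuous_onI[OF fun_upd_continuous[of UNIV k]] by (simp only: borel_prod[where 'a=pt and 'b=real])

text \<open>Lebesgue measure on the cube, built one coordinate at a time: a uniform sample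
  overwrites the zero at position \<open>k\<close>.\<close>

primrec lam :: "nat => pt measure" where
 "lam 0 = return borel (%_. 0)"
| "lam (Suc k) = distr (lam k \<Otimes>\<^sub>M U01) borel (%p. (fst p)(k := snd p))"

lemma sets_lam [simp, measurable_cong]: "sets (lam n) = sets borel" by (cases n) simp_all

lemma space_lam [simp]: "space (lam n) = UNIV" using sets_eq_imp_space_eq[OF sets_lam[of n]] by simp

lemma upd_measurable_lam: "(%p. (fst p)(k := snd p)):measurable (lam n \<Otimes>\<^sub>M U01) borel"
proof -
 have "sets (lam n \<Otimes>\<^sub>M U01) = sets (borel \<Otimes>\<^sub>M borel)" by (rule sets_pair_measure_cong) simp_all
 thus ?thesis using fun_upd_measurable measurable_cong_sets by blast
qed

lemma prob_space_lam: "prob_space (lam n)"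
proof (induction n)
 case 0
 show ?case by (simp add: prob_space_return)
next
 case (Suc n)
 interpret L: prob_space "lam n" by (rule Suc)
 interpret U: prob_space U01 by (rule prob_space_U01)
 interpret P: pair_prob_space "lam n" U01 by standard
 show ?case using P.prob_space_distr[OF upd_measurable_lam] by simp
qed

lemma sigma_finite_U01: "sigma_finite_measure U01" by (simp add: prob_space_U01 prob_space_imp_sigma_finite)

lemma upd_f_measurable:
 assumes f: "f:borel_measurable borel"
 shows "(%p. f ((fst p)(k := snd p))):borel_measurable (lam n \<Otimes>\<^sub>M U01)"
  and "(%t. f (x(k := t))):borel_measurable borel"
  and "(%x. \<integral>\<^sup>+t. f (x(k := t)) \<partial>U01):borel_measurable borel" proof -
 show 1: "(%p. f ((fst p)(k := snd p))):borel_measurable (lam n \<Otimes>\<^sub>M U01)" for n using measurable_compose[OF upd_measurable_lam f] .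
 have "(%t. (x, t)):measurable borel (borel \<Otimes>\<^sub>M borel)" by simp
 from measurable_compose[OF this measurable_compose[OF fun_upd_measurable[of k] f]]
 show "(%t. f (x(k := t))):borel_measurable borel" by simp
 interpret sigma_finite_measure U01 by (rule sigma_finite_U01)
 have "(%x. \<integral>\<^sup>+t. f (x(k := t)) \<partial>U01):borel_measurable (lam n)"
  by (rule borel_measurable_nn_integral) (use 1[of n] in "simp add: case_prod_beta'")
 thus "(%x. \<integral>\<^sup>+t. f (x(k := t)) \<partial>U01):borel_measurable borel" using measurable_cong_sets[OF sets_lam[of n] refl] by blast
qed

lemma nn_integral_lam_Suc:
 assumes f: "f:borel_measurable borel"
 shows "(\<integral>\<^sup>+x. f x \<partial>lam (Suc k)) = (\<integral>\<^sup>+x. \<integral>\<^sup>+t. f (x(k := t)) \<partial>U01 \<partial>lam k)"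
proof -
 interpret sigma_finite_measure U01 by (rule sigma_finite_U01)
 have "(\<integral>\<^sup>+x. f x \<partial>lam (Suc k)) = (\<integral>\<^sup>+p. f ((fst p)(k := snd p)) \<partial>(lam k \<Otimes>\<^sub>M U01))"
  using f by (simp add: nn_integral_distr[OF upd_measurable_lam])
 also have "... = (\<integral>\<^sup>+x. \<integral>\<^sup>+t. f (x(k := t)) \<partial>U01 \<partial>lam k)"
  using nn_integral_fst[OF upd_f_measurable(1)[OF f], of k k] by simp
 finally show ?thesis .
qed

text \<open>Fubini in a form that treats all coordinates alike: replacing one coordinate by a fresh
  sample leaves the integral unchanged. For the last coordinate this is the recursion itself; for an
  earlier one the two inner integrals are exchanged.\<close>

lemma nn_integral_lam_resample:
 assumes f: "f:borel_measurable borel" and j: "j < n"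
 shows "(\<integral>\<^sup>+x. f x \<partial>lam n) = (\<integral>\<^sup>+x. \<integral>\<^sup>+t. f (x(j := t)) \<partial>U01 \<partial>lam n)" using f j
proof (induction n arbitrary: f)
 case (Suc k)
 note f = Suc.prems(1)
 interpret U: prob_space U01 by (rule prob_space_U01)
 interpret P: pair_sigma_finite U01 U01 by standard
 show ?case proof (cases "j = k")
  case True
  have "(\<integral>\<^sup>+x. \<integral>\<^sup>+t. f (x(j := t)) \<partial>U01 \<partial>lam (Suc k)) = (\<integral>\<^sup>+x. \<integral>\<^sup>+s. \<integral>\<^sup>+t. f ((x(k := s))(j := t)) \<partial>U01 \<partial>U01 \<partial>lam k)"
   by (rule nn_integral_lam_Suc[OF upd_f_measurable(3)[OF f]])
  also have "... = (\<integral>\<^sup>+x. \<integral>\<^sup>+t. f (x(k := t)) \<partial>U01 \<partial>lam k)" using True U.emeasure_space_1 by simp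
  also have "... = (\<integral>\<^sup>+x. f x \<partial>lam (Suc k))" by (rule nn_integral_lam_Suc[OF f, symmetric])
  finally show ?thesis by (rule sym)
 next
  case False
  hence j: "j < k" using Suc.prems(2) by simp
  have "(\<integral>\<^sup>+x. f x \<partial>lam (Suc k)) = (\<integral>\<^sup>+x. \<integral>\<^sup>+t. f (x(k := t)) \<partial>U01 \<partial>lam k)" by (rule nn_integral_lam_Suc[OF f])
  also have "... = (\<integral>\<^sup>+x. \<integral>\<^sup>+s. \<integral>\<^sup>+t. f ((x(j := s))(k := t)) \<partial>U01 \<partial>U01 \<partial>lam k)"
   by (rule Suc.IH[OF upd_f_measurable(3)[OF f] j])
  also have "... = (\<integral>\<^sup>+x. \<integral>\<^sup>+t. \<integral>\<^sup>+s. f ((x(j := s))(k := t)) \<partial>U01 \<partial>U01 \<partial>lam k)"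
  proof (rule nn_integral_cong)
   fix x
   have c: "cont (%p :: real \<times> real. (x(j := fst p))(k := snd p))" proof (rule cont_fun)
    fix i show "cont (%p :: real \<times> real. ((x(j := fst p))(k := snd p)) i)"
     by (cases "i = k"; cases "i = j") (auto intro!: continuous_intros)
   qed
   have "(%p :: real \<times> real. (x(j := fst p))(k := snd p)):measurable (borel \<Otimes>\<^sub>M borel) borel"
    using borel_measurable_continuous_onI[OF c] by (simp only: borel_prod[where 'a=real and 'b=real])
   from measurable_compose[OF this f]
   have m: "(%p. f ((x(j := fst p))(k := snd p))):borel_measurable (borel \<Otimes>\<^sub>M borel)" .
   have "sets (U01 \<Otimes>\<^sub>M U01) = sets (borel \<Otimes>\<^sub>M borel)" by (rule sets_pair_measure_cong) simp_all
   hence m': "(%p. f ((x(j := fst p))(k := snd p))):borel_measurable (U01 \<Otimes>\<^sub>M U01)" using m measurable_cong_sets by blast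
   show "(\<integral>\<^sup>+s. \<integral>\<^sup>+t. f ((x(j := s))(k := t)) \<partial>U01 \<partial>U01) = (\<integral>\<^sup>+t. \<integral>\<^sup>+s. f ((x(j := s))(k := t)) \<partial>U01 \<partial>U01)"
    using P.Fubini'[of "%s t. f ((x(j := s))(k := t))"] m' by (simp add: case_prod_beta')
  qed
  also have "... = (\<integral>\<^sup>+x. \<integral>\<^sup>+t. \<integral>\<^sup>+s. f ((x(k := t))(j := s)) \<partial>U01 \<partial>U01 \<partial>lam k)"
   using False by (simp add: fun_upd_twist)
  also have "... = (\<integral>\<^sup>+x. \<integral>\<^sup>+s. f (x(j := s)) \<partial>U01 \<partial>lam (Suc k))"
   by (rule nn_integral_lam_Suc[OF upd_f_measurable(3)[OF f], symmetric])
  finally show ?thesis .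
 qed
qed simp

lemma lam_compl_cube: "emeasure (lam n) (- cube n) = 0"
proof (induction n)
 case 0
 have "(%_. 0):cube 0" by (simp add: cube_def)
 thus ?case by (simp add: closed_cube borel_comp borel_closed)
next
 case (Suc k)
 have b: "- cube (Suc k):sets borel" by (simp add: closed_cube borel_comp borel_closed)
 have "AE x in lam k. x~:- cube k" using Suc by (intro AE_not_in null_setsI) (simp_all add: closed_cube borel_comp borel_closed)
 hence ae: "AE x in lam k. (\<integral>\<^sup>+t. indicator (- cube (Suc k)) (x(k := t)) \<partial>U01) = 0" proof eventually_elim
  case (elim x)
  have "AE t in U01. indicator (- cube (Suc k)) (x(k := t)) = (0::ennreal)" using AE_U01 proof eventually_elim
   case (elim t)
   with \<open>x~:- cube k\<close> have "x(k := t):cube (Suc k)" by (auto simp: cube_def less_Suc_eq)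
   thus ?case by simp
  qed
  hence "(\<integral>\<^sup>+t. indicator (- cube (Suc k)) (x(k := t)) \<partial>U01) = (\<integral>\<^sup>+t. 0 \<partial>U01)" by (rule nn_integral_cong_AE)
  thus ?case by simp
 qed
 have "emeasure (lam (Suc k)) (- cube (Suc k)) = (\<integral>\<^sup>+x. indicator (- cube (Suc k)) x \<partial>lam (Suc k))"
  using b by (intro nn_integral_indicator[symmetric]) (simp only: sets_lam)
 also have "... = (\<integral>\<^sup>+x. \<integral>\<^sup>+t. indicator (- cube (Suc k)) (x(k := t)) \<partial>U01 \<partial>lam k)"
  by (rule nn_integral_lam_Suc[OF borel_measurable_indicator[OF b]])
 also have "... = (\<integral>\<^sup>+x. 0 \<partial>lam k)" by (rule nn_integral_cong_AE[OF ae])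
 finally show ?case by simp
qed

lemma lam_slice:
 assumes "j < n" shows "emeasure (lam n) {x. x j = c} = 0"
proof -
 have b: "{x :: nat => real. x j = c}:sets borel" by (intro borel_closed closed_coord_eq)
 have "emeasure (lam n) {x. x j = c} = (\<integral>\<^sup>+x. indicator {x. x j = c} x \<partial>lam n)"
  using b by (intro nn_integral_indicator[symmetric]) (simp only: sets_lam)
 also have "... = (\<integral>\<^sup>+x. \<integral>\<^sup>+t. indicator {x. x j = c} (x(j := t)) \<partial>U01 \<partial>lam n)"
  by (rule nn_integral_lam_resample[OF borel_measurable_indicator[OF b] assms])
 also have "... = (\<integral>\<^sup>+x. \<integral>\<^sup>+t. indicator {c} t \<partial>U01 \<partial>lam n)"
  by (intro nn_integral_cong) (simp add: indicator_def)
 also have "(\<integral>\<^sup>+t. indicator {c} t \<partial>U01) = 0" proof -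
  have "emeasure U01 {c} = emeasure lborel ({0..1} Int {c}) / 1" unfolding U01_def by (subst emeasure_uniform_measure) auto
  also have "emeasure lborel ({0..1} Int {c}) = 0" by (cases "c:{0..1}") auto
  finally have "emeasure U01 {c} = 0" by simp
  thus ?thesis by simp
 qed
 finally show ?thesis by simp
qed

lemma lam_open_pos: "open U ==> x:U ==> x:cube n ==> 0 < emeasure (lam n) U"
proof (induction n arbitrary: U x)
 case 0
 hence "x = (%_. 0)" by (auto simp: cube_def)
 thus ?case using 0 by (simp add: borel_open)
next
 case (Suc k)
 define y where "y = x(k := 0)"
 have y: "y:cube k" using Suc.prems(3) by (auto simp: cube_def y_def less_Suc_eq)
 have xk: "0 <= x k" "x k <= 1" using Suc.prems(3) by (auto simp: cube_def)
 have "open ((%p. (fst p)(k := snd p)) -` U)" by (rule open_vimage[OF Suc.prems(1) fun_upd_continuous])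
 moreover have "(y, x k):(%p. (fst p)(k := snd p)) -` U" using Suc.prems(2) by (simp add: y_def)
 ultimately obtain A B where AB: "open A" "open B" "(y, x k):A \<times> B" "A \<times> B <= (%p. (fst p)(k := snd p)) -` U" by (rule open_prod_elim)
 have A: "0 < emeasure (lam k) A" using Suc.IH[OF AB(1) _ y] AB(3) by simp
 obtain d where d: "0 < d" "ball (x k) d <= B" using AB(2,3) openE by blast
 define l where "l = max 0 (x k - d)" define r where "r = min 1 (x k + d)"
 have lr: "l < r" "0 <= l" "r <= 1" using xk d(1) by (auto simp: l_def r_def)
 have sub: "{l<..<r} <= B Int {0..1}" using d(2) lr by (auto simp: subset_iff l_def r_def dist_real_def)
 have "0 < emeasure lborel {l<..<r}" using lr by simp
 also have "... <= emeasure lborel (B Int {0..1})" using sub AB(2) by (intro emeasure_mono) (auto simp: borel_open)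
 also have "... = emeasure U01 B" unfolding U01_def using AB(2) by (subst emeasure_uniform_measure) (auto simp: borel_open Int_commute divide_ennreal_def)
 also have "... = (\<integral>\<^sup>+t. indicator B t \<partial>U01)" using AB(2) by (simp add: borel_open)
 finally have B: "0 < (\<integral>\<^sup>+t. indicator B t \<partial>U01)" .
 have Ub: "U:sets borel" using Suc.prems(1) by (rule borel_open)
 have "0 < (\<integral>\<^sup>+t. indicator B t \<partial>U01) * emeasure (lam k) A" using A B by (simp add: ennreal_zero_less_mult_iff)
 also have "... = (\<integral>\<^sup>+x. (\<integral>\<^sup>+t. indicator B t \<partial>U01) * indicator A x \<partial>lam k)"
  using AB(1) by (simp add: nn_integral_cmult_indicator borel_open)
 also have "... <= (\<integral>\<^sup>+x. \<integral>\<^sup>+t. indicator U (x(k := t)) \<partial>U01 \<partial>lam k)" proof (rule nn_integral_mono)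
  fix z
  show "(\<integral>\<^sup>+t. indicator B t \<partial>U01) * indicator A z <= (\<integral>\<^sup>+t. indicator U (z(k := t)) \<partial>U01)"
  proof (cases "z:A")
   case True
   have "indicator B t <= (indicator U (z(k := t)) :: ennreal)" for t proof (cases "t:B")
    case tB: True
    hence "(z, t):(%p. (fst p)(k := snd p)) -` U" using AB(4) True by (meson SigmaI subsetD)
    thus ?thesis by (simp add: indicator_def)
   qed simp
   thus ?thesis using True by (simp add: nn_integral_mono)
  qed simp
 qed
 also have "... = (\<integral>\<^sup>+x. indicator U x \<partial>lam (Suc k))" by (rule nn_integral_lam_Suc[OF borel_measurable_indicator[OF Ub], symmetric])
 also have "... = emeasure (lam (Suc k)) U" using Ub by (intro nn_integral_indicator) (simp only: sets_lam)
 finally show ?case .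
qed

lemma cmeas_lam:
 assumes n: "0 < n" shows "cmeas n (lam n)"
proof -
 have f: "finite_measure (lam n)" using prob_space_lam[of n] by (rule prob_space.finite_measure)
 have p: "emeasure (lam n) {x} = 0" for x proof -
  have "emeasure (lam n) {x} <= emeasure (lam n) {y. y 0 = x 0}" by (rule emeasure_mono) (auto simp: borel_closed closed_coord_eq)
  thus ?thesis using lam_slice[OF n] by simp
 qed
 have b: "emeasure (lam n) (bcube n) = 0" proof -
  let ?N = "UN i:{..<n}. {x. x i = 0} Un {x. x i = 1}"
  have sub: "bcube n <= ?N" by (auto simp: bcube_def)
  have sl: "{x. x i = c}:null_sets (lam n)" if "i < n" for i c by (intro null_setsI lam_slice that) (simp add: borel_closed closed_coord_eq)
  have N: "?N:null_sets (lam n)" by (intro null_sets_UN' null_sets.Un sl) simp_all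
  have "emeasure (lam n) (bcube n) <= emeasure (lam n) ?N" by (rule emeasure_mono[OF sub null_setsD2[OF N]])
  thus ?thesis using null_setsD1[OF N] by simp
 qed
 have "0 < emeasure (lam n) (U Int cube n)" if U: "open U" "U Int cube n ~= {}" for U proof -
  obtain x where "x:U" "x:cube n" using U(2) by (metis IntE ex_in_conv)
  hence "0 < emeasure (lam n) U" using lam_open_pos[OF U(1)] by simp
  also have "... = emeasure (lam n) (U Int cube n)" proof (rule emeasure_eq_AE)
   have "AE x in lam n. x~:- cube n" using lam_compl_cube by (intro AE_not_in null_setsI) (simp_all add: closed_cube borel_comp borel_closed)
   thus "AE x in lam n. (x:U) = (x:U Int cube n)" by eventually_elim auto
   show "U:sets (lam n)" "U Int cube n:sets (lam n)" unfolding sets_lam by (intro sets.Int borel_open borel_closed closed_cube U)+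
  qed
  finally show ?thesis .
 qed
 thus ?thesis unfolding cmeas_def using f p b lam_compl_cube by simp
qed

section \<open>Monotone rearrangement on the unit interval\<close>

lemma prim_extension:
 fixes f :: "real => real"
 assumes f: "continuous_on {0..1} f"
 obtains G where "!!t. t:{0..1} ==> (G has_real_derivative f t) (at t)"
  "!!t. t:{0..1} ==> G t = integral {0..t} f"
proof -
 \<comment> \<open>The constant continuation beyond the interval gives the primitive a two-sided
   derivative at 0 and 1 as well.\<close>
 define e where "e s = f (max 0 (min 1 s))" for s
 have e: "continuous_on S e" for S unfolding e_def by (rule cont_comp[OF f]) (auto intro!: continuous_intros)
 define G where "G t = integral {-1..t} e - integral {-1..0} e" for t
 have ei: "e integrable_on {a..b}" for a b by (rule integrable_continuous_real[OF e])
 show thesis proof (rule that)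
  fix t :: real assume t: "t:{0..1}"
  have "((%x. integral {-1..x} e) has_real_derivative e t) (at t within {-1..2})" by (rule integral_has_real_derivative[OF e]) (use t in auto)
  hence "((%x. integral {-1..x} e) has_real_derivative e t) (at t)" using t at_within_Icc_at[of "-1" t 2] by simp
  moreover have "e t = f t" using t by (simp add: e_def)
  ultimately show "(G has_real_derivative f t) (at t)" unfolding G_def by (auto intro!: derivative_eq_intros)
  have "integral {-1..0} e + integral {0..t} e = integral {-1..t} e" using t by (intro Henstock_Kurzweil_Integration.integral_combine ei) auto
  moreover have "integral {0..t} e = integral {0..t} f" by (rule Henstock_Kurzweil_Integration.integral_cong) (use t in "auto simp: e_def")
  ultimately show "G t = integral {0..t} f" unfolding G_def by simp
 qed
qed

context
 fixes f :: "real => real"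
 assumes f: "continuous_on {0..1} f" and fpos: "ALL t:{0..1}. 0 < f t"
begin

lemma prim_strict:
 assumes st: "0 <= s" "s < t" "t <= 1" shows "integral {0..s} f < integral {0..t} f"
proof (rule prim_extension[OF f])
 fix G assume G: "!!t. t:{0..1} ==> (G has_real_derivative f t) (at t)"
  "!!t. t:{0..1} ==> G t = integral {0..t} f"
 have "G s < G t" proof (rule DERIV_pos_imp_increasing[OF st(2)])
  fix x assume "s <= x" "x <= t"
  hence "x:{0..1}" using st by simp
  thus "EX y. DERIV G x :> y & 0 < y" using G(1) fpos by blast
 qed
 thus ?thesis using G(2)[of s] G(2)[of t] st by simp
qed

lemma prim_le_iff: "s:{0..1} ==> t:{0..1} ==> integral {0..s} f <= integral {0..t} f \<longleftrightarrow> s <= t"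
 using prim_strict[of s t] prim_strict[of t s] by (cases s t rule: linorder_cases) auto

lemma prim_eq_iff: "s:{0..1} ==> t:{0..1} ==> integral {0..s} f = integral {0..t} f \<longleftrightarrow> s = t"
 using prim_le_iff[of s t] prim_le_iff[of t s] by auto

lemma prim_cont: "continuous_on {0..1} (%t. integral {0..t} f)" by (rule indefinite_integral_continuous_1[OF integrable_continuous_real[OF f]])

lemma prim_surj:
 assumes "0 <= u" "u <= integral {0..1} f"
 obtains t where "t:{0..1}" "integral {0..t} f = u"
proof -
 have "EX t. 0 <= t & t <= 1 & integral {0..t} f = u" by (rule IVT'[OF _ assms(2) _ prim_cont]) (use assms in simp_all)
 thus thesis using that by auto
qed

lemma prim_bounds: "t:{0..1} ==> 0 <= integral {0..t} f" "t:{0..1} ==> integral {0..t} f <= integral {0..1} f"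
 using prim_le_iff[of 0 t] prim_le_iff[of t 1] by auto

lemma prim_nn_integral:
 assumes H: "H:borel_measurable borel"
 shows "(\<integral>\<^sup>+u. ennreal (H u * indicator {0..integral {0..1} f} u) \<partial>lborel) =
  (\<integral>\<^sup>+t. ennreal (H (integral {0..t} f) * f t * indicator {0..1} t) \<partial>lborel)"
proof (rule prim_extension[OF f])
 fix G assume G: "!!t. t:{0..1} ==> (G has_real_derivative f t) (at t)"
  "!!t. t:{0..1} ==> G t = integral {0..t} f"
 have G01: "G 0 = 0" "G 1 = integral {0..1} f" using G(2)[of 0] G(2)[of 1] by simp_all
 have "(\<integral>\<^sup>+u. ennreal (H u * indicator {G 0..G 1} u) \<partial>lborel) = (\<integral>\<^sup>+t. ennreal (H (G t) * f t * indicator {0..1} t) \<partial>lborel)"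
  by (rule nn_integral_substitution[OF _ G(1) f])
   (use H fpos in "auto simp: set_borel_measurable_def less_imp_le")
 also have "... = (\<integral>\<^sup>+t. ennreal (H (integral {0..t} f) * f t * indicator {0..1} t) \<partial>lborel)"
  by (intro nn_integral_cong) (auto simp: indicator_def G(2))
 finally show ?thesis unfolding G01 .
qed

end

text \<open>\<open>T\<close> is the monotone rearrangement of \<open>f\<close> into
  \<open>h\<close>. Substituting the primitive of \<open>f\<close> on the left and that of
  \<open>h\<close> on the right turns both sides into the integral of \<open>F (R u)\<close> over
  \<open>{0..?c}\<close>, where \<open>R\<close> inverts the primitive of \<open>h\<close>.\<close>

lemma line_transport:
 fixes f h T F :: "real => real"
 assumes f: "continuous_on {0..1} f" "ALL t:{0..1}. 0 < f t"
  and h: "continuous_on {0..1} h" "ALL t:{0..1}. 0 < h t"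
  and eq: "integral {0..1} f = integral {0..1} h"
  and T: "!!t. t:{0..1} ==> T t:{0..1} & integral {0..T t} h = integral {0..t} f"
  and F: "F:borel_measurable borel"
 shows "(\<integral>\<^sup>+t. ennreal (F (T t) * f t * indicator {0..1} t) \<partial>lborel) = (\<integral>\<^sup>+t. ennreal (F t * h t * indicator {0..1} t) \<partial>lborel)"
proof -
 let ?P = "%t. integral {0..t} h"
 let ?c = "integral {0..1} h"
 define R where "R = the_inv_into {0..1} ?P"
 have inj: "inj_on ?P {0..1}" using prim_eq_iff[OF h] by (intro inj_onI) simp
 have R: "R (?P t) = t" if "t:{0..1}" for t unfolding R_def using the_inv_into_f_f[OF inj that] .
 have img: "?P ` {0..1} = {0..?c}" proof (intro equalityI subsetI)
  fix u assume "u:?P ` {0..1}"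
  thus "u:{0..?c}" using prim_bounds[OF h] by auto
 next
  fix u assume "u:{0..?c}"
  then obtain t where "t:{0..1}" "?P t = u" using prim_surj[OF h, of u] by auto
  thus "u:?P ` {0..1}" by blast
 qed
 have "continuous_on {0..?c} R" using continuous_on_inv_into[OF prim_cont[OF h] compact_Icc inj] unfolding R_def img .
 hence "R:borel_measurable (restrict_space borel {0..?c})" by (rule borel_measurable_continuous_on_restrict)
 hence "(%u. F (R u)):borel_measurable (restrict_space borel {0..?c})" by (rule measurable_compose[OF _ F])
 hence H: "(%u. if u:{0..?c} then F (R u) else 0):borel_measurable borel" (is "?H:_") by (subst (asm) measurable_restrict_space_iff[where c=0]) simp_all
 have "(\<integral>\<^sup>+t. ennreal (F (T t) * f t * indicator {0..1} t) \<partial>lborel) =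
  (\<integral>\<^sup>+t. ennreal (?H (integral {0..t} f) * f t * indicator {0..1} t) \<partial>lborel)"
 proof (intro nn_integral_cong)
  fix t
  show "ennreal (F (T t) * f t * indicator {0..1} t) = ennreal (?H (integral {0..t} f) * f t * indicator {0..1} t)" proof (cases "t:{0..1}")
   case True
   have "integral {0..t} f = ?P (T t)" using T[OF True] by simp
   moreover have "?P (T t):{0..?c}" using prim_bounds[OF h, of "T t"] T[OF True] by simp
   moreover have "R (?P (T t)) = T t" using R[of "T t"] T[OF True] by simp
   ultimately show ?thesis by simp
  qed simp
 qed
 also have "... = (\<integral>\<^sup>+u. ennreal (?H u * indicator {0..?c} u) \<partial>lborel)" using prim_nn_integral[OF f H] eq by simp
 also have "... = (\<integral>\<^sup>+t. ennreal (?H (?P t) * h t * indicator {0..1} t) \<partial>lborel)" by (rule prim_nn_integral[OF h H])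
 also have "... = (\<integral>\<^sup>+t. ennreal (F t * h t * indicator {0..1} t) \<partial>lborel)" proof (intro nn_integral_cong)
  fix t
  show "ennreal (?H (?P t) * h t * indicator {0..1} t) = ennreal (F t * h t * indicator {0..1} t)"
   using prim_bounds[OF h, of t] R[of t] by (cases "t:{0..1}") simp_all
 qed
 finally show ?thesis .
qed

section \<open>Rearrangement along all lines of one coordinate direction\<close>

definition lprim :: "nat => (real => pt => real) => real => pt => real => real"
 where "lprim j ph a x t = integral {0..t} (%s. ph a (x(j := s)))"

definition shiftc :: "nat => (real => pt => real) => (real => pt => real) => real => pt => real"
 where "shiftc j ph si a x = (THE y. y:{0..1} & lprim j si a x y = lprim j ph a x (x j))"

definition line_map :: "nat => (real => pt => real) => (real => pt => real) => real => pt => nat => real"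
 where "line_map j ph si a x = x(j := shiftc j ph si a x)"

lemma lprim_upd [simp]: "lprim j ph a (x(j := u)) t = lprim j ph a x t" by (simp add: lprim_def)

lemma continuous_on_lprim:
 assumes c: "continuous_on (UNIV \<times> cube n) (%(a, x). ph a x)" and j: "j < n"
 shows "continuous_on ((UNIV \<times> cube n) \<times> {0..1}) (%p. lprim j ph (fst (fst p)) (snd (fst p)) (snd p))"
proof -
 let ?S = "((UNIV :: real set) \<times> cube n) \<times> {0..1 :: real}"
 have upd: "continuous_on T (%q. (u q)(j := v q))" if "continuous_on T u" "continuous_on T v"
  for T :: "'c::topological_space set" and u v
 proof (rule cont_fun)
  fix i show "continuous_on T (%q. ((u q)(j := v q)) i)"
   using that cont_coord[OF that(1), of i] by (cases "i = j") simp_all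
 qed
 have cc: "continuous_on T (%q. ph (w q) ((u q)(j := v q)))"
  if "continuous_on T w" "continuous_on T u" "continuous_on T v" "!!q. q:T ==> u q:cube n & v q:{0..1}"
  for T :: "'c::topological_space set" and w u v
 proof -
  have "continuous_on T (%q. (w q, (u q)(j := v q)))" by (intro continuous_on_Pair that upd)
  moreover have "(w q, (u q)(j := v q)):UNIV \<times> cube n" if "q:T" for q
   using that(1) \<open>!!q. q:T ==> u q:cube n & v q:{0..1}\<close> j by (simp add: cube_fun_upd)
  ultimately show ?thesis using cont_comp[OF c, of T "%q. (w q, (u q)(j := v q))"] by (simp add: image_subset_iff)
 qed
 \<comment> \<open>The variable upper limit is removed: the integrand is frozen from
   \<open>t\<close> on and the excess \<open>(1 - t) * ph a (x(j := t))\<close> is subtracted.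
   Continuity then follows from that of parameter integrals over a fixed interval.\<close>
 have "lprim j ph a x t = integral {0..1} (%s. ph a (x(j := min s t))) - (1 - t) * ph a (x(j := t))"
  if x: "x:cube n" and t: "t:{0..1}" for a x t
 proof -
  have ci: "continuous_on {0..1} (%s. ph a (x(j := min s t)))" by (rule cc) (use x t in "auto intro!: continuous_intros")
  have "integral {0..t} (%s. ph a (x(j := min s t))) + integral {t..1} (%s. ph a (x(j := min s t))) =
   integral {0..1} (%s. ph a (x(j := min s t)))"
   using t by (intro Henstock_Kurzweil_Integration.integral_combine integrable_continuous_real[OF ci]) auto
  moreover have "integral {0..t} (%s. ph a (x(j := min s t))) = lprim j ph a x t"
   unfolding lprim_def by (rule Henstock_Kurzweil_Integration.integral_cong) (simp add: min_def)
  moreover have "integral {t..1} (%s. ph a (x(j := min s t))) = integral {t..1} (%s. ph a (x(j := t)))"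
   by (rule Henstock_Kurzweil_Integration.integral_cong) (simp add: min_absorb2)
  ultimately show ?thesis using t by simp
 qed
 hence "lprim j ph (fst (fst p)) (snd (fst p)) (snd p) =
   integral {0..1} (%s. ph (fst (fst p)) ((snd (fst p))(j := min s (snd p)))) - (1 - snd p) * ph (fst (fst p)) ((snd (fst p))(j := snd p))"
  if "p:?S" for p using that by auto
 moreover have "continuous_on ?S (%p. integral (cbox 0 1) (%s. ph (fst (fst p)) ((snd (fst p))(j := min s (snd p)))) - (1 - snd p) * ph (fst (fst p)) ((snd (fst p))(j := snd p)))"
 proof (intro continuous_on_diff continuous_on_mult continuous_on_const continuous_on_snd continuous_on_id integral_continuous_on_param)
  show "continuous_on (?S \<times> cbox 0 1) (%(p, s). ph (fst (fst p)) ((snd (fst p))(j := min s (snd p))))" unfolding case_prod_beta proof (rule cc)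
   show "continuous_on (?S \<times> cbox 0 1) (%q. fst (fst (fst q)))" "continuous_on (?S \<times> cbox 0 1) (%q. snd (fst (fst q)))"
    "continuous_on (?S \<times> cbox 0 1) (%q. min (snd q) (snd (fst q)))"
    by (intro continuous_on_min continuous_on_fst continuous_on_snd continuous_on_id)+
  qed auto
  show "continuous_on ?S (%p. ph (fst (fst p)) ((snd (fst p))(j := snd p)))" proof (rule cc)
   show "continuous_on ?S (%q. fst (fst q))" "continuous_on ?S (%q. snd (fst q))" "continuous_on ?S (%q. snd q)"
    by (intro continuous_on_fst continuous_on_snd continuous_on_id)+
  qed auto
 qed
 ultimately show ?thesis by (subst continuous_on_cong[OF refl]) (auto simp: cbox_interval)
qed

lemma line_cont:
 fixes ph :: "real => pt => real"
 assumes j: "j < n" and c: "continuous_on (UNIV \<times> cube n) (%(a, x). ph a x)" and x: "x:cube n"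
 shows "continuous_on {0..1} (%s. ph a (x(j := s)))"
proof -
 have "continuous_on {0..1} (%s. (a, x(j := s)))" proof (intro continuous_on_Pair continuous_on_const cont_fun)
  fix i show "continuous_on {0..1} (%s. (x(j := s)) i)" by (cases "i = j") (auto intro: continuous_intros)
 qed
 thus ?thesis using cont_comp[OF c, of "{0..1}" "%s. (a, x(j := s))"] x j by (simp add: image_subset_iff cube_fun_upd)
qed

lemma line_pos:
 fixes ph :: "real => pt => real"
 assumes "j < n" "ALL a. ALL x:cube n. 0 < ph a x" "x:cube n" shows "ALL s:{0..1}. 0 < ph a (x(j := s))" using assms by (simp add: cube_fun_upd)

context
 fixes n j :: nat and ph si :: "real => pt => real"
 assumes j: "j < n"
  and cph: "continuous_on (UNIV \<times> cube n) (%(a, x). ph a x)" and csi: "continuous_on (UNIV \<times> cube n) (%(a, x). si a x)"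
  and pph: "ALL a. ALL x:cube n. 0 < ph a x" and psi: "ALL a. ALL x:cube n. 0 < si a x"
  and eq: "!!a x. x:cube n ==> lprim j ph a x 1 = lprim j si a x 1"
begin

lemma coord01: "x:cube n ==> x j:{0..1}" using j by (simp add: cube_def)

lemma shiftc:
 assumes x: "x:cube n"
 shows "shiftc j ph si a x:{0..1}" "lprim j si a x (shiftc j ph si a x) = lprim j ph a x (x j)"
  "y:{0..1} ==> lprim j si a x y = lprim j ph a x (x j) ==> shiftc j ph si a x = y"
proof -
 note F = line_cont[OF j cph x, of a] line_pos[OF j pph x, of a]
 note G = line_cont[OF j csi x, of a] line_pos[OF j psi x, of a]
 have u: "y = y'" if "y:{0..1}" "y':{0..1}" "lprim j si a x y = lprim j si a x y'" for y y'
  using prim_eq_iff[OF G that(1,2)] that(3) unfolding lprim_def by simp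
 have "0 <= lprim j ph a x (x j)" "lprim j ph a x (x j) <= lprim j si a x 1"
  unfolding eq[OF x, symmetric] unfolding lprim_def using prim_bounds[OF F coord01[OF x]] by simp_all
 then obtain y0 where y: "y0:{0..1}" "lprim j si a x y0 = lprim j ph a x (x j)"
  unfolding lprim_def using prim_surj[OF G] by metis
 have ex1: "EX! y. y:{0..1} & lprim j si a x y = lprim j ph a x (x j)" using y u by (intro ex1I[of _ y0]) auto
 show "shiftc j ph si a x:{0..1}" "lprim j si a x (shiftc j ph si a x) = lprim j ph a x (x j)" unfolding shiftc_def using theI'[OF ex1] by simp_all
 show "shiftc j ph si a x = y" if "y:{0..1}" "lprim j si a x y = lprim j ph a x (x j)" unfolding shiftc_def using that by (intro the1_equality[OF ex1]) simp
qed

lemma line_map_in_cube: "x:cube n ==> line_map j ph si a x:cube n" unfolding line_map_def using shiftc(1)[of x a] by (intro cube_fun_upd j) auto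

text \<open>The two reasons for which a boundary point of the cube will stay put: it is an end of
  its line, or its whole line carries equal densities.\<close>

lemma line_map_fix:
 assumes x: "x:cube n" and h: "(ALL s:{0..1}. ph a (x(j := s)) = si a (x(j := s))) \<or> x j = 0 \<or> x j = 1"
 shows "line_map j ph si a x = x"
proof -
 have "lprim j si a x (x j) = lprim j ph a x (x j)" using h proof (elim disjE)
  assume *: "ALL s:{0..1}. ph a (x(j := s)) = si a (x(j := s))"
  show ?thesis unfolding lprim_def proof (rule Henstock_Kurzweil_Integration.integral_cong)
   fix s assume "s:{0..x j}"
   hence "s:{0..1}" using coord01[OF x] by simp
   thus "si a (x(j := s)) = ph a (x(j := s))" using * by simp
  qed
 next
  assume "x j = 0"
  thus ?thesis by (simp add: lprim_def)
 next
  assume "x j = 1"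
  thus ?thesis using eq[OF x, of a] by simp
 qed
 hence "shiftc j ph si a x = x j" by (rule shiftc(3)[OF x coord01[OF x]])
 thus ?thesis by (simp add: line_map_def)
qed

text \<open>By strict monotonicity of the primitives, \<open>l < shiftc j ph si a x\<close> is a
  strict inequality between functions that are continuous in \<open>(a, x)\<close>, hence an open
  condition; likewise for the reverse inequality. Values of \<open>l\<close> outside the unit
  interval are trivial.\<close>

lemma continuous_on_shift_coord: "continuous_on (UNIV \<times> cube n) (%(a, x). shiftc j ph si a x)" unfolding continuous_on_def
proof
 fix p0 :: "real \<times> pt" assume p0: "p0:UNIV \<times> cube n"
 obtain a0 x0 where ax: "p0 = (a0, x0)" by (cases p0)
 have x0: "x0:cube n" using p0 ax by simp
 let ?F = "at p0 within UNIV \<times> cube n"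
 have inS: "eventually (%p. p:UNIV \<times> cube n) ?F" by (simp add: eventually_at_filter)
 have cR: "continuous_on (UNIV \<times> cube n) (%p. lprim j ph (fst p) (snd p) (snd p j))" proof -
  have c: "continuous_on (UNIV \<times> cube n) (%p :: real \<times> pt. (p, snd p j))"
   by (intro continuous_on_Pair continuous_on_id cont_coord[OF continuous_on_snd] continuous_on_id)
  show ?thesis using cont_comp[OF continuous_on_lprim[OF cph j] c] coord01 by (auto simp: image_subset_iff)
 qed
 have cL: "continuous_on (UNIV \<times> cube n) (%p. lprim j si (fst p) (snd p) l)" if l: "l:{0..1}" for l proof -
  have c: "continuous_on (UNIV \<times> cube n) (%p :: real \<times> pt. (p, l))" by (intro continuous_on_Pair continuous_on_id continuous_on_const)
  show ?thesis using cont_comp[OF continuous_on_lprim[OF csi j] c] l by (auto simp: image_subset_iff)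
 qed
 have lt: "lprim j si a x l < lprim j ph a x (x j) \<longleftrightarrow> l < shiftc j ph si a x"
  "lprim j ph a x (x j) < lprim j si a x l \<longleftrightarrow> shiftc j ph si a x < l"
  if x: "x:cube n" and l: "l:{0..1}" for a x l
  unfolding shiftc(2)[OF x, of a, symmetric] using prim_le_iff[OF line_cont[OF j csi x, of a] line_pos[OF j psi x, of a] l shiftc(1)[OF x, of a]]
   prim_le_iff[OF line_cont[OF j csi x, of a] line_pos[OF j psi x, of a] shiftc(1)[OF x, of a] l]
  unfolding lprim_def by linarith+
 show "((%(a, x). shiftc j ph si a x) \<longlongrightarrow> (case p0 of (a, x) => shiftc j ph si a x)) ?F" proof (rule order_tendstoI)
  fix l assume l: "l < (case p0 of (a, x) => shiftc j ph si a x)"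
  show "eventually (%p. l < (case p of (a, x) => shiftc j ph si a x)) ?F" proof (cases "l < 0")
   case True
   from inS show ?thesis proof eventually_elim
    case (elim p)
    hence "0 <= shiftc j ph si (fst p) (snd p)" using shiftc(1)[of "snd p" "fst p"] by auto
    thus ?case using True by (simp add: case_prod_beta)
   qed
  next
   case False
   hence l01: "l:{0..1}" using l shiftc(1)[OF x0, of a0] ax by simp
   have "((%p. lprim j ph (fst p) (snd p) (snd p j) - lprim j si (fst p) (snd p) l) \<longlongrightarrow>
    lprim j ph a0 x0 (x0 j) - lprim j si a0 x0 l) ?F"
    using continuous_on_diff[OF cR cL[OF l01]] p0 ax unfolding continuous_on_def by force
   moreover have "0 < lprim j ph a0 x0 (x0 j) - lprim j si a0 x0 l" using lt(1)[OF x0 l01, of a0] l ax by simp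
   ultimately have "eventually (%p. 0 < lprim j ph (fst p) (snd p) (snd p j) - lprim j si (fst p) (snd p) l) ?F" by (rule order_tendstoD)
   with inS show ?thesis by eventually_elim (use lt(1)[OF _ l01] in "force simp: case_prod_beta")
  qed
 next
  fix l assume l: "(case p0 of (a, x) => shiftc j ph si a x) < l"
  show "eventually (%p. (case p of (a, x) => shiftc j ph si a x) < l) ?F" proof (cases "l > 1")
   case True
   from inS show ?thesis proof eventually_elim
    case (elim p)
    hence "shiftc j ph si (fst p) (snd p) <= 1" using shiftc(1)[of "snd p" "fst p"] by auto
    thus ?case using True by (simp add: case_prod_beta)
   qed
  next
   case False
   hence l01: "l:{0..1}" using l shiftc(1)[OF x0, of a0] ax by simp
   have "((%p. lprim j si (fst p) (snd p) l - lprim j ph (fst p) (snd p) (snd p j)) \<longlongrightarrow>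
    lprim j si a0 x0 l - lprim j ph a0 x0 (x0 j)) ?F"
    using continuous_on_diff[OF cL[OF l01] cR] p0 ax unfolding continuous_on_def by force
   moreover have "0 < lprim j si a0 x0 l - lprim j ph a0 x0 (x0 j)" using lt(2)[OF x0 l01, of a0] l ax by simp
   ultimately have "eventually (%p. 0 < lprim j si (fst p) (snd p) l - lprim j ph (fst p) (snd p) (snd p j)) ?F" by (rule order_tendstoD)
   with inS show ?thesis by eventually_elim (use lt(2)[OF _ l01] in "force simp: case_prod_beta")
  qed
 qed
qed

lemma continuous_on_line_map: "continuous_on (UNIV \<times> cube n) (%(a, x). line_map j ph si a x)"
proof (rule cont_fun)
 fix i
 have "continuous_on (UNIV \<times> cube n) (%p :: real \<times> pt. snd p i)" by (rule cont_coord[OF continuous_on_snd[OF continuous_on_id]])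
 thus "continuous_on (UNIV \<times> cube n) (%p. (case p of (a, x) => line_map j ph si a x) i)"
  using continuous_on_shift_coord by (cases "i = j") (simp_all add: line_map_def case_prod_beta)
qed

lemma continuous_on_line_map1: "continuous_on (cube n) (line_map j ph si a)"
proof -
 have "continuous_on (cube n) (%x. (a, x))" by (intro continuous_on_Pair continuous_on_const continuous_on_id)
 from cont_comp[OF continuous_on_line_map this] show ?thesis by (simp add: image_subset_iff)
qed

lemma continuous_on_density1: "continuous_on (UNIV \<times> cube n) (%(a, x). rh a x) ==> continuous_on (cube n) (rh a)"
proof -
 assume c: "continuous_on (UNIV \<times> cube n) (%(a, x). rh a x)"
 have "continuous_on (cube n) (%x. (a, x))" by (intro continuous_on_Pair continuous_on_const continuous_on_id)
 from cont_comp[OF c this] show ?thesis by (simp add: image_subset_iff)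
qed

text \<open>Resampling coordinate \<open>j\<close> reduces the identity to single lines, where it is
  \<open>line_transport\<close>.\<close>

lemma line_map_measure:
 assumes B: "B:sets borel"
 shows "(\<integral>\<^sup>+x. ennreal (indicator (cube n) x * (indicator B (line_map j ph si a x) * ph a x)) \<partial>lam n) =
  (\<integral>\<^sup>+x. ennreal (indicator (cube n) x * (indicator B x * si a x)) \<partial>lam n)"
proof -
 let ?f = "%x. ennreal (indicator (cube n) x * (indicator B (line_map j ph si a x) * ph a x))"
 let ?h = "%x. ennreal (indicator (cube n) x * (indicator B x * si a x))"
 have ext: "(%x. ennreal (indicator (cube n) x * q x)):borel_measurable borel"
  if "q:borel_measurable (restrict_space borel (cube n))" for q :: "pt => real"
 proof -
  have "(%x. if x:cube n then q x else 0):borel_measurable borel"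
   using that by (subst (asm) measurable_restrict_space_iff[where c=0]) (simp_all add: closed_cube borel_closed)
  moreover have "(if x:cube n then q x else 0) = indicator (cube n) x * q x" for x by simp
  ultimately show ?thesis by simp
 qed
 have mph: "ph a:borel_measurable (restrict_space borel (cube n))" "si a:borel_measurable (restrict_space borel (cube n))"
  by (intro borel_measurable_continuous_on_restrict continuous_on_density1 cph csi)+
 have mg: "(%x. indicator B (line_map j ph si a x) :: real):borel_measurable (restrict_space borel (cube n))"
  using measurable_compose[OF borel_measurable_continuous_on_restrict[OF continuous_on_line_map1] borel_measurable_indicator[OF B]] .
 have mi: "(%x. indicator B x :: real):borel_measurable (restrict_space borel (cube n))"
  by (rule measurable_restrict_space1[OF borel_measurable_indicator[OF B]])
 have mf: "?f:borel_measurable borel" by (rule ext) (intro borel_measurable_times mg mph)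
 have mh: "?h:borel_measurable borel" by (rule ext) (intro borel_measurable_times mi mph)
 have "(\<integral>\<^sup>+x. ?f x \<partial>lam n) = (\<integral>\<^sup>+x. \<integral>\<^sup>+t. ?f (x(j := t)) \<partial>U01 \<partial>lam n)" by (rule nn_integral_lam_resample[OF mf j])
 also have "... = (\<integral>\<^sup>+x. \<integral>\<^sup>+t. ?h (x(j := t)) \<partial>U01 \<partial>lam n)" proof (rule nn_integral_cong_AE)
  have "AE x in lam n. x~:- cube n" using lam_compl_cube by (intro AE_not_in null_setsI) (simp_all add: closed_cube borel_comp borel_closed)
  thus "AE x in lam n. (\<integral>\<^sup>+t. ?f (x(j := t)) \<partial>U01) = (\<integral>\<^sup>+t. ?h (x(j := t)) \<partial>U01)" proof eventually_elim
   case (elim x)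
   hence x: "x:cube n" by simp
   have xt: "x(j := t):cube n" if "t:{0..1}" for t using that x j by (simp add: cube_fun_upd)
   have sl: "(%t. x(j := t)):measurable borel borel" proof (intro borel_measurable_continuous_onI cont_fun)
    fix i show "cont (%t. (x(j := t)) i)" by (cases "i = j") (auto intro: continuous_intros)
   qed
   let ?T = "%t. shiftc j ph si a (x(j := t))"
   have "(\<integral>\<^sup>+t. ?f (x(j := t)) \<partial>U01) = (\<integral>\<^sup>+t. ?f (x(j := t)) * indicator {0..1} t \<partial>lborel)"
    by (rule nn_integral_U01) (rule measurable_compose[OF sl mf])
   also have "... = (\<integral>\<^sup>+t. ennreal (indicator B (x(j := ?T t)) * ph a (x(j := t)) * indicator {0..1} t) \<partial>lborel)"
    by (intro nn_integral_cong) (simp add: indicator_def xt line_map_def)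
   also have "... = (\<integral>\<^sup>+t. ennreal (indicator B (x(j := t)) * si a (x(j := t)) * indicator {0..1} t) \<partial>lborel)"
   proof (rule line_transport[where F="%t. indicator B (x(j := t))" and T="?T"])
    show "integral {0..1} (%s. ph a (x(j := s))) = integral {0..1} (%s. si a (x(j := s)))" using eq[OF x, of a] by (simp add: lprim_def)
    show "?T t:{0..1} & integral {0..?T t} (%s. si a (x(j := s))) = integral {0..t} (%s. ph a (x(j := s)))"
     if "t:{0..1}" for t
     using shiftc(1,2)[OF xt[OF that], of a] by (simp add: lprim_def)
    show "(%t. indicator B (x(j := t)) :: real):borel_measurable borel" by (rule measurable_compose[OF sl borel_measurable_indicator[OF B]])
   qed (rule line_cont[OF j cph x] line_pos[OF j pph x] line_cont[OF j csi x] line_pos[OF j psi x])+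
   also have "... = (\<integral>\<^sup>+t. ?h (x(j := t)) * indicator {0..1} t \<partial>lborel)" by (intro nn_integral_cong) (simp add: indicator_def xt)
   also have "... = (\<integral>\<^sup>+t. ?h (x(j := t)) \<partial>U01)" by (rule nn_integral_U01[symmetric]) (rule measurable_compose[OF sl mh])
   finally show ?case .
  qed
 qed
 also have "... = (\<integral>\<^sup>+x. ?h x \<partial>lam n)" by (rule nn_integral_lam_resample[OF mh j, symmetric])
 finally show ?thesis .
qed

end

lemma line_map_inverse:
 assumes j: "j < n"
  and cph: "continuous_on (UNIV \<times> cube n) (%(a, x). ph a x)" and csi: "continuous_on (UNIV \<times> cube n) (%(a, x). si a x)"
  and pph: "ALL a. ALL x:cube n. 0 < ph a x" and psi: "ALL a. ALL x:cube n. 0 < si a x"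
  and eq: "!!a x. x:cube n ==> lprim j ph a x 1 = lprim j si a x 1"
  and x: "x:cube n"
 shows "line_map j si ph a (line_map j ph si a x) = x"
proof -
 let ?y = "line_map j ph si a x"
 have y: "?y:cube n" by (rule line_map_in_cube[OF j cph csi pph psi eq x])
 have e: "lprim j ph a ?y (x j) = lprim j si a ?y (?y j)" using shiftc(2)[OF j cph csi pph psi eq x, of a] by (simp add: line_map_def)
 have eq': "!!a x. x:cube n ==> lprim j si a x 1 = lprim j ph a x 1" using eq by simp
 have xj: "x j:{0..1}" using x j by (simp add: cube_def)
 have "shiftc j si ph a ?y = x j" by (rule shiftc(3)[where y="x j", OF j csi cph psi pph eq' y xj e])
 thus ?thesis by (simp add: line_map_def)
qed

subsection \<open>Continuous families of homeomorphisms\<close>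

text \<open>Joint continuity of the inverses is carried along so that families can be inverted as
  well as composed. The parameter space is left general: it will be the reals and finally a space of
  functions on the vertices.\<close>

definition hfamily :: "('p::topological_space => 'a::topological_space => 'a) => bool"
 where "hfamily g \<longleftrightarrow> cont (%(p, x). g p x) &
  cont (%(p, x). inv (g p) x) & (ALL p. bij (g p))"

lemma homeo_familyI:
 assumes "cont (%(p, x). g p x)" "cont (%(p, x). g' p x)"
  and "!!p x. g' p (g p x) = x" "!!p x. g p (g' p x) = x"
 shows "hfamily g" "!!p. inv (g p) = g' p"
proof -
 have b: "bij (g p)" for p using assms(3,4) by (intro o_bij[of "g' p"]) auto
 show i: "inv (g p) = g' p" for p using assms(3,4) by (intro inv_equality) auto
 show "hfamily g" unfolding hfamily_def using assms(1,2) b i by simp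
qed

lemma hfamilyD:
 assumes "hfamily g"
 shows "cont (%(p, x). g p x)" "cont (%(p, x). inv (g p) x)" "bij (g p)"
  "inv (g p) (g p x) = x" "g p (inv (g p) x) = x" "cont (g p)" "cont (inv (g p))"
proof -
 show 1: "cont (%(p, x). g p x)" "cont (%(p, x). inv (g p) x)" "bij (g p)" using assms unfolding hfamily_def by simp_all
 show "inv (g p) (g p x) = x" "g p (inv (g p) x) = x" using 1(3) by (simp_all add: bij_is_inj bij_is_surj surj_f_inv_f)
 have c: "cont (%x. (p, x))" by (intro continuous_intros)
 show "cont (g p)" using cont_comp[OF 1(1) c] by simp
 show "cont (inv (g p))" using cont_comp[OF 1(2) c] by simp
qed

lemma hfamily_id: "hfamily (%p x. x)" by (rule homeo_familyI(1)[where g'="%p x. x"]) (auto simp: case_prod_beta intro!: continuous_intros)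

lemma hfamily_const: "hfamily g ==> cont q ==> hfamily (%p. g (q p))"
proof (rule homeo_familyI(1)[where g'="%p. inv (g (q p))"])
 assume g: "hfamily g" and q: "cont q"
 have c: "cont (%z. (q (fst z), snd z))" by (intro continuous_on_Pair cont_comp[OF q] continuous_intros) auto
 show "cont (%(p, x). g (q p) x)" "cont (%(p, x). inv (g (q p)) x)" using cont_comp[OF hfamilyD(1)[OF g] c] cont_comp[OF hfamilyD(2)[OF g] c]
  by (simp_all add: case_prod_beta)
qed (simp_all add: hfamilyD)

lemma hfamily_comp:
 assumes g: "hfamily g" and h: "hfamily h"
 shows "hfamily (%p x. g p (h p x))"
proof (rule homeo_familyI(1)[where g'="%p x. inv (h p) (inv (g p) x)"])
 have c: "cont (%z. (fst z, h (fst z) (snd z)))" "cont (%z. (fst z, inv (g (fst z)) (snd z)))" using hfamilyD(1)[OF h] hfamilyD(2)[OF g]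
  by (auto intro!: continuous_on_Pair continuous_intros simp: case_prod_beta)
 show "cont (%(p, x). g p (h p x))" "cont (%(p, x). inv (h p) (inv (g p) x))" using cont_comp[OF hfamilyD(1)[OF g] c(1)] cont_comp[OF hfamilyD(2)[OF h] c(2)]
  by (simp_all add: case_prod_beta)
qed (simp_all add: hfamilyD[OF g] hfamilyD[OF h])

lemma hfamily_inv: "hfamily g ==> hfamily (%p. inv (g p))" by (rule homeo_familyI(1)[where g'=g]) (simp_all add: hfamilyD)

lemma borel_image_homeo:
 assumes "cont (inv g)" "bij g" "B:sets borel"
 shows "g ` B:sets borel"
proof -
 have "inv g -` B Int space borel:sets borel" by (rule measurable_sets[OF borel_measurable_continuous_onI[OF assms(1)] assms(3)])
 moreover have "inv g -` B = g ` B" using assms(2) by (simp add: bij_vimage_eq_inv_image bij_imp_bij_inv inv_inv_eq)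
 ultimately show ?thesis by simp
qed

section \<open>Densities and the maps that transport them\<close>

definition dens :: "'a measure => ('a => real) => 'a measure"
 where "dens om f = density om (%x. ennreal (f x))"

lemma sets_dens [simp]: "sets (dens om f) = sets om" and space_dens [simp]: "space (dens om f) = space om" by (simp_all add: dens_def)

lemma dens_1 [simp]: "dens om (%x. 1) = om" unfolding dens_def by (simp add: density_1)

definition pushes :: "'a::topological_space measure => ('a => 'a) => ('a => real) => ('a => real) => bool"
 where "pushes om g f f' \<longleftrightarrow> (ALL B:sets borel. emeasure (dens om f') (g ` B) = emeasure (dens om f) B)"

lemma pushes_comp:
 assumes "pushes om g f0 f1" "pushes om h f1 f2" "!!B. B:sets borel ==> g ` B:sets borel"
 shows "pushes om (%x. h (g x)) f0 f2" unfolding pushes_def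
proof
 fix B :: "'a set" assume B: "B:sets borel"
 have "(%x. h (g x)) ` B = h ` g ` B" by (simp add: image_image)
 thus "emeasure (dens om f2) ((%x. h (g x)) ` B) = emeasure (dens om f0) B" using assms(1,2) assms(3)[OF B] B unfolding pushes_def by simp
qed

lemma pushes_inv:
 assumes "pushes om g f f'" "bij g" "!!B. B:sets borel ==> inv g ` B:sets borel"
 shows "pushes om (inv g) f' f" unfolding pushes_def
proof
 fix B :: "'a set" assume B: "B:sets borel"
 have "g ` inv g ` B = B" using assms(2) by (simp add: image_f_inv_f bij_is_surj)
 thus "emeasure (dens om f) (inv g ` B) = emeasure (dens om f') B" using assms(1) assms(3)[OF B] unfolding pushes_def by metis
qed

lemma hfamily_borel:
 assumes "hfamily g" "B:sets borel"
 shows "g p ` B:sets borel" "inv (g p) ` B:sets borel" using borel_image_homeo[OF hfamilyD(7)[OF assms(1)] hfamilyD(3)[OF assms(1)] assms(2)]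
  borel_image_homeo[of "inv (g p)" B] hfamilyD(6)[OF assms(1), of p] hfamilyD(3)[OF assms(1), of p] assms(2)
 by (simp_all add: inv_inv_eq bij_imp_bij_inv)

text \<open>A chart in which \<open>om\<close> is \<open>m\<close> times Lebesgue measure. The image
  of the open cube is open, so functions and maps that are trivial on the boundary extend
  continuously to the whole space.\<close>

definition ou_chart :: "nat => 'a::metric_space measure => (pt => 'a) => real => bool"
 where "ou_chart n om ka m \<longleftrightarrow> 0 < m & 0 < n & continuous_on (cube n) ka & inj_on ka (cube n) & open (ka ` icube n) &
  (ALL B:sets borel. emeasure om (ka ` (B Int cube n)) = ennreal m * emeasure (lam n) B)"

text \<open>Clipping keeps the densities \<open>1 + clip a * u\<close> positive for small
  \<open>u\<close> while the parameter still ranges over all reals.\<close>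

definition clip :: "real => real" where "clip a = max (-1) (min 1 a)"

lemma clip_bounds: "-1 <= clip a" "clip a <= 1" "abs (clip a) <= 1" and clip_0 [simp]: "clip 0 = 0" by (auto simp: clip_def)

lemma clip_id: "abs (a) <= 1 ==> clip a = a" by (auto simp: clip_def)

lemma continuous_on_clip: "continuous_on S clip" unfolding clip_def by (intro continuous_intros)

lemma icube_sub: "icube n <= cube n" by (auto simp: icube_eq)

context
 fixes n :: nat and om :: "'a::metric_space measure" and ka :: "pt => 'a" and m :: real
 assumes ka: "ou_chart n om ka m" and om: "sets om = sets borel"
begin

lemma chart_facts: "0 < m" "0 < n" "continuous_on (cube n) ka" "inj_on ka (cube n)" "open (ka ` icube n)"
 "B:sets borel ==> emeasure om (ka ` (B Int cube n)) = ennreal m * emeasure (lam n) B"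
 using ka unfolding ou_chart_def by simp_all

lemma chart_compact: "compact (ka ` cube n)" by (rule compact_continuous_image[OF chart_facts(3) compact_cube])

lemma chart_sub: "ka ` icube n <= ka ` cube n" by (rule image_mono[OF icube_sub])

lemma chart_bd: "q:cube n ==> ka q:ka ` icube n \<longleftrightarrow> q:icube n" using inj_on_image_mem_iff[OF chart_facts(4) _ icube_sub] .

abbreviation kai where "kai \<equiv> the_inv_into (cube n) ka"

lemma chart_inv: "q:cube n ==> kai (ka q) = q" "x:ka ` cube n ==> ka (kai x) = x" "x:ka ` cube n ==> kai x:cube n"
 "continuous_on (ka ` cube n) kai"
proof -
 show "q:cube n ==> kai (ka q) = q" by (rule the_inv_into_f_f[OF chart_facts(4)])
 show "x:ka ` cube n ==> ka (kai x) = x" by (rule f_the_inv_into_f[OF chart_facts(4)])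
 show "x:ka ` cube n ==> kai x:cube n" by (rule the_inv_into_into[OF chart_facts(4) _ order_refl])
 show "continuous_on (ka ` cube n) kai" by (rule continuous_on_inv_into[OF chart_facts(3) compact_cube chart_facts(4)])
qed

lemma chart_pull: "pull (cube n) ka om = scale_measure (ennreal m) (lam n)" by (rule measure_eqI)
  (simp_all add: sets_pull_eq emeasure_pull[OF compact_cube chart_facts(3,4) om] chart_facts(6))

lemma chart_nn_integral:
 assumes F: "F:borel_measurable borel"
 shows "(\<integral>\<^sup>+x. F x * indicator (ka ` cube n) x \<partial>om) = ennreal m * (\<integral>\<^sup>+q. F (ka q) * indicator (cube n) q \<partial>lam n)"
proof -
 have mF: "(%q. F (ka q) * indicator (cube n) q):borel_measurable borel" proof -
  have "(%q. F (ka q)):borel_measurable (restrict_space borel (cube n))"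
   by (rule measurable_compose[OF borel_measurable_continuous_on_restrict[OF chart_facts(3)] F])
  hence "(%q. if q:cube n then F (ka q) else 0):borel_measurable borel"
   by (subst (asm) measurable_restrict_space_iff[where c=0]) (simp_all add: closed_cube borel_closed)
  moreover have "(if q:cube n then F (ka q) else 0) = F (ka q) * indicator (cube n) q" for q by simp
  ultimately show ?thesis by simp
 qed
 have clo: "ka ` cube n:sets om" using closed_image_cell[OF compact_cube chart_facts(3,4)] by (simp add: om borel_closed)
 have "(\<integral>\<^sup>+q. F (ka q) * indicator (cube n) q \<partial>pull (cube n) ka om) =
  (\<integral>\<^sup>+x. F (ka (kai x)) * indicator (cube n) (kai x) \<partial>restrict_space om (ka ` cube n))"
  unfolding pull_def using mF by (subst nn_integral_distr[OF the_inv_measurable[OF compact_cube chart_facts(3,4) om]]) simp_all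
 also have "... = (\<integral>\<^sup>+x. F (ka (kai x)) * indicator (cube n) (kai x) * indicator (ka ` cube n) x \<partial>om)"
  by (rule nn_integral_restrict_space) (use clo in simp)
 also have "... = (\<integral>\<^sup>+x. F x * indicator (ka ` cube n) x \<partial>om)" by (intro nn_integral_cong) (auto simp: indicator_def chart_inv)
 finally have "(\<integral>\<^sup>+x. F x * indicator (ka ` cube n) x \<partial>om) = (\<integral>\<^sup>+q. F (ka q) * indicator (cube n) q \<partial>pull (cube n) ka om)"
  by simp
 also have "... = ennreal m * (\<integral>\<^sup>+q. F (ka q) * indicator (cube n) q \<partial>lam n)"
  unfolding chart_pull by (rule nn_integral_scale_measure) (use mF in simp)
 finally show ?thesis .
qed

lemma chart_dens:
 assumes f: "f:borel_measurable borel" and B: "B:sets borel"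
 shows "emeasure (dens om f) (ka ` (B Int cube n)) = ennreal m * (\<integral>\<^sup>+q. ennreal (indicator (cube n) q * (indicator B q * f (ka q))) \<partial>lam n)"
proof -
 have C: "ka ` (B Int cube n):sets borel" by (rule image_borel_cell[OF compact_cube chart_facts(3,4) B])
 have f': "(%x. ennreal (f x)):borel_measurable om" using f by (simp add: measurable_cong_sets[OF om refl])
 have "emeasure (dens om f) (ka ` (B Int cube n)) = (\<integral>\<^sup>+x. ennreal (f x) * indicator (ka ` (B Int cube n)) x \<partial>om)"
  unfolding dens_def by (rule emeasure_density[OF f']) (simp add: om C)
 also have "... = (\<integral>\<^sup>+x. (ennreal (f x) * indicator (ka ` (B Int cube n)) x) * indicator (ka ` cube n) x \<partial>om)"
  by (intro nn_integral_cong) (auto simp: indicator_def)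
 also have "... = ennreal m * (\<integral>\<^sup>+q. (ennreal (f (ka q)) * indicator (ka ` (B Int cube n)) (ka q)) * indicator (cube n) q \<partial>lam n)"
  by (rule chart_nn_integral) (use f C in simp)
 also have "(\<integral>\<^sup>+q. (ennreal (f (ka q)) * indicator (ka ` (B Int cube n)) (ka q)) * indicator (cube n) q \<partial>lam n) =
  (\<integral>\<^sup>+q. ennreal (indicator (cube n) q * (indicator B q * f (ka q))) \<partial>lam n)"
 proof (rule nn_integral_cong)
  fix q
  have "q:cube n ==> ka q:ka ` (B Int cube n) \<longleftrightarrow> q:B" using inj_on_image_mem_iff[OF chart_facts(4), of q "B Int cube n"] by simp
  thus "(ennreal (f (ka q)) * indicator (ka ` (B Int cube n)) (ka q)) * indicator (cube n) q =
   ennreal (indicator (cube n) q * (indicator B q * f (ka q)))"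
   by (simp add: indicator_def)
 qed
 finally show ?thesis .
qed

lemma chart_extend_continuous:
 fixes g :: "real => pt => nat => real"
 assumes g: "continuous_on (UNIV \<times> cube n) (%(a, q). g a q)" "!!a q. q:cube n ==> g a q:cube n"
  and bd: "!!a q. q:cube n ==> q~:icube n ==> g a q = q"
 shows "cont (%(a, x). if x:ka ` cube n then ka (g a (kai x)) else x)"
proof -
 let ?f = "%(a, x). if x:ka ` cube n then ka (g a (kai x)) else x"
 let ?S = "(UNIV :: real set) \<times> (ka ` cube n)" and ?T = "(UNIV :: real set) \<times> (- ka ` icube n)"
 have c1: "continuous_on ?S (%p. (fst p, kai (snd p)))"
  by (intro continuous_on_Pair continuous_on_fst continuous_on_id cont_comp[OF chart_inv(4) continuous_on_snd[OF continuous_on_id]]) auto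
 have c2: "continuous_on ?S (%p. g (fst p) (kai (snd p)))" using cont_comp[OF g(1) c1] chart_inv(3) by (force simp: image_subset_iff)
 have c3: "continuous_on ?S (%p. ka (g (fst p) (kai (snd p))))"
  by (rule cont_comp[OF chart_facts(3) c2]) (use g(2) chart_inv(3) in "force simp: image_subset_iff")
 have 1: "continuous_on ?S ?f" by (rule continuous_on_eq[OF c3]) (auto simp: case_prod_beta)
 have c4: "continuous_on ?T snd" by (intro continuous_on_snd continuous_on_id)
 have 2: "continuous_on ?T ?f" proof (rule continuous_on_eq[OF c4])
  fix p assume p: "p:?T"
  show "snd p = ?f p" proof (cases "snd p:ka ` cube n")
   case True
   hence "kai (snd p):cube n" "ka (kai (snd p)) = snd p" using chart_inv by simp_all
   moreover from this have "kai (snd p)~:icube n" using p imageI[of "kai (snd p)" "icube n" ka] by auto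
   ultimately show ?thesis using bd True by (simp add: case_prod_beta)
  qed (simp add: case_prod_beta)
 qed
 have "closed ?S" "closed ?T" using compact_imp_closed[OF chart_compact] chart_facts(5) by (auto intro: closed_Times)
 hence "continuous_on (?S Un ?T) ?f" by (rule continuous_on_closed_Un[OF _ _ 1 2])
 moreover have "?S Un ?T = UNIV" using chart_sub by auto
 ultimately show ?thesis by simp
qed

text \<open>Since \<open>u\<close> has mean zero on every \<open>j\<close>-line of the chart, the
  two densities have equal mass on each line and can be rearranged into each other, continuously in
  \<open>a\<close>. A boundary point of the cube is an end of its line, or its line lies in a face
  where \<open>u\<close> vanishes; so the map extends by the identity.\<close>

lemma moser_chart:
 assumes j: "j < n" and u: "cont u" "!!x. x~:ka ` icube n ==> u x = 0"
  and z: "!!q. q:cube n ==> integral {0..1} (%s. u (ka (q(j := s)))) = 0"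
  and v: "cont v" and pos: "!!x. abs (v x) < 1" "!!x. abs (v x + u x) < 1"
 shows "EX g. hfamily g & (ALL a x. x~:ka ` cube n --> g a x = x) & (ALL x. g 0 x = x) &
  (ALL a. pushes om (g a) (%x. 1 + clip a * v x) (%x. 1 + clip a * (v x + u x)))"
proof -
 define ph where "ph a q = 1 + clip a * v (ka q)" for a q
 define si where "si a q = 1 + clip a * (v (ka q) + u (ka q))" for a q
 have ccl: "continuous_on S (%p. clip (fst p))" for S :: "(real \<times> pt) set"
  by (rule cont_comp[OF continuous_on_clip continuous_on_fst[OF continuous_on_id]]) auto
 have cka: "continuous_on (UNIV \<times> cube n) (%p :: real \<times> pt. ka (snd p))"
  by (rule cont_comp[OF chart_facts(3) continuous_on_snd[OF continuous_on_id]]) auto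
 have cv: "continuous_on (UNIV \<times> cube n) (%p :: real \<times> pt. v (ka (snd p)))"
  and cu: "continuous_on (UNIV \<times> cube n) (%p :: real \<times> pt. u (ka (snd p)))" using cont_comp[OF v cka] cont_comp[OF u(1) cka] by simp_all
 have cph: "continuous_on (UNIV \<times> cube n) (%(a, q). ph a q)" and csi: "continuous_on (UNIV \<times> cube n) (%(a, q). si a q)"
  unfolding ph_def si_def case_prod_beta by (intro continuous_intros ccl cv cu)+
 have pp: "0 < 1 + clip a * w" if "abs (w) < 1" for a w proof -
  have "abs (clip a * w) <= 1 * abs (w)" unfolding abs_mult by (intro mult_right_mono clip_bounds) simp
  thus ?thesis using that by linarith
 qed
 have pph: "ALL a. ALL q:cube n. 0 < ph a q" and psi: "ALL a. ALL q:cube n. 0 < si a q" unfolding ph_def si_def using pp pos by simp_all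
 have eq: "lprim j ph a q 1 = lprim j si a q 1" if q: "q:cube n" for a q proof -
  have cl: "continuous_on {0..1} (%s. ph a (q(j := s)))" by (rule line_cont[OF j cph q])
  have cu': "continuous_on (UNIV \<times> cube n) (%(a :: real, q). u (ka q))" using cu by (simp add: case_prod_beta)
  have cl': "continuous_on {0..1} (%s. clip a * u (ka (q(j := s))))" using line_cont[where ph="%a q. u (ka q)" and a=a, OF j cu' q] by (intro continuous_intros)
  have "lprim j si a q 1 = integral {0..1} (%s. ph a (q(j := s)) + clip a * u (ka (q(j := s))))"
   unfolding lprim_def by (rule Henstock_Kurzweil_Integration.integral_cong) (simp add: ph_def si_def algebra_simps)
  also have "... = lprim j ph a q 1 + integral {0..1} (%s. clip a * u (ka (q(j := s))))"
   unfolding lprim_def by (rule Henstock_Kurzweil_Integration.integral_add[OF integrable_continuous_real[OF cl] integrable_continuous_real[OF cl']])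
  finally show ?thesis using z[OF q] by simp
 qed
 have eq': "lprim j si a q 1 = lprim j ph a q 1" if "q:cube n" for a q using eq[OF that] by simp
 define g0 where "g0 = line_map j ph si"
 define g1 where "g1 = line_map j si ph"
 have gc: "continuous_on (UNIV \<times> cube n) (%(a, q). g0 a q)" "continuous_on (UNIV \<times> cube n) (%(a, q). g1 a q)" unfolding g0_def g1_def
  by (rule continuous_on_line_map[OF j cph csi pph psi eq], assumption, rule continuous_on_line_map[OF j csi cph psi pph eq'], assumption)
 have gin: "g0 a q:cube n" "g1 a q:cube n" if q: "q:cube n" for a q unfolding g0_def g1_def
  by (rule line_map_in_cube[OF j cph csi pph psi eq q], assumption, rule line_map_in_cube[OF j csi cph psi pph eq' q], assumption)
 have gg: "g1 a (g0 a q) = q" "g0 a (g1 a q) = q" if q: "q:cube n" for a q unfolding g0_def g1_def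
  by (rule line_map_inverse[OF j cph csi pph psi eq q], assumption, rule line_map_inverse[OF j csi cph psi pph eq' q], assumption)
 have fixc: "(ALL s:{0..1}. ph a (q(j := s)) = si a (q(j := s))) \<or> q j = 0 \<or> q j = 1"
  if q: "q:cube n" "q~:icube n" for a q
 proof (cases "q j = 0 \<or> q j = 1")
  case False
  have "q:bcube n" using q by (simp add: icube_eq)
  hence "EX i<n. q i = 0 \<or> q i = 1" unfolding bcube_def by simp
  then obtain i where i: "i < n" "q i = 0 \<or> q i = 1" by blast
  have ij: "i ~= j" using i False by auto
  have "u (ka (q(j := s))) = 0" if s: "s:{0..1}" for s proof -
   have qs: "q(j := s):cube n" using s q(1) j by (simp add: cube_fun_upd)
   have "q(j := s)~:icube n" proof
    assume "q(j := s):icube n"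
    hence "ALL i<n. 0 < (q(j := s)) i & (q(j := s)) i < 1" unfolding icube_def by simp
    from spec[OF this, of i] have "0 < (q(j := s)) i & (q(j := s)) i < 1" using i(1) by simp
    thus False using i(2) ij by auto
   qed
   thus ?thesis using u(2) chart_bd[OF qs] by simp
  qed
  thus ?thesis by (simp add: ph_def si_def)
 qed simp
 have fixc': "(ALL s:{0..1}. si a (q(j := s)) = ph a (q(j := s))) \<or> q j = 0 \<or> q j = 1"
  if q: "q:cube n" "q~:icube n" for a q
  using fixc[OF q, of a] by auto
 have gbd: "g0 a q = q" "g1 a q = q" if q: "q:cube n" "q~:icube n" for a q unfolding g0_def g1_def
  by (rule line_map_fix[OF j cph csi pph psi eq q(1) fixc[OF q]], assumption, rule line_map_fix[OF j csi cph psi pph eq' q(1) fixc'[OF q]], assumption)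
 have g00: "g0 0 q = q" if q: "q:cube n" for q unfolding g0_def by (rule line_map_fix[OF j cph csi pph psi eq q], assumption) (simp add: ph_def si_def)
 define G where "G a x = (if x:ka ` cube n then ka (g0 a (kai x)) else x)" for a x
 define G' where "G' a x = (if x:ka ` cube n then ka (g1 a (kai x)) else x)" for a x
 have Gc: "cont (%(a, x). G a x)" "cont (%(a, x). G' a x)" unfolding G_def G'_def
  by (rule chart_extend_continuous[OF gc(1) gin(1) gbd(1)], assumption+, rule chart_extend_continuous[OF gc(2) gin(2) gbd(2)], assumption+)
 have GG: "G' a (G a x) = x" "G a (G' a x) = x" for a x by (cases "x:ka ` cube n"; simp add: G_def G'_def chart_inv gin gg)+
 have fam: "hfamily G" by (rule homeo_familyI(1)[OF Gc GG])
 have push: "pushes om (G a) (%x. 1 + clip a * v x) (%x. 1 + clip a * (v x + u x))" (is "pushes om _ ?f ?h") for a unfolding pushes_def proof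
  fix B :: "'a set" assume B: "B:sets borel"
  have mv: "v:borel_measurable borel" "u:borel_measurable borel" by (intro borel_measurable_continuous_onI v u)+
  have mf: "?f:borel_measurable borel" "?h:borel_measurable borel" using mv by simp_all
  have mf': "(%x. ennreal (?f x)):borel_measurable om" "(%x. ennreal (?h x)):borel_measurable om" using mf by (simp_all add: measurable_cong_sets[OF om refl])
  have K: "ka ` cube n:sets borel" by (rule borel_closed[OF compact_imp_closed[OF chart_compact]])
  define B' where "B' = ka -` B Int cube n"
  have B': "B':sets borel" proof -
   have "ka -` B Int cube n:sets (restrict_space borel (cube n))"
    using measurable_sets[OF borel_measurable_continuous_on_restrict[OF chart_facts(3)] B] by (simp add: space_restrict_space)
   thus ?thesis by (simp add: B'_def sets_restrict_space_iff closed_cube borel_closed)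
  qed
  have KB: "B Int ka ` cube n = ka ` (B' Int cube n)" by (auto simp: B'_def)
  have g0c: "continuous_on (cube n) (g0 a)" unfolding g0_def by (rule continuous_on_line_map1[OF j cph csi pph psi eq])
  have g0i: "inj_on (g0 a) (cube n)" using gg(1) by (metis inj_onI)
  have gB: "g0 a ` (B' Int cube n):sets borel" by (rule image_borel_cell[OF compact_cube g0c g0i B'])
  have gBc: "g0 a ` (B' Int cube n) Int cube n = g0 a ` (B' Int cube n)" using gin(1) by auto
  have "G a ` (B Int ka ` cube n) = ka ` (g0 a ` (B' Int cube n) Int cube n)" unfolding KB gBc image_image by (rule image_cong) (simp_all add: G_def chart_inv)
  hence "emeasure (dens om ?h) (G a ` (B Int ka ` cube n)) =
   ennreal m * (\<integral>\<^sup>+q. ennreal (indicator (cube n) q * (indicator (g0 a ` (B' Int cube n)) q * si a q)) \<partial>lam n)"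
   using chart_dens[OF mf(2) gB] by (simp add: si_def)
  also have "(\<integral>\<^sup>+q. ennreal (indicator (cube n) q * (indicator (g0 a ` (B' Int cube n)) q * si a q)) \<partial>lam n) =
   (\<integral>\<^sup>+q. ennreal (indicator (cube n) q * (indicator (g0 a ` (B' Int cube n)) (g0 a q) * ph a q)) \<partial>lam n)"
   unfolding g0_def by (rule line_map_measure[OF j cph csi pph psi eq gB[unfolded g0_def], symmetric])
  also have "... = (\<integral>\<^sup>+q. ennreal (indicator (cube n) q * (indicator B' q * ph a q)) \<partial>lam n)" proof (rule nn_integral_cong)
   fix q
   have "q:cube n ==> g0 a q:g0 a ` (B' Int cube n) \<longleftrightarrow> q:B'" using inj_on_image_mem_iff[OF g0i, of q "B' Int cube n"] by simp
   thus "ennreal (indicator (cube n) q * (indicator (g0 a ` (B' Int cube n)) (g0 a q) * ph a q)) =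
    ennreal (indicator (cube n) q * (indicator B' q * ph a q))" by (simp add: indicator_def)
  qed
  also have "ennreal m * ... = emeasure (dens om ?f) (B Int ka ` cube n)" using chart_dens[OF mf(1) B'] by (simp add: KB ph_def)
  finally have in1: "emeasure (dens om ?h) (G a ` (B Int ka ` cube n)) = emeasure (dens om ?f) (B Int ka ` cube n)" .
  have D: "B - ka ` cube n:sets borel" using B K by simp
  have gD: "G a ` (B - ka ` cube n) = B - ka ` cube n" using image_cong[OF refl, of "B - ka ` cube n" "G a" "%x. x"] by (simp add: G_def)
  have "emeasure (dens om ?h) (B - ka ` cube n) = emeasure (dens om ?f) (B - ka ` cube n)" proof -
   have u0: "u x = 0" if "x~:ka ` cube n" for x using u(2) chart_sub that by (metis subsetD)
   have "(\<integral>\<^sup>+x. ennreal (?h x) * indicator (B - ka ` cube n) x \<partial>om) = (\<integral>\<^sup>+x. ennreal (?f x) * indicator (B - ka ` cube n) x \<partial>om)"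
    by (intro nn_integral_cong) (simp add: indicator_def u0)
   thus ?thesis unfolding dens_def using mf' D by (simp add: emeasure_density om)
  qed
  hence in2: "emeasure (dens om ?h) (G a ` (B - ka ` cube n)) = emeasure (dens om ?f) (B - ka ` cube n)" using gD by simp
  have GB: "G a ` X:sets borel" if "X:sets borel" for X by (rule hfamily_borel(1)[OF fam that])
  have BB: "B = (B Int ka ` cube n) Un (B - ka ` cube n)" by blast
  have inj: "inj (G a)" using hfamilyD(3)[OF fam] by (rule bij_is_inj)
  have "emeasure (dens om ?h) (G a ` B) = emeasure (dens om ?h) (G a ` (B Int ka ` cube n) Un G a ` (B - ka ` cube n))"
   unfolding image_Un[symmetric] BB[symmetric] ..
  also have "... = emeasure (dens om ?h) (G a ` (B Int ka ` cube n)) + emeasure (dens om ?h) (G a ` (B - ka ` cube n))" proof (rule plus_emeasure[symmetric])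
   have "G a ` (B Int ka ` cube n) Int G a ` (B - ka ` cube n) = G a ` ((B Int ka ` cube n) Int (B - ka ` cube n))" by (rule image_Int[OF inj, symmetric])
   thus "G a ` (B Int ka ` cube n) Int G a ` (B - ka ` cube n) = {}" by auto
  qed (use GB B K D in "simp_all add: om")
  also have "... = emeasure (dens om ?f) (B Int ka ` cube n) + emeasure (dens om ?f) (B - ka ` cube n)" unfolding in1 in2 ..
  also have "... = emeasure (dens om ?f) ((B Int ka ` cube n) Un (B - ka ` cube n))" by (rule plus_emeasure) (use B K D in "auto simp: om")
  also have "... = emeasure (dens om ?f) B" unfolding BB[symmetric] ..
  finally show "emeasure (dens om ?h) (G a ` B) = emeasure (dens om ?f) B" .
 qed
 have "G 0 x = x" for x by (cases "x:ka ` cube n") (simp_all add: G_def chart_inv g00)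
 moreover have "G a x = x" if "x~:ka ` cube n" for a x using that by (simp add: G_def)
 ultimately show ?thesis using fam push by (intro exI[of _ G]) simp
qed

end

text \<open>A change of density that one rearrangement, in one chart and one direction, can bring
  about.\<close>

definition elem :: "nat => 'a::metric_space measure => 'a set => ('a => real) => bool"
 where "elem n om V u \<longleftrightarrow> (EX ka m j. ou_chart n om ka m & j < n & ka ` cube n <= V & cont u &
  (ALL x. x~:ka ` icube n --> u x = 0) & (ALL q:cube n. integral {0..1} (%s. u (ka (q(j := s)))) = 0))"

definition esum :: "nat => 'a::metric_space measure => 'a set => ('a => real) => bool"
 where "esum n om V u \<longleftrightarrow> (EX us. (ALL e:set us. elem n om V e) & (ALL x. u x = (SUM e<-us. e x)))"

lemma elem_continuous: "elem n om V u ==> cont u" unfolding elem_def by blast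

lemma elem_scale:
 assumes "elem n om V u" shows "elem n om V (%x. c * u x)"
proof -
 obtain ka m j where e: "ou_chart n om ka m" "j < n" "ka ` cube n <= V" "cont u"
  "ALL x. x~:ka ` icube n --> u x = 0" "ALL q:cube n. integral {0..1} (%s. u (ka (q(j := s)))) = 0"
  using assms unfolding elem_def by (elim exE conjE)
 have "cont (%x. c * u x)" by (intro continuous_intros e)
 thus ?thesis unfolding elem_def using e by (intro exI[of _ ka], rule_tac exI[of _ m], rule_tac exI[of _ j]) simp
qed

lemma elem_mono: "elem n om V u ==> V <= W ==> elem n om W u"
 unfolding elem_def by (elim exE conjE) (rule_tac exI, rule_tac exI, rule_tac exI, intro conjI, assumption+, rule order_trans, assumption+)

lemma elem_bounded:
 assumes "elem n om V u" shows "EX C. ALL x. abs (u x) <= C"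
proof -
 obtain ka m j where e: "ou_chart n om ka m" "cont u" "ALL x. x~:ka ` icube n --> u x = 0" using assms unfolding elem_def by (elim exE conjE)
 have c: "compact (ka ` cube n)" using e(1) unfolding ou_chart_def by (simp add: compact_continuous_image compact_cube)
 hence "compact (u ` (ka ` cube n))" by (rule compact_continuous_image[OF cont_subset[OF e(2) subset_UNIV]])
 then obtain C where C: "ALL y:u ` (ka ` cube n). norm y <= C" using compact_imp_bounded bounded_iff by metis
 have "abs (u x) <= max C 0" for x proof (cases "x:ka ` cube n")
  case True
  thus ?thesis using C by force
 next
  case False
  hence "x~:ka ` icube n" using image_mono[OF icube_sub[of n], of ka] by (metis subsetD)
  thus ?thesis using e(3) by simp
 qed
 thus ?thesis by blast
qed

lemma esum_0: "esum n om V (%x. 0)" unfolding esum_def by (rule exI[of _ "[]"]) simp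

lemma esum_elem: "elem n om V u ==> esum n om V u" unfolding esum_def by (rule exI[of _ "[u]"]) simp

lemma esum_add:
 assumes "esum n om V u" "esum n om V v" shows "esum n om V (%x. u x + v x)"
proof -
 obtain us vs where "ALL e:set us. elem n om V e" "ALL x. u x = (SUM e<-us. e x)" "ALL e:set vs. elem n om V e" "ALL x. v x = (SUM e<-vs. e x)"
  using assms unfolding esum_def by (elim exE conjE)
 thus ?thesis unfolding esum_def by (intro exI[of _ "us @ vs"]) auto
qed

lemma esum_scale:
 assumes "esum n om V u" shows "esum n om V (%x. c * u x)"
proof -
 obtain us where us: "ALL e:set us. elem n om V e" "ALL x. u x = (SUM e<-us. e x)" using assms unfolding esum_def by (elim exE conjE)
 have "(SUM e<-map (%e x. c * e x) us. e x) = c * (SUM e<-us. e x)" for x by (induction us) (simp_all add: algebra_simps)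
 hence 2: "ALL x. c * u x = (SUM e<-map (%e x. c * e x) us. e x)" using us(2) by simp
 have 1: "ALL e:set (map (%e x. c * e x) us). elem n om V e" proof
  fix e assume "e:set (map (%e x. c * e x) us)"
  then obtain e' where "e':set us" "e = (%x. c * e' x)" by auto
  thus "elem n om V e" using us(1) elem_scale[of n om V e' c] by simp
 qed
 from 1 2 show ?thesis unfolding esum_def by (intro exI conjI)
qed

lemma esum_sum: "finite I ==> (!!i. i:I ==> esum n om V (f i)) ==> esum n om V (%x. SUM i:I. f i x)"
 by (induction I rule: finite_induct) (simp_all add: esum_0 esum_add)

lemma esum_continuous:
 assumes "esum n om V u" shows "cont u"
proof -
 obtain us where us: "ALL e:set us. elem n om V e" "ALL x. u x = (SUM e<-us. e x)" using assms unfolding esum_def by (elim exE conjE)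
 have "cont (%x. SUM e<-us. e x)" using us(1) proof (induction us)
  case (Cons e us)
  hence "cont (%x. e x + (SUM e<-us. e x))" by (intro continuous_on_add) (simp_all add: elem_continuous[of n om V])
  thus ?case by simp
 qed simp
 thus ?thesis using us(2) by simp
qed

definition sfamily :: "'a set => ('p => 'a => 'a) => bool"
 where "sfamily D g \<longleftrightarrow> (ALL p x. x~:D --> g p x = x)"

context
 fixes n :: nat and om :: "'a::metric_space measure" and V :: "'a set"
 assumes om: "sets om = sets borel"
begin

text \<open>The moves are composed one after the other; the bound on the partial sums keeps every
  intermediate density positive.\<close>

lemma list_family:
 assumes "ALL e:set us. elem n om V e" "cont v"
  "!!k x. abs (v x + (SUM e<-take k us. e x)) < 1"
 shows "EX g D. compact D & D <= V & hfamily g & sfamily D g & (ALL x. g (0::real) x = x) &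
  (ALL a. pushes om (g a) (%x. 1 + clip a * v x) (%x. 1 + clip a * (v x + (SUM e<-us. e x))))"
 using assms proof (induction us arbitrary: v)
 case Nil
 show ?case by (rule exI[of _ "%a x. x"], rule exI[of _ "{}"])
   (simp add: hfamily_id sfamily_def pushes_def)
next
 case (Cons u us)
 have pos: "abs (v x) < 1" "abs (v x + u x) < 1" for x using Cons.prems(3)[of x 0] Cons.prems(3)[of x 1] by simp_all
 have "elem n om V u" using Cons.prems(1) by simp
 then obtain ka m j where e: "ou_chart n om ka m" "j < n" "ka ` cube n <= V" "cont u"
  "ALL x. x~:ka ` icube n --> u x = 0" "ALL q:cube n. integral {0..1} (%s. u (ka (q(j := s)))) = 0"
  unfolding elem_def by (elim exE conjE)
 have "EX g. hfamily g & (ALL a x. x~:ka ` cube n --> g a x = x) & (ALL x. g 0 x = x) &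
  (ALL a. pushes om (g a) (%x. 1 + clip a * v x) (%x. 1 + clip a * (v x + u x)))"
  by (rule moser_chart[OF e(1) om e(2) e(4)]) (simp_all add: e(5,6) Cons.prems(2) pos)
 then obtain g where g: "hfamily g" "ALL a x. x~:ka ` cube n --> g a x = x" "ALL x. g 0 x = x"
  "ALL a. pushes om (g a) (%x. 1 + clip a * v x) (%x. 1 + clip a * (v x + u x))"
  by (elim exE conjE)
 have "EX g D. compact D & D <= V & hfamily g & sfamily D g & (ALL x. g (0::real) x = x) &
  (ALL a. pushes om (g a) (%x. 1 + clip a * (v x + u x)) (%x. 1 + clip a * ((v x + u x) + (SUM e<-us. e x))))"
 proof (rule Cons.IH)
  show "ALL e:set us. elem n om V e" using Cons.prems(1) by simp
  show "cont (%x. v x + u x)" by (intro continuous_intros Cons.prems(2) e(4))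
  show "abs (v x + u x + (SUM e<-take k us. e x)) < 1" for k x using Cons.prems(3)[of x "Suc k"] by (simp add: add.assoc)
 qed
 then obtain h D where h: "compact D" "D <= V" "hfamily h" "sfamily D h" "ALL x. h 0 x = x"
  "ALL a. pushes om (h a) (%x. 1 + clip a * (v x + u x)) (%x. 1 + clip a * ((v x + u x) + (SUM e<-us. e x)))"
  by (elim exE conjE)
 have K: "compact (ka ` cube n)" by (rule chart_compact[OF e(1) om])
 show ?case proof (rule exI[of _ "%a x. h a (g a x)"], rule exI[of _ "D Un ka ` cube n"], intro conjI allI)
  show "compact (D Un ka ` cube n)" by (rule compact_Un[OF h(1) K])
  show "D Un ka ` cube n <= V" using h(2) e(3) by (rule Un_least)
  show "hfamily (%a x. h a (g a x))" by (rule hfamily_comp[OF h(3) g(1)])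
  show "sfamily (D Un ka ` cube n) (%a x. h a (g a x))" using g(2) h(4) unfolding sfamily_def by simp
  show "h 0 (g 0 x) = x" for x using g(3) h(5) by simp
  show "pushes om (%x. h a (g a x)) (%x. 1 + clip a * v x) (%x. 1 + clip a * (v x + (SUM e<-u # us. e x)))" for a
   using pushes_comp[OF g(4)[rule_format] h(6)[rule_format] hfamily_borel(1)[OF g(1)], of a] by (simp add: add.assoc)
 qed
qed

text \<open>Although \<open>u\<close> is small, the elementary summands may be large. All of them
  are divided by \<open>N\<close> and the whole list is run \<open>N\<close> times: at round
  \<open>i\<close> the density is \<open>1 + clip a * (i / N * u)\<close> up to a partial sum of
  size less than 1/2, so positivity is never lost.\<close>

lemma block_family:
 assumes u: "esum n om V u" and b: "!!x. abs (u x) <= 1/2"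
 shows "EX g D. compact D & D <= V & hfamily g & sfamily D g & (ALL x. g (0::real) x = x) &
  (ALL a. pushes om (g a) (%x. 1) (%x. 1 + clip a * u x))"
proof -
 obtain us where us: "ALL e:set us. elem n om V e" "ALL x. u x = (SUM e<-us. e x)" using u unfolding esum_def by (elim exE conjE)
 have uc: "cont u" by (rule esum_continuous[OF u])
 have "EX C. ALL k x. abs (SUM e<-take k us. e x) <= C" using us(1) proof (induction us)
  case Nil thus ?case by (intro exI[of _ 0]) simp
 next
  case (Cons e us)
  from Cons.prems obtain C1 where C1: "ALL x. abs (e x) <= C1" using elem_bounded[of n om V e] by auto
  from Cons obtain C2 where C2: "ALL k x. abs (SUM e<-take k us. e x) <= C2" by auto
  have "abs (SUM e<-take k (e # us). e x) <= abs (C1) + abs (C2)" for k x proof (cases k)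
   case (Suc l)
   have "abs (e x) <= C1" "abs (SUM e<-take l us. e x) <= C2" using C1 C2 by simp_all
   thus ?thesis using Suc by simp
  qed simp
  thus ?case by blast
 qed
 then obtain C where C: "!!k x. abs (SUM e<-take k us. e x) <= C" by blast
 obtain N :: nat where N: "2 * C < real N" using reals_Archimedean2 by blast
 have C0: "0 <= C" using C[where k=0] by simp
 have N0: "0 < real N" using N C0 by linarith
 define us' where "us' = map (%e x. (1 / real N) * e x) us"
 have sc: "(SUM e<-map (%e x. (1 / real N) * e x) ws. e x) = (1 / real N) * (SUM e<-ws. e x)" for ws :: "('a => real) list" and x
  by (induction ws) (simp_all add: algebra_simps)
 have us': "ALL e:set us'. elem n om V e" proof
  fix e assume "e:set us'"
  then obtain e' where "e':set us" "e = (%x. (1 / real N) * e' x)" unfolding us'_def by auto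
  thus "elem n om V e" using us(1) elem_scale[of n om V e' "1 / real N"] by simp
 qed
 have st: "(SUM e<-take k us'. e x) = (1 / real N) * (SUM e<-take k us. e x)" for k x unfolding us'_def take_map by (rule sc)
 have stl: "(SUM e<-us'. e x) = u x / real N" for x unfolding us'_def sc using us(2) by simp
 have small: "abs (SUM e<-take k us'. e x) < 1/2" for k x proof -
  have "abs (SUM e<-take k us'. e x) = abs (SUM e<-take k us. e x) / real N" unfolding st abs_mult by simp
  also have "... <= C / real N" using C N0 by (intro divide_right_mono) auto
  also have "... < 1/2" using N N0 by (simp add: field_simps)
  finally show ?thesis .
 qed
 have "i <= N ==> EX g D. compact D & D <= V & hfamily g & sfamily D g & (ALL x. g (0::real) x = x) &
  (ALL a. pushes om (g a) (%x. 1) (%x. 1 + clip a * (real i / real N * u x)))" for i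
 proof (induction i)
  case 0
  show ?case by (rule exI[of _ "%a x. x"], rule exI[of _ "{}"])
    (simp add: hfamily_id sfamily_def pushes_def)
 next
  case (Suc i)
  hence "i <= N" by simp
  from Suc.IH[OF this] obtain g D where g: "compact D" "D <= V" "hfamily g" "sfamily D g" "ALL x. g (0::real) x = x"
   "ALL a. pushes om (g a) (%x. 1) (%x. 1 + clip a * (real i / real N * u x))"
   by (elim exE conjE)
  have "EX g D. compact D & D <= V & hfamily g & sfamily D g & (ALL x. g (0::real) x = x) &
   (ALL a. pushes om (g a) (%x. 1 + clip a * (real i / real N * u x)) (%x. 1 + clip a * (real i / real N * u x + (SUM e<-us'. e x))))"
  proof (rule list_family[OF us'])
   show "cont (%x. real i / real N * u x)" by (intro continuous_intros uc)
   fix k x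
   have "abs (real i / real N * u x) = real i / real N * abs (u x)" by (simp add: abs_mult)
   also have "... <= 1 * (1/2)" using Suc.prems N0 b[of x] by (intro mult_mono) auto
   finally show "abs (real i / real N * u x + (SUM e<-take k us'. e x)) < 1" using small[where k=k and x=x] by linarith
  qed
  then obtain h E where h: "compact E" "E <= V" "hfamily h" "sfamily E h" "ALL x. h (0::real) x = x"
   "ALL a. pushes om (h a) (%x. 1 + clip a * (real i / real N * u x)) (%x. 1 + clip a * (real i / real N * u x + (SUM e<-us'. e x)))"
   by (elim exE conjE)
  have s: "real i / real N * u x + (SUM e<-us'. e x) = real (Suc i) / real N * u x" for x unfolding stl by (simp add: add_divide_distrib algebra_simps)
  show ?case proof (rule exI[of _ "%a x. h a (g a x)"], rule exI[of _ "E Un D"], intro conjI allI)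
   show "compact (E Un D)" by (rule compact_Un[OF h(1) g(1)])
   show "E Un D <= V" using h(2) g(2) by (rule Un_least)
   show "hfamily (%a x. h a (g a x))" by (rule hfamily_comp[OF h(3) g(3)])
   show "sfamily (E Un D) (%a x. h a (g a x))" using g(4) h(4) unfolding sfamily_def by simp
   show "h 0 (g 0 x) = x" for x using g(5) h(5) by simp
   show "pushes om (%x. h a (g a x)) (%x. 1) (%x. 1 + clip a * (real (Suc i) / real N * u x))" for a
    using pushes_comp[OF g(6)[rule_format] h(6)[rule_format] hfamily_borel(1)[OF g(3)], of a] unfolding s .
  qed
 qed
 from this[of N] show ?thesis using N0 by simp
qed

end

subsection \<open>Charts of the manifold\<close>

lemma finite_measure_scale:
 assumes "finite_measure M" shows "finite_measure (scale_measure (ennreal m) M)" using finite_measure.emeasure_finite[OF assms]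
 by (intro finite_measureI) (simp add: ennreal_mult_eq_top_iff)

lemma cmeas_scale:
 assumes "cmeas n mu" "0 < m" shows "cmeas n (scale_measure (ennreal m) mu)" using assms(1,2) finite_measure_scale[of mu m] unfolding cmeas_def
 by (simp add: ennreal_zero_less_mult_iff)

lemma cube_homeo_bd:
 assumes h: "cube_homeo n h h'" and bd: "ALL x:bcube n. h x = x"
 shows "h ` cube n = cube n" "h ` icube n = icube n"
proof -
 have H: "h x:cube n" "h' x:cube n" "h' (h x) = x" "h (h' x) = x" if "x:cube n" for x using h that unfolding cube_homeo_def by simp_all
 show 1: "h ` cube n = cube n" proof (intro equalityI subsetI)
  fix x assume "x:h ` cube n" thus "x:cube n" by (rule imageE) (simp add: H)
 next
  fix x assume "x:cube n" thus "x:h ` cube n" using H(2,4)[of x] by (metis imageI)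
 qed
 have i: "inj_on h (cube n)" using H(3) by (metis inj_onI)
 have "h ` bcube n = (%x. x) ` bcube n" using bd by (intro image_cong) simp_all
 thus "h ` icube n = icube n" unfolding icube_eq using inj_on_image_set_diff[OF i Diff_subset bcube_subset] 1 by simp
qed

lemma radon_sets: "radon_measure om ==> sets om = sets borel"
 and radon_compact: "radon_measure om ==> compact K ==> emeasure om K < \<infinity>" by (simp_all add: radon_measure_def)

lemma image_cube_int_Int:
 assumes ka: "continuous_on (cube n) ka" "inj_on ka (cube n)" "open (ka ` icube n)" and U: "open U"
 shows "open ((ka :: _ => 'a::t2_space) ` (U Int icube n))"
proof -
 have c: "closed (ka ` (cube n Int - U))"
  by (intro compact_imp_closed compact_continuous_image cont_subset[OF ka(1)] compact_Int_closed compact_cube closed_Compl U) simp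
 have "ka ` (U Int icube n) = ka ` (icube n - (cube n Int - U))" by (intro arg_cong[where f="image ka"]) (use icube_sub in auto)
 also have "... = ka ` icube n - ka ` (cube n Int - U)" by (rule inj_on_image_set_diff[OF ka(2)]) (use icube_sub in auto)
 finally show ?thesis using ka(3) c by (simp add: open_Diff)
qed

text \<open>With null boundary the pulled-back measure is admissible, and the Oxtoby-Ulam
  homeomorphism carries a multiple of Lebesgue measure of the same mass to it.\<close>

lemma ou_chart_normalize:
 fixes ka :: "pt => 'a::metric_space"
 assumes n: "0 < n" and ka: "continuous_on (cube n) ka" "inj_on ka (cube n)" "open (ka ` icube n)"
  and om: "radon_measure om" "good_measure om" and bd: "emeasure om (ka ` bcube n) = 0"
 shows "EX ka' m. ou_chart n om ka' m & ka' ` cube n = ka ` cube n & ka' ` icube n = ka ` icube n"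
proof -
 note s = radon_sets[OF om(1)]
 define al where "al = pull (cube n) ka om"
 have al: "emeasure al B = emeasure om (ka ` (B Int cube n))" if "B:sets borel" for B unfolding al_def by (rule emeasure_pull[OF compact_cube ka(1,2) s that])
 have sa: "sets al = sets borel" unfolding al_def by (rule sets_pull_eq)
 hence sp: "space al = UNIV" using sets_eq_imp_space_eq by force
 note lam = cmeas_lam[OF n]
 have pos: "emeasure al U > 0" if U: "open U" "U Int cube n ~= {}" for U proof -
  from U(2) obtain x where "x:U" "x:cube n" by (metis Int_iff ex_in_conv)
  hence "0 < emeasure (lam n) (U Int icube n)" using lam_open_pos[OF U(1)] cmeas_Int[OF lam, of U] U(1) by (simp add: borel_open)
  hence "U Int icube n ~= {}" by (metis emeasure_empty less_irrefl)
  hence ne: "ka ` (U Int icube n) ~= {}" by (simp only: image_is_empty not_False_eq_True)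
  have "0 < emeasure om (ka ` (U Int icube n))" using om(2) image_cube_int_Int[OF ka U(1)] ne unfolding good_measure_def by simp
  also have "... <= emeasure om (ka ` (U Int cube n))" proof (rule emeasure_mono)
   show "ka ` (U Int icube n) <= ka ` (U Int cube n)" by (intro image_mono Int_mono icube_sub) simp
   show "ka ` (U Int cube n):sets om" unfolding s by (rule image_borel_cell[OF compact_cube ka(1,2)]) (simp add: U borel_open)
  qed
  finally show ?thesis using al[of U] U(1) by (simp add: borel_open)
 qed
 have cm: "cmeas n al" unfolding cmeas_def proof (intro conjI allI impI)
  show "finite_measure al" proof (rule finite_measureI)
   have "compact (ka ` cube n)" by (rule compact_continuous_image[OF ka(1) compact_cube])
   thus "emeasure al (space al) ~= \<infinity>" using radon_compact[OF om(1), of "ka ` cube n"] al[of UNIV] by (simp add: sp)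
  qed
  show "emeasure al (- cube n) = 0" using al[of "- cube n"] by (simp add: borel_closed closed_cube)
  show "emeasure al {x} = 0" for x proof (cases "x:cube n")
   case True
   hence "ka ` ({x} Int cube n) = {ka x}" by simp
   thus ?thesis using al[of "{x}"] om(2) unfolding good_measure_def by simp
  next
   case False
   hence "ka ` ({x} Int cube n) = {}" by simp
   thus ?thesis using al[of "{x}"] by simp
  qed
  have "bcube n Int cube n = bcube n" using bcube_subset by (rule Int_absorb2)
  thus "emeasure al (bcube n) = 0" using al[of "bcube n"] bd by (simp add: borel_closed closed_cube_bd)
  fix U :: "pt set" assume U: "open U & U Int cube n ~= {}"
  have "(U Int cube n) Int cube n = U Int cube n" by (simp only: Int_assoc Int_absorb)
  moreover have "U:sets borel" "cube n:sets borel" using U by (simp_all add: borel_open borel_closed closed_cube)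
  ultimately have "emeasure al (U Int cube n) = emeasure al U" using al[of "U Int cube n"] al[of U] by (simp add: sets.Int)
  thus "0 < emeasure al (U Int cube n)" using pos[of U] U by simp
 qed (rule sa)
 define m where "m = measure al UNIV"
 have em: "emeasure al UNIV = ennreal m" unfolding m_def using finite_measure.emeasure_eq_measure[OF cmeasD(2)[OF cm]] by simp
 have "(%_. 0):cube n" by (simp add: cube_def)
 hence "0 < emeasure al UNIV" using pos[of UNIV] by force
 hence m: "0 < m" by (simp add: em)
 have "emeasure (scale_measure (ennreal m) (lam n)) UNIV = emeasure al UNIV" using prob_space.emeasure_space_1[OF prob_space_lam, of n] by (simp add: em)
 from oxtoby_ulam_cube[OF cmeas_scale[OF lam m] cm this] obtain h h' where
  h: "cube_homeo n h h'" "ALL x:bcube n. h x = x"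
  "ALL B:sets borel. emeasure (scale_measure (ennreal m) (lam n)) (B Int cube n) = emeasure al (h ` (B Int cube n))"
  by (elim exE conjE)
 note hi = cube_homeo_bd[OF h(1,2)]
 have hc: "continuous_on (cube n) h" and hinj: "inj_on h (cube n)" using h(1) unfolding cube_homeo_def by (simp, metis inj_onI)
 have im: "(%q. ka (h q)) ` cube n = ka ` cube n" "(%q. ka (h q)) ` icube n = ka ` icube n" unfolding image_image[symmetric] hi by (rule refl)+
 have "ou_chart n om (%q. ka (h q)) m" unfolding ou_chart_def im proof (intro conjI ballI m n ka(3))
  show "continuous_on (cube n) (%q. ka (h q))" by (rule cont_comp[OF ka(1) hc]) (simp only: hi subset_refl)
  have "inj_on ka (h ` cube n)" using ka(2) by (simp only: hi)
  from comp_inj_on[OF hinj this] show "inj_on (%q. ka (h q)) (cube n)" by (simp add: comp_def)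
  fix B :: "pt set" assume B: "B:sets borel"
  have hB: "h ` (B Int cube n):sets borel" by (rule image_borel_cell[OF compact_cube hc hinj B])
  have "h ` (B Int cube n) <= cube n" using image_mono[of "B Int cube n" "cube n" h] by (simp only: hi Int_lower2)
  hence hB': "h ` (B Int cube n) Int cube n = h ` (B Int cube n)" by (rule Int_absorb2)
  have "emeasure om ((%q. ka (h q)) ` (B Int cube n)) = emeasure al (h ` (B Int cube n))" using al[OF hB] unfolding hB' by (simp add: image_image)
  also have "... = ennreal m * emeasure (lam n) (B Int cube n)" using h(3) B by simp
  also have "emeasure (lam n) (B Int cube n) = emeasure (lam n) B" proof (rule emeasure_eq_AE)
   show "AE x in lam n. (x:B Int cube n) = (x:B)" using cmeas_AE[OF lam] by eventually_elim (use icube_sub in auto)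
  qed (use B in "simp_all add: borel_closed closed_cube")
  finally show "emeasure om ((%q. ka (h q)) ` (B Int cube n)) = ennreal m * emeasure (lam n) B" .
 qed
 with im show ?thesis by (intro exI[of _ "%q. ka (h q)"] exI[of _ m] conjI)
qed

text \<open>The faces of a chart may carry mass. Shrinking the cube about its centre by a factor
  \<open>s\<close> moves them to the slices \<open>(1 + s) / 2\<close> and
  \<open>(1 - s) / 2\<close>; only countably many slices are not null, so a suitable
  \<open>s\<close> exists.\<close>

lemma ou_chart_shrink:
 fixes ka :: "pt => 'a::metric_space"
 assumes n: "0 < n" and ka: "continuous_on (cube n) ka" "inj_on ka (cube n)" "open (ka ` icube n)"
  and om: "radon_measure om" "good_measure om"
 shows "EX ka' m. ou_chart n om ka' m & ka' ` cube n <= ka ` cube n & ka (%i. if i < n then 1/2 else 0):ka' ` icube n"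
proof -
 note s = radon_sets[OF om(1)]
 define al where "al = pull (cube n) ka om"
 have al: "emeasure al B = emeasure om (ka ` (B Int cube n))" if "B:sets borel" for B unfolding al_def by (rule emeasure_pull[OF compact_cube ka(1,2) s that])
 have sa: "sets al = sets borel" unfolding al_def by (rule sets_pull_eq)
 hence sp: "space al = UNIV" using sets_eq_imp_space_eq by force
 have fin: "finite_measure al" proof (rule finite_measureI)
  have "compact (ka ` cube n)" by (rule compact_continuous_image[OF ka(1) compact_cube])
  thus "emeasure al (space al) ~= \<infinity>" using radon_compact[OF om(1), of "ka ` cube n"] al[of UNIV] by (simp add: sp)
 qed
 define Z where "Z = (UN i<n. {t. emeasure al {x :: nat => real. x i = t} ~= 0})"
 have Z: "countable Z" unfolding Z_def by (intro countable_UN countable_null_slices[OF fin sa]) simp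
 have "countable ((%t. 2 * t - 1) ` Z Un (%t. 1 - 2 * t) ` Z)" using Z by simp
 moreover have "uncountable {1/2<..<1::real}" by (simp add: uncountable_open_interval)
 ultimately have "~ {1/2<..<1} <= (%t. 2 * t - 1) ` Z Un (%t. 1 - 2 * t) ` Z" using countable_subset by blast
 then obtain s where s1: "1/2 < s" "s < 1" "s~:(%t. 2 * t - 1) ` Z Un (%t. 1 - 2 * t) ` Z"
  unfolding subset_iff greaterThanLessThan_iff by blast
 have sZ: "(1 + s) / 2~:Z" "(1 - s) / 2~:Z" proof -
  have e: "s = 2 * ((1 + s) / 2) - 1" "s = 1 - 2 * ((1 - s) / 2)" by (simp_all add: field_simps)
  show "(1 + s) / 2~:Z" "(1 - s) / 2~:Z" using s1(3) image_eqI[where f="%t. 2 * t - 1", OF e(1)] image_eqI[where f="%t. 1 - 2 * t", OF e(2)] by blast+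
 qed
 define A where "A q i = (if i < n then 1/2 + s * (q i - 1/2) else (0::real))" for q :: pt and i :: nat
 have bnd: "0 < 1/2 + s * (t - 1/2) & 1/2 + s * (t - 1/2) < 1" if "0 <= t" "t <= 1" for t proof -
  have "abs (s * (t - 1/2)) <= s * (1/2)"  proof -
   have "abs (t - 1/2) <= 1/2" using that by linarith
   thus ?thesis using mult_left_mono[of "abs (t - 1/2)" "1/2" s] s1 by (simp add: abs_mult)
  qed
  thus ?thesis using s1 by linarith
 qed
 have Ac: "continuous_on S A" for S proof (rule cont_fun)
  fix i show "continuous_on S (%q. A q i)" unfolding A_def by (cases "i < n") (simp_all add: continuous_intros)
 qed
 have Ain: "A q:cube n" if "q:cube n" for q proof -
  have "0 <= A q i & A q i <= 1" if "i < n" for i using bnd[of "q i"] \<open>q:cube n\<close> that unfolding A_def cube_def by (simp add: less_imp_le)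
  thus ?thesis unfolding cube_def by (simp add: A_def)
 qed
 have Ainj: "inj_on A (cube n)" proof (rule inj_onI, rule ext)
  fix x y i assume "x:cube n" "y:cube n" "A x = A y"
  thus "x i = y i" using fun_cong[of "A x" "A y" i] s1 unfolding A_def cube_def by (cases "i < n") simp_all
 qed
 have imAs: "A ` cube n <= cube n" by (rule image_subsetI, rule Ain)
 let ?B = "{x:cube n. EX i<n. abs (x i - 1/2) >= s/2}"
 have clB: "compact ?B" proof -
  have eq: "?B = (UN i<n. cube n Int ({x. x i >= 1/2 + s/2} Un {x. x i <= 1/2 - s/2}))" proof (rule set_eqI)
   fix x :: pt
   have "abs (x i - 1/2) >= s/2 \<longleftrightarrow> x i >= 1/2 + s/2 \<or> x i <= 1/2 - s/2" for i by arith
   thus "x:?B \<longleftrightarrow> x:(UN i<n. cube n Int ({x. x i >= 1/2 + s/2} Un {x. x i <= 1/2 - s/2}))" by auto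
  qed
  have cl: "closed ({x::nat => real. x i >= 1/2 + s/2} Un {x. x i <= 1/2 - s/2})" for i by (intro closed_Un closed_coord_le closed_coord_ge)
  show ?thesis unfolding eq by (intro compact_UN compact_Int_closed compact_cube cl finite_lessThan)
 qed
 have ab: "abs (1/2 + s * (t - 1/2) - 1/2) < s/2 \<longleftrightarrow> 0 < t & t < 1" for t proof -
  have "abs (1/2 + s * (t - 1/2) - 1/2) = s * abs (t - 1/2)" using s1 by (simp add: abs_mult)
  moreover have "s * abs (t - 1/2) < s * (1/2) \<longleftrightarrow> abs (t - 1/2) < 1/2" using s1 by (subst mult_less_cancel_left_pos) auto
  moreover have "abs (t - 1/2) < 1/2 \<longleftrightarrow> 0 < t & t < 1" by arith
  ultimately show ?thesis by simp
 qed
 have imA: "A ` icube n = icube n - ?B" proof (intro equalityI subsetI)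
  fix x assume "x:A ` icube n"
  then obtain q where q: "q:icube n" "x = A q" by (rule imageE)
  hence "ALL i<n. abs (x i - 1/2) < s/2" using ab unfolding A_def icube_def by simp
  moreover have "0 < x i & x i < 1" if "i < n" for i using bnd[of "q i"] q that unfolding A_def icube_def by (simp add: less_imp_le)
  hence "x:icube n" unfolding icube_def using q(2) by (simp add: A_def)
  ultimately show "x:icube n - ?B" by force
 next
  fix x assume x: "x:icube n - ?B"
  have lt: "abs (x i - 1/2) < s/2" if "i < n" for i proof (rule ccontr)
   assume "~ ?thesis"
   hence "x:?B" using x that subsetD[OF icube_sub, of x n] by auto
   thus False using x by simp
  qed
  define q where "q i = (if i < n then 1/2 + (x i - 1/2) / s else 0)" for i
  have Aq: "A q = x" proof
   fix i show "A q i = x i" using x s1 unfolding A_def q_def icube_def by auto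
  qed
  have "q:icube n" proof -
   have "0 < q i & q i < 1" if i: "i < n" for i using lt[OF i] fun_cong[OF Aq, of i] ab[of "q i"] i by (simp add: A_def)
   thus ?thesis by (simp add: icube_def q_def)
  qed
  thus "x:A ` icube n" using Aq by (metis imageI)
 qed
 let ?k = "%q. ka (A q)"
 have k1: "continuous_on (cube n) ?k" by (rule cont_comp[OF ka(1) Ac imAs])
 have k2: "inj_on ?k (cube n)" using comp_inj_on[OF Ainj inj_on_subset[OF ka(2) imAs]] by (simp add: comp_def)
 have k3: "open (?k ` icube n)" proof -
  have "?k ` icube n = ka ` (icube n - ?B)" unfolding image_image[symmetric] imA ..
  also have "... = ka ` icube n - ka ` ?B" by (rule inj_on_image_set_diff[OF ka(2)]) (use icube_sub in auto)
  finally show ?thesis using ka(3) compact_imp_closed[OF compact_continuous_image[OF cont_subset[OF ka(1)] clB]] by (simp add: open_Diff)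
 qed
 have k4: "emeasure om (?k ` bcube n) = 0" proof -
  let ?T = "UN i<n. {x. x i = (1 + s)/2} Un {x. x i = (1 - s)/2}"
  have Tb: "?T:sets borel" by (intro sets.finite_UN borel_closed closed_Un closed_coord_eq) simp
  have T0: "emeasure al ?T = 0" proof -
   have "?T:null_sets al" proof (intro null_sets.finite_UN null_sets.Un null_setsI)
    fix i assume "i:{..<n}"
    thus "emeasure al {x. x i = (1 + s)/2} = 0" "emeasure al {x. x i = (1 - s)/2} = 0" using sZ unfolding Z_def by auto
   qed (simp_all add: sa borel_closed closed_coord_eq)
   thus ?thesis by auto
  qed
  have "A ` bcube n <= ?T Int cube n" proof
   fix x assume "x:A ` bcube n"
   then obtain q where q: "q:bcube n" "x = A q" by (rule imageE)
   then obtain i where i: "i < n" "q i = 0 \<or> q i = 1" unfolding bcube_def by auto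
   hence "x i = (1 + s)/2 \<or> x i = (1 - s)/2" unfolding q(2) A_def by (auto simp: field_simps)
   moreover have "x:cube n" unfolding q(2) by (rule Ain[OF subsetD[OF bcube_subset q(1)]])
   ultimately show "x:?T Int cube n" using i(1) by auto
  qed
  hence "?k ` bcube n <= ka ` (?T Int cube n)" unfolding image_image[symmetric] by (rule image_mono)
  hence "emeasure om (?k ` bcube n) <= emeasure om (ka ` (?T Int cube n))" by (rule emeasure_mono) (unfold s, rule image_borel_cell[OF compact_cube ka(1,2) Tb])
  thus ?thesis using al[OF Tb] T0 by simp
 qed
 from ou_chart_normalize[OF n k1 k2 k3 om k4] obtain ka' m where
  k: "ou_chart n om ka' m" "ka' ` cube n = ?k ` cube n" "ka' ` icube n = ?k ` icube n"
  by (elim exE conjE)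
 have "?k ` cube n <= ka ` cube n" unfolding image_image[symmetric] by (rule image_mono[OF imAs])
 moreover have "ka (%i. if i < n then 1/2 else 0):?k ` icube n" proof (rule image_eqI[where x="%i. if i < n then 1/2 else 0"])
  show "ka (%i. if i < n then 1/2 else 0) = ka (A (%i. if i < n then 1/2 else 0))" by (rule arg_cong[of _ _ ka]) (auto simp: A_def)
 qed (simp add: icube_def)
 ultimately show ?thesis using k by (intro exI[of _ ka'] exI[of _ m]) simp
qed

section \<open>Consequences of the charts at interior and boundary points\<close>

lemma good_measure_singleton:
 assumes "good_measure om" shows "emeasure om {p} = 0" using assms[unfolded good_measure_def, THEN conjunct1] by (rule spec)

lemma good_measure_open:
 assumes "good_measure om" "open U" "x:U" shows "0 < emeasure om U"
proof -
 have "U ~= {}" using assms(3) by (metis emptyE)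
 thus ?thesis using assms(1)[unfolded good_measure_def, THEN conjunct2, THEN spec, of U] assms(2) by simp
qed

lemma Euclidean_space_eq: "Euclidean_space n = top_of_set {x. ALL i>=n. x i = 0}" unfolding Euclidean_space_def euclidean_product_topology ..

lemma half_space_eq: "half_space n = top_of_set {x. (ALL i>=n. x i = 0) & 0 <= x 0}"
 unfolding half_space_def Euclidean_space_eq subtopology_subtopology by (rule arg_cong[of _ _ top_of_set]) auto

lemma homeomorphic_charts:
 assumes "openin (top_of_set S) V" "subtopology euclidean U homeomorphic_space subtopology (top_of_set S) V"
 shows "EX f g. continuous_on U f & continuous_on V g & f ` U = V & g ` V = U & (ALL x:U. g (f x) = x) & (ALL y:V. f (g y) = y)"
proof -
 have VS: "V <= S" using assms(1) by (rule openin_imp_subset)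
 hence e: "subtopology (top_of_set S) V = top_of_set V" by (simp add: subtopology_subtopology inf_absorb2)
 from assms(2) obtain f g where "homeomorphic_maps (top_of_set U) (top_of_set V) f g" unfolding e homeomorphic_space_def by (elim exE)
 hence *: "continuous_on U f" "continuous_on V g" "f:U \<rightarrow> V" "g:V \<rightarrow> U"
  "ALL x:U. g (f x) = x" "ALL y:V. f (g y) = y"
  unfolding homeomorphic_maps_def continuous_map_subtopology_eu by simp_all
 have "f ` U = V" proof (intro equalityI subsetI)
  fix y assume "y:f ` U" thus "y:V" using *(3) by (metis imageE PiE)
 next
  fix y assume "y:V" thus "y:f ` U" using *(4,6) by (metis imageI PiE)
 qed
 moreover have "g ` V = U" proof (intro equalityI subsetI)
  fix y assume "y:g ` V" thus "y:U" using *(4) by (metis imageE PiE)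
 next
  fix y assume "y:U" thus "y:g ` V" using *(3,5) by (metis imageI PiE)
 qed
 ultimately show ?thesis using *(1,2,5,6) by (intro exI[of _ f] exI[of _ g]) simp
qed

lemma homeomorphic_open:
 assumes U: "open U" and f: "continuous_on U f" "f ` U = V" and g: "!!x. x:U ==> g (f x) = x" "!!y. y:V ==> f (g y) = y" "g ` V = U"
  and T: "open T"
 shows "open (g ` (T Int V))"
proof -
 have "g ` (T Int V) = U Int f -` T" proof (intro equalityI subsetI)
  fix x assume "x:g ` (T Int V)"
  then obtain y where "y:T" "y:V" "x = g y" by (elim imageE IntE)
  thus "x:U Int f -` T" using g(2,3) by (metis IntI imageI vimageI)
 next
  fix x assume x: "x:U Int f -` T"
  hence "f x:T Int V" "x = g (f x)" using f(2) g(1) by (auto)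
  thus "x:g ` (T Int V)" by (metis imageI)
 qed
 thus ?thesis using continuous_open_preimage[OF f(1) U T] by simp
qed

lemma box_in_open:
 assumes "open T" "c:T"
 obtains rh :: real where "0 < rh" "!!y :: nat => real. (!!i. abs (y i - c i) <= rh) ==> y:T"
proof -
 obtain e where e: "e > 0" "ball c e <= T" using assms open_contains_ball by metis
 show thesis proof (rule that)
  \<comment> \<open>The metric of \<open>pt\<close> is at most twice the largest coordinate
    distance, so a third of the radius is enough.\<close>
  show "0 < e / 3" using e by simp
  fix y :: pt assume "!!i. abs (y i - c i) <= e / 3"
  hence "dist c y <= 2 * (e / 3)" by (intro dist_fun_le) (simp add: dist_real_def abs_minus_commute)
  hence "y:ball c e" using e by simp
  thus "y:T" using e(2) by (rule subsetD[rotated])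
 qed
qed

lemma open_manifold_interior: "open (manifold_interior n (euclidean :: 'a::metric_space topology))" by (subst open_subopen) (auto simp: manifold_interior_def)

lemma interior_chart:
 fixes om :: "'a::metric_space measure"
 assumes om: "radon_measure om" "good_measure om" and p: "p:manifold_interior n euclidean" "open W" "p:W"
 shows "EX ka m. ou_chart n om ka m & ka ` cube n <= W & p:ka ` icube n"
proof -
 let ?E = "{x :: nat => real. ALL i>=n. x i = 0}"
 from p(1) obtain U V where UV: "open U" "p:U" "openin (top_of_set ?E) V"
  "subtopology euclidean U homeomorphic_space subtopology (top_of_set ?E) V"
  unfolding manifold_interior_def Euclidean_space_eq by auto
 from homeomorphic_charts[OF UV(3,4)] obtain f g where
  fg: "continuous_on U f" "continuous_on V g" "f ` U = V" "g ` V = U"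
  "ALL x:U. g (f x) = x" "ALL y:V. f (g y) = y" by (elim exE conjE)
 have VE: "V <= ?E" using UV(3) by (rule openin_imp_subset)
 obtain T1 where T1: "open T1" "V = ?E Int T1" using UV(3) unfolding openin_open by auto
 have "openin (top_of_set V) (V Int g -` W)" by (rule continuous_openin_preimage_gen[OF fg(2) p(2)])
 then obtain T2 where T2: "open T2" "V Int g -` W = V Int T2" unfolding openin_open by auto
 have fp: "f p:V" using fg(3) UV(2) by (metis imageI)
 have "f p:V Int g -` W" using fp fg(5)[rule_format, OF UV(2)] p(3) by simp
 hence "f p:T1 Int T2" unfolding T2(2) using T1(2) by simp
 then obtain rh where rh: "0 < rh" "!!y. (!!i. abs (y i - f p i) <= rh) ==> y:T1 Int T2"
  using box_in_open[OF open_Int[OF T1(1) T2(1)]] by blast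
 define A where "A q i = (if i < n then f p i + rh * (2 * q i - 1) else (0::real))" for q :: pt and i :: nat
 have fpE: "f p i = 0" if "i >= n" for i using fp VE that by auto
 have Ain: "A q:V Int T2" if q: "q:cube n" for q proof -
  have "abs (A q i - f p i) <= rh" for i proof (cases "i < n")
   case True
   hence "abs (2 * q i - 1) <= 1" using q unfolding cube_def by (auto simp: abs_le_iff)
   thus ?thesis using mult_left_mono[of "abs (2 * q i - 1)" 1 rh] rh(1) True by (simp add: A_def abs_mult)
  qed (use fpE rh(1) in "simp add: A_def")
  hence "A q:T1 Int T2" by (rule rh(2))
  moreover have "A q:?E" by (simp add: A_def)
  ultimately show ?thesis unfolding T1(2) by blast
 qed
 have Ac: "continuous_on S A" for S proof (rule cont_fun)
  fix i show "continuous_on S (%q. A q i)" unfolding A_def by (cases "i < n") (simp_all add: continuous_intros)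
 qed
 have Ainj: "inj_on A (cube n)" proof (rule inj_onI, rule ext)
  fix x y i assume "x:cube n" "y:cube n" "A x = A y"
  thus "x i = y i" using fun_cong[of "A x" "A y" i] rh(1) unfolding A_def cube_def by (cases "i < n") simp_all
 qed
 have AV: "A ` cube n <= V" using Ain by (intro image_subsetI) (rule IntD1)
 let ?k = "%q. g (A q)"
 have k1: "continuous_on (cube n) ?k" by (rule cont_comp[OF fg(2) Ac AV])
 have "inj_on g V" using fg(6) by (metis inj_onI)
 hence k2: "inj_on ?k (cube n)" using comp_inj_on[OF Ainj inj_on_subset[OF _ AV]] by (simp add: comp_def)
 have k3: "open (?k ` icube n)" proof -
  let ?T = "INT i<n. {y. f p i - rh < y i} Int {y :: nat => real. y i < f p i + rh}"
  have oT: "open ?T" by (intro open_INT open_Int open_Collect_less continuous_intros ballI finite_lessThan)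
  have "A ` icube n = ?T Int V" proof (intro equalityI subsetI)
   fix x assume "x:A ` icube n"
   then obtain q where q: "q:icube n" "x = A q" by (rule imageE)
   have "f p i - rh < A q i & A q i < f p i + rh" if i: "i < n" for i proof -
    have "0 < q i" "q i < 1" using q(1) i unfolding icube_def by auto
    thus ?thesis using rh(1) i mult_pos_pos[of rh "q i"] mult_pos_pos[of rh "1 - q i"] by (simp add: A_def algebra_simps)
   qed
   moreover have "x:V" unfolding q(2) using Ain[OF subsetD[OF icube_sub q(1)]] by simp
   ultimately show "x:?T Int V" using q(2) by simp
  next
   fix x assume x: "x:?T Int V"
   define q where "q i = (if i < n then ((x i - f p i) / rh + 1) / 2 else 0)" for i
   have "A q = x" proof
    fix i show "A q i = x i" using x VE rh(1) unfolding A_def q_def by (cases "i < n") (auto simp: field_simps)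
   qed
   moreover have "q:icube n" using x rh(1) unfolding icube_def q_def by (auto simp: field_simps)
   ultimately show "x:A ` icube n" by (metis imageI)
  qed
  hence "?k ` icube n = g ` (?T Int V)" unfolding image_image[symmetric] by simp
  thus ?thesis using homeomorphic_open[OF UV(1) fg(1,3) fg(5,6)[rule_format] fg(4) oT] by simp
 qed
 have c: "?k (%i. if i < n then 1/2 else 0) = p" proof -
  have "A (%i. if i < n then 1/2 else 0) = f p" using fpE by (auto simp: A_def)
  thus ?thesis using fg(5)[rule_format, OF UV(2)] by simp
 qed
 \<comment> \<open>In dimension zero the chart would make a point open, but points are null and
   nonempty open sets are not.\<close>
 have n: "0 < n" proof (rule ccontr)
  assume "~ 0 < n"
  hence "icube n = {%i. if i < n then 1/2 else 0}" by (auto simp: icube_def)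
  hence "?k ` icube n = {p}" using c by simp
  thus False using k3 om(2) unfolding good_measure_def by (metis insert_not_empty less_irrefl)
 qed
 have "?k ` cube n <= W" proof (rule image_subsetI)
  fix q assume "q:cube n"
  hence "A q:V Int T2" by (rule Ain)
  thus "?k q:W" unfolding T2(2)[symmetric] by simp
 qed
 thus ?thesis using ou_chart_shrink[OF n k1 k2 k3 om] unfolding c by (meson order_trans)
qed

lemma manifold_chart:
 fixes p :: "'a::metric_space"
 assumes M: "manifold_with_boundary n (euclidean :: 'a topology)"
 shows "EX U V f g. open U & p:U & openin (top_of_set {x. (ALL i>=n. x i = (0::real)) & 0 <= x 0}) V &
  continuous_on U f & continuous_on V g & f ` U = V & g ` V = U & (ALL x:U. g (f x) = x) & (ALL y:V. f (g y) = y)"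
proof -
 have "EX U V. openin euclidean U & p:U & openin (half_space n) V &
   subtopology euclidean U homeomorphic_space subtopology (half_space n) V"
  using M unfolding manifold_with_boundary_def by simp
 then obtain U V where UV: "open U" "p:U" "openin (top_of_set {x. (ALL i>=n. x i = (0::real)) & 0 <= x 0}) V"
  "subtopology euclidean U homeomorphic_space subtopology (top_of_set {x. (ALL i>=n. x i = (0::real)) & 0 <= x 0}) V"
  unfolding half_space_eq open_openin[symmetric] by (elim exE conjE)
 from homeomorphic_charts[OF UV(3,4)] obtain f g where fg: "continuous_on U f" "continuous_on V g" "f ` U = V" "g ` V = U"
  "ALL x:U. g (f x) = x" "ALL y:V. f (g y) = y" by (elim exE conjE)
 show ?thesis by (rule exI[of _ U], rule exI[of _ V], rule exI[of _ f], rule exI[of _ g]) (intro conjI UV(1-3) fg)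
qed

lemma dimension_pos:
 assumes M: "manifold_with_boundary n (euclidean :: 'a::metric_space topology)" and om: "good_measure (om :: 'a measure)"
 shows "0 < n"
proof (rule ccontr)
 assume n: "~ 0 < n"
 fix p :: 'a
 obtain U V f g where UV: "open U" "p:U" "openin (top_of_set {x. (ALL i>=n. x i = (0::real)) & 0 <= x 0}) V"
  and fg: "f ` U = V" "ALL x:U. g (f x) = x" using manifold_chart[OF M, of p] by (elim exE conjE)
 have "x = p" if "x:U" for x proof -
  have "f x:V" "f p:V" using that UV(2) fg(1) by auto
  hence "f x:{x. (ALL i>=n. x i = 0) & 0 <= x 0}" "f p:{x. (ALL i>=n. x i = 0) & 0 <= x 0}" using openin_imp_subset[OF UV(3)] by (metis (lifting) subsetD)+
  hence "f x = f p" using n by (intro ext) simp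
  thus ?thesis using fg(2) that UV(2) by metis
 qed
 hence "U <= {p}" by (intro subsetI) (rule singletonI[THEN back_subst[of "%z. z:{p}"]], rule sym)
 hence "U = {p}" using UV(2) by (intro equalityI) (assumption, rule insert_subsetI, assumption, rule empty_subsetI)
 thus False using good_measure_singleton[OF om, of p] good_measure_open[OF om UV(1) UV(2)] by simp
qed

lemma connected_cube_like:
 assumes "!!i. connected (S i)" shows "connected {y :: nat => real. ALL i. y i:S i}"
proof -
 have 1: "connectedin (product_topology (%i. euclidean) UNIV) (PiE UNIV S)"
  by (rule connectedin_PiE[THEN iffD2], rule disjI2, rule ballI, simp only: connectedin_iff_connected assms)
 have 2: "PiE UNIV S = {y. ALL i. y i:S i}" unfolding PiE_UNIV_domain Pi_def by simp
 show ?thesis using 1 unfolding 2 euclidean_product_topology connectedin_iff_connected .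
qed

text \<open>The neighbourhood is the image of a half box \<open>B\<close>, and \<open>B'\<close> is
  its part with positive coordinate 0. Chart points with coordinate 0 equal to zero may or may not
  belong to the interior; in any case the set in question lies between the connected image of
  \<open>B'\<close> and its closure.\<close>

lemma interior_locally_connected:
 fixes W :: "'a::metric_space set"
 assumes M: "manifold_with_boundary n (euclidean :: 'a topology)" and n: "0 < n" and W: "open W" "p:W"
 shows "EX N. open N & p:N & N <= W & connected N & connected (N Int manifold_interior n euclidean)"
proof -
 let ?E = "{x :: nat => real. (ALL i>=n. x i = 0) & 0 <= x 0}"
 obtain U V f g where UV: "open U" "p:U" "openin (top_of_set ?E) V" and
  fg: "continuous_on U f" "continuous_on V g" "f ` U = V" "g ` V = U"
  "ALL x:U. g (f x) = x" "ALL y:V. f (g y) = y" using manifold_chart[OF M, of p] by (elim exE conjE)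
 have VE: "V <= ?E" using UV(3) by (rule openin_imp_subset)
 obtain T1 where T1: "open T1" "V = ?E Int T1" using UV(3) unfolding openin_open by auto
 have "openin (top_of_set V) (V Int g -` W)" by (rule continuous_openin_preimage_gen[OF fg(2) W(1)])
 then obtain T2 where T2: "open T2" "V Int g -` W = V Int T2" unfolding openin_open by auto
 have fp: "f p:V" using fg(3) UV(2) by (metis imageI)
 have fpE: "f p:?E" using fp VE by (rule subsetD[rotated])
 have "f p:V Int g -` W" using fp fg(5)[rule_format, OF UV(2)] W(2) by simp
 hence "f p:T1 Int T2" unfolding T2(2) using T1(2) by simp
 then obtain rh where rh: "0 < rh" "!!y. (!!i. abs (y i - f p i) <= rh) ==> y:T1 Int T2"
  using box_in_open[OF open_Int[OF T1(1) T2(1)]] by blast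
 define I where "I i = {f p i - rh <..< f p i + rh}" for i
 define S where "S i = (if i < n then if i = 0 then I i Int {0..} else I i else {0})" for i
 define S' where "S' i = (if i < n then if i = 0 then I i Int {0<..} else I i else {0})" for i
 define B where "B = {y. ALL i. y i:S i}"
 define B' where "B' = {y. ALL i. y i:S' i}"
 define T where "T = (INT i<n. {y :: nat => real. f p i - rh < y i} Int {y. y i < f p i + rh})"
 have oT: "open T" unfolding T_def by (intro open_INT open_Int open_Collect_less continuous_intros ballI finite_lessThan)
 have hS: "t:S i \<longleftrightarrow> (if i < n then f p i - rh < t & t < f p i + rh & (i = 0 --> 0 <= t) else t = 0)"
  and hS': "t:S' i \<longleftrightarrow> (if i < n then f p i - rh < t & t < f p i + rh & (i = 0 --> 0 < t) else t = 0)" for t i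
  by (simp_all add: S_def S'_def I_def)
 have BT: "y:B \<longleftrightarrow> y:?E & y:T" for y proof
  assume "y:B"
  hence a: "y i:S i" for i by (simp add: B_def)
  have "0 <= y 0" using a[of 0] n by (simp add: hS)
  moreover have "y i = 0" if "i >= n" for i using a[of i] that by (simp add: hS)
  moreover have "f p i - rh < y i & y i < f p i + rh" if "i < n" for i using a[of i] that by (simp add: hS)
  ultimately show "y:?E & y:T" unfolding T_def by simp
 next
  assume a: "y:?E & y:T"
  have "y i:S i" for i using a unfolding hS T_def by simp
  thus "y:B" by (simp add: B_def)
 qed
 have B1: "y:T1 Int T2" if "y:B" for y proof (rule rh(2))
  fix i show "abs (y i - f p i) <= rh"
  proof (cases "i < n")
   case True thus ?thesis using that unfolding BT T_def by (auto simp: abs_le_iff less_imp_le) (smt (verit) lessThan_iff)+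
  next
   case False thus ?thesis using that fpE rh(1) unfolding BT by auto
  qed
 qed
 have BV: "y:V Int T2" if "y:B" for y using B1[OF that] that unfolding BT T1(2) by simp
 have BVs: "B <= V" using BV by (intro subsetI) (rule IntD1)
 have BTV: "B = T Int T1 Int V"  proof (rule set_eqI)
  fix y show "y:B \<longleftrightarrow> y:T Int T1 Int V" using BV[of y] B1[of y] BT[of y] subsetD[OF VE, of y] by blast
 qed
 have SS: "t:S' i \<longleftrightarrow> t:S i & (i = 0 --> 0 < t)" for t i using n by (auto simp: hS hS')
 have B'T: "y:B' \<longleftrightarrow> 0 < y 0 & y:B" for y unfolding B_def B'_def mem_Collect_eq SS by blast
 hence B'B: "B' <= B" by (intro subsetI) simp
 have cB: "connected B" unfolding B_def by (rule connected_cube_like) (simp add: S_def I_def is_interval_connected_1[symmetric] is_interval_Int is_interval_convex_1 convex_Int)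
 have cB': "connected B'" unfolding B'_def by (rule connected_cube_like) (simp add: S'_def I_def is_interval_connected_1[symmetric] is_interval_Int is_interval_convex_1 convex_Int)
 have BB': "y:closure B'" if y: "y:B" for y proof -
  define z where "z k = y(0 := y 0 + inverse (Suc k) * ((f p 0 + rh - y 0) / 2))" for k
  have y0: "f p 0 - rh < y 0" "y 0 < f p 0 + rh" "0 <= y 0" using y n unfolding BT T_def by auto
  have zB: "z k:B'" for k proof -
   let ?r = "(f p 0 + rh - y 0) / 2" and ?i = "inverse (real (Suc k))"
   have "?i * ?r <= 1 * ?r" using y0 by (intro mult_right_mono) (auto simp: field_simps)
   moreover have p0: "0 < ?i * ?r" using y0 by (intro mult_pos_pos) auto
   define v where "v = ?i * ?r"
   ultimately have "f p 0 - rh < y 0 + ?i * ?r & y 0 + ?i * ?r < f p 0 + rh & 0 < y 0 + ?i * ?r" using y0 p0 unfolding v_def[symmetric] mult_1 by argo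
   hence "y 0 + ?i * ?r:S' 0" using n unfolding hS' by simp
   moreover have "y i:S' i" if "i ~= 0" for i using y that unfolding B_def SS by simp
   ultimately show ?thesis unfolding B'_def z_def by simp
  qed
  have "z \<longlonglongrightarrow> y" proof -
   let ?w = "%t. y(0 := y 0 + t * ((f p 0 + rh - y 0) / 2))"
   have "cont ?w" proof (rule cont_fun)
    fix i show "cont (%t. ?w t i)" by (cases "i = 0") (simp_all add: continuous_intros)
   qed
   hence "isCont ?w 0" by (simp add: continuous_on_eq_continuous_at)
   from isCont_tendsto_compose[OF this LIMSEQ_inverse_real_of_nat] show ?thesis by (simp add: z_def[abs_def])
  qed
  thus ?thesis using zB unfolding closure_sequential by blast
 qed
 have gI: "g ` B' <= manifold_interior n euclidean" proof -
  let ?P = "{y :: nat => real. 0 < y 0}"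
  have oP: "open ?P" by (intro open_Collect_less continuous_intros)
  have "g ` (?P Int V) <= manifold_interior n euclidean" proof
   fix x assume x: "x:g ` (?P Int V)"
   have "open (g ` (?P Int V))" by (rule homeomorphic_open[OF UV(1) fg(1,3) fg(5,6)[rule_format] fg(4) oP])
   moreover have "openin (top_of_set {x. ALL i>=n. x i = 0}) (?P Int V)" unfolding openin_open T1(2) using T1(1) oP by (intro exI[of _ "?P Int T1"]) auto
   moreover have "subtopology euclidean (g ` (?P Int V)) homeomorphic_space
    subtopology (top_of_set {x. ALL i>=n. x i = (0::real)}) (?P Int V)"
   proof -
    have s: "?P Int V <= {x. ALL i>=n. x i = 0}" unfolding T1(2) by auto
    have "homeomorphic_maps (top_of_set (g ` (?P Int V))) (top_of_set (?P Int V)) f g" unfolding homeomorphic_maps_def continuous_map_subtopology_eu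
    proof (intro conjI)
     have "g ` (?P Int V) <= U" using fg(4) by auto
     thus "continuous_on (g ` (?P Int V)) f" by (rule cont_subset[OF fg(1)])
     show "continuous_on (?P Int V) g" by (rule cont_subset[OF fg(2)]) simp
    qed (use fg(6) in auto)
    thus ?thesis using s unfolding homeomorphic_space_def by (simp add: subtopology_subtopology inf_absorb2) blast
   qed
   ultimately show "x:manifold_interior n euclidean" unfolding manifold_interior_def Euclidean_space_eq using x by (intro CollectI conjI exI) simp_all
  qed
  moreover have "g ` B' <= g ` (?P Int V)"  proof (intro image_mono subsetI)
   fix y assume "y:B'" thus "y:?P Int V" using subsetD[OF BVs, of y] unfolding B'T by simp
  qed
  ultimately show ?thesis by (rule order_trans[rotated])
 qed
 have N: "open (g ` B)" unfolding BTV using homeomorphic_open[OF UV(1) fg(1,3) fg(5,6)[rule_format] fg(4) open_Int[OF oT T1(1)]] .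
 have gc: "continuous_on B g" by (rule cont_subset[OF fg(2) BVs])
 have fpB: "f p:B" unfolding BT T_def using fpE rh(1) by simp
 have cg: "g ` B <= closure (g ` B')" proof
  fix x assume "x:g ` B"
  then obtain y where y: "y:B" "x = g y" by (rule imageE)
  from BB'[OF y(1)] obtain z where z: "ALL k. z k:B'" "z \<longlonglongrightarrow> y" unfolding closure_sequential by (elim exE conjE)
  have "(%k. g (z k)) \<longlonglongrightarrow> g y" using gc z B'B y(1) unfolding continuous_on_sequentially by (auto simp: comp_def)
  thus "x:closure (g ` B')" unfolding closure_sequential using z(1) y(2) by (intro exI[of _ "%k. g (z k)"]) simp
 qed
 show ?thesis proof (intro exI[of _ "g ` B"] conjI)
  show "p:g ` B" using fpB fg(5)[rule_format, OF UV(2)] by (metis imageI)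
  show "g ` B <= W" proof (rule image_subsetI)
   fix y assume "y:B" hence "y:V Int g -` W" unfolding T2(2) by (rule BV)
   thus "g y:W" by simp
  qed
  show "connected (g ` B)" by (rule connected_continuous_image[OF gc cB])
  have "connected (g ` B')" by (rule connected_continuous_image[OF cont_subset[OF gc B'B] cB'])
  thus "connected (g ` B Int manifold_interior n euclidean)" proof (rule connected_intermediate_closure)
   show "g ` B' <= g ` B Int manifold_interior n euclidean" using gI image_mono[OF B'B, of g] by blast
   show "g ` B Int manifold_interior n euclidean <= closure (g ` B')" using cg by blast
  qed
 qed (rule N)
qed

text \<open>Interior points are dense, since the boundary is null and open sets are not. A
  separation of the interior part of \<open>W\<close> therefore extends to \<open>W\<close>: each
  point has a small neighbourhood with connected interior part, which lies on one side, and by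
  density the sides cannot overlap.\<close>

lemma interior_connected:
 fixes W :: "'a::metric_space set" and om :: "'a measure"
 assumes M: "manifold_with_boundary n (euclidean :: 'a topology)" and om: "radon_measure om" "good_measure om"
  and bd: "emeasure om (manifold_boundary n euclidean) = 0" and W: "open W" "connected W"
 shows "connected (W Int manifold_interior n euclidean)"
proof (rule ccontr)
 let ?I = "manifold_interior n (euclidean :: 'a topology)"
 note oI = open_manifold_interior[of n, where 'a='a]
 assume "~ ?thesis"
 then obtain A B where AB: "open A" "open B" "W Int ?I <= A Un B" "A Int B Int (W Int ?I) = {}" "A Int (W Int ?I) ~= {}" "B Int (W Int ?I) ~= {}"
  unfolding connected_def by blast
 have dense: "O' Int ?I ~= {}" if O': "open O'" "O' ~= {}" for O' proof
  assume "O' Int ?I = {}"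
  hence "O' <= manifold_boundary n euclidean" by (auto simp: manifold_boundary_def)
  moreover have "manifold_boundary n euclidean:sets om" unfolding radon_sets[OF om(1)] manifold_boundary_def using oI by (simp add: borel_open)
  ultimately have "emeasure om O' <= 0" using emeasure_mono bd by metis
  moreover obtain z where "z:O'" using O'(2) by (metis ex_in_conv)
  ultimately show False using good_measure_open[OF om(2) O'(1)] by (metis not_less)
 qed
 define H where "H X = \<Union>{N. open N & N <= W & N Int ?I <= X}" for X
 have oH: "open (H X)" for X unfolding H_def by (rule open_Union) simp
 have "W <= H A Un H B" proof
  fix x assume "x:W"
  from interior_locally_connected[OF M dimension_pos[OF M om(2)] W(1) this]
  obtain N where N: "open N" "x:N" "N <= W" "connected (N Int ?I)" by blast
  have "A Int (N Int ?I) = {} \<or> B Int (N Int ?I) = {}" by (rule connectedD[OF N(4) AB(1,2)]) (use AB(3,4) N(3) in blast)+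
  hence "N Int ?I <= B \<or> N Int ?I <= A" using AB(3) N(3) by blast
  thus "x:H A Un H B" unfolding H_def using N by blast
 qed
 moreover have H: "H X Int W ~= {}" if X: "open X" "X Int (W Int ?I) ~= {}" for X proof -
  have "X Int (W Int ?I) <= H X" unfolding H_def using X(1) W(1) oI by (intro Union_upper CollectI conjI open_Int) auto
  thus ?thesis using X(2) by blast
 qed
 moreover note H[OF AB(1,5)] H[OF AB(2,6)]
 moreover have "H A Int H B Int W = {}" proof (rule ccontr)
  assume "H A Int H B Int W ~= {}"
  then obtain x N N' where "x:N" "open N" "N <= W" "N Int ?I <= A" "x:N'" "open N'" "N' Int ?I <= B"
   unfolding H_def by auto
  thus False using dense[of "N Int N'"] AB(4) by blast
 qed
 ultimately show False using connectedD[OF W(2) oH[of A] oH[of B]] by blast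
qed

section \<open>Functions in a chart modulo elementary ones\<close>

definition cext :: "nat => (pt => 'a) => (pt => real) => 'a => real"
 where "cext n ka F x = (if x:ka ` cube n then F (the_inv_into (cube n) ka x) else 0)"

text \<open>The constant 6 makes each factor integrate to 1 over the unit interval, so multiplying
  an average by the factor gives back a function with that average.\<close>

definition tent :: "nat => pt => real"
 where "tent k q = (PROD i<k. 6 * (q i * (1 - q i)))"

definition cbump :: "nat => (pt => 'a) => 'a => real"
 where "cbump n ka = cext n ka (tent n)"

lemma tent_continuous: "continuous_on S (tent k)" unfolding tent_def by (intro continuous_intros)

lemma tent_Suc: "tent (Suc k) q = tent k q * (6 * (q k * (1 - q k)))" by (simp add: tent_def)

lemma tent_upd: "tent k (q(k := s)) = tent k q" unfolding tent_def by (intro prod.cong) auto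

lemma tent_zero: "i < k ==> q i = 0 \<or> q i = 1 ==> tent k q = 0" unfolding tent_def by (intro prod_zero) auto

lemma tent_pos: "q:icube n ==> 0 < tent n q" unfolding tent_def icube_def by (intro prod_pos) simp

lemma has_integral_tent: "((%s::real. 6 * (s * (1 - s))) has_integral 1) {0..1}"
proof -
 have "((%s. 6 * (s * (1 - s))) has_integral (3 * 1^2 - 2 * 1^3) - (3 * 0^2 - 2 * 0^3)) {0..1::real}" by (rule fundamental_theorem_of_calculus)
   (auto simp: has_real_derivative_iff_has_vector_derivative[symmetric] algebra_simps power2_eq_square intro!: derivative_eq_intros)
 thus ?thesis by simp
qed

lemma cube_bdE: "q:cube n ==> q~:icube n ==> EX i<n. q i = 0 \<or> q i = 1" unfolding icube_eq bcube_def by simp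

context
 fixes n :: nat and om :: "'a::metric_space measure" and ka :: "pt => 'a" and m :: real
 assumes ka: "ou_chart n om ka m" and s: "sets om = sets borel"
begin

lemma cext_chart: "q:cube n ==> cext n ka F (ka q) = F q" unfolding cext_def using chart_inv(1)[OF ka s, of q] by (simp add: imageI)

lemma cext_zero:
 assumes F: "!!q. q:cube n ==> q~:icube n ==> F q = 0" and x: "x~:ka ` icube n"
 shows "cext n ka F x = 0"
proof (cases "x:ka ` cube n")
 case True
 then obtain q where q: "q:cube n" "x = ka q" by (rule imageE) 
 hence "q~:icube n" using x by (metis imageI)
 thus ?thesis using F[OF q(1)] cext_chart[OF q(1)] q(2) by simp
qed (simp add: cext_def)

lemma cext_continuous:
 assumes c: "continuous_on (cube n) F" and F: "!!q. q:cube n ==> q~:icube n ==> F q = 0"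
 shows "cont (cext n ka F)"
proof -
 let ?S = "ka ` cube n" and ?T = "- ka ` icube n"
 have "continuous_on ?S (%x. F (the_inv_into (cube n) ka x))"
  by (rule cont_comp[OF c chart_inv(4)[OF ka s]]) (use chart_inv(3)[OF ka s] in "intro image_subsetI, simp")
 hence 1: "continuous_on ?S (cext n ka F)" by (rule continuous_on_eq) (simp add: cext_def)
 have 2: "continuous_on ?T (cext n ka F)" by (rule continuous_on_eq[OF continuous_on_const[of _ 0]]) (simp add: cext_zero F)
 have "closed ?S" "closed ?T" using compact_imp_closed[OF chart_compact[OF ka s]] chart_facts(5)[OF ka s] by (simp_all add: closed_Compl)
 hence "continuous_on (?S Un ?T) (cext n ka F)" by (rule continuous_on_closed_Un[OF _ _ 1 2])
 moreover have "?S Un ?T = UNIV" using chart_sub[OF ka s] by auto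
 ultimately show ?thesis by simp
qed

lemma tent_bd: "q:cube n ==> q~:icube n ==> tent n q = 0" using cube_bdE[of q n] by (metis tent_zero)

lemma cbump_continuous: "cont (cbump n ka)" unfolding cbump_def by (rule cext_continuous[OF tent_continuous]) (rule tent_bd)

lemma cbump_zero: "x~:ka ` icube n ==> cbump n ka x = 0" unfolding cbump_def by (rule cext_zero) (rule tent_bd)

lemma cbump_pos: "x:ka ` icube n ==> 0 < cbump n ka x" unfolding cbump_def by (erule imageE) (simp add: cext_chart subsetD[OF icube_sub] tent_pos)

lemma cbump_nonneg: "0 <= cbump n ka x" using cbump_pos[of x] cbump_zero[of x] by (cases "x:ka ` icube n") simp_all

text \<open>Coordinates are averaged out one at a time. If \<open>H'\<close> is the average of
  \<open>H\<close> over coordinate \<open>k\<close>, then \<open>tent k * H\<close> and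
  \<open>tent (Suc k) * H'\<close> have the same integrals along direction \<open>k\<close>, so
  their difference is elementary. After the last coordinate a constant multiple of the bump is
  left.\<close>

lemma esum_average:
 assumes V: "ka ` cube n <= V" and k: "k <= n"
  and H: "continuous_on (cube n) H" "ALL q:cube n. ALL i. k <= i --> i < n --> q i = 0 \<or> q i = 1 --> H q = 0"
   "ALL q:cube n. ALL q':cube n. (ALL i>=k. q i = q' i) --> H q = H q'"
 shows "EX c. esum n om V (%x. cext n ka (%q. tent k q * H q) x - c * cbump n ka x)" using k H
proof (induction k arbitrary: H rule: inc_induct)
 case base
 have H0: "H q = H (%_. 0)" if "q:cube n" for q by (rule base(3)[rule_format]) (use that in "simp_all add: cube_def")
 have "cext n ka (%q. tent n q * H q) x - H (%_. 0) * cbump n ka x = 0" for x unfolding cbump_def cext_def using H0[OF chart_inv(3)[OF ka s], of x] by simp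
 thus ?case by (intro exI[of _ "H (%_. 0)"]) (simp only: esum_0)
next
 case (step k)
 define H' where "H' q = integral {0..1} (%s. H (q(k := s)))" for q
 have upd: "q(k := t):cube n" if "q:cube n" "t:{0..1}" for q t using that step.hyps by (intro cube_fun_upd) auto
 have cH: "continuous_on (cube n \<times> cbox 0 1) (%p. H ((fst p)(k := snd p)))"
  by (rule cont_comp[OF step.prems(1) fun_upd_continuous]) (use upd in "intro image_subsetI, auto")
 have H'c: "continuous_on (cube n) H'" using integral_continuous_on_param[of "cube n" 0 1 "%q s. H (q(k := s))"] cH
  unfolding H'_def by (simp add: case_prod_beta cbox_interval)
 have int: "(%s. H (q(k := s))) integrable_on {0..1}" if "q:cube n" for q proof (rule integrable_continuous_interval)
  have "continuous_on {0..1} (%s. (q, s))" by (intro continuous_intros)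
  from cont_comp[OF cH this] show "continuous_on {0..1} (%s. H (q(k := s)))" using that by (simp add: image_subset_iff)
 qed
 have H'0: "H' q = 0" if q: "q:cube n" and i: "Suc k <= i" "i < n" "q i = 0 \<or> q i = 1" for q i proof -
  have "H' q = integral {0..1} (%_::real. 0 :: real)" unfolding H'_def proof (rule integral_cong)
   fix t :: real assume "t:{0..1}"
   from step.prems(2)[rule_format, OF upd[OF q this], of i] show "H (q(k := t)) = 0" using i by simp
  qed
  thus ?thesis by simp
 qed
 have H'e: "H' q = H' q'" if q: "q:cube n" "q':cube n" and e: "!!i. Suc k <= i ==> q i = q' i" for q q' unfolding H'_def proof (rule integral_cong)
  fix t :: real assume t: "t:{0..1}"
  show "H (q(k := t)) = H (q'(k := t))" by (rule step.prems(3)[rule_format, OF upd[OF q(1) t] upd[OF q(2) t]]) (use e in simp)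
 qed
 have "ALL q:cube n. ALL i. Suc k <= i --> i < n --> q i = 0 \<or> q i = 1 --> H' q = 0" by (intro ballI allI impI) (rule H'0)
 moreover have "ALL q:cube n. ALL q':cube n. (ALL i>=Suc k. q i = q' i) --> H' q = H' q'" by (intro ballI allI impI) (rule H'e, assumption+, simp)
 ultimately have "EX c. esum n om V (%x. cext n ka (%q. tent (Suc k) q * H' q) x - c * cbump n ka x)" by (rule step.IH[OF H'c])
 then obtain c where c: "esum n om V (%x. cext n ka (%q. tent (Suc k) q * H' q) x - c * cbump n ka x)" by (elim exE)
 let ?D = "%q. tent k q * H q - tent (Suc k) q * H' q"
 have D0: "?D q = 0" if q: "q:cube n" "q~:icube n" for q proof -
  obtain i where i: "i < n" "q i = 0 \<or> q i = 1" using cube_bdE[OF q] by blast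
  consider "i < k" | "i = k" | "Suc k <= i" by linarith
  thus ?thesis proof cases
   case 1 thus ?thesis using tent_zero[of i k q] tent_zero[of i "Suc k" q] i by simp
  next
   case 2 thus ?thesis using step.prems(2)[rule_format, OF q(1), of i] tent_zero[of i "Suc k" q] i by simp
  next
   case 3 thus ?thesis using step.prems(2)[rule_format, OF q(1), of i] H'0[OF q(1) 3] i by simp
  qed
 qed
 have Dc: "continuous_on (cube n) ?D" by (intro continuous_on_diff continuous_on_mult tent_continuous H'c step.prems(1))
 have "elem n om V (cext n ka ?D)" unfolding elem_def proof (rule exI[of _ ka], rule exI[of _ m], rule exI[of _ k], intro conjI allI impI ballI)
  show "ou_chart n om ka m" "ka ` cube n <= V" "k < n" by (fact ka V step.hyps)+
  show "cont (cext n ka ?D)" by (rule cext_continuous[OF Dc D0])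
  show "x~:ka ` icube n ==> cext n ka ?D x = 0" for x by (rule cext_zero[OF D0])
  fix q assume q: "q:cube n"
  have "integral {0..1} (%t. cext n ka ?D (ka (q(k := t)))) =
   integral {0..1} (%t. tent k q * H (q(k := t)) - tent k q * H' q * (6 * (t * (1 - t))))"
  proof (rule integral_cong)
   fix t :: real assume t: "t:{0..1}"
   have "H' (q(k := t)) = H' q" by (rule H'e[OF upd[OF q t] q]) simp
   thus "cext n ka ?D (ka (q(k := t))) = tent k q * H (q(k := t)) - tent k q * H' q * (6 * (t * (1 - t)))"
    by (simp add: cext_chart[OF upd[OF q t]] tent_Suc tent_upd)
  qed
  also have "... = tent k q * H' q - tent k q * H' q * 1" by (rule integral_unique, rule has_integral_diff, rule has_integral_mult_right,
     rule integrable_integral[OF int[OF q], folded H'_def], rule has_integral_mult_right, rule has_integral_tent)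
  finally show "integral {0..1} (%t. cext n ka ?D (ka (q(k := t)))) = 0" by simp
 qed
 from esum_add[OF esum_elem[OF this] c]
 have "esum n om V (%x. cext n ka ?D x + (cext n ka (%q. tent (Suc k) q * H' q) x - c * cbump n ka x))" .
 moreover have "cext n ka ?D x + (cext n ka (%q. tent (Suc k) q * H' q) x - c * cbump n ka x)
  = cext n ka (%q. tent k q * H q) x - c * cbump n ka x" for x
  by (simp add: cext_def)
 ultimately show ?case by (intro exI[of _ c]) simp
qed

lemma chart_esum:
 assumes V: "ka ` cube n <= V" and f: "cont f" "!!x. x~:ka ` icube n ==> f x = 0"
 shows "EX c. esum n om V (%x. f x - c * cbump n ka x)"
proof -
 have c: "continuous_on (cube n) (%q. f (ka q))" by (rule cont_comp[OF f(1) chart_facts(3)[OF ka s]]) simp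
 have "EX c. esum n om V (%x. cext n ka (%q. tent 0 q * f (ka q)) x - c * cbump n ka x)" proof (rule esum_average[OF V _ c], simp, intro ballI allI impI)
  fix q i assume q: "q:cube n" and i: "i < n" "q i = 0 \<or> q i = 1"
  hence "q~:icube n" unfolding icube_def by auto
  hence "ka q~:ka ` icube n" using chart_bd[OF ka s q] by simp
  thus "f (ka q) = 0" by (rule f(2))
 next
  show "ALL q:cube n. ALL q':cube n. (ALL i>=0. q i = q' i) --> f (ka q) = f (ka q')" proof (intro ballI impI)
   fix q q' :: pt assume "ALL i>=0. q i = q' i"
   hence "q = q'" by (intro ext) simp
   thus "f (ka q) = f (ka q')" by simp
  qed
 qed
 moreover have "cext n ka (%q. tent 0 q * f (ka q)) x = f x" for x proof (cases "x:ka ` cube n")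
  case True thus ?thesis using chart_inv(2)[OF ka s True] by (simp add: cext_def tent_def)
 next
  case False
  hence "x~:ka ` icube n" using chart_sub[OF ka s] by (metis subsetD)
  thus ?thesis using False f(2) by (simp add: cext_def)
 qed
 ultimately show ?thesis by simp
qed

end

lemma elem_compact_support:
 assumes "elem n om V u" shows "EX D. compact D & D <= V & (ALL x. x~:D --> u x = 0)"
proof -
 obtain ka m where e: "ou_chart n om ka m" "ka ` cube n <= V" "ALL x. x~:ka ` icube n --> u x = 0" using assms unfolding elem_def by (elim exE conjE)
 have "compact (ka ` cube n)" using e(1) unfolding ou_chart_def by (simp add: compact_continuous_image compact_cube)
 moreover have "ka ` icube n <= ka ` cube n" by (rule image_mono[OF icube_sub])
 ultimately show ?thesis using e(2,3) by (metis subsetD)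
qed

lemma esum_compact_support:
 assumes "esum n om V u" shows "EX D. compact D & D <= V & (ALL x. x~:D --> u x = 0)"
proof -
 obtain us where us: "ALL e:set us. elem n om V e" "ALL x. u x = (SUM e<-us. e x)" using assms unfolding esum_def by (elim exE conjE)
 have "EX D. compact D & D <= V & (ALL x. x~:D --> (SUM e<-us. e x) = 0)" using us(1) proof (induction us)
  case Nil thus ?case by (intro exI[of _ "{}"]) simp
 next
  case (Cons e us)
  obtain D where "compact D" "D <= V" "ALL x. x~:D --> (SUM e<-us. e x) = 0" using Cons by auto
  moreover obtain D' where "compact D'" "D' <= V" "ALL x. x~:D' --> e x = 0" using elem_compact_support[of n om V e] Cons.prems by auto
  ultimately show ?case by (intro exI[of _ "D Un D'"]) (simp add: compact_Un)
 qed
 thus ?thesis using us(2) by simp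
qed

lemma compactly_supported_bounded:
 fixes u :: "'a::topological_space => real"
 assumes "cont u" "compact D" "ALL x. x~:D --> u x = 0"
 shows "EX C>0. ALL x. abs (u x) <= C"
proof -
 have "compact (u ` D)" by (rule compact_continuous_image[OF cont_subset[OF assms(1)] assms(2)]) simp
 then obtain C where C: "ALL y:u ` D. norm y <= C" using compact_imp_bounded bounded_iff by metis
 have "abs (u x) <= abs (C) + 1" for x using C assms(3) by (cases "x:D") force+
 thus ?thesis by (intro exI[of _ "abs (C) + 1"]) simp
qed

lemma compactly_supported_integrable:
 fixes u :: "'a::t2_space => real"
 assumes om: "radon_measure om" and u: "cont u" and D: "compact D" "ALL x. x~:D --> u x = 0"
 shows "integrable om u"
proof -
 obtain C where C: "C > 0" "ALL x. abs (u x) <= C" using compactly_supported_bounded[OF u D] by blast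
 have sp: "space om = UNIV" using radon_sets[OF om] sets_eq_imp_space_eq by force
 have Dm: "D:sets om" using D(1) by (simp add: radon_sets[OF om] borel_closed compact_imp_closed)
 have "integrable om (%x. C * ind D x)" using Dm radon_compact[OF om D(1)] by simp
 moreover have "u:borel_measurable om" using borel_measurable_continuous_onI[OF u] by (simp add: measurable_cong_sets[OF radon_sets[OF om] refl])
 moreover have "AE x in om. norm (u x) <= norm (C * ind D x)" using C D(2) by (intro AE_I2) (auto simp: indicator_def)
 ultimately show ?thesis by (rule Bochner_Integration.integrable_bound)
qed

text \<open>A small multiple \<open>v\<close> of \<open>u\<close> is the change of density produced
  by a homeomorphism that maps a compact set onto itself. Comparing the mass of this set before and
  after shows that \<open>v\<close> has integral zero.\<close>

lemma esum_integral:
 assumes om: "radon_measure om" and u: "esum n om V u"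
 shows "integrable om u" "integral\<^sup>L om u = 0"
proof -
 note s = radon_sets[OF om]
 note uc = esum_continuous[OF u]
 obtain D1 where D1: "compact D1" "ALL x. x~:D1 --> u x = 0" using esum_compact_support[OF u] by blast
 show i: "integrable om u" by (rule compactly_supported_integrable[OF om uc D1])
 obtain C where C: "C > 0" "ALL x. abs (u x) <= C" using compactly_supported_bounded[OF uc D1] by blast
 define v where "v x = 1 / (2 * C) * u x" for x
 have v: "esum n om V v" unfolding v_def[abs_def] by (rule esum_scale[OF u])
 have vb: "abs (v x) <= 1/2" for x using C unfolding v_def by (simp add: abs_mult field_simps)
 from block_family[OF s v vb] obtain g D where g: "compact D" "hfamily g" "sfamily D g"
  "ALL a::real. pushes om (g a) (%x. 1) (%x. 1 + clip a * v x)" by blast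
 let ?D = "D Un D1"
 have cD: "compact ?D" using g(1) D1(1) by (rule compact_Un)
 have bD: "?D:sets borel" by (rule borel_closed[OF compact_imp_closed[OF cD]])
 have gD: "g 1 ` ?D = ?D" proof (intro equalityI subsetI)
  fix x assume "x:g 1 ` ?D"
  then obtain y where y: "y:?D" "x = g 1 y" by blast
  show "x:?D" proof (rule ccontr)
   assume x: "x~:?D"
   hence "g 1 x = g 1 y" using g(3) y(2) unfolding sfamily_def by auto
   hence "x = y" using hfamilyD(4)[OF g(2), of 1] by metis
   thus False using x y(1) by simp
  qed
 next
  fix x assume x: "x:?D"
  show "x:g 1 ` ?D" proof (cases "inv (g 1) x:?D")
   case True thus ?thesis using hfamilyD(5)[OF g(2), of 1 x] by (metis imageI)
  next
   case False
   hence "g 1 (inv (g 1) x) = inv (g 1) x" using g(3) unfolding sfamily_def by simp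
   thus ?thesis using hfamilyD(5)[OF g(2), of 1 x] False x by simp
  qed
 qed
 have vi: "integrable om v" unfolding v_def using i by simp
 have fin: "emeasure om ?D < \<infinity>" by (rule radon_compact[OF om cD])
 have ii: "integrable om (%x. ind ?D x + v x)" using vi fin bD by (intro Bochner_Integration.integrable_add) (simp_all add: s)
 have pos: "0 <= ind ?D x + v x" for x proof (cases "x:?D")
  case True thus ?thesis using vb[of x] by (simp only: indicator_simps)
 next
  case False thus ?thesis using D1(2) by (simp add: v_def)
 qed
 have "emeasure om ?D = emeasure (dens om (%x. 1 + v x)) ?D" using bspec[OF g(4)[THEN spec, of 1, unfolded pushes_def] bD] gD by (simp add: clip_id)
 also have "... = (\<integral>\<^sup>+x. ennreal (1 + v x) * indicator ?D x \<partial>om)" proof -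
  have "v:borel_measurable borel" by (rule borel_measurable_continuous_onI[OF esum_continuous[OF v]])
  hence "(%x. ennreal (1 + v x)):borel_measurable om" by (simp add: measurable_cong_sets[OF s refl])
  thus ?thesis unfolding dens_def using bD by (intro emeasure_density) (simp_all add: s)
 qed
 also have "... = (\<integral>\<^sup>+x. ennreal (ind ?D x + v x) \<partial>om)" using D1(2) by (intro nn_integral_cong) (auto simp: indicator_def v_def)
 also have "... = ennreal (\<integral>x. ind ?D x + v x \<partial>om)" by (rule nn_integral_eq_integral[OF ii], rule AE_I2, rule pos)
 also have "(\<integral>x. ind ?D x + v x \<partial>om) = measure om ?D + integral\<^sup>L om v"
  using vi fin bD by (subst Bochner_Integration.integral_add) (simp_all add: s)
 finally have e: "ennreal (measure om ?D) = ennreal (measure om ?D + integral\<^sup>L om v)" using emeasure_eq_ennreal_measure[of om ?D] fin by simp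
 have "0 <= (\<integral>x. ind ?D x + v x \<partial>om)" by (rule Bochner_Integration.integral_nonneg) (rule pos)
 hence "0 <= measure om ?D + integral\<^sup>L om v" using vi fin bD by (subst (asm) Bochner_Integration.integral_add) (simp_all add: s)
 with e have "integral\<^sup>L om v = 0" by (simp add: ennreal_inj)
 thus "integral\<^sup>L om u = 0" using C(1) unfolding v_def by simp
qed

lemma integral_pos_continuous:
 fixes b :: "'a::t2_space => real"
 assumes om: "radon_measure om" "good_measure om" and b: "cont b" "integrable om b" "!!x. 0 <= b x" "0 < b x0"
 shows "0 < integral\<^sup>L om b"
proof (rule ccontr)
 assume "~ ?thesis"
 moreover have "0 <= integral\<^sup>L om b" using b(3) by (intro Bochner_Integration.integral_nonneg)
 ultimately have "AE x in om. b x = 0" using integral_nonneg_eq_0_iff_AE[OF b(2)] b(3) by simp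
 moreover have sp: "space om = UNIV" using radon_sets[OF om(1)] sets_eq_imp_space_eq by force
 moreover have o: "open {x. 0 < b x}" by (intro open_Collect_less continuous_intros b(1))
 moreover have "{x:space om. ~ b x = 0} = {x. 0 < b x}" using b(3) sp by (auto simp: less_le)
 ultimately have "emeasure om {x. 0 < b x} = 0" using AE_iff_measurable[of "{x. 0 < b x}" om "%x. b x = 0"] radon_sets[OF om(1)] by simp
 thus False using good_measure_open[OF om(2) o, of x0] b(4) by simp
qed

text \<open>A partition of unity splits \<open>u\<close> into pieces in charts, each a multiple of a
  chart bump up to elementary sums. By connectedness all these bumps are multiples of one of them in
  the same sense, so \<open>u\<close> is a multiple of one bump; its integral is zero, hence so is
  the factor.\<close>

lemma esum_connected:
 fixes om :: "'a::metric_space measure"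
 assumes om: "radon_measure om" "good_measure om" and V: "open V" "connected V" "V <= manifold_interior n euclidean"
  and u: "cont u" and D: "compact D" "D <= V" "!!x. x~:D ==> u x = 0" and z: "integral\<^sup>L om u = 0"
 shows "esum n om V u"
proof (cases "D = {}")
 case True
 hence "u = (%x. 0)" using D(3) by auto
 thus ?thesis by (simp add: esum_0)
next
 case False
 then obtain x0 where x0: "x0:D" by blast
 note s = radon_sets[OF om(1)]
 have "ALL x:V. EX ka. (EX m. ou_chart n om ka m) & ka ` cube n <= V & x:ka ` icube n" using interior_chart[OF om subsetD[OF V(3)] V(1)] by meson
 then obtain ka where "ALL x:V. (EX m. ou_chart n om (ka x) m) & ka x ` cube n <= V & x:ka x ` icube n"
  by (rule bchoice[THEN exE])
 hence ka: "EX m. ou_chart n om (ka x) m" "ka x ` cube n <= V" "x:ka x ` icube n" if "x:V" for x using that by simp_all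
 define B where "B x = cbump n (ka x)" for x
 have int: "integrable om (cbump n ka')" "0 < integral\<^sup>L om (cbump n ka')" if o: "ou_chart n om ka' m" and x: "x:ka' ` icube n" for ka' m x proof -
  have "cbump n ka' x = 0" if "x~:ka' ` cube n" for x using cbump_zero[OF o s, of x] that chart_sub[OF o s] by (metis subsetD)
  thus i: "integrable om (cbump n ka')" by (intro compactly_supported_integrable[OF om(1) cbump_continuous[OF o s] chart_compact[OF o s]]) simp
  show "0 < integral\<^sup>L om (cbump n ka')" by (rule integral_pos_continuous[OF om cbump_continuous[OF o s] i cbump_nonneg[OF o s] cbump_pos[OF o s x]])
 qed
 have B: "cont (B x)" "integrable om (B x)" "0 < integral\<^sup>L om (B x)" "0 <= B x y" "0 < B x y \<longleftrightarrow> y:ka x ` icube n"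
  "open (ka x ` icube n)" "ka x ` icube n <= V" if x: "x:V" for x y
 proof -
  obtain m where o: "ou_chart n om (ka x) m" using ka(1)[OF x] by blast
  show "cont (B x)" "integrable om (B x)" "0 < integral\<^sup>L om (B x)" "0 <= B x y" "open (ka x ` icube n)"
   unfolding B_def using cbump_continuous[OF o s] int[OF o ka(3)[OF x]] cbump_nonneg[OF o s] chart_facts(5)[OF o s] by simp_all
  show "0 < B x y \<longleftrightarrow> y:ka x ` icube n" unfolding B_def using cbump_pos[OF o s, of y] cbump_zero[OF o s, of y] by force
  show "ka x ` icube n <= V" using chart_sub[OF o s] ka(2)[OF x] by (rule order_trans)
 qed
 have E: "EX c. esum n om V (%y. f y - c * B x y)"
  if x: "x:V" and f: "cont f" "!!y. y~:ka x ` icube n ==> f y = 0" for x f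
 proof -
  obtain m where o: "ou_chart n om (ka x) m" using ka(1)[OF x] by blast
  show ?thesis unfolding B_def by (rule chart_esum[OF o s ka(2)[OF x] f])
 qed
 have ez: "integral\<^sup>L om f = c * integral\<^sup>L om (B x)"
  if e: "esum n om V (%y. f y - c * B x y)" and "integrable om f" "x:V" for f c x
  using esum_integral(2)[OF om(1) e] that B(2)[OF \<open>x:V\<close>] by simp
 \<comment> \<open>Equivalence of bumps up to a factor. The factor must be nonzero for symmetry, and
   it is, because bumps have positive integral and elementary sums have integral zero. Overlapping
   charts are compared through a third chart inside both.\<close>
 define R where "R x y \<longleftrightarrow> (EX c. c ~= 0 & esum n om V (%z. B x z - c * B y z))" for x y
 have R: "R x y" if "x:V" "y:V" for x y proof (rule connected_equivalence_relation[OF V(2) that, of R])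
  fix x y assume "R x y"
  then obtain c where c: "c ~= 0" "esum n om V (%z. B x z - c * B y z)" unfolding R_def by blast
  have "(- 1 / c) * (B x z - c * B y z) = B y z - (1 / c) * B x z" for z using c(1) by (simp add: field_simps)
  thus "R y x" unfolding R_def using esum_scale[OF c(2), of "- 1 / c"] c(1) by (intro exI[of _ "1 / c"]) simp
 next
  fix x y w assume "R x y" "R y w"
  then obtain c d where c: "c ~= 0" "esum n om V (%z. B x z - c * B y z)" and d: "d ~= 0" "esum n om V (%z. B y z - d * B w z)"
   unfolding R_def by blast
  have eq: "(B x z - c * B y z) + c * (B y z - d * B w z) = B x z - (c * d) * B w z" for z by (simp add: algebra_simps)
  show "R x w" unfolding R_def using esum_add[OF c(2) esum_scale[OF d(2), of c]] c(1) d(1) unfolding eq by (intro exI[of _ "c * d"]) simp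
 next
  fix a assume a: "a:V"
  have "R a y" if y: "y:ka a ` icube n" for y proof -
   have yV: "y:V" using B(7)[OF a] y by (rule subsetD)
   let ?W = "ka a ` icube n Int ka y ` icube n"
   obtain l m where l: "ou_chart n om l m" "l ` cube n <= ?W" "y:l ` icube n"
    using interior_chart[OF om subsetD[OF V(3) yV] open_Int[OF B(6)[OF a] B(6)[OF yV]] IntI[OF y ka(3)[OF yV]]] by blast
   have z: "cbump n l x = 0" if "x~:?W" for x using cbump_zero[OF l(1) s, of x] that chart_sub[OF l(1) s] l(2) by (metis subsetD)
   note lc = cbump_continuous[OF l(1) s] and li = int[OF l(1,3)]
   obtain c where c: "esum n om V (%x. cbump n l x - c * B a x)" using E[OF a lc] z by auto
   obtain d where d: "esum n om V (%x. cbump n l x - d * B y x)" using E[OF yV lc] z by auto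
   have "c ~= 0" "d ~= 0" using ez[OF c li(1) a] ez[OF d li(1) yV] li(2) by auto
   moreover have "(1 / c) * ((cbump n l x - d * B y x) + (- 1) * (cbump n l x - c * B a x)) = B a x - (d / c) * B y x" for x
    using \<open>c ~= 0\<close> by (simp add: field_simps)
   ultimately show ?thesis unfolding R_def using esum_scale[OF esum_add[OF d esum_scale[OF c, of "- 1"]], of "1 / c"] by (intro exI[of _ "d / c"]) simp
  qed
  thus "EX T. openin (top_of_set V) T & a:T & (ALL y:T. R a y)"
   using B(6,7)[OF a] ka(3)[OF a] V(1) by (intro exI[of _ "ka a ` icube n"]) (simp add: openin_open_eq)
 qed
 have DV: "x:V" if "x:D" for x using D(2) that by (rule subsetD)
 have "D <= (UN x:D. ka x ` icube n)" using ka(3)[OF DV] by (intro subsetI UN_I)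
 then obtain F where F: "F <= D" "finite F" "D <= (UN x:F. ka x ` icube n)"
  using compactE_image[OF D(1), of D "%x. ka x ` icube n"] B(6)[OF DV] by metis
 have FV: "x:V" if "x:F" for x using DV[OF subsetD[OF F(1) that]] .
 define S where "S y = (SUM x:F. B x y)" for y
 have Sc: "cont S" unfolding S_def using B(1)[OF FV] by (intro continuous_on_sum)
 have Spos: "0 < S y" if y: "y:D" for y proof -
  obtain x where x: "x:F" "y:ka x ` icube n" using subsetD[OF F(3) y] by (rule UN_E)
  thus ?thesis unfolding S_def using B(4,5)[OF FV] F(2) by (intro sum_pos2[of F x]) auto
 qed
 \<comment> \<open>The sum \<open>S\<close> is positive on \<open>D\<close> only; outside
   \<open>D\<close> the quotient vanishes together with \<open>u\<close>, and the open sets where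
   one or the other description applies cover the space.\<close>
 define U where "U x y = u y * B x y / S y" for x y
 have Uc: "cont (U x)" if x: "x:F" for x proof -
  have o: "open {y. 0 < S y}" by (intro open_Collect_less continuous_intros Sc)
  have "continuous_on {y. 0 < S y} (U x)" unfolding U_def
   by (intro continuous_intros cont_subset[OF u] cont_subset[OF Sc] cont_subset[OF B(1)[OF FV[OF x]]]) auto
  moreover have "continuous_on (- D) (U x)" by (rule continuous_on_eq[OF continuous_on_const[of _ 0]]) (simp add: U_def D(3))
  ultimately have "continuous_on ({y. 0 < S y} Un - D) (U x)" using o compact_imp_closed[OF D(1)] by (intro continuous_on_open_Un) (auto simp: open_Compl)
  moreover have "{y. 0 < S y} Un - D = UNIV" using Spos by auto
  ultimately show ?thesis by simp
 qed
 have "EX c. esum n om V (%y. U x y - c * B x y)" if x: "x:F" for x proof (rule E[OF FV[OF x] Uc[OF x]])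
  fix y assume "y~:ka x ` icube n"
  hence "B x y = 0" using B(4,5)[OF FV[OF x], of y] by force
  thus "U x y = 0" by (simp add: U_def)
 qed
 then obtain c where c: "ALL x:F. esum n om V (%y. U x y - c x * B x y)" by metis
 have "ALL x:F. EX d. esum n om V (%y. B x y - d * B x0 y)" using R[OF FV DV[OF x0]] unfolding R_def by blast
 then obtain d where d: "ALL x:F. esum n om V (%y. B x y - d x * B x0 y)" by metis
 let ?c = "SUM x:F. c x * d x"
 have "esum n om V (%y. SUM x:F. (U x y - c x * B x y) + c x * (B x y - d x * B x0 y))"
  by (intro esum_sum F(2) esum_add esum_scale c[rule_format] d[rule_format])
 moreover have "(SUM x:F. (U x y - c x * B x y) + c x * (B x y - d x * B x0 y)) = u y - ?c * B x0 y" for y proof -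
  have "(SUM x:F. U x y) = u y" proof (cases "y:D")
   case True
   have "(SUM x:F. U x y) = u y * S y / S y" unfolding U_def S_def by (simp add: sum_distrib_left sum_divide_distrib)
   thus ?thesis using Spos[OF True] by simp
  qed (simp add: U_def D(3))
  moreover have "(SUM x:F. (U x y - c x * B x y) + c x * (B x y - d x * B x0 y)) = (SUM x:F. U x y - (c x * d x) * B x0 y)"
   by (intro sum.cong) (simp_all add: algebra_simps)
  ultimately show ?thesis by (simp add: sum_subtractf sum_distrib_right)
 qed
 ultimately have e: "esum n om V (%y. u y - ?c * B x0 y)" by simp
 have "integrable om u" by (rule compactly_supported_integrable[OF om(1) u D(1)]) (simp add: D(3))
 hence "?c * integral\<^sup>L om (B x0) = 0" using ez[OF e _ DV[OF x0]] z by simp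
 hence "?c = 0" using B(3)[OF DV[OF x0]] by simp
 with e show ?thesis by simp
qed

subsection \<open>Components at infinity\<close>

definition bounded_set :: "'a::topological_space set => bool"
 where "bounded_set A \<longleftrightarrow> (EX K. compact K & A <= K)"

lemma manifold_locally_compact:
 fixes p :: "'a::metric_space"
 assumes M: "manifold_with_boundary n (euclidean :: 'a topology)"
 shows "EX N K. open N & p:N & N <= K & compact K"
proof -
 let ?E = "{x :: nat => real. (ALL i>=n. x i = 0) & 0 <= x 0}"
 obtain U V f g where UV: "open U" "p:U" "openin (top_of_set ?E) V" and
  fg: "continuous_on U f" "continuous_on V g" "f ` U = V" "g ` V = U"
  "ALL x:U. g (f x) = x" "ALL y:V. f (g y) = y" using manifold_chart[OF M, of p] by (elim exE conjE)
 obtain T1 where T1: "open T1" "V = ?E Int T1" using UV(3) unfolding openin_open by auto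
 have fp: "f p:V" using fg(3) UV(2) by (metis imageI)
 hence "f p:T1" unfolding T1(2) by simp
 then obtain rh where rh: "0 < rh" "!!y. (!!i. abs (y i - f p i) <= rh) ==> y:T1"
  using box_in_open[OF T1(1)] by blast
 define C where "C = PiE UNIV (%i. {f p i - rh .. f p i + rh})"
 have C: "y:C \<longleftrightarrow> (ALL i. abs (y i - f p i) <= rh)" for y unfolding C_def PiE_UNIV_domain Pi_def by (simp add: abs_le_iff) (smt (verit))
 have "compactin (product_topology (%i. euclidean) UNIV) C" unfolding C_def compactin_PiE by (rule disjI2) simp
 hence cC: "compact C" unfolding euclidean_product_topology by simp
 have "?E = (INT i:{n..}. {x. x i = 0}) Int {x. x 0 >= 0}" by (rule set_eqI) (simp only: INT_iff Int_iff mem_Collect_eq Ball_def atLeast_iff)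
 hence clE: "closed ?E" by (simp add: closed_INT closed_Int closed_coord_eq closed_coord_ge)
 have CV: "C Int ?E <= V" unfolding T1(2) using rh(2) C by (intro subsetI IntI) simp_all
 let ?T = "INT i<n. {y :: nat => real. f p i - rh < y i} Int {y. y i < f p i + rh}"
 have oT: "open ?T" by (intro open_INT open_Int open_Collect_less continuous_intros ballI finite_lessThan)
 show ?thesis proof (intro exI conjI)
  show "open (g ` (?T Int V))" by (rule homeomorphic_open[OF UV(1) fg(1,3) fg(5,6)[rule_format] fg(4) oT])
  show "compact (g ` (C Int ?E))" by (intro compact_continuous_image cont_subset[OF fg(2) CV] compact_Int_closed cC clE)
  have "f p:?T Int V" using fp rh(1) by simp
  hence "g (f p):g ` (?T Int V)" by (rule imageI)
  thus "p:g ` (?T Int V)" unfolding fg(5)[rule_format, OF UV(2)] .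
  show "g ` (?T Int V) <= g ` (C Int ?E)" proof (rule image_mono, rule subsetI)
   fix y assume y: "y:?T Int V"
   have "abs (y i - f p i) <= rh" for i proof (cases "i < n")
    case True
    hence "f p i - rh < y i & y i < f p i + rh" using y by simp
    thus ?thesis by (simp add: abs_le_iff)
   next
    case False
    thus ?thesis using y fp rh(1) unfolding T1(2) by simp
   qed
   thus "y:C Int ?E" using y C unfolding T1(2) by simp
  qed
 qed
qed

locale manifold_measure =
 fixes n :: nat and om :: "'a::metric_space measure"
 assumes M: "manifold_with_boundary n (euclidean :: 'a topology)"
  and conn: "connected (UNIV :: 'a set)"
  and ncomp: "~ compact (UNIV :: 'a set)"
  and radon: "radon_measure om" and good: "good_measure om"
  and bdry: "emeasure om (manifold_boundary n euclidean) = 0"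
begin

abbreviation I :: "'a set" where "I \<equiv> manifold_interior n euclidean"

lemma sets_eq [simp, measurable_cong]: "sets om = sets borel" by (rule radon_sets[OF radon])
lemma space_eq [simp]: "space om = UNIV" using sets_eq_imp_space_eq[OF sets_eq] by simp

lemma openI_interior: "open I" by (rule open_manifold_interior)

lemma compact_nbhd: "EX K'. compact K' & K <= interior K'" if K: "compact K" for K :: "'a set"
proof -
 have "EX N. open N & p:N & bounded_set N" for p :: 'a proof -
  obtain N K where "open N" "p:N" "N <= K" "compact K" using manifold_locally_compact[OF M, of p] by (elim exE conjE)
  thus ?thesis unfolding bounded_set_def by (intro exI[of _ N]) (simp, intro exI[of _ K], simp)
 qed
 then obtain N :: "'a => 'a set" where N: "!!p. open (N p)" "!!p. p:N p" "!!p. bounded_set (N p)" by metis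
 obtain F where F: "F <= K" "finite F" "K <= (UN p:F. N p)" using compactE_image[OF K, of K N] N(1,2) by blast
 obtain L :: "'a => 'a set" where L: "!!p. compact (L p)" "!!p. N p <= L p" using N(3) unfolding bounded_set_def by metis
 have "K <= interior (UN p:F. L p)" by (rule order_trans[OF F(3)], rule interior_maximal) (use L(2) N(1) in auto)
 thus ?thesis using L(1) F(2) by (intro exI[of _ "UN p:F. L p"]) (simp add: compact_UN)
qed

text \<open>The compact ones among the closed balls with rational radius and centre in a countable
  dense set are countably many, and by local compactness their interiors cover.\<close>

lemma compact_exhaustion: "EX L :: nat => 'a set. (ALL k. compact (L k)) & (\<Union>k. interior (L k)) = UNIV"
proof -
 obtain Q :: "'a set" where Q: "countable Q" "closure Q = UNIV" using M unfolding manifold_with_boundary_def separable_space_def by auto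
 define P where "P = {(q, r). q:Q & r:\<rat> & compact (cball q r)}"
 have "P <= Q \<times> \<rat>" unfolding P_def by auto
 hence P: "countable P" using Q(1) countable_rat by (meson countable_SIGMA countable_subset)
 have cover: "EX (q, r):P. x:ball q r" for x proof -
  obtain N K where N: "open N" "x:N" "N <= K" "compact K" using manifold_locally_compact[OF M, of x] by blast
  obtain e where e: "e > 0" "cball x e <= N" using N(1,2) open_contains_cball by blast
  obtain q where q: "q:Q" "dist q x < e / 4" using Q(2) e(1) closure_approachable[of x Q] by (metis UNIV_I divide_pos_pos zero_less_numeral)
  obtain r where r: "r:\<rat>" "e / 4 < r" "r < e / 2" using Rats_dense_in_real[of "e/4" "e/2"] e(1) by auto
  have "cball q r <= cball x e" proof
   fix y assume "y:cball q r"
   thus "y:cball x e" using q(2) r(3) e(1) dist_triangle[of x y q] by (simp add: dist_commute)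
  qed
  hence "cball q r = K Int cball q r" using e(2) N(3) by blast
  hence "compact (cball q r)" using compact_Int_closed[OF N(4) closed_cball[of q r]] by simp
  thus ?thesis unfolding P_def using q r by (intro bexI[of _ "(q, r)"]) auto
 qed
 have "P ~= {}" using cover by blast
 then obtain f :: "nat => 'a \<times> real" where f: "range f = P" using P by (metis uncountable_def)
 define L where "L k = cball (fst (f k)) (snd (f k))" for k
 have "compact (L k)" for k using f unfolding L_def P_def by (metis (mono_tags, lifting) case_prodE fst_conv mem_Collect_eq rangeI snd_conv)
 moreover have "(\<Union>k. interior (L k)) = UNIV" proof -
  have "x:(\<Union>k. interior (L k))" for x proof -
   obtain z where z: "z:P" "x:ball (fst z) (snd z)" using cover[of x] by auto
   then obtain k where "f k = z" using f by blast
   thus ?thesis using z(2) interior_maximal[OF ball_subset_cball open_ball] unfolding L_def by blast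
  qed
  thus ?thesis by blast
 qed
 ultimately show ?thesis by blast
qed

lemma open_components: "open W ==> U:components W ==> open (U :: 'a set)"
proof (subst open_subopen, intro ballI)
 fix x assume W: "open W" and U: "U:components W" and x: "x:U"
 then obtain N where N: "open N" "x:N" "N <= W" "connected N"
  using interior_locally_connected[OF M dimension_pos[OF M good] W, of x] in_components_subset by blast
 have "N <= U" by (rule components_maximal[OF U N(4,3)]) (use x N(2) in blast)
 thus "EX T. open T & x:T & T <= U" using N by blast
qed

lemma components_facts:
 fixes K :: "'a set"
 assumes "compact K" "U:components (- K)"
 shows "open U" "connected U" "U ~= {}" "U Int K = {}"
proof -
 show "open U" by (rule open_components[OF open_Compl[OF compact_imp_closed[OF assms(1)]] assms(2)])
 show "connected U" "U ~= {}" using assms(2) by (rule in_components_connected, rule in_components_nonempty)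
 show "U Int K = {}" using in_components_subset[OF assms(2)] by blast
qed

text \<open>A component that leaves \<open>K'\<close> meets its frontier, for otherwise it would be
  open and closed. The frontier is compact and covered by disjoint open components, so finitely many
  of them meet it.\<close>

lemma unbounded_components_finite:
 fixes K :: "'a set"
 assumes K: "compact K" and K': "compact K'" "K <= interior K'"
 shows "finite {U:components (- K). ~ U <= K'}"
proof (cases "K = {}")
 case True
 thus ?thesis using components_eq_sing_iff[of "UNIV :: 'a set"] conn by simp
next
 case False
 let ?S = "{U:components (- K). ~ U <= K'}"
 have meet: "U Int frontier K' ~= {}" if U: "U:?S" for U proof
  assume e: "U Int frontier K' = {}"
  have c: "connected U" "U ~= {}" "open U" "U Int K = {}" using components_facts[OF K] U by auto
  have "U Int K' = {}" using connected_Int_frontier[OF c(1), of K'] e U by blast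
  hence "interior K' Int U = {}" using interior_subset by blast
  hence "closure U Int interior K' = {}" using open_Int_closure_eq_empty[OF open_interior, of K' U] by blast
  hence "closure U <= - K" using K'(2) by blast
  hence "closure U <= U" using components_maximal[of U "- K" "closure U"] U c(1,2) connected_imp_connected_closure closure_subset by blast
  hence "closed U" using closure_subset[of U] closed_closure[of U] by (simp add: subset_antisym)
  hence "U = UNIV" using c(2,3) conn connected_clopen[of UNIV] by auto
  thus False using c(4) False by blast
 qed
 have "K' Int frontier K' = frontier K'" using closure_closed[OF compact_imp_closed[OF K'(1)]] unfolding frontier_def by blast
 hence cf: "compact (frontier K')" using compact_Int_closed[OF K'(1), of "frontier K'"] by simp
 have "frontier K' <= - K" using K'(2) by (auto simp: frontier_def)
 hence "frontier K' <= \<Union>(components (- K))" by (simp add: Union_components[symmetric])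
 then obtain F where F: "F <= components (- K)" "finite F" "frontier K' <= \<Union>F"
  using compactE[OF cf, of "components (- K)"] components_facts(1)[OF K] by metis
 have "?S <= F" proof
  fix U assume U: "U:?S"
  then obtain x V where "x:U" "V:F" "x:V" using meet[OF U] F(3) by blast
  thus "U:F" using components_eq[of U "- K" V] U F(1) by blast
 qed
 thus ?thesis using F(2) finite_subset by blast
qed

definition icomps :: "'a set => 'a set set"
 where "icomps K = {U:components (- K). emeasure om U = \<infinity>}"

lemma finite_compact: "compact K ==> emeasure om K < \<infinity>" by (rule radon_compact[OF radon])

lemma borel_compact: "compact (K :: 'a set) ==> K:sets borel" by (rule borel_closed[OF compact_imp_closed])

lemma emeasure_le_compact: "compact K ==> A <= K ==> emeasure om A < \<infinity>"
 using emeasure_mono[of A K om] finite_compact[of K] borel_compact[of K] by (simp add: le_less_trans)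

lemma finite_inf_comps:
 assumes K: "compact K" shows "finite (icomps K)"
proof -
 obtain K' where K': "compact K'" "K <= interior K'" using compact_nbhd[OF K] by blast
 have "icomps K <= {U:components (- K). ~ U <= K'}" proof
  fix U assume "U:icomps K"
  thus "U:{U:components (- K). ~ U <= K'}" using emeasure_le_compact[OF K'(1), of U] unfolding icomps_def by (cases "U <= K'") simp_all
 qed
 thus ?thesis using unbounded_components_finite[OF K K'] finite_subset by blast
qed

text \<open>Up to a set of finite measure, a union of components of \<open>- K\<close> consists of those of infinite measure.\<close>

lemma finite_measure_rest:
 assumes K: "compact K" and A: "A <= components (- K)" "A Int icomps K = {}"
 shows "emeasure om (\<Union>A) < \<infinity>" "open (\<Union>A)"
proof -
 obtain K' where K': "compact K'" "K <= interior K'" using compact_nbhd[OF K] by blast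
 let ?F = "{U:A. ~ U <= K'}"
 have F: "finite ?F" by (rule finite_subset[OF _ unbounded_components_finite[OF K K']]) (use A(1) in blast)
 show o: "open (\<Union>A)" using components_facts(1)[OF K] A(1) by blast
 have Fb: "?F <= sets borel" using components_facts(1)[OF K] A(1) by (auto simp: borel_open)
 have "\<Union>A <= K' Un \<Union>?F" by blast
 hence "emeasure om (\<Union>A) <= emeasure om (K' Un \<Union>?F)" using F Fb borel_compact[OF K'(1)] by (intro emeasure_mono) auto
 also have "... <= emeasure om K' + emeasure om (\<Union>?F)" using F Fb borel_compact[OF K'(1)] by (intro emeasure_subadditive) auto
 also have "emeasure om (\<Union>?F) <= (SUM U:?F. emeasure om U)" using emeasure_subadditive_finite[OF F, of "%U. U" om] Fb by simp
 finally have le: "emeasure om (\<Union>A) <= emeasure om K' + (SUM U:?F. emeasure om U)" by (simp add: add_left_mono)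
 have fin: "emeasure om U < top" if "U:?F" for U proof -
  have "U:components (- K)" "U~:icomps K" using that A by blast+
  thus ?thesis unfolding icomps_def by (simp add: less_top)
 qed
 hence "(SUM U:?F. emeasure om U) < top" using ennreal_sum_less_top[OF F, of "emeasure om"] by blast
 thus "emeasure om (\<Union>A) < \<infinity>" using le finite_compact[OF K'(1)] by (simp add: le_less_trans)
qed

text \<open>Otherwise \<open>U\<close> would lie in \<open>K'\<close> together with components of
  finite measure, whose union has finite measure by \<open>finite_measure_rest\<close>.\<close>

lemma inf_child:
 assumes K: "compact K" "compact K'" "K <= K'" and U: "U:icomps K"
 shows "EX V:icomps K'. V <= U"
proof (rule ccontr)
 assume n: "~ ?thesis"
 let ?A = "{V:components (- K'). V <= U}"
 have Uc: "U:components (- K)" and Ui: "emeasure om U = \<infinity>" using U unfolding icomps_def by auto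
 have "U <= K' Un \<Union>?A" proof
  fix x assume x: "x:U"
  show "x:K' Un \<Union>?A" proof (cases "x:K'")
   case False
   let ?V = "connected_component_set (- K') x"
   have V: "?V:components (- K')" using False by (intro componentsI) simp
   have xV: "x:?V" using False by (simp add: connected_component_refl)
   have "?V <= - K" using connected_component_subset[of "- K'" x] K(3) by blast
   hence "?V <= U" using x xV by (intro components_maximal[OF Uc connected_connected_component]) blast+
   thus ?thesis using V xV by blast
  qed simp
 qed
 moreover have A: "?A <= components (- K')" "?A Int icomps K' = {}" using n by blast+
 note fm = finite_measure_rest[OF K(2) A]
 have bA: "\<Union>?A:sets om" "K':sets om" using fm(2) borel_compact[OF K(2)] by (simp_all add: borel_open)
 ultimately have "emeasure om U <= emeasure om (K' Un \<Union>?A)" by (intro emeasure_mono sets.Un)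
 also have "... <= emeasure om K' + emeasure om (\<Union>?A)" using bA by (intro emeasure_subadditive)
 also have "... < \<infinity>" using fm(1) finite_compact[OF K(2)] by simp
 finally show False using Ui by simp
qed

text \<open>Infinite measure leaves room for a function with values in the unit interval and large
  integral; dividing by the integral gives total mass 1 with values at most 1/4. Such heights stay
  below the bound 1/2 of \<open>block_family\<close>.\<close>

lemma bump_exists:
 assumes V: "open V" "V <= I" "emeasure om V = \<infinity>"
 shows "EX b D. cont b & compact D & D <= V & (ALL x. x~:D --> b x = 0) & (ALL x. 0 <= b x & b x <= 1/4) & integral\<^sup>L om b = (1::real)"
proof -
 obtain L :: "nat => 'a set" where L: "!!k. compact (L k)" "(\<Union>k. interior (L k)) = UNIV" using compact_exhaustion by blast
 \<comment> \<open>Compact sets that exhaust \<open>V\<close>: points in the first members of the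
   exhaustion that keep distance \<open>inverse (Suc k)\<close> from the complement of
   \<open>V\<close>.\<close>
 define A where "A k = (UN j<=k. L j) Int (INT y:-V. {x. inverse (Suc k) <= dist x y})" for k
 have cA: "compact (A k)" for k unfolding A_def by (intro compact_Int_closed compact_UN closed_INT ballI closed_Collect_le continuous_intros L(1)) simp
 have AV: "A k <= V" for k proof
  fix x assume x: "x:A k"
  show "x:V" proof (rule ccontr)
   assume "x~:V"
   hence "inverse (Suc k) <= dist x x" using x unfolding A_def by blast
   thus False by simp
  qed
 qed
 have inc: "incseq A" proof (rule monoI)
  fix j k :: nat assume jk: "j <= k"
  hence le: "inverse (real (Suc k)) <= inverse (real (Suc j))" by (intro le_imp_inverse_le) auto
  have "x:A k" if x: "x:A j" for x proof -
   have "x:(UN j<=k. L j)" using x jk unfolding A_def by force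
   moreover have "inverse (Suc k) <= dist x y" if "y:- V" for y by (rule order_trans[OF le]) (use x that in "simp add: A_def")
   ultimately show ?thesis unfolding A_def by blast
  qed
  thus "A j <= A k" by blast
 qed
 have UA: "(\<Union>k. A k) = V" proof (intro equalityI subsetI)
  fix x assume "x:(\<Union>k. A k)" thus "x:V" using AV by blast
 next
  fix x assume x: "x:V"
  obtain e where e: "e > 0" "ball x e <= V" using V(1) x open_contains_ball by metis
  obtain j where j: "x:L j" using L(2) interior_subset by blast
  obtain i where i: "inverse (real (Suc i)) < e" using reals_Archimedean e(1) by blast
  have le2: "inverse (real (Suc (i + j))) <= inverse (real (Suc i))" by (intro le_imp_inverse_le) auto
  have d: "e <= dist x y" if "y~:V" for y using e(2) that by (meson mem_ball not_less subsetD)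
  have "inverse (Suc (i + j)) <= dist x y" if "y:- V" for y by (rule order_trans[OF less_imp_le[OF le_less_trans[OF le2 i]]]) (use d that in simp)
  moreover have "x:(UN l<=i + j. L l)" using j by (intro UN_I[of j]) simp_all
  ultimately have "x:A (i + j)" unfolding A_def by blast
  thus "x:(\<Union>k. A k)" by blast
 qed
 have eq: "(SUP k. emeasure om (A k)) = emeasure om V" using SUP_emeasure_incseq[of A om] inc borel_compact[OF cA] unfolding UA by (simp add: image_subset_iff)
 \<comment> \<open>Any bound of at least 4 would give the height 1/4 after normalization.\<close>
 have "8 < (SUP k. emeasure om (A k))" unfolding eq V(3) by simp
 then obtain k where k: "8 < emeasure om (A k)" unfolding less_SUP_iff by blast
 have mC: "8 < measure om (A k)" proof -
  have "emeasure om (A k) = ennreal (measure om (A k))" using finite_compact[OF cA[of k]] by (intro emeasure_eq_ennreal_measure) simp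
  thus ?thesis using k by (metis ennreal_less_iff ennreal_numeral zero_le_numeral)
 qed
 have "ALL x:V. EX ka. (EX m. ou_chart n om ka m) & ka ` cube n <= V & x:ka ` icube n" using interior_chart[OF radon good subsetD[OF V(2)] V(1)] by meson
 then obtain ka where "ALL x:V. (EX m. ou_chart n om (ka x) m) & ka x ` cube n <= V & x:ka x ` icube n"
  by (rule bchoice[THEN exE])
 hence ka: "EX m. ou_chart n om (ka x) m" "ka x ` cube n <= V" "x:ka x ` icube n" if "x:V" for x using that by simp_all
 have o: "open (ka x ` icube n)" if "x:V" for x using ka(1)[OF that] unfolding ou_chart_def by blast
 have "A k <= (UN x:A k. ka x ` icube n)" using ka(3)[OF subsetD[OF AV]] by (intro subsetI UN_I)
 then obtain F where F: "F <= A k" "finite F" "A k <= (UN x:F. ka x ` icube n)"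
  using compactE_image[OF cA[of k], of "A k" "%x. ka x ` icube n"] o[OF subsetD[OF AV]] by metis
 have FV: "x:V" if "x:F" for x using subsetD[OF AV subsetD[OF F(1) that]] .
 define S where "S y = (SUM x:F. cbump n (ka x) y)" for y
 have ch: "cont (cbump n (ka x))" "0 <= cbump n (ka x) y" "y:ka x ` icube n ==> 0 < cbump n (ka x) y"
  "y~:ka x ` cube n ==> cbump n (ka x) y = 0" "compact (ka x ` cube n)" if x: "x:F" for x y
 proof -
  obtain m where o: "ou_chart n om (ka x) m" using ka(1)[OF FV[OF x]] by blast
  show "cont (cbump n (ka x))" "0 <= cbump n (ka x) y" "compact (ka x ` cube n)"
   using cbump_continuous[OF o sets_eq] cbump_nonneg[OF o sets_eq] chart_compact[OF o sets_eq] by simp_all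
  show "y:ka x ` icube n ==> 0 < cbump n (ka x) y" by (rule cbump_pos[OF o sets_eq])
  show "y~:ka x ` cube n ==> cbump n (ka x) y = 0" using cbump_zero[OF o sets_eq, of y] chart_sub[OF o sets_eq] by (metis subsetD)
 qed
 have Sc: "cont S" unfolding S_def using ch(1) by (intro continuous_on_sum)
 have Spos: "0 < S y" if y: "y:A k" for y proof -
  obtain x where x: "x:F" "y:ka x ` icube n" using subsetD[OF F(3) y] by (rule UN_E)
  thus ?thesis unfolding S_def using ch(2,3) F(2) by (intro sum_pos2[of F x]) auto
 qed
 have "A k ~= {}" using k by auto
 then obtain y0 where y0: "y0:A k" "ALL y:A k. S y0 <= S y"
  using continuous_attains_inf[OF cA _ cont_subset[OF Sc subset_UNIV]] by blast
 define b where "b y = min 1 (S y / S y0)" for y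
 define D where "D = (UN x:F. ka x ` cube n)"
 have Snn: "0 <= S y" for y unfolding S_def using ch(2) by (intro sum_nonneg)
 have D: "compact D" "D <= V" unfolding D_def using F(2) ch(5) ka(2)[OF FV] by (auto intro: compact_UN)
 have bD: "b y = 0" if "y~:D" for y proof -
  have "S y = 0" unfolding S_def using that ch(4) unfolding D_def by (intro sum.neutral) blast
  thus ?thesis by (simp add: b_def)
 qed
 have bc: "cont b" unfolding b_def using Spos[OF y0(1)] by (intro continuous_intros Sc) simp
 have bb: "0 <= b y" "b y <= 1" for y unfolding b_def using Snn[of y] Spos[OF y0(1)] by simp_all
 have bi: "integrable om b" by (rule compactly_supported_integrable[OF radon bc D(1)]) (simp add: bD)
 have "integral\<^sup>L om (ind (A k)) <= integral\<^sup>L om b" proof (rule integral_mono[OF _ bi])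
  show "integrable om (ind (A k))" using finite_compact[OF cA[of k]] borel_compact[OF cA[of k]] by simp
  show "ind (A k) y <= b y" for y using bb(1)[of y] y0(2) Spos[OF y0(1)] unfolding b_def by (cases "y:A k") auto
 qed
 hence i8: "8 < integral\<^sup>L om b" using mC by simp
 show ?thesis proof (rule exI[of _ "%y. b y / integral\<^sup>L om b"], rule exI[of _ D], intro conjI allI impI D)
  show "cont (%y. b y / integral\<^sup>L om b)" using i8 by (intro continuous_intros bc) simp
  show "b x / integral\<^sup>L om b = 0" if "x~:D" for x using bD[OF that] by simp
  show "0 <= b x / integral\<^sup>L om b" for x using bb(1)[of x] i8 by simp
  show "b x / integral\<^sup>L om b <= 1/4" for x using bb(2)[of x] i8 by (simp add: divide_le_eq)
  show "integral\<^sup>L om (%y. b y / integral\<^sup>L om b) = 1" using i8 by simp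
 qed
qed

end

section \<open>Blocks: density changes on a component and its children\<close>

context manifold_measure
begin

lemma inf_interior:
 assumes "open U" "emeasure om U = \<infinity>" shows "emeasure om (U Int I) = \<infinity>"
proof -
 have b: "manifold_boundary n euclidean:sets om" unfolding manifold_boundary_def using openI_interior by (simp add: borel_open)
 have "emeasure om U <= emeasure om ((U Int I) Un manifold_boundary n euclidean)"
  using assms(1) openI_interior b by (intro emeasure_mono) (auto simp: manifold_boundary_def borel_open)
 also have "... <= emeasure om (U Int I) + 0"
  unfolding bdry[symmetric] using assms(1) openI_interior b by (intro emeasure_subadditive) (simp_all add: borel_open open_Int)
 finally show ?thesis using assms(2) by (simp add: top_unique)
qed

definition is_bump :: "'a set => ('a => real) \<times> 'a set => bool"
 where "is_bump U = (%(b, D). cont b & compact D & D <= U Int I & (ALL x. x~:D --> b x = 0) &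
  (ALL x. 0 <= b x & b x <= 1/4) & integral\<^sup>L om b = 1)"

definition bump :: "'a set => 'a => real" where "bump U = fst (SOME p. is_bump U p)"
definition bsupp :: "'a set => 'a set" where "bsupp U = snd (SOME p. is_bump U p)"

lemma bump:
 assumes "open U" "emeasure om U = \<infinity>"
 shows "cont (bump U)" "compact (bsupp U)" "bsupp U <= U Int I" "x~:bsupp U ==> bump U x = 0"
  "0 <= bump U x" "bump U x <= 1/4" "integral\<^sup>L om (bump U) = 1"
proof -
 have "EX p. is_bump U p" using bump_exists[of "U Int I"] inf_interior[OF assms] assms(1) openI_interior unfolding is_bump_def by (simp add: open_Int)
 hence "is_bump U (bump U, bsupp U)" unfolding bump_def bsupp_def prod.collapse by (rule someI_ex)
 thus "cont (bump U)" "compact (bsupp U)" "bsupp U <= U Int I" "x~:bsupp U ==> bump U x = 0"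
  "0 <= bump U x" "bump U x <= 1/4" "integral\<^sup>L om (bump U) = 1" unfolding is_bump_def by simp_all
qed

definition block :: "'a set set => ('a set => real) => 'a set => (real => 'a => 'a) => bool"
 where "block N ep D g \<longleftrightarrow> hfamily g & sfamily D g & (ALL x. g 0 x = x) &
  (ALL a. pushes om (g a) (%x. 1) (%x. 1 + clip a * (SUM V:N. ep V * bump V x)))"

lemma block_exists:
 assumes U: "open U" "connected U" and N: "finite N" "!!V. V:N ==> open V" "!!V. V:N ==> V <= U"
   "!!V. V:N ==> emeasure om V = \<infinity>" "disjoint_family_on bsupp N"
  and ep: "!!V. V:N ==> abs (ep V) <= 1" "(SUM V:N. ep V) = 0"
 shows "EX D g. compact D & D <= U Int I & block N ep D g"
proof -
 note b = bump[OF N(2,4)]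
 define u where "u x = (SUM V:N. ep V * bump V x)" for x
 have uc: "cont u" unfolding u_def by (intro continuous_intros b(1))
 let ?D = "UN V:N. bsupp V"
 have cD: "compact ?D" using N(1) b(2) by (intro compact_UN)
 have DU: "?D <= U Int I" using b(3) N(3) by blast
 have u0: "u x = 0" if "x~:?D" for x unfolding u_def using that b(4) by (intro sum.neutral) auto
 have ub: "abs (u x) <= 1/2" for x proof (cases "x:?D")
  case True
  then obtain V where V: "V:N" "x:bsupp V" by blast
  have "x~:bsupp W" if "W:N - {V}" for W using N(5) V that unfolding disjoint_family_on_def by blast
  hence "(SUM W:N - {V}. ep W * bump W x) = 0" using b(4) by (intro sum.neutral) auto
  hence "u x = ep V * bump V x" unfolding u_def using sum.remove[OF N(1) V(1), of "%V. ep V * bump V x"] by simp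
  moreover have "abs (ep V * bump V x) <= 1 * (1/4)" unfolding abs_mult using ep(1)[OF V(1)] b(5,6)[OF V(1) V(1), of x] by (intro mult_mono) auto
  ultimately show ?thesis by simp
 qed (simp add: u0)
 have bi: "integrable om (bump V)" if "V:N" for V
  by (rule compactly_supported_integrable[OF radon b(1)[OF that that] b(2)[OF that that]]) (simp add: b(4)[OF that that])
 have "integral\<^sup>L om u = (SUM V:N. ep V * integral\<^sup>L om (bump V))" unfolding u_def using bi by (subst Bochner_Integration.integral_sum) simp_all
 also have "... = (SUM V:N. ep V)" using b(7) by (intro sum.cong) simp_all
 finally have "integral\<^sup>L om u = 0" using ep(2) by simp
 hence "esum n om (U Int I) u"
  by (intro esum_connected[OF radon good _ _ _ uc cD DU u0] interior_connected[OF M radon good bdry U] open_Int U openI_interior) auto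
 from block_family[OF sets_eq this ub] show ?thesis unfolding block_def u_def by blast
qed

text \<open>The same \<open>D\<close> is required for every pattern of coefficients -1, 0, 1 with
  sum zero. The supports have to be known when the next compact set is chosen, long before the
  coefficients are.\<close>

definition blocks :: "'a set set => 'a set => bool"
 where "blocks N D \<longleftrightarrow> (UN V:N. bsupp V) <= D &
  (ALL ep. (ALL V:N. ep V:{-1, 0, 1}) & (SUM V:N. ep V) = 0 --> (EX g. block N ep D g))"

text \<open>There are finitely many patterns, so the supports of one family for each can be united.
  The supports of the bumps are added, also for bumps with coefficient zero.\<close>

lemma blocks_exist:
 assumes U: "open U" "connected U" and N: "finite N" "!!V. V:N ==> open V" "!!V. V:N ==> V <= U"
   "!!V. V:N ==> emeasure om V = \<infinity>" "disjoint_family_on bsupp N"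
 shows "EX D. compact D & D <= U Int I & blocks N D"
proof -
 define P where "P = {ep:PiE N (%_. {-1, 0, 1::real}). (SUM V:N. ep V) = 0}"
 have "finite P" unfolding P_def using N(1) by (intro finite_subset[OF _ finite_PiE[OF N(1), of "%_. {-1, 0, 1::real}"]]) auto
 have "ALL ep:P. EX D. compact D & D <= U Int I & (EX g. block N ep D g)" proof
  fix ep assume e: "ep:P"
  hence "ep V:{-1, 0, 1}" if "V:N" for V using that unfolding P_def by (auto simp: PiE_iff)
  hence "abs (ep V) <= 1" if "V:N" for V using that by force
  thus "EX D. compact D & D <= U Int I & (EX g. block N ep D g)" using block_exists[OF U N, of ep] e unfolding P_def by blast
 qed
 then obtain D where D: "!!ep. ep:P ==> compact (D ep)" "!!ep. ep:P ==> D ep <= U Int I" "!!ep. ep:P ==> EX g. block N ep (D ep) g"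
  by metis
 let ?D = "(UN ep:P. D ep) Un (UN V:N. bsupp V)"
 have "compact ?D" using \<open>finite P\<close> D(1) N bump(2) by (intro compact_Un compact_UN) auto
 moreover have "?D <= U Int I" using D(2) bump(3) N by blast
 moreover have "EX g. block N ep ?D g" if ep: "ALL V:N. ep V:{-1, 0, 1}" "(SUM V:N. ep V) = 0" for ep proof -
  have r: "restrict ep N:P" unfolding P_def using ep by auto
  then obtain g where g: "block N (restrict ep N) (D (restrict ep N)) g" using D(3) by blast
  have "(SUM V:N. restrict ep N V * bump V x) = (SUM V:N. ep V * bump V x)" for x by (intro sum.cong) auto
  moreover have "sfamily ?D g" using g r unfolding block_def sfamily_def by blast
  ultimately have "block N ep ?D g" using g unfolding block_def by simp
  thus ?thesis by blast
 qed
 ultimately show ?thesis unfolding blocks_def by (intro exI[of _ ?D]) simp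
qed

definition nbhd_comps :: "'a set => 'a set => 'a set set"
 where "nbhd_comps U K' = insert U {V:icomps K'. V <= U}"

lemma icompsD:
 assumes "compact K" "U:icomps K"
 shows "open U" "connected U" "U Int K = {}" "emeasure om U = \<infinity>" "U ~= {}" "U:components (- K)"
 using components_facts[OF assms(1), of U] assms(2) unfolding icomps_def by simp_all

lemma icomps_disjoint: "U:icomps K ==> V:icomps K ==> U ~= V ==> U Int V = {}" using components_eq[of U "- K" V] unfolding icomps_def by blast

text \<open>The bump of \<open>U\<close> is supported in \<open>K'\<close>, those of the smaller
  components outside \<open>K'\<close> and in disjoint sets; hence all supports are disjoint,
  although the components are nested.\<close>

lemma comp_blocks_exist:
 assumes K: "compact K" "compact K'" and U: "U:icomps K" "bsupp U <= K'"
 shows "EX D. compact D & D <= U Int I & blocks (nbhd_comps U K') D"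
proof (rule blocks_exist)
 note u = icompsD[OF K(1) U(1)]
 show "open U" "connected U" by (fact u)+
 show "finite (nbhd_comps U K')" unfolding nbhd_comps_def using finite_inf_comps[OF K(2)] by simp
 fix V assume V: "V:nbhd_comps U K'"
 thus "open V" "V <= U" "emeasure om V = \<infinity>" using u icompsD[OF K(2)] unfolding nbhd_comps_def by auto
next
 have s: "bsupp V <= V" if "V:icomps K'" for V using bump(3) icompsD[OF K(2) that] by blast
 show "disjoint_family_on bsupp (nbhd_comps U K')" unfolding disjoint_family_on_def proof (intro ballI impI)
  fix V W assume VW: "V:nbhd_comps U K'" "W:nbhd_comps U K'" "V ~= W"
  have 1: "bsupp U Int bsupp X = {}" if "X:icomps K'" for X using s[OF that] icompsD(3)[OF K(2) that] U(2) by blast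
  thus "bsupp V Int bsupp W = {}" proof (cases "V = U \<or> W = U")
   case True thus ?thesis using VW 1 unfolding nbhd_comps_def by blast
  next
   case False
   hence "V:icomps K'" "W:icomps K'" using VW unfolding nbhd_comps_def by blast+
   thus ?thesis using s[of V] s[of W] icomps_disjoint[of V K' W] VW(3) by blast
  qed
 qed
qed

text \<open>\<open>K (Suc i)\<close> must contain the bumps of level \<open>i\<close>, and
  \<open>K (Suc (Suc i))\<close> the blocks of level \<open>i\<close>, which depend on
  \<open>K (Suc i)\<close>. Starting from the empty set makes the whole manifold the only possible
  root.\<close>

lemma exhaustion:
 "EX K D. (ALL i. compact (K i)) & K (0::nat) = {} & (ALL i. K i <= interior (K (Suc i))) & (ALL L. compact L --> (EX i. L <= K i)) &
  (ALL i. ALL U:icomps (K i). bsupp U <= interior (K (Suc i)) & compact (D i U) & D i U <= U Int I Int interior (K (Suc (Suc i))) &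
   blocks (nbhd_comps U (K (Suc i))) (D i U))"
proof -
 obtain L :: "nat => 'a set" where L: "!!k. compact (L k)" "(\<Union>k. interior (L k)) = UNIV" using compact_exhaustion by blast
 \<comment> \<open>The state of the recursion is a pair of consecutive compact sets, because the
   blocks at one set refer to the next.\<close>
 define P where "P i s \<longleftrightarrow> compact (fst s) & compact (snd s) & fst s <= interior (snd s) & (i = 0 --> fst s = {}) &
  (ALL U:icomps (fst s). bsupp U <= interior (snd s))" for i :: nat and s :: "'a set \<times> 'a set"
 define Q where "Q i s t \<longleftrightarrow> fst t = snd s & L i <= snd t & (ALL U:icomps (fst s). EX D. compact D & D <= U Int I Int interior (snd t) &
  blocks (nbhd_comps U (snd s)) D)" for i and s t :: "'a set \<times> 'a set"
 have cb: "compact (UN U:icomps K. bsupp U)" if "compact K" for K using finite_inf_comps[OF that] bump(2) icompsD[OF that] by (intro compact_UN) auto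
 have "EX f. ALL i. P i (f i) & Q i (f i) (f (Suc i))" proof (rule dependent_nat_choice)
  obtain K' where "compact K'" "(UN U:icomps {}. bsupp U) <= interior K'" using compact_nbhd[OF cb[OF compact_empty]] by blast
  hence "P 0 ({}, K')" unfolding P_def by auto
  thus "EX s. P 0 s" by blast
 next
  fix s i assume s: "P i s"
  hence c: "compact (fst s)" "compact (snd s)" and sub: "!!U. U:icomps (fst s) ==> bsupp U <= snd s" using interior_subset[of "snd s"] unfolding P_def by blast+
  have "ALL U:icomps (fst s). EX D. compact D & D <= U Int I & blocks (nbhd_comps U (snd s)) D" using comp_blocks_exist[OF c _ sub] by blast
  then obtain D where D: "ALL U:icomps (fst s). compact (D U) & D U <= U Int I & blocks (nbhd_comps U (snd s)) (D U)"
   by (rule bchoice[THEN exE])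
  let ?X = "snd s Un L i Un (UN U:icomps (snd s). bsupp U) Un (UN U:icomps (fst s). D U)"
  have "compact ?X" using finite_inf_comps[OF c(1)] D by (intro compact_Un c L cb compact_UN) auto
  then obtain K' where K': "compact K'" "?X <= interior K'" using compact_nbhd by blast
  have "P (Suc i) (snd s, K')" unfolding P_def using K' c by auto
  moreover have "Q i s (snd s, K')" unfolding Q_def proof (intro conjI ballI)
   show "L i <= snd (snd s, K')" using K'(2) interior_subset[of K'] by auto
   fix U assume U: "U:icomps (fst s)"
   hence "D U <= interior K'" using K'(2) by blast
   thus "EX D. compact D & D <= U Int I Int interior (snd (snd s, K')) & blocks (nbhd_comps U (snd s)) D" using D U by (intro exI[of _ "D U"]) auto
  qed simp
  ultimately show "EX t. P (Suc i) t & Q i s t" by blast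
 qed
 then obtain f where f: "!!i. P i (f i)" "!!i. Q i (f i) (f (Suc i))" by blast
 define K where "K i = fst (f i)" for i
 have K': "snd (f i) = K (Suc i)" for i using f(2)[of i] unfolding Q_def K_def by simp
 have KP: "compact (K i)" "K i <= interior (K (Suc i))" "i = 0 ==> K i = {}"
  "U:icomps (K i) ==> bsupp U <= interior (K (Suc i))" for i U
  using f(1)[of i] unfolding P_def K'[symmetric] unfolding K_def by auto
 have LK: "L i <= K (Suc (Suc i))" for i using f(2)[of i] unfolding Q_def K' by simp
 have "ALL i U. U:icomps (K i) --> (EX D. compact D & D <= U Int I Int interior (K (Suc (Suc i))) & blocks (nbhd_comps U (K (Suc i))) D)"
  using f(2) unfolding Q_def K' K_def[symmetric] by blast
 then obtain D where D: "!!i U. U:icomps (K i) ==> compact (D i U) & D i U <= U Int I Int interior (K (Suc (Suc i))) & blocks (nbhd_comps U (K (Suc i))) (D i U)"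
  by metis
 have mono: "K i <= K j" if "i <= j" for i j using that proof (induction j rule: dec_induct)
  case (step j) thus ?case using KP(2)[of j] interior_subset[of "K (Suc j)"] by blast
 qed simp
 have "EX i. X <= K i" if X: "compact X" for X proof -
  have "X <= (UN k:UNIV. interior (L k))" using L(2) by simp
  then obtain F where F: "finite F" "X <= (UN k:F. interior (L k))" using compactE_image[OF X, of UNIV "%k. interior (L k)"] by (metis open_interior)
  have "L k <= K (Suc (Suc (Max F)))" if "k:F" for k using LK[of k] mono[of "Suc (Suc k)" "Suc (Suc (Max F))"] Max_ge[OF F(1) that] by auto
  thus ?thesis using F(2) interior_subset by (intro exI[of _ "Suc (Suc (Max F))"]) blast
 qed
 thus ?thesis using KP D by (intro exI[of _ K] exI[of _ D]) simp
qed

end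

subsection \<open>Flows on a tree\<close>

locale levelled_tree =
 fixes V :: "'v set" and lev :: "'v => nat" and par :: "'v => 'v"
 assumes par: "x:V ==> 0 < lev x ==> par x:V" "x:V ==> 0 < lev x ==> Suc (lev (par x)) = lev x"
  and finite_kids': "x:V ==> finite {y:V. 0 < lev y & par y = x}"
  and kids_ne: "x:V ==> {y:V. 0 < lev y & par y = x} ~= {}"
begin

definition kids :: "'v => 'v set" where "kids x = {y:V. 0 < lev y & par y = x}"

definition fst_kid :: "'v => 'v" where "fst_kid x = (SOME y. y:kids x)"

text \<open>With a single child the second child is the first one; then an owned ray runs on through
  it and no new owned ray starts there.\<close>

definition snd_kid :: "'v => 'v"
 where "snd_kid x = (if EX y:kids x. y ~= fst_kid x then SOME y. y:kids x & y ~= fst_kid x else fst_kid x)"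

lemma kids:
 assumes "y:kids x" shows "y:V" "0 < lev y" "par y = x" "lev y = Suc (lev x)" using par assms unfolding kids_def by auto

lemma finite_kids: "x:V ==> finite (kids x)" and kid_par: "x:V ==> 0 < lev x ==> x:kids (par x)" using finite_kids' unfolding kids_def by auto

lemma fst_kid: "x:V ==> fst_kid x:kids x" unfolding fst_kid_def by (rule someI_ex[of "%y. y:kids x"]) (use kids_ne[of x] in "auto simp: kids_def")

lemma snd_kid:
 assumes "x:V"
 shows "snd_kid x:kids x" "y:kids x ==> y ~= fst_kid x ==> snd_kid x ~= fst_kid x"
proof -
 have "snd_kid x:kids x & snd_kid x ~= fst_kid x" if "EX y:kids x. y ~= fst_kid x"
  unfolding snd_kid_def if_P[OF that] by (rule someI_ex[of "%y. y:kids x & y ~= fst_kid x"]) (use that in blast)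
 moreover have "snd_kid x = fst_kid x" if "~ (EX y:kids x. y ~= fst_kid x)" unfolding snd_kid_def if_not_P[OF that] ..
 ultimately show "snd_kid x:kids x" "y:kids x ==> y ~= fst_kid x ==> snd_kid x ~= fst_kid x" using fst_kid[OF assms] by (metis, metis)
qed

text \<open>A vertex that is not a first child starts a ray of first children; \<open>rtop x\<close> is the start of the ray through \<open>x\<close>.
 Every branching vertex \<open>v\<close> also owns the ray of second children starting at its first child;
 \<open>owner x = Some v\<close> says that \<open>x\<close> lies on it.\<close>

function rtop :: "'v => 'v"
 where "rtop x = (if x:V & 0 < lev x & x = fst_kid (par x) then rtop (par x) else x)"
 by auto
termination by (relation "inv_image less_than lev") (auto simp: par(2)[symmetric])

function owner :: "'v => 'v option"
 where "owner x = (if x:V & 0 < lev x then if x = snd_kid (par x) then owner (par x)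
  else if x = fst_kid (par x) then Some (par x) else None else None)"
 by auto
termination by (relation "inv_image less_than lev") (auto simp: par(2)[symmetric])

declare rtop.simps [simp del] owner.simps [simp del]

definition Lines :: "'v set" where "Lines = {w:V. 0 < lev w & w ~= fst_kid (par w)}"
definition lines :: "'v => 'v set" where "lines v = {w:kids v. w ~= fst_kid v}"

text \<open>The unit flow that comes in along the ray owned by \<open>par w\<close> and goes out along the ray starting at \<open>w\<close>.\<close>

definition flow :: "'v => 'v => real"
 where "flow w x = (if rtop x = w then 1 else 0) - (if owner x = Some (par w) then 1 else 0)"

text \<open>The vertices whose blocks are used by the lines that start at children of
  \<open>v\<close>: the two kinds of rays, and \<open>v\<close> itself, where the flow turns from
  one ray into the other.\<close>

definition grp :: "'v => 'v set"
 where "grp v = {x:V. x = v \<or> (rtop x:Lines & par (rtop x) = v) \<or> owner x = Some v}"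

lemma lines_kid: "w:lines v \<longleftrightarrow> w:Lines & par w = v" unfolding Lines_def lines_def kids_def by auto

lemma tl_kid: "y:kids x ==> rtop y = (if y = fst_kid x then rtop x else y)" using kids[of y x] by (subst rtop.simps) auto

lemma own_kid: "y:kids x ==> owner y = (if y = snd_kid x then owner x else if y = fst_kid x then Some x else None)"
 using kids[of y x] by (subst owner.simps) auto

lemma at_root: "lev x = 0 ==> rtop x = x" "lev x = 0 ==> owner x = None" by (subst rtop.simps, simp) (subst owner.simps, simp)

lemma V_induct [consumes 1, case_names root kid]:
 assumes "x:V" and "!!x. x:V ==> lev x = 0 ==> P x" and "!!x y. x:V ==> P x ==> y:kids x ==> P y"
 shows "P x" using assms(1)
proof (induction "lev x" arbitrary: x)
 case 0 thus ?case using assms(2) by simp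
next
 case (Suc l)
 hence "0 < lev x" "par x:V" "l = lev (par x)" using par[of x] by auto
 thus ?case using Suc assms(3)[of "par x" x] kid_par[of x] by auto
qed

lemma rtop: "x:V ==> rtop x:V & (0 < lev (rtop x) --> rtop x:Lines)"
proof (induction x rule: V_induct)
 case (root x) thus ?case by (simp add: at_root(1))
next
 case (kid x y) thus ?case using kids[of y x] by (auto simp: tl_kid Lines_def)
qed

lemma owner: "x:V ==> owner x = Some v ==> v:V & lev v < lev x"
proof (induction x rule: V_induct)
 case (root x) thus ?case by (simp add: at_root(2))
next
 case (kid x y) thus ?case using kids(4)[of y x] by (auto simp: own_kid split: if_splits)
qed

lemma flow_root: "lev x = 0 ==> w:Lines ==> flow w x = 0" unfolding flow_def Lines_def using at_root[of x] by auto

lemma flow_values: "flow w x:{-1, 0, 1}" by (simp add: flow_def)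

lemma lines_fst_snd: "x:V ==> fst_kid x = snd_kid x ==> lines x = {}" using snd_kid(2)[of x] unfolding lines_def by auto

text \<open>Each ray that passes \<open>x\<close> continues in exactly one child. At
  \<open>x = par w\<close> two rays start, with opposite signs: one at \<open>w\<close>, the other
  at the first child, which is not the second child because \<open>w\<close> differs from
  it.\<close>

lemma flow_conserved:
 assumes x: "x:V" and w: "w:Lines"
 shows "(SUM y:kids x. flow w y) = flow w x"
proof -
 note f = finite_kids[OF x] and m = fst_kid[OF x] and s = snd_kid(1)[OF x]
 have "(SUM y:kids x. if rtop y = w then 1 else 0) = (if rtop (fst_kid x) = w then 1 else 0) + (SUM y:kids x - {fst_kid x}. if rtop y = w then 1 else (0::real))"
  by (rule sum.remove[OF f m])
 also have "(SUM y:kids x - {fst_kid x}. if rtop y = w then 1 else (0::real)) = (SUM y:kids x - {fst_kid x}. if y = w then 1 else 0)"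
  by (intro sum.cong) (auto simp: tl_kid)
 also have "... = (if w:lines x then 1 else 0)" using f by (simp add: sum.delta' lines_def)
 finally have 1: "(SUM y:kids x. if rtop y = w then 1 else (0::real)) = (if rtop x = w then 1 else 0) + (if w:lines x then 1 else 0)"
  by (simp add: tl_kid[OF m])
 have "(SUM y:kids x. if owner y = Some (par w) then 1 else 0) = (if owner (snd_kid x) = Some (par w) then 1 else 0) + (SUM y:kids x - {snd_kid x}. if owner y = Some (par w) then 1 else (0::real))"
  by (rule sum.remove[OF f s])
 also have "(SUM y:kids x - {snd_kid x}. if owner y = Some (par w) then 1 else (0::real)) = (SUM y:kids x - {snd_kid x}. if y = fst_kid x then (if par w = x then 1 else 0) else 0)"
  by (intro sum.cong) (auto simp: own_kid split: if_splits)
 also have "... = (if par w = x & fst_kid x ~= snd_kid x then 1 else 0)" using f m by (simp add: sum.delta')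
 also have "... = (if w:lines x then 1 else 0)" using w lines_fst_snd[OF x] lines_kid[of w x] by auto
 finally have 2: "(SUM y:kids x. if owner y = Some (par w) then 1 else (0::real)) = (if owner x = Some (par w) then 1 else 0) + (if w:lines x then 1 else 0)"
  by (simp add: own_kid[OF s])
 show ?thesis unfolding flow_def sum_subtractf 1 2 by simp
qed

lemma grp_kid: "x:V ==> y:kids x ==> y:grp v ==> y = v \<or> x:grp v" using kids[of y x] unfolding grp_def by (auto simp: tl_kid own_kid split: if_splits)

lemma flow_grp: "w:Lines ==> x:V ==> flow w x ~= 0 ==> x:grp (par w)" unfolding flow_def grp_def by (auto split: if_splits)

text \<open>Mass moves through \<open>y\<close> by means of the block of its parent, so the parent
  must belong to the group. The only vertex of the group whose parent may be outside is
  \<open>par w\<close> itself, and there the flow is zero.\<close>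

lemma flow_grp_kid:
 assumes "w:Lines" "x:V" "y:kids x" "flow w y ~= 0" shows "x:grp (par w)"
proof (rule ccontr)
 assume n: "x~:grp (par w)"
 have "y:grp (par w)" using flow_grp[OF assms(1) kids(1)[OF assms(3)] assms(4)] .
 hence y: "y = par w" using grp_kid[OF assms(2,3)] n by blast
 have "rtop y = w \<or> owner y = Some y" using assms(4) y unfolding flow_def by (auto split: if_splits)
 thus False proof
  assume "owner y = Some y"
  thus False using owner[OF kids(1)[OF assms(3)]] by blast
 next
  assume t: "rtop y = w"
  have "rtop y = rtop x \<or> rtop y = y" using tl_kid[OF assms(3)] by auto
  thus False proof
   assume "rtop y = y" thus False using t y assms(1) par(2)[of w] unfolding Lines_def by auto
  next
   assume "rtop y = rtop x"
   thus False using t n assms(1,2) unfolding grp_def by auto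
  qed
 qed
qed

lemma finite_lines: "v:V ==> finite (lines v)" using finite_kids unfolding lines_def by simp

lemma finite_grps: "x:V ==> finite {v. x:grp v}"
proof (rule finite_subset)
 show "{v. x:grp v} <= {x, par (rtop x), the (owner x)}" unfolding grp_def by auto
qed simp

text \<open>The colour of a vertex together with the colours of the (at most two) other groups it belongs to; 4 stands for none.\<close>

function cols :: "'v => nat \<times> nat \<times> nat"
 where "cols x = (if x:V & 0 < lev x then
  (LEAST c. c~:{fst (cols (par x)), fst (snd (cols (par x))), snd (snd (cols (par x)))},
  if x = fst_kid (par x) then fst (snd (cols (par x))) else fst (cols (par x)),
  if x = snd_kid (par x) then snd (snd (cols (par x))) else if x = fst_kid (par x) then fst (cols (par x)) else 4)
  else (0, 4, 4))"
 by auto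
termination by (relation "inv_image less_than lev") (auto simp: par(2)[symmetric])

declare cols.simps [simp del]

definition col :: "'v => nat" where "col x = fst (cols x)"
definition lcol :: "'v => nat" where "lcol x = fst (snd (cols x))"
definition rcol :: "'v => nat" where "rcol x = snd (snd (cols x))"

lemma col_kid:
 assumes "y:kids x"
 shows "lcol y = (if y = fst_kid x then lcol x else col x)"
  "rcol y = (if y = snd_kid x then rcol x else if y = fst_kid x then col x else 4)"
  "col y < 4" "col y ~= col x" "col y ~= lcol x" "col y ~= rcol x"
proof -
 note k = kids[OF assms]
 have "cols y = (LEAST c. c~:{col x, lcol x, rcol x}, if y = fst_kid x then lcol x else col x,
   if y = snd_kid x then rcol x else if y = fst_kid x then col x else 4)"
  unfolding col_def lcol_def rcol_def by (rule cols.simps[of y, unfolded if_P[OF conjI[OF k(1,2)]] k(3)])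
 hence c: "col y = (LEAST c. c~:{col x, lcol x, rcol x})"
  and l: "lcol y = (if y = fst_kid x then lcol x else col x)"
  and r: "rcol y = (if y = snd_kid x then rcol x else if y = fst_kid x then col x else 4)" by (simp_all add: col_def[of y] lcol_def[of y] rcol_def[of y])
 have "EX c<4. c ~= col x & c ~= lcol x & c ~= rcol x" by presburger
 then obtain c where "c < 4" "c~:{col x, lcol x, rcol x}" by blast
 note LeastI[of "%c. c~:{col x, lcol x, rcol x}", OF this(2)] Least_le[of "%c. c~:{col x, lcol x, rcol x}", OF this(2)]
 thus "col y < 4" "col y ~= col x" "col y ~= lcol x" "col y ~= rcol x" using \<open>c < 4\<close> unfolding c[symmetric] by auto
 show "lcol y = (if y = fst_kid x then lcol x else col x)"
  "rcol y = (if y = snd_kid x then rcol x else if y = fst_kid x then col x else 4)" by (fact l r)+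
qed

lemma col_root: "lev x = 0 ==> col x = 0 & lcol x = 4 & rcol x = 4" unfolding col_def lcol_def rcol_def by (simp add: cols.simps[of x])

text \<open>\<open>lcol x\<close> and \<open>rcol x\<close> are the colours of the group of the ray
  through \<open>x\<close> and of the owner of \<open>x\<close>. The invariant says that the at most
  three groups containing \<open>x\<close> have distinct colours.\<close>

lemma col_inv:
 assumes "x:V"
 shows "col x < 4 & col x ~= lcol x & col x ~= rcol x & (lcol x = rcol x --> lcol x = 4) &
  (rtop x:Lines --> lcol x = col (par (rtop x))) & (ALL v. owner x = Some v --> rcol x = col v) &
  (rtop x:Lines --> lcol x < 4) & (owner x ~= None --> rcol x < 4)"
 using assms proof (induction x rule: V_induct)
 case (root x)
 thus ?case using col_root[of x] at_root[of x] by (simp add: Lines_def)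
next
 case (kid x y)
 note k = kids[OF kid.hyps(2)] and c = col_kid[OF kid.hyps(2)]
 show ?case using kid.IH c k(3) unfolding tl_kid[OF kid.hyps(2)] own_kid[OF kid.hyps(2)]
  by (cases "y = fst_kid x"; cases "y = snd_kid x") (auto simp: Lines_def)
qed

lemma grp_col:
 assumes x: "x:V" and v: "x:grp v" "x:grp v'" and c: "col v = col v'" shows "v = v'" using col_inv[OF x] v c unfolding grp_def by auto

text \<open>Regions of parent and child overlap, so groups of one colour must also be kept apart
  across an edge.\<close>

lemma grp_col_kid:
 assumes x: "x:V" "y:kids x" and v: "y:grp v" "x:grp v'" and c: "col v = col v'" shows "v = v'"
proof (cases "x:grp v")
 case True thus ?thesis using grp_col[OF x(1) _ v(2) c] by simp
next
 case False
 hence "y = v" using grp_kid[OF x v(1)] by simp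
 moreover have "col v':{col x, lcol x, rcol x}" using v(2) col_inv[OF x(1)] unfolding grp_def by auto
 ultimately show ?thesis using col_kid(4-6)[OF x(2)] c by auto
qed

text \<open>The flow values needed on the lines are found from the top of the tree downwards.\<close>

function line_coeff :: "('v => real) => 'v => real"
 where "line_coeff c x = c x + (SUM w:{w:Lines. owner x = Some (par w) & lev w < lev x}. line_coeff c w)"
 by auto
termination by (relation "inv_image less_than (%(c, x). lev x)") auto

declare line_coeff.simps [simp del]

lemma line_coeff_zero: "(!!x. c x = 0) ==> line_coeff c x = 0"
proof (induction "lev x" arbitrary: x rule: less_induct)
 case less thus ?case by (subst line_coeff.simps) (auto intro: sum.neutral)
qed

lemma continuous_map_line_coeff:
 assumes "!!x. continuous_map X euclideanreal (%z. c z x)"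
 shows "continuous_map X euclideanreal (%z. line_coeff (c z) x)"
proof (induction "lev x" arbitrary: x rule: less_induct)
 case less
 have "continuous_map X euclideanreal (%z. c z x + (SUM w:{w:Lines. owner x = Some (par w) & lev w < lev x}. line_coeff (c z) w))"
 proof (cases "finite {w:Lines. owner x = Some (par w) & lev w < lev x}")
  case True
  thus ?thesis using less by (intro continuous_map_add continuous_map_sum assms) auto
 qed (simp add: assms)
 thus ?case by (subst line_coeff.simps)
qed

text \<open>At the start of a line the equation is solved for its own coefficient; all lines of its
  owner start at smaller level, so the bound in \<open>line_coeff\<close> keeps every one of them.
  At a first child the equation follows from those of its siblings and conservation of
  \<open>c\<close>.\<close>

lemma line_coeff_flow:
 assumes x: "x:V" and c0: "!!x. x:V ==> lev x = 0 ==> c x = 0"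
  and cc: "!!x. x:V ==> (SUM y:kids x. c y) = c x"
 shows "(if rtop x:Lines then line_coeff c (rtop x) else 0) -
  (case owner x of None => 0 | Some v => SUM w:lines v. line_coeff c w) = c x"
 using x proof (induction x rule: V_induct)
 case (root x)
 thus ?case using at_root[of x] c0[of x] by (simp add: Lines_def)
next
 case (kid x y)
 let ?T = "%x. if rtop x:Lines then line_coeff c (rtop x) else 0"
 let ?G = "%x. case owner x of None => 0 | Some v => SUM w:lines v. line_coeff c w"
 have other: "?T z - ?G z = c z" if z: "z:kids x" "z ~= fst_kid x" for z proof -
  note k = kids[OF z(1)]
  have zL: "z:Lines" using k z(2) unfolding Lines_def by simp
  have "{w:Lines. owner z = Some (par w) & lev w < lev z} = (case owner z of None => {} | Some v => lines v)" proof (cases "owner z")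
   case (Some v)
   hence "owner x = Some v" using own_kid[OF z(1)] z(2) by (simp split: if_splits)
   hence "lev v < lev x" using owner[OF kid.hyps(1)] by simp
   hence "lev w < lev z" if "w:Lines" "par w = v" for w using par(2)[of w] that k(4) unfolding Lines_def by simp
   thus ?thesis unfolding Some option.case set_eq_iff mem_Collect_eq lines_kid by blast
  qed simp
  hence "line_coeff c z = c z + ?G z" by (subst line_coeff.simps) (simp split: option.splits)
  thus ?thesis using zL tl_kid[OF z(1)] z(2) by simp
 qed
 show ?case proof (cases "y = fst_kid x")
  case False thus ?thesis using other kid.hyps(2) by simp
 next
  case True
  note f = finite_kids[OF kid.hyps(1)] and m = fst_kid[OF kid.hyps(1)] and s = snd_kid(1)[OF kid.hyps(1)]
  have cx: "c (fst_kid x) + (SUM z:kids x - {fst_kid x}. c z) = c x" using cc[OF kid.hyps(1)] sum.remove[OF f m, of c] by simp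
  have "(SUM z:kids x - {fst_kid x}. c z) = (SUM z:kids x - {fst_kid x}. line_coeff c z - ?G z)" proof (intro sum.cong refl)
   fix z assume z: "z:kids x - {fst_kid x}"
   hence "z:Lines" using kids[of z x] unfolding Lines_def by auto
   thus "c z = line_coeff c z - ?G z" using other[of z] z tl_kid[of z x] by simp
  qed
  also have "... = (SUM w:lines x. line_coeff c w) - (SUM z:kids x - {fst_kid x}. ?G z)" proof -
   have "lines x = kids x - {fst_kid x}" unfolding lines_def by auto
   thus ?thesis by (simp add: sum_subtractf)
  qed
  also have "(SUM z:kids x - {fst_kid x}. ?G z) = (SUM z:kids x - {fst_kid x}. if z = snd_kid x then ?G x else 0)" by (intro sum.cong refl) (auto simp: own_kid)
  also have "... = (if fst_kid x = snd_kid x then 0 else ?G x)" using f s by (simp add: sum.delta')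
  finally have "c (fst_kid x) = c x - (SUM w:lines x. line_coeff c w) + (if fst_kid x = snd_kid x then 0 else ?G x)" using cx by simp
  moreover have "?T x - ?G x = c x" by (rule kid.IH)
  moreover have "?T y = ?T x" "?G y = (if fst_kid x = snd_kid x then ?G x else SUM w:lines x. line_coeff c w)"
   unfolding True tl_kid[OF m] own_kid[OF m] by simp_all
  moreover have "(SUM w:lines x. line_coeff c w) = 0" if "fst_kid x = snd_kid x" using lines_fst_snd[OF kid.hyps(1) that] by simp
  moreover have "ty - gy = cf" if "cf = cx - s + (if P then 0 else gx)" "tx - gx = cx" "ty = tx" "gy = (if P then gx else s)" "P ==> s = 0"
   for cf cx s gx gy tx ty :: real and P using that by (cases P) auto
  ultimately show ?thesis unfolding True by blast
 qed
qed

text \<open>At \<open>y\<close> only the line whose ray passes \<open>y\<close> and the lines of the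
  owner of \<open>y\<close> contribute, and all of these belong to groups that contain the parent
  \<open>x\<close>.\<close>

lemma flow_sum:
 assumes A: "finite A" "A <= V" and x: "x:V" "y:kids x" and v: "!!v. v:V ==> x:grp v ==> v:A"
 shows "(SUM v:A. SUM w:lines v. a w * flow w y) =
  (if rtop y:Lines then a (rtop y) else 0) - (case owner y of None => 0 | Some v => SUM w:lines v. a w)"
proof -
 have fl: "finite (lines v)" if "v:A" for v using finite_lines A(2) that by blast
 have pw: "par w = v" if "w:lines v" for w v using that unfolding lines_kid by simp
 note k = kids[OF x(2)]
 have top: "par (rtop y):A" if L: "rtop y:Lines" proof (rule v)
  show "par (rtop y):V" using L par(1) unfolding Lines_def by simp
  show "x:grp (par (rtop y))" using L x(1) k(3) unfolding tl_kid[OF x(2)] grp_def by (auto split: if_splits)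
 qed
 have own: "v':A" if o: "owner y = Some v'" for v' using o v owner[OF k(1) o] x(1) unfolding own_kid[OF x(2)] grp_def by (auto split: if_splits)
 have "(SUM v:A. SUM w:lines v. a w * flow w y) =
  (SUM v:A. SUM w:lines v. (if w = rtop y then a w else 0)) - (SUM v:A. SUM w:lines v. (if owner y = Some v then a w else 0))"
  unfolding sum_subtractf[symmetric] by (intro sum.cong refl) (auto simp: flow_def pw)
 also have "(SUM v:A. SUM w:lines v. (if w = rtop y then a w else 0)) =
  (SUM v:A. if v = par (rtop y) & rtop y:Lines then a (rtop y) else 0)"
  using fl by (intro sum.cong refl) (auto simp: sum.delta lines_kid)
 also have "... = (if rtop y:Lines then a (rtop y) else 0)" using A(1) top by (cases "rtop y:Lines") (simp_all add: sum.delta)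
 also have "(SUM v:A. SUM w:lines v. (if owner y = Some v then a w else 0)) =
  (SUM v:A. if owner y = Some v then (SUM w:lines v. a w) else 0)"
  by (intro sum.cong refl) auto
 also have "... = (case owner y of None => 0 | Some v => SUM w:lines v. a w)" using A(1) own by (cases "owner y") (simp_all add: sum.delta)
 finally show ?thesis .
qed

end

subsection \<open>Products of families and flux\<close>

lemma continuous_on_locally:
 assumes "!!z. EX N. open N & z:N & continuous_on N f" shows "cont f"
proof -
 have "continuous_on (\<Union>{N. open N & continuous_on N f}) f" by (rule continuous_on_open_Union) auto
 moreover have "\<Union>{N. open N & continuous_on N f} = UNIV" using assms by blast
 ultimately show ?thesis by simp
qed

lemma hfamily_local:
 fixes G :: "'p::topological_space => 'a::topological_space => 'a"
 assumes "!!p. EX P G'. open P & p:P & hfamily G' & (ALL q:P. G q = G' q)"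
 shows "hfamily G" unfolding hfamily_def
proof (intro conjI allI)
 fix p show "bij (G p)" using assms[of p] hfamilyD(3) by metis
next
 show "cont (%(p, x). G p x)" proof (rule continuous_on_locally)
  fix z :: "'p \<times> 'a" obtain P G' where P: "open P" "fst z:P" "hfamily G'" "ALL q:P. G q = G' q" using assms[of "fst z"] by blast
  have "continuous_on (P \<times> UNIV) (%(p, x). G p x)" by (rule continuous_on_eq[OF cont_subset[OF hfamilyD(1)[OF P(3)]]]) (use P(4) in auto)
  thus "EX N. open N & z:N & continuous_on N (%(p, x). G p x)" using P(1,2) by (intro exI[of _ "P \<times> UNIV"]) (auto simp: open_Times mem_Times_iff)
 qed
next
 show "cont (%(p, x). inv (G p) x)" proof (rule continuous_on_locally)
  fix z :: "'p \<times> 'a" obtain P G' where P: "open P" "fst z:P" "hfamily G'" "ALL q:P. G q = G' q" using assms[of "fst z"] by blast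
  have "continuous_on (P \<times> UNIV) (%(p, x). inv (G p) x)" by (rule continuous_on_eq[OF cont_subset[OF hfamilyD(2)[OF P(3)]]]) (use P(4) in auto)
  thus "EX N. open N & z:N & continuous_on N (%(p, x). inv (G p) x)" using P(1,2) by (intro exI[of _ "P \<times> UNIV"]) (auto simp: open_Times mem_Times_iff)
 qed
qed

lemma sfamily_image:
 assumes g: "hfamily g" and s: "sfamily D g"
 shows "sfamily D (%p. inv (g p))" "x:D \<longleftrightarrow> g p x:D"
proof -
 show "sfamily D (%p. inv (g p))" using s hfamilyD(4)[OF g] unfolding sfamily_def by metis
 show "x:D \<longleftrightarrow> g p x:D" using s hfamilyD(4)[OF g] unfolding sfamily_def by metis
qed

text \<open>On the open set \<open>W j\<close> the product agrees with \<open>g j\<close>, and off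
  the closed union of supports it is the identity; these open sets cover the space. Closedness of
  the union expresses local finiteness.\<close>

lemma product_family:
 fixes g :: "'j => 'p::topological_space => 'a::topological_space => 'a"
 assumes g: "!!j. j:J ==> hfamily (g j)" "!!j. j:J ==> sfamily (D j) (g j)"
  and O: "!!j. j:J ==> open (W j)" "!!j. j:J ==> D j <= W j" "!!i j. i:J ==> j:J ==> i ~= j ==> W i Int W j = {}"
  and cl: "closed (UN j:J. D j)"
 shows "EX G. hfamily G & sfamily (UN j:J. D j) G & (ALL j:J. ALL x:W j. ALL p. G p x = g j p x)"
proof -
 define glue where "glue h p x = (if EX j:J. x:D j then h (THE j. j:J & x:D j) p x else x)"
  for h :: "'j => 'p => 'a => 'a" and p x
 have glue: "glue h p x = h j p x" if s: "sfamily (D j) (h j)" and x: "j:J" "x:W j" for h j p x proof (cases "x:D j")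
  case True
  hence "(THE j. j:J & x:D j) = j" using O(2,3) x by (intro the_equality) blast+
  thus ?thesis using True x unfolding glue_def by auto
 next
  case False
  hence "~ (EX j:J. x:D j)" using O(2,3) x by blast
  thus ?thesis using False s unfolding glue_def sfamily_def by simp
 qed
 have off: "glue h p x = x" if "x~:(UN j:J. D j)" for h p x using that unfolding glue_def by auto
 have cont: "cont (%(p, x). glue h p x)"
  if h: "!!j. j:J ==> sfamily (D j) (h j)" "!!j. j:J ==> cont (%(p, x). h j p x)" for h
 proof (rule continuous_on_locally)
  fix z :: "'p \<times> 'a"
  show "EX N. open N & z:N & continuous_on N (%(p, x). glue h p x)" proof (cases "snd z:(UN j:J. D j)")
   case True
   then obtain j where j: "j:J" "snd z:W j" using O(2) by blast
   have "continuous_on (UNIV \<times> W j) (%(p, x). glue h p x)"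
    by (rule continuous_on_eq[OF cont_subset[OF h(2)[OF j(1)]]]) (use glue[where h=h and j=j, OF h(1)[OF j(1)] j(1)] in auto)
   thus ?thesis using j O(1) by (intro exI[of _ "UNIV \<times> W j"]) (auto simp: open_Times mem_Times_iff)
  next
   case False
   have "continuous_on (UNIV \<times> - (UN j:J. D j)) (%(p, x). glue h p x)"
    by (rule continuous_on_eq[OF continuous_on_snd[OF continuous_on_id]]) (use off in auto)
   thus ?thesis using False cl by (intro exI[of _ "UNIV \<times> - (UN j:J. D j)"]) (auto simp: mem_Times_iff intro!: open_Times open_Compl simp del: Compl_UN)
  qed
 qed
 let ?g' = "%j p. inv (g j p)"
 have s': "sfamily (D j) (?g' j)" if "j:J" for j by (rule sfamily_image(1)[OF g(1,2)[OF that]])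
 have inv: "glue h p (glue k p x) = x"
  if h: "!!j. j:J ==> sfamily (D j) (h j)" "!!j. j:J ==> sfamily (D j) (k j)"
   "!!j y. j:J ==> h j p (k j p y) = y" "!!j y. j:J ==> k j p (h j p y) = y" for h k p x
 proof (cases "x:(UN j:J. D j)")
  case True
  then obtain j where j: "j:J" "x:D j" by blast
  have "k j p x:D j" proof (rule ccontr)
   assume "k j p x~:D j"
   hence "h j p (k j p x) = k j p x" using h(1)[OF j(1)] unfolding sfamily_def by blast
   thus False using h(3)[OF j(1)] j(2) \<open>k j p x~:D j\<close> by simp
  qed
  hence "k j p x:W j" "x:W j" using O(2) j by blast+
  thus ?thesis using glue[where h=h and j=j, OF h(1)[OF j(1)] j(1)] glue[where h=k and j=j, OF h(2)[OF j(1)] j(1)] h(3)[OF j(1)] by simp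
 qed (simp add: off)
 have "hfamily (glue g)" proof (rule homeo_familyI(1)[where g'="glue ?g'"])
  show "cont (%(p, x). glue g p x)" "cont (%(p, x). glue ?g' p x)" using g s' hfamilyD(1,2) by (intro cont; blast)+
  show "glue ?g' p (glue g p x) = x" for p x by (rule inv) (simp_all add: g s' hfamilyD[OF g(1)])
  show "glue g p (glue ?g' p x) = x" for p x by (rule inv) (simp_all add: g s' hfamilyD[OF g(1)])
 qed
 moreover have "sfamily (UN j:J. D j) (glue g)" unfolding sfamily_def using off by blast
 ultimately show ?thesis using glue g(2) by (intro exI[of _ "glue g"]) blast
qed

lemma dens_cong:
 assumes s: "sets om = sets borel" and f: "f:borel_measurable borel" "f':borel_measurable borel"
  and A: "A:sets borel" "!!x. x:A ==> f x = f' x"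
 shows "emeasure (dens om f) A = emeasure (dens om f') A"
proof -
 have m: "(%x. ennreal (f x)):borel_measurable om" "(%x. ennreal (f' x)):borel_measurable om" using f by (simp_all add: measurable_cong_sets[OF s refl])
 show ?thesis unfolding dens_def using A(1) by (simp add: emeasure_density m s) (intro nn_integral_cong, use A(2) in "auto simp: indicator_def")
qed

lemma pushes_product:
 fixes om :: "'a::topological_space measure"
 assumes s: "sets om = sets borel" and J: "countable J" "!!j. j:J ==> D j:sets borel" "disjoint_family_on D J"
  and g: "!!j. j:J ==> pushes om (g j) f (F' j)" "!!j x. j:J ==> x:D j ==> G x = g j x" "!!x. x~:(UN j:J. D j) ==> G x = x"
   "!!j. j:J ==> g j ` D j <= D j"
  and F: "f:borel_measurable borel" "F:borel_measurable borel" "!!j. j:J ==> F' j:borel_measurable borel"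
   "!!j x. j:J ==> x:D j ==> F' j x = F x" "!!x. x~:(UN j:J. D j) ==> F x = f x"
  and b: "!!j B. j:J ==> B:sets borel ==> g j ` B:sets borel"
 shows "pushes om G f F" unfolding pushes_def
proof
 fix B :: "'a set" assume B: "B:sets borel"
 let ?U = "UN j:J. D j"
 have U: "?U:sets borel" using J(1,2) by (intro sets.countable_UN') auto
 let ?C = "UN j:J. g j ` (B Int D j)"
 have gB: "g j ` (B Int D j):sets borel" if "j:J" for j using b[OF that] B J(2)[OF that] by blast
 have C: "?C:sets borel" using J(1) gB by (intro sets.countable_UN') auto
 have sub: "g j ` (B Int D j) <= D j" if "j:J" for j using g(4)[OF that] by blast
 have GB: "G ` B = (B - ?U) Un ?C" proof -
  have "G ` B = G ` (B - ?U) Un (UN j:J. G ` (B Int D j))" by blast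
  moreover have "G ` (B - ?U) = (%x. x) ` (B - ?U)" using g(3) by (intro image_cong) auto
  moreover have "G ` (B Int D j) = g j ` (B Int D j)" if "j:J" for j using g(2)[OF that] by (intro image_cong) auto
  ultimately show ?thesis by simp
 qed
 have "emeasure (dens om F) (G ` B) = emeasure (dens om F) (B - ?U) + emeasure (dens om F) ?C"
  unfolding GB using B U C sub by (intro plus_emeasure[symmetric]) (auto simp: s)
 also have "emeasure (dens om F) (B - ?U) = emeasure (dens om f) (B - ?U)" using B U F(5) by (intro dens_cong[OF s F(2,1)]) auto
 also have "emeasure (dens om F) ?C = (\<integral>\<^sup>+j. emeasure (dens om F) (g j ` (B Int D j)) \<partial>count_space J)"
 proof (rule emeasure_UN_countable)
  show "disjoint_family_on (%j. g j ` (B Int D j)) J" using J(3) sub unfolding disjoint_family_on_def by blast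
 qed (use gB J(1) in "simp_all add: s")
 also have "... = (\<integral>\<^sup>+j. emeasure (dens om f) (B Int D j) \<partial>count_space J)" proof (rule nn_integral_cong)
  fix j assume "j:space (count_space J)"
  hence j: "j:J" by simp
  have "emeasure (dens om F) (g j ` (B Int D j)) = emeasure (dens om (F' j)) (g j ` (B Int D j))"
   using sub[OF j] F(4)[OF j] by (intro dens_cong[OF s F(2) F(3)[OF j] gB[OF j]]) (metis subsetD)
  thus "emeasure (dens om F) (g j ` (B Int D j)) = emeasure (dens om f) (B Int D j)" using g(1)[OF j] B J(2)[OF j] unfolding pushes_def by simp
 qed
 also have "... = emeasure (dens om f) (UN j:J. B Int D j)" using J B by (intro emeasure_UN_countable[symmetric]) (auto simp: s disjoint_family_on_def)
 also have "emeasure (dens om f) (B - ?U) + emeasure (dens om f) (UN j:J. B Int D j) = emeasure (dens om f) ((B - ?U) Un (UN j:J. B Int D j))"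
  using B U J by (intro plus_emeasure) (auto simp: s intro!: sets.countable_UN')
 also have "(B - ?U) Un (UN j:J. B Int D j) = B" by blast
 finally show "emeasure (dens om F) (G ` B) = emeasure (dens om f) B" .
qed

text \<open>The flux of \<open>h\<close> through \<open>U\<close> is the difference of the measures of \<open>U - h ` U\<close> and \<open>h ` U - U\<close>.\<close>

definition has_flux :: "'a measure => ('a => 'a) => 'a set => real => bool"
 where "has_flux om h U r \<longleftrightarrow> has_bochner_integral om (%x. ind U x - ind (h ` U) x) r"

lemma has_flux_invariant: "h ` U = U ==> has_flux om h U 0" unfolding has_flux_def by (simp add: has_bochner_integral_zero)

lemma distr_pushes:
 assumes s: "sets om = sets borel" and g: "cont g" "bij g" and p: "pushes om g (%x. 1) F"
 shows "distr om borel g = dens om F"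
proof (rule measure_eqI)
 have m: "g:measurable om borel" using borel_measurable_continuous_onI[OF g(1)] by (simp add: measurable_cong_sets[OF s refl])
 have sp: "space om = UNIV" using sets_eq_imp_space_eq[OF s] by simp
 fix B assume "B:sets (distr om borel g)"
 hence B: "B:sets borel" by simp
 have v: "g -` B:sets borel" using measurable_sets[OF m B] by (simp add: s sp)
 have "g ` (g -` B) = B" using g(2) by (simp only: bij_is_surj surj_image_vimage_eq)
 hence "emeasure (dens om F) B = emeasure om (g -` B)" using bspec[OF p[unfolded pushes_def] v] by simp
 thus "emeasure (distr om borel g) B = emeasure (dens om F) B" by (simp add: emeasure_distr[OF m B] sp)
qed (simp add: s)

lemma has_integral_pushes:
 fixes f :: "'a::topological_space => real"
 assumes s: "sets om = sets borel" and g: "cont g" "bij g" "pushes om g (%x. 1) F"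
  and F: "F:borel_measurable borel" "!!x. 0 <= F x" and f: "f:borel_measurable borel"
  and i: "has_bochner_integral om (%x. F x * f x) r"
 shows "has_bochner_integral om (%x. f (g x)) r"
proof -
 have m: "g:measurable om borel" using borel_measurable_continuous_onI[OF g(1)] by (simp add: measurable_cong_sets[OF s refl])
 have F': "F:borel_measurable om" and f': "f:borel_measurable om" using F(1) f by (simp_all add: measurable_cong_sets[OF s refl])
 have "has_bochner_integral (dens om F) f r" unfolding dens_def using F' f' F(2) i by (intro has_bochner_integral_density) simp_all
 hence "has_bochner_integral (distr om borel g) f r" unfolding distr_pushes[OF s g] .
 thus ?thesis unfolding has_bochner_integral_iff using integrable_distr_eq[OF m f] integral_distr[OF m f] by simp
qed

text \<open>The indicator difference for the composition is that of \<open>h\<close> plus that of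
  \<open>k\<close> composed with \<open>inv h\<close>, and \<open>inv h\<close> preserves the
  measure.\<close>

lemma has_flux_comp:
 fixes om :: "'a::topological_space measure"
 assumes s: "sets om = sets borel" and h: "cont (inv h)" "bij h" "pushes om (inv h) (%x. 1) (%x. 1)"
  and U: "U:sets borel" "k ` U:sets borel" and f: "has_flux om h U a" "has_flux om k U b"
 shows "has_flux om (%x. h (k x)) U (a + b)"
proof -
 have "has_bochner_integral om (%x. ind U (inv h x) - ind (k ` U) (inv h x)) b"
 proof (rule has_integral_pushes[where F="%x. 1" and f="%x. ind U x - ind (k ` U) x"])
  show "bij (inv h)" using h(2) by (rule bij_imp_bij_inv)
 qed (use s h U f(2) in "simp_all add: has_flux_def")
 moreover have "ind X (inv h x) = ind (h ` X) x" for X x proof -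
  have "inv h x:X \<longleftrightarrow> x:h ` X" proof
   assume "inv h x:X"
   hence "h (inv h x):h ` X" by (rule imageI)
   thus "x:h ` X" using h(2) by (simp add: bij_is_surj surj_f_inv_f)
  next
   assume "x:h ` X"
   then obtain y where "y:X" "x = h y" by (rule imageE)
   thus "inv h x:X" using h(2) by (simp add: bij_is_inj)
  qed
  thus ?thesis by (simp add: indicator_def)
 qed
 ultimately have "has_bochner_integral om (%x. ind (h ` U) x - ind (h ` k ` U) x) b" by simp
 from has_bochner_integral_add[OF f(1)[unfolded has_flux_def] this]
 show ?thesis unfolding has_flux_def by (simp add: image_image)
qed

text \<open>Composition with \<open>h\<close> turns integrals against the density \<open>F\<close>
  into integrals against \<open>om\<close>. Thus the flux of the quotient compares the two images of
  \<open>U\<close> in the density \<open>F\<close>, each relative to \<open>U\<close>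
  itself.\<close>

lemma has_flux_quotient:
 fixes om :: "'a::topological_space measure"
 assumes s: "sets om = sets borel" and h: "cont h" "bij h" "pushes om h (%x. 1) F"
  and F: "F:borel_measurable borel" "!!x. 0 <= F x" and U: "h ` U:sets borel" "g ` U:sets borel"
  and f: "has_bochner_integral om (%x. F x * (ind (h ` U) x - ind U x)) a"
   "has_bochner_integral om (%x. F x * (ind (g ` U) x - ind U x)) b"
 shows "has_flux om (%x. inv h (g x)) U (a - b)"
proof -
 have "has_bochner_integral om (%x. F x * (ind (h ` U) x - ind (g ` U) x)) (a - b)" using has_bochner_integral_diff[OF f] by (simp add: algebra_simps)
 hence "has_bochner_integral om (%x. ind (h ` U) (h x) - ind (g ` U) (h x)) (a - b)" by (intro has_integral_pushes[OF s h F]) (use U in simp_all)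
 moreover have "ind (h ` U) (h x) = ind U x" for x using h(2) by (auto simp: indicator_def bij_def inj_def)
 moreover have "ind (g ` U) (h x) = ind ((%x. inv h (g x)) ` U) x" for x proof -
  have "h x:g ` U \<longleftrightarrow> x:(%x. inv h (g x)) ` U" using h(2) by (smt (verit) bij_inv_eq_iff imageE image_eqI)
  thus ?thesis by (simp add: indicator_def)
 qed
 ultimately show ?thesis unfolding has_flux_def by simp
qed

text \<open>Only the part in \<open>D\<close> matters. In the new density its image has the old
  mass, while the set \<open>U Int D\<close> itself has gained the integral of \<open>u\<close> over
  it; the difference is minus that gain.\<close>

lemma straddle_integral:
 fixes om :: "'a::t2_space measure"
 assumes om: "radon_measure om" and p: "pushes om g (%x. 1) (%x. 1 + u x)" and u: "u:borel_measurable borel" "!!x. abs (u x) <= 1"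
  and D: "compact D" "g ` (U Int D) <= D" "g ` (U - D) = U - D" and U: "U:sets borel" "g ` (U Int D):sets borel"
 shows "has_bochner_integral om (%x. (1 + u x) * (ind (g ` U) x - ind U x)) (- (\<integral>x. ind (U Int D) x * u x \<partial>om))"
proof -
 note s = radon_sets[OF om]
 have bD: "D:sets borel" using D(1) by (simp add: borel_closed compact_imp_closed)
 have mu: "(%x. 1 + u x):borel_measurable om" using u(1) by (simp add: measurable_cong_sets[OF s refl])
 have gU: "ind (g ` U) x - ind U x = ind (g ` (U Int D)) x - ind (U Int D) x" for x proof -
  have "g ` U = g ` (U Int D) Un (U - D)" using D(3) by (metis Int_Diff_Un image_Un)
  thus ?thesis using D(2) by (auto simp: indicator_def)
 qed
 have I: "integrable om (%x. (1 + u x) * ind A x)" and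
  E: "emeasure (dens om (%x. 1 + u x)) A = ennreal (\<integral>x. (1 + u x) * ind A x \<partial>om)"
  if A: "A:sets borel" "A <= D" for A
 proof -
  have fin: "emeasure om A < \<infinity>" using emeasure_mono[OF A(2), of om] radon_compact[OF om D(1)] bD by (simp add: s le_less_trans)
  have "integrable om (%x. 2 * ind A x)" using A(1) fin by (simp add: s)
  thus I: "integrable om (%x. (1 + u x) * ind A x)" proof (rule Bochner_Integration.integrable_bound)
   show "(%x. (1 + u x) * ind A x):borel_measurable om" using A(1) by (intro borel_measurable_times mu borel_measurable_indicator) (simp add: s)
   have "abs (1 + u x) <= 2" for x using u(2)[of x] by linarith
   thus "AE x in om. norm ((1 + u x) * ind A x) <= norm (2 * ind A x)" by (intro AE_I2) (simp add: indicator_def)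
  qed
  have "emeasure (dens om (%x. 1 + u x)) A = (\<integral>\<^sup>+x. ennreal ((1 + u x) * ind A x) \<partial>om)"
   unfolding dens_def using A(1) mu by (subst emeasure_density) (auto simp: s indicator_def intro!: nn_integral_cong)
  also have "... = ennreal (\<integral>x. (1 + u x) * ind A x \<partial>om)" proof (rule nn_integral_eq_integral[OF I], rule AE_I2)
   fix x show "0 <= (1 + u x) * ind A x" using u(2)[of x] by (intro mult_nonneg_nonneg) auto
  qed
  finally show "emeasure (dens om (%x. 1 + u x)) A = ennreal (\<integral>x. (1 + u x) * ind A x \<partial>om)" .
 qed
 have UD: "U Int D:sets borel" "U Int D <= D" using U(1) bD by auto
 have pos: "0 <= (\<integral>x. (1 + u x) * ind A x \<partial>om)" for A proof (rule Bochner_Integration.integral_nonneg)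
  fix x show "0 <= (1 + u x) * ind A x" using u(2)[of x] by (intro mult_nonneg_nonneg) auto
 qed
 have fin: "emeasure om (U Int D) < \<infinity>" using emeasure_mono[OF UD(2), of om] radon_compact[OF om D(1)] bD by (simp add: s le_less_trans)
 have "ennreal (\<integral>x. (1 + u x) * ind (g ` (U Int D)) x \<partial>om) = emeasure om (U Int D)"
  using p UD(1) E[OF U(2) D(2)] unfolding pushes_def by simp
 also have "... = ennreal (measure om (U Int D))" using fin by (intro emeasure_eq_ennreal_measure) simp
 finally have 1: "(\<integral>x. (1 + u x) * ind (g ` (U Int D)) x \<partial>om) = measure om (U Int D)"
  using pos[of "g ` (U Int D)"] by (simp add: ennreal_inj)
 have i1: "integrable om (ind (U Int D))" using UD(1) fin by (simp add: s)
 have i2: "integrable om (%x. ind (U Int D) x * u x)" using Bochner_Integration.integrable_diff[OF I[OF UD] i1] by (simp add: algebra_simps)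
 have "(\<integral>x. (1 + u x) * ind (U Int D) x \<partial>om) = (\<integral>x. ind (U Int D) x + ind (U Int D) x * u x \<partial>om)"
  by (simp add: algebra_simps)
 also have "... = measure om (U Int D) + (\<integral>x. ind (U Int D) x * u x \<partial>om)"
  using UD(1) i1 i2 by (subst Bochner_Integration.integral_add) (simp_all add: s)
 finally have 2: "(\<integral>x. (1 + u x) * ind (U Int D) x \<partial>om) = measure om (U Int D) + (\<integral>x. ind (U Int D) x * u x \<partial>om)" .
 show ?thesis using has_bochner_integral_diff[OF has_bochner_integral_integrable[OF I[OF U(2) D(2)]] has_bochner_integral_integrable[OF I[OF UD]]]
  unfolding 1 2 gU by (simp add: right_diff_distrib)
qed

section \<open>The tree of components of infinite measure\<close>

locale exhausted_manifold = manifold_measure n om for n :: nat and om :: "'a::metric_space measure" +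
 fixes K :: "nat => 'a set" and D :: "nat => 'a set => 'a set"
 assumes cK: "compact (K i)" and K_0: "K 0 = {}" and K_Suc: "K i <= interior (K (Suc i))"
  and K_exhausts: "compact L ==> EX i. L <= K i"
  and bsupp_K: "U:icomps (K i) ==> bsupp U <= interior (K (Suc i))"
  and D_facts: "U:icomps (K i) ==> compact (D i U)"
   "U:icomps (K i) ==> D i U <= U Int I Int interior (K (Suc (Suc i)))"
   "U:icomps (K i) ==> blocks (nbhd_comps U (K (Suc i))) (D i U)"
begin

lemma K_mono: "i <= j ==> K i <= K j"
proof (induction j rule: dec_induct)
 case (step j) thus ?case using K_Suc[of j] interior_subset[of "K (Suc j)"] by blast
qed simp

definition V :: "(nat \<times> 'a set) set" where "V = {x. snd x:icomps (K (fst x))}"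

definition par :: "nat \<times> 'a set => nat \<times> 'a set"
 where "par x = (fst x - 1, THE W. W:icomps (K (fst x - 1)) & snd x <= W)"

abbreviation Dv :: "nat \<times> 'a set => 'a set" where "Dv x \<equiv> D (fst x) (snd x)"
text \<open>Open room around the block \<open>Dv x\<close>, as needed for gluing; it ends two steps
  further in the exhaustion.\<close>

definition Rg :: "nat \<times> 'a set => 'a set" where "Rg x = snd x Int interior (K (Suc (Suc (fst x))))"

lemma V_facts:
 assumes "x:V"
 shows "open (snd x)" "connected (snd x)" "snd x Int K (fst x) = {}" "emeasure om (snd x) = \<infinity>" "snd x ~= {}"
  "snd x:components (- K (fst x))" "snd x:icomps (K (fst x))"
 using icompsD[OF cK, of "snd x" "fst x"] assms unfolding V_def by simp_all

lemma V_bump: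
 assumes "x:V"
 shows "cont (bump (snd x))" "bsupp (snd x) <= snd x" "p~:bsupp (snd x) ==> bump (snd x) p = 0"
  "0 <= bump (snd x) p" "bump (snd x) p <= 1/4" "integral\<^sup>L om (bump (snd x)) = 1" "bsupp (snd x) <= interior (K (Suc (fst x)))"
 using bump[OF V_facts(1,4)[OF assms]] bsupp_K[OF V_facts(7)[OF assms]] by auto

lemma V_nested:
 assumes x: "x:V" and y: "y:V" and le: "fst x <= fst y" shows "snd y <= snd x \<or> snd y Int snd x = {}"
proof (rule disjCI)
 assume "snd y Int snd x ~= {}"
 moreover have "snd y <= - K (fst x)" using V_facts(3)[OF y] K_mono[OF le] by blast
 ultimately show "snd y <= snd x" using components_maximal[OF V_facts(6)[OF x] V_facts(2)[OF y]] by blast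
qed

lemma V_same_level: "x:V ==> y:V ==> fst x = fst y ==> snd x Int snd y ~= {} ==> x = y"
 using icomps_disjoint[of "snd x" "K (fst x)" "snd y"] unfolding V_def by (auto simp: prod_eq_iff)

lemma par_eq:
 assumes x: "x:V" and y: "y:V" and l: "fst x = Suc (fst y)" and m: "snd x Int snd y ~= {}" shows "par x = y"
proof -
 have sub: "snd x <= snd y" using V_nested[OF y x] l m by auto
 have "(THE W. W:icomps (K (fst y)) & snd x <= W) = snd y" proof (rule the_equality)
  show "snd y:icomps (K (fst y)) & snd x <= snd y" using V_facts(7)[OF y] sub by simp
  fix W assume W: "W:icomps (K (fst y)) & snd x <= W"
  thus "W = snd y" using icomps_disjoint[of W _ "snd y"] V_facts(7)[OF y] sub V_facts(5)[OF x] by blast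
 qed
 thus ?thesis unfolding par_def using l by (simp add: prod_eq_iff)
qed

lemma par_facts:
 assumes x: "x:V" "0 < fst x" shows "par x:V" "Suc (fst (par x)) = fst x" "snd x <= snd (par x)"
proof -
 let ?i = "fst x - 1"
 have i: "Suc ?i = fst x" using x(2) by simp
 have "snd x <= - K ?i" using V_facts(3)[OF x(1)] K_mono[of ?i "fst x"] by force
 then obtain W where W: "W:components (- K ?i)" "snd x <= W"
  using exists_component_superset[OF _ _ V_facts(2)[OF x(1)]] V_facts(5)[OF x(1)] by (metis subset_empty)
 have "emeasure om (snd x) <= emeasure om W" using W components_facts(1)[OF cK W(1)] by (intro emeasure_mono) (auto simp: borel_open)
 hence "W:icomps (K ?i)" using W V_facts(4)[OF x(1)] unfolding icomps_def by (simp add: top_unique)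
 hence y: "(?i, W):V" unfolding V_def by simp
 have "par x = (?i, W)" by (rule par_eq[OF x(1) y]) (use i W(2) V_facts(5)[OF x(1)] in auto)
 thus "par x:V" "Suc (fst (par x)) = fst x" "snd x <= snd (par x)" using y i W(2) by auto
qed

lemma finite_level: "finite {x:V. fst x = i}"
proof (rule finite_subset)
 show "{x:V. fst x = i} <= Pair i ` icomps (K i)" unfolding V_def by (auto simp: image_iff prod_eq_iff)
qed (simp add: finite_inf_comps cK)

sublocale levelled_tree V fst par
proof
 fix x assume x: "x:V"
 show "0 < fst x ==> par x:V" "0 < fst x ==> Suc (fst (par x)) = fst x" using par_facts[OF x] by simp_all
 have "{y:V. 0 < fst y & par y = x} <= {y:V. fst y = Suc (fst x)}" using par_facts(2) by auto
 thus "finite {y:V. 0 < fst y & par y = x}" using finite_level finite_subset by blast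
 obtain W where W: "W:icomps (K (Suc (fst x)))" "W <= snd x" using inf_child[OF cK cK K_mono V_facts(7)[OF x], of "Suc (fst x)"] by auto
 have y: "(Suc (fst x), W):V" using W unfolding V_def by simp
 have "par (Suc (fst x), W) = x" by (rule par_eq[OF y x]) (use W V_facts(5)[OF y] in auto)
 thus "{y:V. 0 < fst y & par y = x} ~= {}" using y by force
qed

lemma kids_iff: "x:V ==> y:kids x \<longleftrightarrow> y:V & fst y = Suc (fst x) & snd y <= snd x"
proof
 assume x: "x:V" and y: "y:V & fst y = Suc (fst x) & snd y <= snd x"
 hence "par y = x" using par_eq[of y x] V_facts(5)[of y] by blast
 thus "y:kids x" using y unfolding kids_def by simp
next
 assume x: "x:V" and y: "y:kids x"
 thus "y:V & fst y = Suc (fst x) & snd y <= snd x" using kids[OF y] par_facts(3)[of y] by simp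
qed

lemma region:
 assumes "x:V"
 shows "open (Rg x)" "Dv x <= Rg x" "compact (Dv x)" "Dv x <= I" "Rg x <= snd x" "Rg x <= K (Suc (Suc (fst x)))" "bsupp (snd x) <= Dv x"
  "y:kids x ==> bsupp (snd y) <= Dv x" "bsupp (snd x) <= Rg x"
proof -
 note f = D_facts[OF V_facts(7)[OF assms]]
 show "open (Rg x)" unfolding Rg_def using V_facts(1)[OF assms] by (simp add: open_Int)
 show r: "Dv x <= Rg x" "compact (Dv x)" "Dv x <= I" "Rg x <= snd x" "Rg x <= K (Suc (Suc (fst x)))" using f(1,2) interior_subset unfolding Rg_def by blast+
 show b: "bsupp (snd x) <= Dv x" using f(3) unfolding blocks_def nbhd_comps_def by blast
 thus "bsupp (snd x) <= Rg x" using r(1) by blast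
 assume "y:kids x"
 hence "snd y:nbhd_comps (snd x) (K (Suc (fst x)))" using kids_iff[OF assms, of y] V_facts(7)[of y] unfolding nbhd_comps_def by auto
 thus "bsupp (snd y) <= Dv x" using f(3) unfolding blocks_def by blast
qed

lemma deep_disjoint: "x:V ==> i <= fst x ==> snd x Int K i = {}" using V_facts(3)[of x] K_mono[of i "fst x"] by blast

text \<open>A region lies beyond \<open>K (fst x)\<close> and inside
  \<open>K (Suc (Suc (fst x)))\<close>, so levels of meeting regions differ by at most one. In
  particular regions of distinct vertices with levels of equal parity are disjoint.\<close>

lemma regions_meet:
 assumes x: "x:V" and y: "y:V" and m: "Rg x Int Rg y ~= {}" shows "x = y \<or> x:kids y \<or> y:kids x"
proof -
 have s: "snd x Int snd y ~= {}" using m region(5) x y by blast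
 have far: False if "x:V" "y:V" "Rg x Int Rg y ~= {}" "Suc (Suc (fst x)) <= fst y" for x y
  using deep_disjoint[OF that(2,4)] region(6)[OF that(1)] region(5)[OF that(2)] that(3) by blast
 consider "fst x = fst y" | "fst x = Suc (fst y)" | "fst y = Suc (fst x)" | "Suc (Suc (fst x)) <= fst y" | "Suc (Suc (fst y)) <= fst x" by linarith
 thus ?thesis proof cases
  case 1 thus ?thesis using V_same_level[OF x y _ s] by simp
 next
  case 2 thus ?thesis using par_eq[OF x y _ s] x unfolding kids_def by simp
 next
  case 3 thus ?thesis using par_eq[OF y x] y s unfolding kids_def by (simp add: Int_commute)
 next
  case 4 thus ?thesis using far[OF x y m] by simp
 next
  case 5 thus ?thesis using far[OF y x] m by blast
 qed
qed

text \<open>Only the block of the parent can cross the edge of a component; this reduces the flux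
  through the component to one block.\<close>

lemma region_straddle:
 assumes x: "x:V" and y: "y:V" and n: "x~:kids y" shows "Rg y <= snd x \<or> Rg y Int snd x = {}"
proof -
 consider "fst x <= fst y" | "fst x = Suc (fst y)" | "Suc (Suc (fst y)) <= fst x" by linarith
 thus ?thesis proof cases
  case 1 thus ?thesis using V_nested[OF x y] region(5)[OF y] by blast
 next
  case 2
  hence "snd x Int snd y = {}" using par_eq[OF x y] n x unfolding kids_def by auto
  thus ?thesis using region(5)[OF y] by blast
 next
  case 3 thus ?thesis using deep_disjoint[OF x 3] region(6)[OF y] by blast
 qed
qed

lemma in_some_K: "EX i. p:interior (K i)"
proof -
 obtain i where "{p} <= K i" using K_exhausts[of "{p}"] by auto
 thus ?thesis using K_Suc[of i] by blast
qed

text \<open>Local finiteness: \<open>interior (K i)\<close> meets only blocks of level below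
  \<open>i\<close>, and these are finitely many compact sets.\<close>

lemma closed_Union_Dv:
 assumes A: "A <= V" shows "closed (UN x:A. Dv x)"
proof -
 have "open (- (UN x:A. Dv x))" proof (subst open_subopen, intro ballI)
  fix p assume p: "p:- (UN x:A. Dv x)"
  obtain i where i: "p:interior (K i)" using in_some_K by blast
  let ?F = "{x:A. fst x < i}"
  have "?F <= (UN j<i. {x:V. fst x = j})" using A by auto
  hence F: "finite ?F" using finite_level finite_subset by blast
  have "closed (UN x:?F. Dv x)" using F A compact_imp_closed[OF region(3)] by (intro closed_UN) blast+
  hence o: "open (interior (K i) Int - (UN x:?F. Dv x))" by (intro open_Int open_interior open_Compl)
  have "interior (K i) Int - (UN x:?F. Dv x) <= - (UN x:A. Dv x)" proof
   fix q assume q: "q:interior (K i) Int - (UN x:?F. Dv x)"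
   have "q~:Dv x" if x: "x:A" for x proof (cases "fst x < i")
    case False
    have xV: "x:V" using A x by blast
    hence "snd x Int K i = {}" using False by (intro deep_disjoint) auto
    thus ?thesis using q region(2,5)[OF xV] interior_subset by blast
   qed (use q x in blast)
   thus "q:- (UN x:A. Dv x)" by blast
  qed
  thus "EX T. open T & p:T & T <= - (UN x:A. Dv x)" using o p i by (intro exI[of _ "interior (K i) Int - (UN x:?F. Dv x)"]) blast
 qed
 thus ?thesis by (simp add: open_closed)
qed

lemma countable_V: "countable V"
proof (rule countable_subset)
 show "V <= (\<Union>i. {x:V. fst x = i})" by auto
 show "countable (\<Union>i. {x:V. fst x = i})" by (rule countable_UN) (simp_all add: countable_finite finite_level)
qed

subsection \<open>Circulation along one line\<close>

text \<open>Alternating signs turn conservation, a vertex equals the sum of its children, into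
  coefficients of total zero over a vertex and its children.\<close>

definition sflow :: "nat \<times> 'a set => nat \<times> 'a set => real"
 where "sflow w x = (-1) ^ Suc (fst x) * flow w x"

text \<open>The change of density common to both rounds. The supports of distinct bumps are
  disjoint, so the sum has at most one term.\<close>

definition ldens :: "nat \<times> 'a set => 'a => real"
 where "ldens w p = (SUM z:{z:V. p:bsupp (snd z)}. sflow w z * bump (snd z) p)"

abbreviation vdens :: "nat \<times> 'a set => nat \<times> 'a set => 'a => real"
 where "vdens w x p \<equiv> sflow w x * bump (snd x) p + (SUM y:kids x. sflow w y * bump (snd y) p)"

lemma sflow_values: "sflow w x:{-1, 0, 1}" using flow_values[of w x] unfolding sflow_def by (cases "even (fst x)") auto

lemma sflow_sum:
 assumes "x:V" "w:Lines" shows "sflow w x + (SUM y:kids x. sflow w y) = 0"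
proof -
 have "(SUM y:kids x. sflow w y) = (SUM y:kids x. (-1) ^ Suc (Suc (fst x)) * flow w y)" by (intro sum.cong) (simp_all add: sflow_def kids(4))
 thus ?thesis using flow_conserved[OF assms] by (simp add: sflow_def sum_distrib_left[symmetric])
qed

lemma bsupp_unique: "z:V ==> z':V ==> p:bsupp (snd z) ==> p:bsupp (snd z') ==> z = z'"
proof -
 have far: False if "z:V" "z':V" "p:bsupp (snd z)" "p:bsupp (snd z')" "fst z < fst z'" for z z'
  using V_bump(7)[OF that(1)] V_bump(2)[OF that(2)] deep_disjoint[OF that(2), of "Suc (fst z)"] that interior_subset by fastforce
 assume a: "z:V" "z':V" "p:bsupp (snd z)" "p:bsupp (snd z')"
 have "fst z = fst z'" using far[OF a] far[OF a(2,1,4,3)] nat_neq_iff by blast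
 thus "z = z'" using V_same_level[OF a(1,2)] V_bump(2)[OF a(1)] V_bump(2)[OF a(2)] a by blast
qed

lemma ldens_bound: "abs (ldens w p) <= 1/4"
proof (cases "EX z:V. p:bsupp (snd z)")
 case True
 then obtain z where z: "z:V" "p:bsupp (snd z)" by blast
 hence "{z:V. p:bsupp (snd z)} = {z}" using bsupp_unique by blast
 hence "abs (ldens w p) = abs (sflow w z) * abs (bump (snd z) p)" unfolding ldens_def by (simp add: abs_mult)
 also have "... <= 1 * (1/4)" using sflow_values[of w z] V_bump(4,5)[OF z(1), of p] by (intro mult_mono) auto
 finally show ?thesis by simp
next
 case False
 hence "{z:V. p:bsupp (snd z)} = {}" by blast
 hence "ldens w p = 0" unfolding ldens_def by (simp only: sum.empty)
 thus ?thesis by simp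
qed

text \<open>The bump of an ancestor ends before the region begins, and regions further down do not
  meet this one; so the block sees exactly the bumps of \<open>x\<close> and its children.\<close>

lemma ldens_region:
 assumes x: "x:V" and p: "p:Rg x"
 shows "ldens w p = vdens w x p"
proof -
 have xk: "x~:kids x" using kids(4)[of x x] by auto
 note f = finite_kids[OF x]
 have sub: "{z:V. p:bsupp (snd z)} <= insert x (kids x)" proof
  fix z assume "z:{z:V. p:bsupp (snd z)}"
  hence z: "z:V" "p:bsupp (snd z)" by auto
  hence "p:Rg z" using region(9) by blast
  hence "z = x \<or> x:kids z \<or> z:kids x" using regions_meet[OF z(1) x] p by blast
  moreover have False if "x:kids z" proof -
   have "p:K (fst x)" using V_bump(7)[OF z(1)] z(2) kids(4)[OF that] interior_subset by auto
   thus False using p region(5)[OF x] V_facts(3)[OF x] by blast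
  qed
  ultimately show "z:insert x (kids x)" by blast
 qed
 have "ldens w p = (SUM z:insert x (kids x). sflow w z * bump (snd z) p)" unfolding ldens_def proof (rule sum.mono_neutral_left)
  show "ALL z:insert x (kids x) - {z:V. p:bsupp (snd z)}. sflow w z * bump (snd z) p = 0" proof
   fix z assume z: "z:insert x (kids x) - {z:V. p:bsupp (snd z)}"
   hence "z:V" using x kids(1)[of z x] by blast
   thus "sflow w z * bump (snd z) p = 0" using V_bump(3)[of z p] z by simp
  qed
 qed (use f sub in auto)
 thus ?thesis using f xk by simp
qed

lemma ldens_zero:
 assumes p: "p~:(UN x:V. Dv x)" shows "ldens w p = 0"
proof -
 have "{z:V. p:bsupp (snd z)} = {}" using p region(7) by blast
 thus ?thesis unfolding ldens_def by (simp only: sum.empty)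
qed

lemma ldens_continuous: "cont (ldens w)"
proof (rule continuous_on_locally)
 fix p :: 'a
 show "EX N. open N & p:N & continuous_on N (ldens w)" proof (cases "p:(UN x:V. Dv x)")
  case True
  then obtain x where x: "x:V" "p:Rg x" using region(2) by blast
  have "continuous_on (Rg x) (%p. vdens w x p)" by (intro continuous_intros cont_subset[OF V_bump(1)[OF x(1)]] cont_subset[OF V_bump(1)[OF kids(1)]]) auto
  hence "continuous_on (Rg x) (ldens w)" by (rule continuous_on_eq) (simp add: ldens_region[OF x(1)])
  thus ?thesis using x region(1) by blast
 next
  case False
  have "continuous_on (- (UN x:V. Dv x)) (ldens w)" by (rule continuous_on_eq[OF continuous_on_const[of _ 0]]) (simp add: ldens_zero)
  thus ?thesis using False open_Compl[OF closed_Union_Dv[OF subset_refl]] by blast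
 qed
qed

lemma line_block:
 assumes x: "x:V" and w: "w:Lines"
 shows "EX g. hfamily g & sfamily (Dv x) g & (ALL p. g 0 p = p) &
  (ALL a. pushes om (g a) (%p. 1) (%p. 1 + clip a * vdens w x p))"
proof -
 let ?C = "{W:icomps (K (Suc (fst x))). W <= snd x}"
 have N: "nbhd_comps (snd x) (K (Suc (fst x))) = insert (snd x) ?C" unfolding nbhd_comps_def ..
 have fC: "finite ?C" using finite_inf_comps[OF cK] by simp
 \<comment> \<open>The bump has integral 1, hence nonempty support in \<open>snd x\<close> inside
   the next compact set; so \<open>snd x\<close> is not a component outside that set.\<close>
 have xC: "snd x~:?C" proof
  assume c: "snd x:?C"
  have "bsupp (snd x) ~= {}" proof
   assume "bsupp (snd x) = {}"
   hence "bump (snd x) = (%p. 0)" using V_bump(3)[OF x] by auto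
   thus False using V_bump(6)[OF x] by simp
  qed
  thus False using c V_bump(2,7)[OF x] icompsD(3)[OF cK, of "snd x" "Suc (fst x)"] interior_subset by blast
 qed
 have bij: "bij_betw snd (kids x) ?C" proof (rule bij_betwI[where g="Pair (Suc (fst x))"])
  show "snd:kids x \<rightarrow> ?C" using kids_iff[OF x] V_facts(7) by (intro Pi_I) auto
  show "Pair (Suc (fst x)):?C \<rightarrow> kids x" using kids_iff[OF x] unfolding V_def by (intro Pi_I) auto
 qed (use kids(4) in "auto simp: prod_eq_iff")
 define ep where "ep W = (if W = snd x then sflow w x else sflow w (Suc (fst x), W))" for W
 have ek: "ep (snd y) = sflow w y" if y: "y:kids x" for y proof -
  have "snd y ~= snd x" using bij y xC unfolding bij_betw_def by blast
  thus ?thesis unfolding ep_def using kids(4)[OF y] by (metis prod.collapse)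
 qed
 have sum: "(SUM W:insert (snd x) ?C. ep W * F W) = sflow w x * F (snd x) + (SUM y:kids x. sflow w y * F (snd y))" for F :: "'a set => real" proof -
  have "(SUM W:?C. ep W * F W) = (SUM y:kids x. ep (snd y) * F (snd y))" using sum.reindex_bij_betw[OF bij, of "%W. ep W * F W"] by simp
  also have "... = (SUM y:kids x. sflow w y * F (snd y))" by (intro sum.cong) (simp_all add: ek)
  finally show ?thesis using fC xC by (simp add: ep_def)
 qed
 have "(SUM W:insert (snd x) ?C. ep W) = 0" using sum[of "%_. 1"] sflow_sum[OF x w] by simp
 moreover have "ep W:{-1, 0, 1}" for W unfolding ep_def using sflow_values by simp
 ultimately obtain g where "block (insert (snd x) ?C) ep (Dv x) g" using D_facts(3)[OF V_facts(7)[OF x]] unfolding blocks_def N by blast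
 thus ?thesis unfolding block_def sum by blast
qed

end

section \<open>Measure-preserving families with prescribed flux\<close>

context exhausted_manifold
begin

text \<open>The family is the identity at the parameter \<open>z\<close>, and \<open>Ph q x\<close>
  is its flux through the component of \<open>x\<close>. The last clause says that a component can
  only be moved by the block of its parent.\<close>

definition ffamily :: "'p => (nat \<times> 'a set) set => ('p::topological_space => 'a => 'a) => ('p => nat \<times> 'a set => real) => bool"
 where "ffamily z A G Ph \<longleftrightarrow> hfamily G & sfamily (UN x:A. Dv x) G & (ALL p. G z p = p) &
  (ALL q. pushes om (G q) (%p. 1) (%p. 1)) & (ALL q. ALL x:V. has_flux om (G q) (snd x) (Ph q x)) &
  (ALL q. ALL x:V. fst x = 0 \<or> par x~:A --> G q ` snd x = snd x)"

lemma ffamily_id: "ffamily z A (%q p. p) (%q x. 0)" unfolding ffamily_def by (simp add: hfamily_id sfamily_def pushes_def) (simp add: has_flux_invariant)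

lemma ffamily_cong: "ffamily z A G Ph ==> (!!q x. x:V ==> Ph q x = Ps q x) ==> ffamily z A G Ps" unfolding ffamily_def by simp

lemma ffamily_const:
 assumes "ffamily z A G Ph" "cont q" "q z' = z"
 shows "ffamily z' A (%p. G (q p)) (%p. Ph (q p))" using assms hfamily_const[OF _ assms(2), of G] unfolding ffamily_def sfamily_def by simp

lemma ffamily_comp:
 assumes g: "ffamily z A G Ph" and h: "ffamily z A H Ps"
 shows "ffamily z A (%q p. G q (H q p)) (%q x. Ph q x + Ps q x)"
proof -
 have G: "hfamily G" "!!q. pushes om (G q) (%p. 1) (%p. 1)" and H: "hfamily H" "!!q. pushes om (H q) (%p. 1) (%p. 1)"
  using g h unfolding ffamily_def by simp_all
 have fl: "has_flux om (%p. G q (H q p)) (snd x) (Ph q x + Ps q x)" if x: "x:V" for q x proof (rule has_flux_comp[OF sets_eq hfamilyD(7,3)[OF G(1)]])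
  show "pushes om (inv (G q)) (%x. 1) (%x. 1)" by (rule pushes_inv[OF G(2) hfamilyD(3)[OF G(1)] hfamily_borel(2)[OF G(1)]])
  show b: "snd x:sets borel" using V_facts(1)[OF x] by (rule borel_open)
  show "H q ` snd x:sets borel" by (rule hfamily_borel(1)[OF H(1) b])
 qed (use g h x in "simp_all add: ffamily_def")
 have "pushes om (%p. G q (H q p)) (%p. 1) (%p. 1)" for q by (rule pushes_comp[OF H(2) G(2) hfamily_borel(1)[OF H(1)]])
 moreover have "(%p. G q (H q p)) ` snd x = snd x" if x: "x:V" "fst x = 0 \<or> par x~:A" for q x proof -
  have "G q ` snd x = snd x" "H q ` snd x = snd x" using g h x unfolding ffamily_def by blast+
  thus ?thesis unfolding image_image[symmetric, of "G q" "H q"] by simp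
 qed
 moreover have "sfamily (UN x:A. Dv x) (%q p. G q (H q p))" "ALL p. G z (H z p) = p" using g h unfolding ffamily_def sfamily_def by simp_all
 ultimately show ?thesis unfolding ffamily_def using hfamily_comp[OF G(1) H(1)] fl by blast
qed

lemma ffamily_fold:
 assumes "!!j. j:set js ==> ffamily z A (G j) (Ph j)"
 shows "ffamily z A (%q. foldr (%j. G j q) js) (%q x. SUM j<-js. Ph j q x)" using assms
proof (induction js)
 case Nil show ?case using ffamily_id by (simp add: id_def)
next
 case (Cons j js)
 hence "ffamily z A (%q p. G j q (foldr (%j. G j q) js p)) (%q x. Ph j q x + (SUM j<-js. Ph j q x))" by (intro ffamily_comp) simp_all
 thus ?case by (simp add: comp_def)
qed

lemma ffamily_local:
 assumes z: "!!p. G z p = p" and "!!q. EX P G' Ph'. open P & q:P & ffamily z A G' Ph' & (ALL r:P. G r = G' r & (ALL x. Ph r x = Ph' r x))"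
 shows "ffamily z A G Ph"
proof -
 have "hfamily G" proof (rule hfamily_local)
  fix q obtain P G' Ph' where "open P" "q:P" "ffamily z A G' Ph'" "ALL r:P. G r = G' r & (ALL x. Ph r x = Ph' r x)" using assms(2)[of q] by (elim exE conjE)
  thus "EX P G'. open P & q:P & hfamily G' & (ALL r:P. G r = G' r)" unfolding ffamily_def by (intro exI[of _ P] exI[of _ G']) simp
 qed
 moreover have "(ALL p. p~:(UN x:A. Dv x) --> G q p = p) & pushes om (G q) (%p. 1) (%p. 1) &
  (ALL x:V. has_flux om (G q) (snd x) (Ph q x)) & (ALL x:V. fst x = 0 \<or> par x~:A --> G q ` snd x = snd x)" for q
 proof -
  obtain P G' Ph' where "q:P" and e: "ffamily z A G' Ph'" and "ALL r:P. G r = G' r & (ALL x. Ph r x = Ph' r x)" using assms(2)[of q] by (elim exE conjE)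
  hence q: "G q = G' q" "ALL x. Ph q x = Ph' q x" by blast+
  show ?thesis unfolding q(1) q(2)[rule_format] using e unfolding ffamily_def sfamily_def by blast
 qed
 ultimately show ?thesis using z unfolding ffamily_def sfamily_def by blast
qed

text \<open>For two uses: with \<open>y0\<close> outside \<open>A\<close> the whole component is
  invariant; with \<open>y0\<close> the parent of \<open>x\<close>, what lies outside the block of
  the parent is.\<close>

lemma block_image:
 assumes g: "hfamily G" and s: "sfamily (UN x:A. Dv x) G" and A: "A <= V"
  and inv: "!!y p. y:A ==> p:Dv y ==> G q p:Rg y" and x: "x:V" "!!y. y:A ==> y ~= y0 ==> x~:kids y"
  and y0: "!!p. y0:A ==> p:Dv y0 \<longleftrightarrow> G q p:Dv y0"
 shows "G q ` (snd x - (if y0:A then Dv y0 else {})) = snd x - (if y0:A then Dv y0 else {})"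
proof -
 define E where "E = (if y0:A then Dv y0 else {})"
 have eE: "p:E \<longleftrightarrow> G q p:E" for p unfolding E_def using y0[of p] by (cases "y0:A") simp_all
 have "G q p:snd x - E \<longleftrightarrow> p:snd x - E" for p proof (cases "p:E")
  case True thus ?thesis using eE[of p] by blast
 next
  case False
  have "G q p:snd x \<longleftrightarrow> p:snd x" proof (cases "p:(UN x:A. Dv x)")
   case True
   then obtain y where y: "y:A" "p:Dv y" by (rule UN_E)
   have "y ~= y0" using False y unfolding E_def by auto
   hence "Rg y <= snd x \<or> Rg y Int snd x = {}" using region_straddle[OF x(1) subsetD[OF A y(1)] x(2)[OF y(1)]] by blast
   thus ?thesis using inv[OF y] subsetD[OF region(2)[OF subsetD[OF A y(1)]] y(2)] by blast
  next
   case False thus ?thesis using s unfolding sfamily_def by simp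
  qed
  thus ?thesis using False eE[of p] by blast
 qed
 hence e: "G q -` (snd x - E) = snd x - E" by blast
 have "G q ` (G q -` (snd x - E)) = snd x - E" by (rule surj_image_vimage_eq[OF bij_is_surj[OF hfamilyD(3)[OF g]]])
 thus ?thesis unfolding e unfolding E_def .
qed

text \<open>One round, with the blocks of the group whose level has the parity \<open>b\<close>.
  Their regions are disjoint, so the blocks can be moved together, and either parity reaches the
  same density \<open>ldens w\<close>.\<close>

lemma line_half:
 assumes w: "w:Lines"
 shows "EX G. hfamily G & sfamily (UN x:grp (par w). Dv x) G & (ALL p. G (0::real) p = p) &
  (ALL a. pushes om (G a) (%p. 1) (%p. 1 + clip a * ldens w p)) &
  (ALL a. ALL x:V. fst x = 0 \<or> par x~:grp (par w) --> G a ` snd x = snd x) &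
  (ALL a. ALL x:V. has_bochner_integral om (%p. (1 + clip a * ldens w p) * (ind (G a ` snd x) p - ind (snd x) p))
   (if 0 < fst x & even (fst (par x)) = b then - (clip a * sflow w x) else 0))"
proof -
 define A where "A = {x:grp (par w). even (fst x) = b}"
 have AV: "A <= V" unfolding A_def grp_def by auto
 obtain g where g: "!!x. x:A ==> hfamily (g x)" "!!x. x:A ==> sfamily (Dv x) (g x)" "!!x p. x:A ==> g x 0 p = p"
  "!!x a. x:A ==> pushes om (g x a) (%p. 1) (%p. 1 + clip a * vdens w x p)"
 proof -
  have "ALL x:A. EX g. hfamily g & sfamily (Dv x) g & (ALL p. g 0 p = p) &
   (ALL a. pushes om (g a) (%p. 1) (%p. 1 + clip a * vdens w x p))"
   by (intro ballI line_block[OF subsetD[OF AV] w])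
  then obtain g where "ALL x:A. hfamily (g x) & sfamily (Dv x) (g x) & (ALL p. g x 0 p = p) &
   (ALL a. pushes om (g x a) (%p. 1) (%p. 1 + clip a * vdens w x p))"
   by (rule bchoice[THEN exE])
  thus thesis by (intro that[of g]) simp_all
 qed
 have disj: "Rg x Int Rg y = {}" if "x:A" "y:A" "x ~= y" for x y proof (rule ccontr)
  assume "Rg x Int Rg y ~= {}"
  hence "x:kids y \<or> y:kids x" using regions_meet[of x y] AV that by blast
  hence "fst x = Suc (fst y) \<or> fst y = Suc (fst x)" using kids(4) by blast
  thus False using that unfolding A_def by auto
 qed
 note rA = region[OF subsetD[OF AV]]
 have cl: "closed (UN x:A. Dv x)" by (rule closed_Union_Dv[OF AV])
 have "EX G. hfamily G & sfamily (UN x:A. Dv x) G & (ALL x:A. ALL p:Rg x. ALL a. G a p = g x a p)" by (rule product_family[OF g(1,2) rA(1,2) disj cl])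
 then obtain G where G: "hfamily G" "sfamily (UN x:A. Dv x) G" "!!x p a. x:A ==> p:Rg x ==> G a p = g x a p" by blast
 have GD: "G a p = g x a p" "p:Dv x \<longleftrightarrow> G a p:Dv x" if x: "x:A" and p: "p:Dv x \<or> G a p:Dv x" for x p a proof -
  have "p:Rg x" proof (rule ccontr)
   assume n: "p~:Rg x"
   hence "p~:Dv x" "G a p:Dv x" using p rA(2)[OF x] by blast+
   hence "p:(UN x:A. Dv x)" using G(2) unfolding sfamily_def by metis
   then obtain y where y: "y:A" "p:Dv y" by blast
   hence "G a p:Dv y" using G(3)[OF y(1)] rA(2)[OF y(1)] sfamily_image(2)[OF g(1,2)[OF y(1)], of p a] by auto
   hence "y = x" using disj[OF y(1) x] rA(2)[OF y(1)] rA(2)[OF x] \<open>G a p:Dv x\<close> by blast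
   thus False using y \<open>p~:Dv x\<close> by simp
  qed
  thus e: "G a p = g x a p" using G(3)[OF x] by simp
  thus "p:Dv x \<longleftrightarrow> G a p:Dv x" using sfamily_image(2)[OF g(1,2)[OF x]] by simp
 qed
 have GDi: "p:Dv x \<longleftrightarrow> G a p:Dv x" if "x:A" for x p a using GD(2)[OF that] by blast
 \<comment> \<open>Every bump with nonzero coefficient belongs to a block of this round: that of its
   own vertex if the parity is right, and otherwise that of the parent, which is in the group by
   \<open>flow_grp_kid\<close>.\<close>
 have off0: "ldens w p = 0" if p: "p~:(UN x:A. Dv x)" for p unfolding ldens_def proof (rule sum.neutral, intro ballI)
  fix z assume "z:{z:V. p:bsupp (snd z)}"
  hence z: "z:V" "p:bsupp (snd z)" by auto
  show "sflow w z * bump (snd z) p = 0" proof (cases "sflow w z = 0")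
   case False
   hence fz: "flow w z ~= 0" unfolding sflow_def by simp
   have "EX x:A. p:Dv x" proof (cases "even (fst z) = b")
    case True
    hence "z:A" unfolding A_def using flow_grp[OF w z(1) fz] by simp
    thus ?thesis using region(7)[OF z(1)] z(2) by blast
   next
    case odd: False
    have l: "0 < fst z" using flow_root[OF _ w, of z] fz by auto
    note k = kid_par[OF z(1) l] and pz = par_facts[OF z(1) l]
    have "even (fst (par z)) = b" using even_Suc[of "fst (par z)"] odd unfolding pz(2) by blast
    hence "par z:A" unfolding A_def using flow_grp_kid[OF w pz(1) k fz] by simp
    thus ?thesis using region(8)[OF pz(1) k] z(2) by blast
   qed
   thus ?thesis using p by blast
  qed simp
 qed
 have mes: "(%p. 1 + clip a * ldens w p):borel_measurable borel" for a by (intro borel_measurable_continuous_onI continuous_intros ldens_continuous)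
 have psh: "pushes om (G a) (%p. 1) (%p. 1 + clip a * ldens w p)" for a
 proof (rule pushes_product[OF sets_eq, of A Dv "%x. g x a" _ "%x p. 1 + clip a * vdens w x p"])
  show "countable A" by (rule countable_subset[OF AV countable_V])
  show "disjoint_family_on Dv A" unfolding disjoint_family_on_def using disj rA(2) by blast
  show "G a p = p" if "p~:(UN x:A. Dv x)" for p using that G(2) unfolding sfamily_def by blast
  show "1 + clip a * ldens w p = 1" if "p~:(UN x:A. Dv x)" for p using off0[OF that] by simp
  fix x assume x: "x:A"
  hence xV: "x:V" using AV by blast
  show "Dv x:sets borel" using rA(3)[OF x] by (rule borel_compact)
  show "pushes om (g x a) (%p. 1) (%p. 1 + clip a * vdens w x p)" by (rule g(4)[OF x])
  show "g x a ` Dv x <= Dv x" using sfamily_image(2)[OF g(1,2)[OF x]] by blast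
  show "G a p = g x a p" if "p:Dv x" for p using GD(1)[OF x] that by blast
  show "g x a ` B:sets borel" if "B:sets borel" for B by (rule hfamily_borel(1)[OF g(1)[OF x] that])
  show "(%p. 1 + clip a * vdens w x p):borel_measurable borel"
   by (intro borel_measurable_continuous_onI continuous_intros V_bump(1)[OF xV] V_bump(1)[OF kids(1)])
  show "1 + clip a * vdens w x p = 1 + clip a * ldens w p" if "p:Dv x" for p using ldens_region[OF xV, of p w] rA(2)[OF x] that by (simp add: subsetD)
 qed (use mes in simp_all)
 have im: "G a ` (snd x - (if y0:A then Dv y0 else {})) = snd x - (if y0:A then Dv y0 else {})"
  if x: "x:V" "!!y. y:A ==> y ~= y0 ==> x~:kids y" for a x y0
  by (rule block_image[OF G(1,2) AV _ x GDi]) (use GD(2) rA(2) in blast)+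
 have keep: "G a ` snd x = snd x" if x: "x:V" "fst x = 0 \<or> par x~:A" for a x proof -
  have "x~:kids y" if "y:A" for y using x(2) that kids(2,3)[of x y] by auto
  \<comment> \<open>The empty set is not a component, so this pair serves as a vertex outside
    \<open>A\<close>.\<close>
  moreover have "(undefined, {})~:A" using AV V_facts(5) by force
  ultimately show ?thesis using im[OF x(1), of "(undefined, {})" a] by simp
 qed
 have straddle: "has_bochner_integral om (%p. (1 + clip a * ldens w p) * (ind (G a ` snd x) p - ind (snd x) p))
   (- (clip a * sflow w x))" if x: "x:V" "0 < fst x" and y: "par x:A" for a x
 proof -
  let ?y = "par x"
  note k = kid_par[OF x] and yV = subsetD[OF AV y]
  have "x~:kids y'" if "y' ~= ?y" for y' using kids(3)[of x y'] that by blast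
  hence "G a ` (snd x - (if ?y:A then Dv ?y else {})) = snd x - (if ?y:A then Dv ?y else {})" by (intro im x(1))
  hence "G a ` (snd x - Dv ?y) = snd x - Dv ?y" unfolding if_P[OF y] .
  moreover have "G a ` (snd x Int Dv ?y) <= Dv ?y" using GDi[OF y] by blast
  moreover have bU: "snd x:sets borel" using V_facts(1)[OF x(1)] by (rule borel_open)
  moreover have "G a ` (snd x Int Dv ?y):sets borel" using bU borel_compact[OF region(3)[OF yV]] by (intro hfamily_borel(1)[OF G(1)] sets.Int)
  moreover have "abs (clip a * ldens w p) <= 1" for p
   using mult_mono[of "abs (clip a)" 1 "abs (ldens w p)" "1/4"] clip_bounds(3)[of a] ldens_bound[of w p] by (simp add: abs_mult)
  moreover have "(%p. clip a * ldens w p):borel_measurable borel" by (intro borel_measurable_continuous_onI continuous_intros ldens_continuous)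
  ultimately have "has_bochner_integral om (%p. (1 + clip a * ldens w p) * (ind (G a ` snd x) p - ind (snd x) p))
   (- (\<integral>p. ind (snd x Int Dv ?y) p * (clip a * ldens w p) \<partial>om))"
   using straddle_integral[OF radon psh[of a] _ _ region(3)[OF yV]] by blast
  \<comment> \<open>Inside \<open>snd x\<close> the bump of the parent has already ended and the
    bumps of the siblings live in other components; only the bump of \<open>x\<close> is left, and
    its integral is 1.\<close>
  moreover have "ind (snd x Int Dv ?y) p * (clip a * ldens w p) = clip a * sflow w x * bump (snd x) p" for p proof (cases "p:snd x Int Dv ?y")
   case True
   have "bump (snd ?y) p = 0" using True V_bump(7)[OF yV] V_facts(3)[OF x(1)] par_facts(2)[OF x] interior_subset by (intro V_bump(3)[OF yV]) auto
   moreover have "(SUM z:kids ?y - {x}. sflow w z * bump (snd z) p) = 0" proof (rule sum.neutral, intro ballI)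
    fix z assume z: "z:kids ?y - {x}"
    hence zV: "z:V" "fst z = fst x" using kids(1,4)[of z ?y] kids(4)[OF k] by auto
    hence "p~:bsupp (snd z)" using V_same_level[OF zV(1) x(1) zV(2)] z True V_bump(2)[OF zV(1)] by blast
    thus "sflow w z * bump (snd z) p = 0" using V_bump(3)[OF zV(1)] by simp
   qed
   moreover have "p:Rg ?y" using True region(2)[OF yV] by blast
   ultimately have "ldens w p = sflow w x * bump (snd x) p"
    using ldens_region[OF yV] sum.remove[OF finite_kids[OF yV] k, of "%z. sflow w z * bump (snd z) p"] by simp
   thus ?thesis using True by simp
  next
   case False
   have "p~:bsupp (snd x)" using False V_bump(2)[OF x(1)] region(8)[OF yV k] by blast
   thus ?thesis using False V_bump(3)[OF x(1)] by simp
  qed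
  ultimately show ?thesis using V_bump(6)[OF x(1)] by simp
 qed
 have sub: "(UN x:A. Dv x) <= (UN x:grp (par w). Dv x)" unfolding A_def by blast
 show ?thesis proof (rule exI[of _ G], intro conjI allI ballI impI)
  show "sfamily (UN x:grp (par w). Dv x) G" using G(2) sub unfolding sfamily_def by blast
  show "G 0 p = p" for p proof (cases "p:(UN x:A. Dv x)")
   case True
   then obtain x where x: "x:A" "p:Dv x" by (rule UN_E)
   show ?thesis using GD(1)[OF x(1), of p 0] g(3)[OF x(1)] x(2) by simp
  qed (use G(2) in "simp add: sfamily_def")
  show "G a ` snd x = snd x" if "x:V" "fst x = 0 \<or> par x~:grp (par w)" for a x using keep[OF that(1)] that(2) unfolding A_def by blast
  fix a x assume x: "x:V"
  show "has_bochner_integral om (%p. (1 + clip a * ldens w p) * (ind (G a ` snd x) p - ind (snd x) p))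
   (if 0 < fst x & even (fst (par x)) = b then - (clip a * sflow w x) else 0)"
  proof (cases "0 < fst x & par x:A")
   case True thus ?thesis using straddle[OF x, of a] unfolding A_def by simp
  next
   case False
   hence "fst x = 0 \<or> par x~:A" by simp
   hence "G a ` snd x = snd x" by (rule keep[OF x])
   moreover have "sflow w x = 0" if l: "0 < fst x" "even (fst (par x)) = b"
    using False l flow_grp_kid[OF w par_facts(1)[OF x l(1)] kid_par[OF x l(1)]] unfolding A_def sflow_def by auto
   ultimately show ?thesis by (simp add: has_bochner_integral_zero)
  qed
 qed (fact G(1) psh)+
qed

text \<open>The two rounds reach the same density, so \<open>inv (H a)\<close> after
  \<open>G a\<close> preserves the measure. Each component is straddled in one round only, and the
  sign of that round cancels the sign in \<open>sflow\<close>.\<close>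

lemma line_family:
 assumes w: "w:Lines"
 shows "EX h. ffamily (0::real) (grp (par w)) h (%a x. clip a * flow w x)"
proof -
 obtain G where G: "hfamily G" "sfamily (UN x:grp (par w). Dv x) G" "ALL p. G (0::real) p = p"
  "ALL a. pushes om (G a) (%p. 1) (%p. 1 + clip a * ldens w p)" "ALL a. ALL x:V. fst x = 0 \<or> par x~:grp (par w) --> G a ` snd x = snd x"
  "ALL a. ALL x:V. has_bochner_integral om (%p. (1 + clip a * ldens w p) * (ind (G a ` snd x) p - ind (snd x) p))
   (if 0 < fst x & even (fst (par x)) = True then - (clip a * sflow w x) else 0)"
  using line_half[OF w, of True] by (elim exE conjE)
 obtain H where H: "hfamily H" "sfamily (UN x:grp (par w). Dv x) H" "ALL p. H (0::real) p = p"
  "ALL a. pushes om (H a) (%p. 1) (%p. 1 + clip a * ldens w p)" "ALL a. ALL x:V. fst x = 0 \<or> par x~:grp (par w) --> H a ` snd x = snd x"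
  "ALL a. ALL x:V. has_bochner_integral om (%p. (1 + clip a * ldens w p) * (ind (H a ` snd x) p - ind (snd x) p))
   (if 0 < fst x & even (fst (par x)) = False then - (clip a * sflow w x) else 0)"
  using line_half[OF w, of False] by (elim exE conjE)
 note hi = hfamily_inv[OF H(1)]
 let ?h = "%a p. inv (H a) (G a p)"
 have fl: "has_flux om (?h a) (snd x) (clip a * flow w x)" if x: "x:V" for a x proof -
  let ?c = "%b. if 0 < fst x & even (fst (par x)) = b then - (clip a * sflow w x) else 0"
  have b: "snd x:sets borel" using V_facts(1)[OF x] by (rule borel_open)
  have "has_flux om (?h a) (snd x) (?c False - ?c True)" proof (rule has_flux_quotient[OF sets_eq hfamilyD(6,3)[OF H(1)] H(4)[rule_format]])
   show "(%p. 1 + clip a * ldens w p):borel_measurable borel" by (intro borel_measurable_continuous_onI continuous_intros ldens_continuous)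
   fix p show "0 <= 1 + clip a * ldens w p"
    using mult_mono[of "abs (clip a)" 1 "abs (ldens w p)" "1/4"] clip_bounds(3)[of a] ldens_bound[of w p] by (simp add: abs_mult[symmetric])
  qed (use hfamily_borel(1)[OF H(1) b] hfamily_borel(1)[OF G(1) b] G(6) H(6) x in simp_all)
  moreover have "?c False - ?c True = clip a * flow w x" proof (cases "0 < fst x")
   case True
   have "even (fst x) \<longleftrightarrow> odd (fst (par x))" using even_Suc[of "fst (par x)"] unfolding par_facts(2)[OF x True] .
   thus ?thesis using True by (cases "even (fst x)") (simp_all add: sflow_def)
  qed (use flow_root[OF _ w, of x] in simp)
  ultimately show ?thesis by (simp only:)
 qed
 have ps: "pushes om (?h a) (%p. 1) (%p. 1)" for a
  by (rule pushes_comp[OF G(4)[rule_format] pushes_inv[OF H(4)[rule_format] hfamilyD(3)[OF H(1)] hfamily_borel(2)[OF H(1)]]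
   hfamily_borel(1)[OF G(1)]])
 have keep: "?h a ` snd x = snd x" if x: "x:V" "fst x = 0 \<or> par x~:grp (par w)" for a x proof -
  have "inv (H a) ` H a ` snd x = snd x" by (rule image_inv_f_f[OF bij_is_inj[OF hfamilyD(3)[OF H(1)]]])
  moreover have "G a ` snd x = snd x" "H a ` snd x = snd x" using G(5) H(5) x by blast+
  ultimately show ?thesis unfolding image_image[symmetric, of "inv (H a)" "G a"] by simp
 qed
 have sp: "sfamily (UN x:grp (par w). Dv x) ?h" using G(2) sfamily_image(1)[OF H(1,2)] unfolding sfamily_def by simp
 have "?h 0 p = p" for p using G(3) H(3) hfamilyD(4)[OF H(1), of 0 p] by simp
 thus ?thesis unfolding ffamily_def using hfamily_comp[OF hi G(1)] sp ps fl keep by (intro exI[of _ ?h]) simp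
qed

text \<open>The part of \<open>a\<close> between the truncations at \<open>s\<close> and
  \<open>s + 1\<close>. These parts have size at most 1, depend continuously on \<open>a\<close>,
  and sum to \<open>a\<close>.\<close>

definition step :: "nat => real => real"
 where "step s a = max (- real (Suc s)) (min (real (Suc s)) a) - max (- real s) (min (real s) a)"

lemma step: "abs (step s a) <= 1" "abs (a) <= real s ==> step s a = 0" "cont (step s)"
proof -
 show "cont (step s)" unfolding step_def by (intro continuous_intros)
qed (auto simp: step_def max_def min_def)

lemma step_sum: "abs (a) <= real N ==> (SUM s<-[0..<N]. step s a) = a"
proof -
 assume a: "abs (a) <= real N"
 have "(SUM s<-[0..<N]. step s a) = max (- real N) (min (real N) a)" unfolding step_def by (induction N) simp_all
 thus ?thesis using a by (simp add: max_def min_def) linarith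
qed

text \<open>The amount \<open>a\<close> is moved in steps of size at most 1. Steps with index at
  least the modulus of \<open>a\<close> vanish, so locally in \<open>a\<close> the number of steps
  can be taken constant although it depends on \<open>a\<close>.\<close>

lemma line_family_real:
 assumes w: "w:Lines"
 shows "EX h. ffamily (0::real) (grp (par w)) h (%a x. a * flow w x)"
proof -
 obtain h where h: "ffamily (0::real) (grp (par w)) h (%a x. clip a * flow w x)" using line_family[OF w] by blast
 define R where "R N a = foldr (%s. h (step s a)) [0..<N]" for N a
 have R: "ffamily 0 (grp (par w)) (R N) (%a x. SUM s<-[0..<N]. clip (step s a) * flow w x)" for N
  unfolding R_def by (rule ffamily_fold, rule ffamily_const[OF h step(3)]) (simp add: step(2))
 have h0: "h 0 = id" using h unfolding ffamily_def by auto
 have RN: "R N a = R M a" if "abs (a) <= real M" "M <= N" for M N a proof -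
  have "foldr (%s. h (step s a)) ss = id" if "ALL s:set ss. M <= s" for ss
   using that by (induction ss) (use \<open>abs (a) <= real M\<close> step(2)[of a] in "auto simp: h0 fun_eq_iff")
  hence "foldr (%s. h (step s a)) [M..<N] p = p" for p by simp
  moreover have "[0..<N] = [0..<M] @ [M..<N]" using upt_add_eq_append[of 0 M "N - M"] that(2) by simp
  ultimately show ?thesis unfolding R_def by (simp only: fun_eq_iff foldr_append)  simp
 qed
 have "ffamily 0 (grp (par w)) (%a. R (nat \<lceil>abs (a)\<rceil>) a) (%a x. a * flow w x)" proof (rule ffamily_local)
  show "R (nat \<lceil>abs (0::real)\<rceil>) 0 p = p" for p by (simp add: R_def)
  fix q :: real
  let ?N = "Suc (nat \<lceil>abs (q)\<rceil>)"
  have "abs (q) < real ?N" using le_of_int_ceiling[of "abs (q)"] by linarith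
  moreover have "R (nat \<lceil>abs (r)\<rceil>) r = R ?N r & (ALL x. r * flow w x = (SUM s<-[0..<?N]. clip (step s r) * flow w x))" if r: "abs (r) < real ?N" for r
  proof
   show "R (nat \<lceil>abs (r)\<rceil>) r = R ?N r" by (rule RN[symmetric]) (use r in linarith)+
   have "(SUM s<-[0..<?N]. clip (step s r) * flow w x) = (SUM s<-[0..<?N]. step s r) * flow w x" for x by (simp only: clip_id[OF step(1)] sum_list_mult_const)
   thus "ALL x. r * flow w x = (SUM s<-[0..<?N]. clip (step s r) * flow w x)" using step_sum[of r ?N] r by simp
  qed
  moreover have "open {r :: real. abs (r) < real ?N}" by (intro open_Collect_less continuous_intros)
  ultimately show "EX P G' Ph'. open P & q:P & ffamily 0 (grp (par w)) G' Ph' &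
    (ALL r:P. R (nat \<lceil>abs (r)\<rceil>) r = G' r & (ALL x. r * flow w x = Ph' r x))"
   using R[of ?N] by (intro exI[of _ "{r. abs (r) < real ?N}"] exI[of _ "R ?N"] exI[of _ "%a x. SUM s<-[0..<?N]. clip (step s a) * flow w x"]) blast
 qed
 thus ?thesis by blast
qed

lemma group_family:
 assumes v: "v:V"
 shows "EX G. ffamily (%_. 0) (grp v) G (%p x. SUM w:lines v. p w * flow w x)"
proof -
 obtain ws where ws: "set ws = lines v" "distinct ws" using finite_distinct_list[OF finite_lines[OF v]] by blast
 have "ALL w:lines v. EX h. ffamily (0::real) (grp v) h (%a x. a * flow w x)" proof
  fix w assume "w:lines v"
  thus "EX h. ffamily (0::real) (grp v) h (%a x. a * flow w x)" using line_family_real[of w] unfolding lines_kid by simp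
 qed
 then obtain h where h: "ALL w:lines v. ffamily (0::real) (grp v) (h w) (%a x. a * flow w x)" by (rule bchoice[THEN exE])
 have "ffamily (%_. 0) (grp v) (%q. foldr (%w. h w (q w)) ws) (%q x. SUM w<-ws. q w * flow w x)"
  by (rule ffamily_fold, rule ffamily_const) (use h ws(1) in "auto intro: continuous_on_product_coordinates")
 moreover have "(SUM w<-ws. f w) = sum f (lines v)" for f :: "nat \<times> 'a set => real" using sum_list_distinct_conv_sum_set[OF ws(2), of f] ws(1) by simp
 ultimately show ?thesis by auto
qed

text \<open>Groups of one colour have disjoint open regions, so their families form a locally finite
  product. At most one of these groups contains the parent of \<open>x\<close>, and it alone
  accounts for the flux.\<close>

lemma colour_family:
 "EX G. ffamily (%_. 0) V G (%p x. SUM v:{v:V. col v = c & 0 < fst x & par x:grp v}. SUM w:lines v. p w * flow w x)"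
proof -
 define J where "J = {v:V. col v = c}"
 have "ALL v:J. EX G. ffamily (%_. 0) (grp v) G (%p x. SUM w:lines v. p w * flow w x)" using group_family unfolding J_def by blast
 then obtain g where gf: "ALL v:J. ffamily (%_. 0) (grp v) (g v) (%p x. SUM w:lines v. p w * flow w x)" by (rule bchoice[THEN exE])
 define E where "E v = (UN x:grp v. Dv x)" for v
 define W where "W v = (UN x:grp v. Rg x)" for v
 have g: "hfamily (g v)" "sfamily (E v) (g v)" "g v (%_. 0) p = p" "pushes om (g v q) (%p. 1) (%p. 1)"
  "x:V ==> has_flux om (g v q) (snd x) (SUM w:lines v. q w * flow w x)" "x:V ==> fst x = 0 \<or> par x~:grp v ==> g v q ` snd x = snd x"
  if "v:J" for v p q x using gf that unfolding ffamily_def E_def by blast+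
 have gV: "grp v <= V" for v unfolding grp_def by blast
 have W: "open (W v)" "E v <= W v" for v unfolding W_def E_def using region(1,2)[OF subsetD[OF gV]] by blast+
 have disj: "W u Int W v = {}" if uv: "u:J" "v:J" "u ~= v" for u v proof (rule ccontr)
  have c: "col u = col v" using uv unfolding J_def by simp
  assume "W u Int W v ~= {}"
  then obtain x y where xy: "x:grp u" "y:grp v" "Rg x Int Rg y ~= {}" unfolding W_def by blast
  hence V: "x:V" "y:V" using gV by blast+
  from regions_meet[OF V xy(3)] show False
   using grp_col[OF V(1) xy(1) _ c] grp_col_kid[OF V(2) _ xy(1,2) c] grp_col_kid[OF V(1) _ xy(2,1) c[symmetric]] xy uv(3) by blast
 qed
 have EE: "(UN v:J. E v) = (UN x:(UN v:J. grp v). Dv x)" unfolding E_def by blast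
 have cl: "closed (UN v:J. E v)" unfolding EE by (rule closed_Union_Dv) (use gV in blast)
 have clE: "closed (E v)" for v unfolding E_def by (rule closed_Union_Dv[OF gV])
 have "EX G. hfamily G & sfamily (UN v:J. E v) G & (ALL v:J. ALL p:W v. ALL q. G q p = g v q p)" by (rule product_family[OF g(1,2) W disj cl])
 then obtain G where G: "hfamily G" "sfamily (UN v:J. E v) G" "!!v p q. v:J ==> p:W v ==> G q p = g v q p" by blast
 have GE: "G q p = g v q p & g v q p:E v" if "v:J" "p:E v" for v p q
  using G(3)[OF that(1)] subsetD[OF W(2) that(2)] sfamily_image(2)[OF g(1,2)[OF that(1)]] that(2) by simp
 have off: "G q p = p" if "p~:(UN v:J. E v)" for q p using G(2) that unfolding sfamily_def by blast
 have psh: "pushes om (G q) (%p. 1) (%p. 1)" for q proof (rule pushes_product[OF sets_eq, of J E "%v. g v q" _ "%v p. 1"])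
  show "countable J" using countable_V unfolding J_def by (rule countable_subset[rotated]) blast
  show "disjoint_family_on E J" unfolding disjoint_family_on_def using disj W(2) by blast
 qed (use g(4) GE off hfamily_borel(1)[OF g(1)] borel_closed[OF clE] in "simp_all add: image_subset_iff")
 text \<open>At most one group of the given colour can move the component \<open>snd x\<close>.\<close>
 have img: "G q ` (snd x - X) = snd x - X"
  if x: "x:V" and X: "X = {} & (ALL v:J. fst x = 0 \<or> par x~:grp v) \<or> (EX u:J. X = E u & (ALL v:J. v ~= u --> par x~:grp v))" for q x X
 proof -
  have nx: "fst x = 0 \<or> par x~:grp v" if "v:J" "X ~= E v" for v using X that by auto
  have m: "G q p:snd x - X" if p: "p:snd x - X" for q p proof (cases "p:(UN v:J. E v)")
   case True
   then obtain v where v: "v:J" "p:E v" by (rule UN_E)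
   have "fst x = 0 \<or> par x~:grp v" by (rule nx[OF v(1)]) (use v(2) p in blast)
   hence "g v q ` snd x = snd x" using g(6)[OF v(1) x] by blast
   hence "g v q p:snd x" using p by blast
   moreover have "g v q p~:X" proof
    assume a: "g v q p:X"
    then obtain u where u: "u:J" "X = E u" using X by blast
    have "u = v" using disj[OF u(1) v(1)] a GE[OF v, of q] W(2) u(2) by blast
    thus False using p v(2) u(2) by blast
   qed
   ultimately show ?thesis using GE[OF v, of q] by simp
  next
   case False thus ?thesis using off[OF False] p by simp
  qed
  have "p:G q ` (snd x - X)" if p: "p:snd x - X" for p proof (cases "p:(UN v:J. E v)")
   case True
   then obtain v where v: "v:J" "p:E v" by (rule UN_E)
   have "fst x = 0 \<or> par x~:grp v" by (rule nx[OF v(1)]) (use v(2) p in blast)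
   then obtain r where r: "r:snd x" "p = g v q r" using g(6)[OF v(1) x, of q] p by blast
   have rE: "r:E v" using v(2) r(2) sfamily_image(2)[OF g(1,2)[OF v(1)]] by blast
   have "r~:X" proof
    assume a: "r:X"
    then obtain u where u: "u:J" "X = E u" using X by blast
    have "u = v" using disj[OF u(1) v(1)] a rE W(2) u(2) by blast
    thus False using p v(2) u(2) by blast
   qed
   thus ?thesis using GE[OF v(1) rE, of q] r by (intro image_eqI[of _ _ r]) auto
  next
   case False thus ?thesis using off[OF False, of q] p by (metis imageI)
  qed
  thus ?thesis using m by blast
 qed
 have fl: "has_flux om (G q) (snd x) (SUM v:{v:V. col v = c & 0 < fst x & par x:grp v}. SUM w:lines v. q w * flow w x)" if x: "x:V" for q x
 proof (cases "EX u:J. 0 < fst x & par x:grp u")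
  case False
  hence "{v:V. col v = c & 0 < fst x & par x:grp v} = {}" unfolding J_def by blast
  moreover have "G q ` snd x = snd x" using img[OF x, of "{}" q] False by auto
  ultimately show ?thesis using has_flux_invariant by (simp only: sum.empty)
 next
  case True
  then obtain u where u: "u:J" "0 < fst x" "par x:grp u" by blast
  have uniq: "par x~:grp v" if "v:J" "v ~= u" for v using grp_col[OF par_facts(1)[OF x u(2)] u(3), of v] that u(1) unfolding J_def by auto
  hence "{v:V. col v = c & 0 < fst x & par x:grp v} = {u}" using u unfolding J_def by blast
  moreover have "G q ` snd x = g u q ` snd x" proof -
   have "G q ` (snd x Int E u) = g u q ` (snd x Int E u)" using GE[OF u(1)] by (intro image_cong) auto
   moreover have "G q ` (snd x - E u) = snd x - E u" using img[OF x, of "E u" q] u(1) uniq by blast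
   moreover have "g u q ` (snd x - E u) = (%p. p) ` (snd x - E u)" using g(2)[OF u(1)] by (intro image_cong) (auto simp: sfamily_def)
   ultimately have "G q ` (snd x Int E u Un (snd x - E u)) = g u q ` (snd x Int E u Un (snd x - E u))" unfolding image_Un by simp
   thus ?thesis by (simp only: Int_Diff_Un)
  qed
  ultimately show ?thesis using g(5)[OF u(1) x, of q] unfolding has_flux_def by simp
 qed
 have "sfamily (UN x:V. Dv x) G" using G(2) gV unfolding sfamily_def EE by blast
 moreover have "G (%_. 0) p = p" for p proof (cases "p:(UN v:J. E v)")
  case True
  then obtain v where v: "v:J" "p:E v" by (rule UN_E)
  thus ?thesis using GE[OF v, of "%_. 0"] g(3)[OF v(1)] by simp
 qed (rule off)
 moreover have "G q ` snd x = snd x" if x: "x:V" "fst x = 0 \<or> par x~:V" for q x proof -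
  have "ALL v:J. fst x = 0 \<or> par x~:grp v" using x(2) gV by blast
  thus ?thesis using img[OF x(1) disjI1[OF conjI[OF refl]], of q] by simp
 qed
 ultimately have "ffamily (%_. 0) V G (%p x. SUM v:{v:V. col v = c & 0 < fst x & par x:grp v}. SUM w:lines v. p w * flow w x)"
  unfolding ffamily_def using G(1) psh fl by blast
 thus ?thesis by blast
qed

text \<open>The four colours are composed and their fluxes add up. Every group containing the parent
  of \<open>x\<close> is counted in exactly one colour.\<close>

lemma total_family:
 "EX G. ffamily (%_. 0) V G (%p x. if fst x = 0 then 0 else
  (if rtop x:Lines then p (rtop x) else 0) - (case owner x of None => 0 | Some v => SUM w:lines v. p w))"
proof -
 define F where "F c x = {v:V. col v = c & 0 < fst x & par x:grp v}" for c x
 have "ALL c. EX G. ffamily (%_. 0) V G (%p x. SUM v:F c x. SUM w:lines v. p w * flow w x)" unfolding F_def by (intro allI colour_family)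
 then obtain g where g: "ALL c. ffamily (%_. 0) V (g c) (%p x. SUM v:F c x. SUM w:lines v. p w * flow w x)"
  by (rule choice[THEN exE])
 have "ffamily (%_. 0) V (%q. foldr (%c. g c q) [0..<4]) (%q x. SUM c<-[0..<4]. SUM v:F c x. SUM w:lines v. q w * flow w x)"
  by (rule ffamily_fold) (rule g[rule_format])
 moreover have "(SUM c<-[0..<4]. SUM v:F c x. SUM w:lines v. q w * flow w x) = (if fst x = 0 then 0 else
  (if rtop x:Lines then q (rtop x) else 0) - (case owner x of None => 0 | Some v => SUM w:lines v. q w))" if x: "x:V" for q x
 proof (cases "fst x = 0")
  case False
  hence l: "0 < fst x" by simp
  let ?A = "{v:V. par x:grp v}"
  note p = par_facts(1)[OF x l]
  have fin: "finite ?A" using finite_grps[OF p] by (rule finite_subset[rotated]) blast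
  have "(SUM c<-[0..<4]. SUM v:F c x. SUM w:lines v. q w * flow w x) = (SUM c:{0..<4}. SUM v:F c x. SUM w:lines v. q w * flow w x)"
   by (simp add: interv_sum_list_conv_sum_set_nat)
  also have "... = (SUM v:(UN c:{0..<4}. F c x). SUM w:lines v. q w * flow w x)"
   by (rule sum.UNION_disjoint[symmetric]) (use fin in "auto simp: F_def elim: rev_finite_subset")
  also have "(UN c:{0..<4}. F c x) = ?A" using l col_inv by (force simp: F_def)
  finally show ?thesis using flow_sum[OF fin _ p kid_par[OF x l], of q] l by simp
 qed (simp add: F_def)
 ultimately have "ffamily (%_. 0) V (%q. foldr (%c. g c q) [0..<4]) (%p x. if fst x = 0 then 0 else
  (if rtop x:Lines then p (rtop x) else 0) - (case owner x of None => 0 | Some v => SUM w:lines v. p w))"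
  by (rule ffamily_cong)
 thus ?thesis by blast
qed

end

subsection \<open>Ends and end charges\<close>

lemma endsD:
 assumes "e:ends" "compact C"
 shows "e C:components (- C)" "compact C' ==> C <= C' ==> e C' <= e C" "e C ~= {}"
 using assms in_components_nonempty[of "e C" "- C"] unfolding ends_def by (auto simp: PiE_iff)

lemma ends_coarser:
 assumes "e:ends" "e':ends" "compact C" "compact C'" "C <= C'" "e C' = e' C'" shows "e C = e' C"
 using endsD(1)[OF assms(1,3)] endsD(1)[OF assms(2,3)] endsD(2)[OF assms(1,3,4,5)] endsD(2)[OF assms(2,3,4,5)] endsD(3)[OF assms(1,4)] assms(6)
 by (metis components_eq inf.absorb_iff2 inf.commute inf_assoc inf_bot_right)

lemma openin_end_fibre:
 assumes C: "compact C" shows "openin end_topology {e:ends. e C:\<U>}"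
proof (subst openin_subopen, intro ballI)
 fix e assume "e:{e:ends. e C:\<U>}"
 hence e: "e:ends" "e C:\<U>" by auto
 have "openin end_compactification (end_nbhd e C)" unfolding end_compactification_def by (rule topology_generated_by_Basis) (use e(1) C in blast)
 hence "openin end_topology (Inr -` end_nbhd e C Int ends)" unfolding end_topology_def openin_pullback_topology by blast
 moreover have "Inr -` end_nbhd e C Int ends = {e':ends. e' C = e C}" unfolding end_nbhd_def by auto
 ultimately show "EX T. openin end_topology T & e:T & T <= {e:ends. e C:\<U>}" using e by (intro exI[of _ "{e':ends. e' C = e C}"]) auto
qed

lemma clopen_end_fibre: "compact C ==> {e:ends. e C:\<U>}:clopen_ends"
proof -
 assume C: "compact C"
 have "topspace end_topology - {e:ends. e C:\<U>} = {e:ends. e C:- \<U>}" unfolding topspace_end_topology by auto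
 thus ?thesis using openin_end_fibre[OF C, of \<U>] openin_end_fibre[OF C, of "- \<U>"]
  unfolding clopen_ends_def closedin_def by (auto simp: topspace_end_topology)
qed

lemma has_flux_measure:
 fixes om :: "'a::topological_space measure"
 assumes s: "sets om = sets borel" and U: "U:sets borel" "h ` U:sets borel" and f: "has_flux om h U r"
 shows "measure om (U - h ` U) - measure om (h ` U - U) = r" "emeasure om (U - h ` U) < \<infinity>"
proof -
 let ?f = "%x. ind U x - ind (h ` U) x"
 have i: "integrable om ?f" "integral\<^sup>L om ?f = r" using f unfolding has_flux_def has_bochner_integral_iff by simp_all
 have e: "max 0 (?f x) = ind (U - h ` U) x" "max 0 (- ?f x) = ind (h ` U - U) x" for x by (auto simp: indicator_def)
 have "integrable om (%x. max 0 (?f x))" "integrable om (%x. max 0 (- ?f x))"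
  using integrable_max[OF integrable_zero i(1)] integrable_max[OF integrable_zero Bochner_Integration.integrable_minus[OF i(1)]] by simp_all
 hence j: "integrable om (ind (U - h ` U))" "integrable om (ind (h ` U - U))" unfolding e by simp_all
 thus "emeasure om (U - h ` U) < \<infinity>" using U by (simp add: integrable_indicator_iff s)
 have sp: "space om = UNIV" using sets_eq_imp_space_eq[OF s] by simp
 have "r = (\<integral>x. ind (U - h ` U) x - ind (h ` U - U) x \<partial>om)"
  unfolding i(2)[symmetric] by (intro Bochner_Integration.integral_cong) (auto simp: indicator_def)
 also have "... = measure om (U - h ` U) - measure om (h ` U - U)" using j by (simp add: sp)
 finally show "measure om (U - h ` U) - measure om (h ` U - U) = r" by simp
qed

lemma has_flux_Un:
 assumes "inj h" "A Int B = {}" "has_flux om h A a" "has_flux om h B b" shows "has_flux om h (A Un B) (a + b)"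
proof -
 have "h ` A Int h ` B = {}" using assms(1,2) by (simp add: image_Int[symmetric])
 hence "ind (A Un B) x - ind (h ` (A Un B)) x =
  (ind A x - ind (h ` A) x) + (ind B x - ind (h ` B) x)" for x
  using assms(2) unfolding image_Un by (auto simp: indicator_def)
 thus ?thesis using has_bochner_integral_add[OF assms(3,4)[unfolded has_flux_def]] unfolding has_flux_def by simp
qed

lemma has_flux_finite:
 assumes s: "sets om = sets borel" and Z: "Z:sets borel" "h ` Z:sets borel" "emeasure om Z < \<infinity>" "emeasure om (h ` Z) = emeasure om Z"
 shows "has_flux om h Z 0"
proof -
 have "has_bochner_integral om (ind Z) (measure om Z)" "has_bochner_integral om (ind (h ` Z)) (measure om (h ` Z))"
  using Z by (simp_all add: has_bochner_integral_real_indicator s)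
 from has_bochner_integral_diff[OF this] show ?thesis using Z(4) unfolding has_flux_def measure_def by simp
qed

context exhausted_manifold
begin

text \<open>For an arbitrary compact set the end takes the component that contains the members of
  the branch from some index on; nestedness makes the choices compatible.\<close>

lemma branch_end:
 assumes U: "!!i. U i:components (- K i)" "!!i. U (Suc i) <= U i" shows "EX e:ends. ALL i. e (K i) = U i"
proof -
 have mono: "U j <= U i" if "i <= j" for i j using that U(2) by (rule lift_Suc_antimono_le[rotated])
 have ne: "U i ~= {}" and con: "connected (U i)" and sub: "U i <= - K i" for i
  using in_components_nonempty[OF U(1)] in_components_connected[OF U(1)] in_components_subset[OF U(1)] by blast+
 define J where "J C = (LEAST j. C <= K j)" for C
 have J: "C <= K (J C)" if "compact C" for C unfolding J_def using K_exhausts[OF that] by (rule LeastI_ex)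
 have ex: "EX W. W:components (- C) & U (J C) <= W" if "compact C" for C
  using exists_component_superset[of "U (J C)" "- C"] J[OF that] sub[of "J C"] ne[of "J C"] con by blast
 define e where "e = (\<lambda>C\<in>{C. compact C}. SOME W. W:components (- C) & U (J C) <= W)"
 have e: "e C:components (- C)" "U (J C) <= e C" if "compact C" for C using someI_ex[OF ex[OF that]] that unfolding e_def by simp_all
 have Ue: "U j <= e C" if C: "compact C" "C <= K j" for C j proof -
  have "J C <= j" unfolding J_def using C(2) by (rule Least_le)
  thus ?thesis using mono e(2)[OF C(1)] by blast
 qed
 have "e:ends" unfolding ends_def proof (intro CollectI conjI allI impI)
  show "e:(\<Pi>\<^sub>E K\<in>{K. compact K}. components (- K))" using e(1) unfolding e_def by (simp add: PiE_iff extensional_def)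
  fix C C' :: "'a set" assume C: "compact C & compact C' & C <= C'"
  then obtain j where j: "C' <= K j" using K_exhausts by blast
  have "U j <= e C" "U j <= e C'" using Ue C j by blast+
  thus "e C' <= e C" using C ne[of j] in_components_subset[OF e(1)[of C']] by (intro components_maximal[OF e(1) in_components_connected[OF e(1)]]) blast+
 qed
 moreover have "e (K i) = U i" for i using components_eq[OF e(1)[OF cK] U(1)] Ue[OF cK order_refl, of i] ne[of i] by blast
 ultimately show ?thesis by blast
qed

text \<open>The compact sets \<open>K i\<close> are cofinal, so the ends that agree with
  \<open>e\<close> on one of them form small neighbourhoods of \<open>e\<close>.\<close>

lemma end_ball:
 assumes F: "openin end_topology F" "e:F" shows "EX i. ALL e':ends. e' (K i) = e (K i) --> e':F"
proof -
 have P: "ALL e:ends. Inr e:T --> (EX i. ALL e':ends. e' (K i) = e (K i) --> Inr e':T)"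
  if "generate_topology_on ({Inl ` U | U. open U} Un {end_nbhd e C | e C. e:ends & compact C}) T" for T :: "('a + ('a set => 'a set)) set"
  using that proof (induction T rule: generate_topology_on.induct)
  case (Int A B)
  show ?case proof (intro ballI impI)
   fix e assume e: "e:ends" "Inr e:A Int B"
   obtain i j where ij: "ALL e':ends. e' (K i) = e (K i) --> Inr e':A" "ALL e':ends. e' (K j) = e (K j) --> Inr e':B" using Int.IH e by blast
   have eq: "e' (K i) = e (K i)" "e' (K j) = e (K j)" if "e':ends" "e' (K (max i j)) = e (K (max i j))" for e'
    using ends_coarser[OF that(1) e(1) cK cK K_mono[of i "max i j"] that(2)]
     ends_coarser[OF that(1) e(1) cK cK K_mono[of j "max i j"] that(2)] by simp_all
   show "EX i. ALL e':ends. e' (K i) = e (K i) --> Inr e':A Int B" proof (rule exI[of _ "max i j"], intro ballI impI)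
    fix e' assume a: "e':ends" "e' (K (max i j)) = e (K (max i j))"
    show "Inr e':A Int B" using ij(1)[rule_format, OF a(1) eq(1)[OF a]] ij(2)[rule_format, OF a(1) eq(2)[OF a]] by simp
   qed
  qed
 next
  case (UN S)
  show ?case proof (intro ballI impI)
   fix e :: "'a set => 'a set" assume e: "e:ends" "Inr e:\<Union>S"
   then obtain A where A: "A:S" "Inr e:A" by (elim UnionE)
   obtain i where i: "ALL e':ends. e' (K i) = e (K i) --> Inr e':A" using bspec[OF UN.IH[OF A(1)] e(1)] A(2) by (elim impE exE) simp_all
   show "EX i. ALL e':ends. e' (K i) = e (K i) --> Inr e':\<Union>S" proof (rule exI[of _ i], intro ballI impI)
    fix e' assume "e':ends" "e' (K i) = e (K i)"
    hence "Inr e':A" using i by simp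
    thus "Inr e':\<Union>S" using A(1) by (rule UnionI[rotated])
   qed
  qed
 next
  case (Basis T)
  show ?case proof (intro ballI impI)
   fix e :: "'a set => 'a set" assume e: "e:ends" "Inr e:T"
   then obtain e0 C where C: "compact C" "T = end_nbhd e0 C" "e C = e0 C" using Basis unfolding end_nbhd_def by auto
   obtain i where "C <= K i" using K_exhausts[OF C(1)] by blast
   hence "e' C = e0 C" if "e':ends" "e' (K i) = e (K i)" for e' using ends_coarser[OF that(1) e(1) C(1) cK _ that(2)] C(3) by simp
   thus "EX i. ALL e':ends. e' (K i) = e (K i) --> Inr e':T" unfolding C(2) end_nbhd_def by (intro exI[of _ i]) auto
  qed
 qed auto
 obtain T where T: "openin end_compactification T" "F = Inr -` T Int ends" using F(1) unfolding end_topology_def openin_pullback_topology by blast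
 show ?thesis using P[of T] T F(2) unfolding end_compactification_def openin_topology_generated_by_iff by auto
qed

text \<open>Compactness of the space of ends, by Koenig's lemma: a clopen set of ends is determined at a finite level.\<close>

lemma clopen_level:
 fixes F :: "('a set => 'a set) set"
 assumes F: "F:clopen_ends" shows "EX i. ALL e:ends. ALL e':ends. e (K i) = e' (K i) --> (e:F \<longleftrightarrow> e':F)"
proof (rule ccontr)
 assume neg: "~ ?thesis"
 have Fe: "F <= ends" and oF: "openin end_topology F" "openin end_topology (ends - F)"
  using F openin_subset[of end_topology F] unfolding clopen_ends_def closedin_def topspace_end_topology by auto
 \<comment> \<open>Some end of \<open>F\<close> and some end outside \<open>F\<close> cannot be
   distinguished at level \<open>j\<close> and run inside \<open>U\<close>. The branch keeps this
   property for all \<open>j\<close> and so leads to an end in the closure of both sides.\<close>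
 define mix where "mix j U \<longleftrightarrow> (EX e:F. EX e':ends - F. e (K j) = e' (K j) & e (K j) <= U)" for j U
 define Q where "Q i U \<longleftrightarrow> U:components (- K i) & (ALL j>=i. mix j U)" for i U
 have "EX U. ALL i. Q i (U i) & U (Suc i) <= U i" proof (rule dependent_nat_choice)
  have "components (- K 0) = {UNIV}" using components_eq_sing_iff[of "UNIV :: 'a set"] conn by (simp add: K_0)
  moreover have "mix j UNIV" for j proof -
   have "~ (ALL e:ends. ALL e':ends. e (K j) = e' (K j) --> (e:F \<longleftrightarrow> e':F))" by (rule notI, rule notE[OF neg], rule exI)
   then obtain e e' where e: "e:ends" "e':ends" "e (K j) = e' (K j)" "(e:F) ~= (e':F)"
    unfolding Ball_def not_all not_imp by (elim exE conjE)
   show ?thesis proof (cases "e:F")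
    case True thus ?thesis unfolding mix_def using e by (intro bexI[of _ e] bexI[of _ e']) simp_all
   next
    case False thus ?thesis unfolding mix_def using e by (intro bexI[of _ e'] bexI[of _ e]) simp_all
   qed
  qed
  ultimately show "EX U. Q 0 U" unfolding Q_def by blast
 next
  fix U i assume Q: "Q i U"
  \<comment> \<open>A component may have infinitely many children; only finitely many of them leave
    \<open>K (Suc (Suc i))\<close>, and those that carry ends do.\<close>
  let ?W = "{W:components (- K (Suc i)). ~ W <= K (Suc (Suc i))}"
  have "EX W:?W. W <= U & mix j W" if j: "Suc i <= j" for j proof -
   obtain e e' where e: "e:F" "e':ends - F" "e (K j) = e' (K j)" "e (K j) <= U" using Q j unfolding Q_def mix_def by (meson Suc_leD)
   hence eE: "e:ends" using Fe by blast
   note D = endsD[OF eE cK]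
   have s: "e (K j) <= e (K (Suc i))" "e (K (Suc i)) <= e (K i)" "e (K (Suc (Suc i))) <= e (K (Suc i))" using D(2)[OF cK K_mono] j by auto
   have "e (K i) = U" using components_eq[OF D(1)[of i], of U] Q e(4) s D(3)[of j] unfolding Q_def by blast
   moreover have "~ e (K (Suc i)) <= K (Suc (Suc i))" using s(3) D(3)[of "Suc (Suc i)"] in_components_subset[OF D(1)[of "Suc (Suc i)"]] by blast
   ultimately show ?thesis using D(1)[of "Suc i"] s e unfolding mix_def by blast
  qed
  then obtain W where W: "!!j. Suc i <= j ==> W j:?W & W j <= U & mix j (W j)" by metis
  have "finite (W ` {Suc i..})" using W by (intro finite_subset[OF _ unbounded_components_finite[OF cK cK K_Suc]]) blast
  then obtain W0 where W0: "W0:{Suc i..}" "infinite {j:{Suc i..}. W j = W W0}"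
   \<comment> \<open>One child serves infinitely many \<open>j\<close>. Agreement at a later level
     implies agreement at an earlier one, so it serves all \<open>j\<close>.\<close>
   using pigeonhole_infinite[OF infinite_Ici, of W "Suc i"] by blast
  have "mix j (W W0)" if j: "Suc i <= j" for j proof -
   obtain j' where j': "j <= j'" "Suc i <= j'" "W j' = W W0" using W0(2) unfolding infinite_nat_iff_unbounded_le by auto
   obtain e e' where e: "e:F" "e':ends - F" "e (K j') = e' (K j')" "e (K j') <= W W0" using W[OF j'(2)] j'(3) unfolding mix_def by metis
   hence E: "e:ends" "e':ends" using Fe by blast+
   have "e (K j) = e' (K j)" by (rule ends_coarser[OF E cK cK K_mono[OF j'(1)] e(3)])
   moreover have "e (K (Suc i)) = W W0" using components_eq[OF endsD(1)[OF E(1) cK[of "Suc i"]], of "W W0"] W[of W0] W0(1) e(4) endsD(3)[OF E(1) cK[of j']]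
     endsD(2)[OF E(1) cK cK K_mono[OF j'(2)]] by blast
   ultimately show ?thesis using e endsD(2)[OF E(1) cK cK K_mono[OF j]] unfolding mix_def by blast
  qed
  thus "EX U'. Q (Suc i) U' & U' <= U" using W[of W0] W0(1) unfolding Q_def by (intro exI[of _ "W W0"]) auto
 qed
 then obtain U where U: "!!i. Q i (U i)" "!!i. U (Suc i) <= U i" by blast
 then obtain e where e: "e:ends" "!!i. e (K i) = U i" using branch_end[of U] unfolding Q_def by blast
 have m: "EX a:F. EX b:ends - F. a (K i) = e (K i) & b (K i) = e (K i)" for i proof -
  obtain a b where ab: "a:F" "b:ends - F" "a (K i) = b (K i)" "a (K i) <= U i" using U(1)[of i] unfolding Q_def mix_def by blast
  have "a:ends" using ab(1) Fe by blast
  hence "a (K i) = U i" using components_eq[of "a (K i)" "- K i" "U i"] endsD(1,3)[OF _ cK[of i], of a] U(1)[of i] ab(4) unfolding Q_def by blast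
  thus ?thesis using ab e(2) by auto
 qed
 show False proof (cases "e:F")
  case True thus False using end_ball[OF oF(1) True] m by blast
 next
  case False thus False using end_ball[OF oF(2), of e] e(1) m Fe by blast
 qed
qed

text \<open>The definite description in \<open>end_charge_hom\<close> speaks of all representatives
  of \<open>F\<close>; it determines a value only because one exists.\<close>

lemma clopen_realized:
 fixes F :: "('a set => 'a set) set"
 assumes F: "F:clopen_ends" shows "EX C. C:sets borel & compact (frontier C) & ends_of C = F"
proof -
 obtain i where i: "!!e e'. e:ends ==> e':ends ==> e (K i) = e' (K i) ==> e:F \<longleftrightarrow> e':F" using clopen_level[OF F] by blast
 have Fe: "F <= ends" using F openin_subset[of end_topology F] unfolding clopen_ends_def topspace_end_topology by auto
 define C where "C = (UN e:F. e (K i))"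
 note comp = endsD(1)[OF subsetD[OF Fe] cK[of i]]
 have oC: "open C" unfolding C_def using components_facts(1)[OF cK comp] by blast
 have op: "open (\<Union>{U:components (- K i). U Int C = {}})" using components_facts(1)[OF cK] by blast
 have eq: "C Un K i = - \<Union>{U:components (- K i). U Int C = {}}" proof -
  have in_C: "EX e:F. x:e (K i)" if "x:C" for x using that unfolding C_def by (rule UN_E) (rule bexI)
  have dich: "x:C" if U: "U:components (- K i)" "x:U" "y:U" "y:C" for U x y proof -
   obtain e where e: "e:F" "y:e (K i)" using in_C[OF U(4)] by (rule bexE)
   hence "U = e (K i)" using components_eq[OF U(1) comp[OF e(1)]] U(3) by blast
   thus ?thesis unfolding C_def using e(1) U(2) by (intro UN_I[OF e(1)]) simp
  qed
  have out: "x~:K i" if xC: "x:C" for x proof -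
   obtain e where e: "e:F" "x:e (K i)" using in_C[OF xC] by (rule bexE)
   thus ?thesis using in_components_subset[OF comp[OF e(1)]] by blast
  qed
  have cov: "EX U:components (- K i). x:U" if "x~:K i" for x using that Union_components[of "- K i"] by blast
  have sub: "U <= - K i" if "U:components (- K i)" for U by (rule in_components_subset[OF that])
  show ?thesis proof (intro equalityI subsetI)
   fix x assume "x:C Un K i" thus "x:- \<Union>{U:components (- K i). U Int C = {}}" using sub by blast
  next
   fix x assume x: "x:- \<Union>{U:components (- K i). U Int C = {}}"
   show "x:C Un K i" proof (rule ccontr)
    assume n: "x~:C Un K i"
    then obtain U where U: "U:components (- K i)" "x:U" using cov[of x] by blast
    thus False using x dich[OF U] n by blast
   qed
  qed
 qed
 have "closed (C Un K i)" unfolding eq using op by (rule closed_Compl)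
 hence "closure C <= C Un K i" by (intro closure_minimal) auto
 hence "frontier C <= K i" using oC unfolding frontier_def by (auto simp: interior_open)
 hence "compact (frontier C)" using compact_Int_closed[OF cK frontier_closed, of i C] by (simp add: Int_absorb1 inf.absorb2)
 moreover have "ends_of C = F" proof (intro equalityI subsetI)
  fix e assume "e:ends_of C"
  then obtain L where e: "e:ends" and L: "compact L" "e L <= C" unfolding ends_of_def by blast
  have c: "compact (L Un K i)" using L(1) cK by (rule compact_Un)
  have "e (L Un K i) <= e L" "e (L Un K i) <= e (K i)" "e (L Un K i) ~= {}" using endsD[OF e] L(1) c cK by blast+
  then obtain e' where e': "e':F" "e (K i) Int e' (K i) ~= {}" using L(2) unfolding C_def by blast
  hence "e (K i) = e' (K i)" using components_eq[OF endsD(1)[OF e cK] comp[OF e'(1)]] by blast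
  thus "e:F" using i[OF e] e'(1) Fe by blast
 next
  fix e assume "e:F" thus "e:ends_of C" using Fe cK unfolding ends_of_def C_def by blast
 qed
 ultimately show ?thesis using oC by (intro exI[of _ C]) (simp add: borel_open)
qed

section \<open>End charges read off from the components of infinite measure\<close>

definition end_comp :: "nat => 'a set => ('a set => 'a set) set" where "end_comp i U = {e:ends. e (K i):{U}}"

text \<open>Charges are only finitely additive, but the possibly infinitely many components of
  finite measure together give one clopen set of finite ends, on which the charge vanishes; finitely
  many components remain.\<close>

lemma charge_fibre:
 assumes c: "c:charges_on om" and A: "A <= components (- K i)"
 shows "c {e:ends. e (K i):A} = (SUM U:A Int icomps (K i). c (end_comp i U))"
proof -
 let ?E = "%B. {e:ends. e (K i):B}"
 have add: "c (?E (B Un B')) = c (?E B) + c (?E B')" if d: "B Int B' = {}" for B B' proof -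
  have "?E (B Un B') = ?E B Un ?E B'" "?E B Int ?E B' = {}" using d by auto
  thus ?thesis using c clopen_end_fibre[OF cK[of i]] unfolding charges_on_def end_charges_def by simp
 qed
 have fin: "c (?E B) = (SUM U:B. c (end_comp i U))" if "finite B" for B using that proof induction
  case empty thus ?case using add[of "{}" "{}"] by simp
 next
  case (insert U B) thus ?case using add[of "{U}" B] by (simp add: end_comp_def)
 qed
 have "c (?E (A - icomps (K i))) = 0" proof -
  have "?E (A - icomps (K i)) <= finite_ends om" using A cK unfolding finite_ends_def icomps_def by (auto simp: less_top)
  thus ?thesis using c clopen_end_fibre[OF cK[of i], of "A - icomps (K i)"] unfolding charges_on_def by blast
 qed
 moreover have "A = (A Int icomps (K i)) Un (A - icomps (K i))" by blast
 ultimately show ?thesis using add[of "A Int icomps (K i)" "A - icomps (K i)"] fin[of "A Int icomps (K i)"] finite_inf_comps[OF cK, of i] by auto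
qed

text \<open>Beyond a compact set that contains its frontier, \<open>C\<close> is a union of
  components. Up to a remainder of finite measure, which contributes no flux, it consists of
  finitely many components of infinite measure, and the flux is additive.\<close>

lemma flux_charge:
 assumes c: "c:charges_on om" and h: "inj h" "!!B. B:sets borel ==> h ` B:sets borel" "!!B. B:sets borel ==> emeasure om (h ` B) = emeasure om B"
  and f: "!!i U. U:icomps (K i) ==> has_flux om h U (c (end_comp i U))"
  and C: "C:sets borel" "compact (frontier C)"
 shows "measure om (C - h ` C) - measure om (h ` C - C) = c (ends_of C)"
proof -
 obtain i where i: "frontier C <= K i" using K_exhausts[OF C(2)] by blast
 let ?A = "{U:components (- K i). U <= C}"
 have dich: "U <= C \<or> U Int C = {}" if "U:components (- K i)" for U
  using connected_Int_frontier[OF in_components_connected[OF that], of C] in_components_subset[OF that] i by blast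
 define B where "B = ?A Int icomps (K i)"
 have B: "finite B" unfolding B_def using finite_inf_comps[OF cK] by blast
 define Z where "Z = C - \<Union>B"
 have oB: "open (\<Union>B)" unfolding B_def using components_facts(1)[OF cK] by blast
 have bZ: "Z:sets borel" unfolding Z_def using C(1) oB by (simp add: borel_open sets.Diff)
 have dA: "?A - icomps (K i) <= components (- K i)" "(?A - icomps (K i)) Int icomps (K i) = {}" by blast+
 note fm = finite_measure_rest[OF cK dA]
 have bX: "\<Union>(?A - icomps (K i)):sets om" "K i:sets om" using borel_open[OF fm(2)] borel_compact[OF cK] by simp_all
 have "Z <= K i Un \<Union>(?A - icomps (K i))" proof
  fix x assume x: "x:Z"
  show "x:K i Un \<Union>(?A - icomps (K i))" proof (cases "x:K i")
   case False
   then obtain U where U: "U:components (- K i)" "x:U" using Union_components[of "- K i"] by blast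
   thus ?thesis using dich[OF U(1)] x unfolding Z_def B_def by blast
  qed simp
 qed
 hence "emeasure om Z <= emeasure om (K i Un \<Union>(?A - icomps (K i)))" using bX by (intro emeasure_mono sets.Un)
 also have "... <= emeasure om (K i) + emeasure om (\<Union>(?A - icomps (K i)))" using bX by (intro emeasure_subadditive)
 also have "... < \<infinity>" using fm(1) finite_compact[OF cK[of i]] by auto
 finally have "has_flux om h Z 0" using bZ h(2,3)[OF bZ] by (intro has_flux_finite[OF sets_eq]) auto
 moreover have "has_flux om h (\<Union>B') (SUM U:B'. c (end_comp i U))" if "B' <= B" for B' using finite_subset[OF that B] that proof (induction B')
  case empty thus ?case by (simp add: has_flux_invariant)
 next
  case (insert U B')
  have "U Int \<Union>B' = {}" using insert.prems insert.hyps(2) icomps_disjoint[of U "K i"] unfolding B_def by blast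
  thus ?case using has_flux_Un[OF h(1) _ f insert.IH, of U i] insert.prems insert.hyps unfolding B_def by simp
 qed
 ultimately have "has_flux om h (\<Union>B Un Z) ((SUM U:B. c (end_comp i U)) + 0)" by (intro has_flux_Un[OF h(1)]) (auto simp: Z_def)
 moreover have "\<Union>B Un Z = C" unfolding Z_def B_def by blast
 ultimately have "has_flux om h C (SUM U:B. c (end_comp i U))" by simp
 hence "measure om (C - h ` C) - measure om (h ` C - C) = (SUM U:B. c (end_comp i U))" by (rule has_flux_measure(1)[OF sets_eq C(1) h(2)[OF C(1)]])
 also have "... = c {e:ends. e (K i):?A}" unfolding B_def by (rule charge_fibre[OF c, symmetric]) blast
 also have "{e:ends. e (K i):?A} = ends_of C" proof (intro equalityI subsetI)
  fix e assume "e:{e:ends. e (K i):?A}" thus "e:ends_of C" unfolding ends_of_def using cK by blast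
 next
  fix e assume "e:ends_of C"
  then obtain L where e: "e:ends" and L: "compact L" "e L <= C" unfolding ends_of_def by blast
  have cc: "compact (L Un K i)" using L(1) cK by (rule compact_Un)
  have "e (L Un K i) <= e L" "e (L Un K i) <= e (K i)" "e (L Un K i) ~= {}" using endsD[OF e] L(1) cc cK by blast+
  thus "e:{e:ends. e (K i):?A}" using dich[OF endsD(1)[OF e cK]] endsD(1)[OF e cK] e L(2) by blast
 qed
 finally show ?thesis .
qed

end

text \<open>The tube lemma: if a compact set is mapped into \<open>U\<close> at one parameter, it is
  so at all nearby parameters.\<close>

lemma hfamily_compact_open:
 fixes H :: "'p::topological_space => 'a::topological_space => 'a"
 assumes H: "hfamily H" shows "continuous_map euclidean compact_open_topology H" unfolding compact_open_topology_def continuous_on_generated_topo_iff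
proof (intro conjI allI impI)
 show "H ` topspace euclidean <= \<Union>{{f. cont f & f ` K <= U} |K U. compact K & open U}"
  using topspace_compact_open_topology[where 'a='a and 'b='a] hfamilyD(6)[OF H] unfolding compact_open_topology_def topology_generated_by_topspace by auto
 fix X :: "('a => 'a) set" assume "X:{{f. cont f & f ` K <= U} |K U. compact K & open U}"
 then obtain K U where X: "X = {f. cont f & f ` K <= U}" "compact K" "open U" by blast
 have "open {p. H p ` K <= U}" proof (subst open_subopen, intro ballI)
  fix p assume p: "p:{p. H p ` K <= U}"
  let ?W = "(%(p, x). H p x) -` U"
  have W: "open ?W" using hfamilyD(1)[OF H] X(3) by (simp add: continuous_on_open_vimage)
  hence "openin (prod_topology euclidean euclidean) ?W" by simp
  moreover have "{p} \<times> K <= ?W" using p by auto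
  ultimately obtain P Q where P: "open P" "p:P" "K <= Q" "P \<times> Q <= ?W" using tube_lemma_right[of euclidean euclidean ?W K p] X(2) by auto
  have "H q x:U" if "q:P" "x:K" for q x using subsetD[OF P(4), of "(q, x)"] P(3) that by auto
  thus "EX T. open T & p:T & T <= {p. H p ` K <= U}" using P(1,2) by (intro exI[of _ P]) auto
 qed
 moreover have "H -` X Int topspace euclidean = {p. H p ` K <= U}" unfolding X(1) using hfamilyD(6)[OF H] by auto
 ultimately show "openin euclidean (H -` X Int topspace euclidean)" by simp
qed

lemma continuous_map_charge_eval:
 assumes "F:clopen_ends" shows "continuous_map (charges_on_topology om) euclideanreal (%c. c F)"
proof -
 have "continuous_map end_charge_topology euclideanreal (%c :: (('a::topological_space set => 'a set) set => real). c F)" if F: "F:clopen_ends" for F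
  unfolding continuous_map_def proof (intro conjI allI impI)
  fix U :: "real set" assume "openin euclideanreal U"
  hence "{c:end_charges. c F:U}:{{c:end_charges. c F:V} | F V. F:clopen_ends & open V}" using F by auto
  thus "openin end_charge_topology {c:topspace end_charge_topology. c F:U}"
   unfolding topspace_end_charge_topology unfolding end_charge_topology_def by (rule topology_generated_by_Basis)
 qed simp
 thus ?thesis using assms unfolding charges_on_topology_def by (intro continuous_map_from_subtopology)
qed

context exhausted_manifold
begin

text \<open>It is enough that some point of a deep component \<open>e (K i)\<close> is mapped into
  that component; then the image of the component at \<open>h -\<close> followed by \<open>C\<close>
  overlaps the one at \<open>C\<close>, and maximality of components, applied to \<open>h\<close>
  and to its inverse, gives equality. For infinite measure such a point exists because the flux is
  finite.\<close>

lemma end_action_fixed: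
 assumes h: "bij h" "cont h" "cont (inv h)" and off: "!!p. p~:(UN x:V. Dv x) ==> h p = p"
  and f: "!!i U. U:icomps (K i) ==> has_flux om h U (r i U)" and b: "!!B. B:sets borel ==> h ` B:sets borel"
  and e: "e:ends"
 shows "end_action h e = e"
proof
 fix C :: "'a set"
 show "end_action h e C = e C" proof (cases "compact C")
  case False thus ?thesis using e unfolding end_action_def ends_def by (simp add: PiE_iff extensional_def)
 next
  case True
  have vi: "h -` C = inv h ` C" using h(1) by (rule bij_vimage_eq_inv_image)
  have vC: "compact (h -` C)" unfolding vi by (rule compact_continuous_image[OF cont_subset[OF h(3)] True]) simp
  obtain i where i: "C Un h -` C <= K i" using K_exhausts[OF compact_Un[OF True vC]] by blast
  have meet: "EX p. p:e (K i) & h p:e (K i)" proof (cases "e (K i):icomps (K i)")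
   case True
   let ?U = "e (K i)"
   note u = icompsD[OF cK True]
   have bU: "?U:sets borel" using u(1) by (rule borel_open)
   have "emeasure om (?U - h ` ?U) < \<infinity>" by (rule has_flux_measure(2)[OF sets_eq bU b[OF bU] f[OF True]])
   hence "?U - h ` ?U ~= ?U" using u(4) by force
   thus ?thesis by blast
  next
   case False
   \<comment> \<open>In a component of finite measure the map is trivial two levels deeper: blocks
     of level at most \<open>i\<close> end inside \<open>K ?j\<close>, and later blocks inside
     \<open>e (K i)\<close> would force infinite measure.\<close>
   let ?j = "Suc (Suc i)"
   have s: "e (K ?j) <= e (K i)" by (rule endsD(2)[OF e cK cK K_mono]) simp
   obtain p where p: "p:e (K ?j)" using endsD(3)[OF e cK[of ?j]] by blast
   have "p~:Dv x" if x: "x:V" for x proof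
    assume pD: "p:Dv x"
    hence px: "p:snd x" "p:K (Suc (Suc (fst x)))" using region(2,5,6)[OF x] by blast+
    show False proof (cases "fst x <= i")
     case True
     hence "p:K ?j" using px(2) K_mono[of "Suc (Suc (fst x))" ?j] by auto
     thus False using p in_components_subset[OF endsD(1)[OF e cK[of ?j]]] by blast
    next
     case F2: False
     have "snd x <= - K i" using deep_disjoint[OF x, of i] F2 by auto
     hence "snd x <= e (K i)" using px(1) p s by (intro components_maximal[OF endsD(1)[OF e cK] V_facts(2)[OF x]]) blast+
     moreover have "e (K i):sets om" using components_facts(1)[OF cK endsD(1)[OF e cK]] by (simp add: borel_open)
     ultimately have "emeasure om (e (K i)) = \<infinity>" using emeasure_mono[of "snd x" "e (K i)" om] V_facts(4)[OF x] by (simp add: top_unique)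
     thus False using False endsD(1)[OF e cK[of i]] unfolding icomps_def by simp
    qed
   qed
   hence "h p = p" using off by blast
   thus ?thesis using p s by (intro exI[of _ p]) auto
  qed
  have sub: "e (K i) <= e C" "e (K i) <= e (h -` C)" using endsD(2)[OF e True cK] endsD(2)[OF e vC cK] i by auto
  let ?X = "h ` e (h -` C)"
  have E: "e (h -` C):components (- (h -` C))" by (rule endsD(1)[OF e vC])
  have X1: "connected ?X" "?X <= - C"
   using connected_continuous_image[OF cont_subset[OF h(2) subset_UNIV] in_components_connected[OF E]] in_components_subset[OF E] by auto
  have m: "?X Int e C ~= {}" using meet sub by blast
  have 1: "?X <= e C" by (rule components_maximal[OF endsD(1)[OF e True] X1]) (use m in blast)
  have "inv h ` e C <= e (h -` C)" proof (rule components_maximal[OF E])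
   show "connected (inv h ` e C)" by (rule connected_continuous_image[OF cont_subset[OF h(3) subset_UNIV] in_components_connected[OF endsD(1)[OF e True]]])
   show "inv h ` e C <= - (h -` C)" using in_components_subset[OF endsD(1)[OF e True]] h(1) by (auto simp: bij_is_surj surj_f_inv_f)
   have "inv h (h p) = p" for p using h(1) by (simp add: bij_is_inj)
   thus "e (h -` C) Int inv h ` e C ~= {}" using meet sub by (metis (no_types, lifting) disjoint_iff imageI subsetD)
  qed
  hence "h ` inv h ` e C <= ?X" by (rule image_mono)
  hence "e C <= ?X" using h(1) by (simp add: image_f_inv_f bij_is_surj)
  hence "?X = e C" using 1 by blast
  thus ?thesis unfolding end_action_def using True by simp
 qed
qed

definition vcharge :: "(('a set => 'a set) set => real) => nat \<times> 'a set => real"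
 where "vcharge c x = (if x:V then c (end_comp (fst x) (snd x)) else 0)"

text \<open>The charge is conserved along the tree: the ends through a component split among its
  children, apart from finite ends, and the total charge at a root is zero.\<close>

lemma vcharge:
 assumes c: "c:charges_on om" and x: "x:V"
 shows "fst x = 0 ==> vcharge c x = 0" "(SUM y:kids x. vcharge c y) = vcharge c x"
proof -
 assume l: "fst x = 0"
 have "components (- K 0) = {UNIV}" using components_eq_sing_iff[of "UNIV :: 'a set"] conn by (simp add: K_0)
 hence "snd x = UNIV" "e (K 0) = UNIV" if "e:ends" for e using V_facts(6)[OF x] l endsD(1)[OF that cK[of 0]] by auto
 hence "end_comp (fst x) (snd x) = ends" unfolding end_comp_def using l by auto
 thus "vcharge c x = 0" using c x unfolding vcharge_def charges_on_def by simp
next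
 let ?j = "Suc (fst x)"
 let ?A = "{W:components (- K ?j). W <= snd x}"
 have sub: "snd x:components (- K (fst x))" by (rule V_facts(6)[OF x])
 have "end_comp (fst x) (snd x) = {e:ends. e (K ?j):?A}" proof (intro equalityI subsetI)
  fix e assume "e:end_comp (fst x) (snd x)"
  hence e: "e:ends" "e (K (fst x)) = snd x" unfolding end_comp_def by auto
  thus "e:{e:ends. e (K ?j):?A}" using endsD(1)[OF e(1) cK[of ?j]] endsD(2)[OF e(1) cK cK K_mono[of "fst x" ?j]] by auto
 next
  fix e assume "e:{e:ends. e (K ?j):?A}"
  hence e: "e:ends" "e (K ?j) <= snd x" by auto
  have "e (K ?j) <= e (K (fst x))" by (rule endsD(2)[OF e(1) cK cK K_mono]) simp
  hence "e (K (fst x)) = snd x" using components_eq[OF endsD(1)[OF e(1) cK] sub] e(2) endsD(3)[OF e(1) cK[of ?j]] by blast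
  thus "e:end_comp (fst x) (snd x)" using e(1) unfolding end_comp_def by simp
 qed
 hence "vcharge c x = (SUM W:?A Int icomps (K ?j). c (end_comp ?j W))" using charge_fibre[OF c, of ?A ?j] x unfolding vcharge_def by auto
 also have "... = (SUM y:kids x. vcharge c y)" proof (rule sum.reindex_bij_witness[where i=snd and j="Pair ?j"])
  fix W assume W: "W:?A Int icomps (K ?j)"
  thus "(?j, W):kids x" using kids_iff[OF x] unfolding V_def by simp
  thus "vcharge c (?j, W) = c (end_comp ?j W)" using kids(1) unfolding vcharge_def by simp
 next
  fix y assume y: "y:kids x"
  hence yV: "y:V" "fst y = ?j" "snd y <= snd x" using kids_iff[OF x] by auto
  thus "(?j, snd y) = y" by (simp add: prod_eq_iff)
  show "snd y:?A Int icomps (K ?j)" using V_facts(6,7)[OF yV(1)] yV by simp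
 qed simp
 finally show "(SUM y:kids x. vcharge c y) = vcharge c x" ..
qed

text \<open>The parameters of \<open>H\<close> are real functions on all pairs of level and set,
  with the product topology. Each line coefficient depends on finitely many values of the charge, so
  the coefficients are continuous in \<open>c\<close>, and by \<open>line_coeff_flow\<close> they
  produce the flux \<open>c\<close> through every component of the tree, which determines the end
  charge.\<close>

lemma section_exists:
 "EX s. continuous_map (charges_on_topology om) (subtopology compact_open_topology (homeos_rel_boundary_1 n om)) s &
  (ALL c:charges_on om. end_charge_hom om (s c) = c) & s zero_charge = id"
proof -
 obtain H where H: "ffamily (%_. 0) V H (%p x. if fst x = 0 then 0 else
  (if rtop x:Lines then p (rtop x) else 0) - (case owner x of None => 0 | Some v => SUM w:lines v. p w))"
  using total_family by (elim exE)
 hence hf: "hfamily H" and sup: "sfamily (UN x:V. Dv x) H" and H0: "!!p. H (%_. 0) p = p"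
  and psh: "!!q. pushes om (H q) (%p. 1) (%p. 1)" unfolding ffamily_def by blast+
 have flux: "has_flux om (H q) (snd x) (if fst x = 0 then 0 else
  (if rtop x:Lines then q (rtop x) else 0) - (case owner x of None => 0 | Some v => SUM w:lines v. q w))" if "x:V" for q x
  using H that unfolding ffamily_def by blast
 note hd = hfamilyD[OF hf]
 have ms: "emeasure om (H q ` B) = emeasure om B" if "B:sets borel" for q B using bspec[OF psh[of q, unfolded pushes_def] that] by simp
 have pres: "H q:preserving_homeos om" for q proof -
  have "homeomorphic_maps euclidean euclidean (H q) (inv (H q))" unfolding homeomorphic_maps_def using hd(4-7) by simp
  hence "homeomorphic_map euclidean euclidean (H q)" by (rule homeomorphic_maps_imp_map)
  thus ?thesis unfolding preserving_homeos_def using ms by simp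
 qed
 have rel: "H q:homeos_rel_boundary n om" for q proof -
  have "H q x = x" if "x:manifold_boundary n euclidean" for x proof -
   have "x~:(UN x:V. Dv x)" using that region(4) unfolding manifold_boundary_def by blast
   thus ?thesis using sup unfolding sfamily_def by blast
  qed
  thus ?thesis using pres unfolding homeos_rel_boundary_def by simp
 qed
 have cH: "continuous_map euclidean (subtopology compact_open_topology (homeos_rel_boundary n om)) H"
  using hfamily_compact_open[OF hf] rel by (simp add: continuous_map_in_subtopology image_subset_iff)
 \<comment> \<open>Scaling the parameters by \<open>t\<close> joins \<open>H q\<close> to the
   identity within the homeomorphisms that preserve the measure and fix the boundary.\<close>
 have H1: "H q:homeos_rel_boundary_1 n om" for q proof -
  have "cont (%t w. t * q w)" by (intro cont_fun continuous_intros)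
  hence "continuous_map (subtopology euclideanreal {0..1}) euclidean (%t w. t * q w)" by (intro continuous_map_from_subtopology) simp
  from continuous_map_compose[OF this cH]
  have "pathin (subtopology compact_open_topology (homeos_rel_boundary n om)) (%t. H (%w. t * q w))" unfolding pathin_def by (simp add: comp_def)
  thus ?thesis unfolding homeos_rel_boundary_1_def path_component_of_def using H0 by (intro CollectI exI[of _ "%t. H (%w. t * q w)"]) auto
 qed
 define s where "s c = H (%w. line_coeff (vcharge c) w)" for c
 have ec: "end_comp i U:clopen_ends" for i U unfolding end_comp_def by (rule clopen_end_fibre[OF cK])
 have cont: "continuous_map (charges_on_topology om) (subtopology compact_open_topology (homeos_rel_boundary_1 n om)) s" proof -
  have "continuous_map (charges_on_topology om) euclideanreal (%c. vcharge c x)" for x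
   using continuous_map_charge_eval[OF ec, of om "fst x" "snd x"] unfolding vcharge_def by (cases "x:V") simp_all
  hence "continuous_map (charges_on_topology om) euclidean (%c w. line_coeff (vcharge c) w)"
   unfolding euclidean_product_topology[symmetric] continuous_map_componentwise_UNIV by (intro allI continuous_map_line_coeff)
  from continuous_map_compose[OF this hfamily_compact_open[OF hf]]
  show ?thesis using H1 unfolding s_def[abs_def] by (simp add: comp_def continuous_map_in_subtopology image_subset_iff)
 qed
 have s0: "s zero_charge = id" proof -
  have "vcharge zero_charge x = 0" for x unfolding vcharge_def zero_charge_def using ec by simp
  hence "(%w. line_coeff (vcharge zero_charge) w) = (%_. 0)" by (intro ext line_coeff_zero)
  hence "s zero_charge = H (%_. 0)" unfolding s_def by (rule arg_cong[of _ _ H])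
  also have "... = id" by (rule ext) (simp add: H0)
  finally show ?thesis .
 qed
 have "end_charge_hom om (s c) = c" if c: "c:charges_on om" for c proof -
  have fl: "has_flux om (s c) U (c (end_comp i U))" if U: "U:icomps (K i)" for i U proof -
   have x: "(i, U):V" using U unfolding V_def by simp
   have "(if i = 0 then 0 else (if rtop (i, U):Lines then line_coeff (vcharge c) (rtop (i, U)) else 0) -
    (case owner (i, U) of None => 0 | Some v => SUM w:lines v. line_coeff (vcharge c) w)) = vcharge c (i, U)"
    using line_coeff_flow[OF x, of "vcharge c"] vcharge[OF c] vcharge(1)[OF c x] by (cases "i = 0") simp_all
   thus ?thesis using flux[OF x, of "%w. line_coeff (vcharge c) w"] x unfolding s_def vcharge_def by simp
  qed
  have im: "s c ` B:sets borel" if "B:sets borel" for B unfolding s_def by (rule hfamily_borel(1)[OF hf that])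
  have "end_action (s c) e = e" if "e:ends" for e by (rule end_action_fixed[OF _ _ _ _ fl im that]) (use hd(3,6,7) sup in "simp_all add: s_def sfamily_def")
  hence ef: "s c:end_fixing_homeos om" unfolding end_fixing_homeos_def using pres unfolding s_def by simp
  have val: "measure om (C - s c ` C) - measure om (s c ` C - C) = c (ends_of C)" if "C:sets borel" "compact (frontier C)" for C
   by (rule flux_charge[OF c _ im _ fl that]) (use hd(3) ms in "simp_all add: s_def bij_is_inj")
  have "end_charge_hom om (s c) F = c F" for F proof (cases "F:clopen_ends")
   case True
   obtain C where C: "C:sets borel" "compact (frontier C)" "ends_of C = F" using clopen_realized[OF True] by blast
   have "(THE r. ALL C. C:sets borel & compact (frontier C) & ends_of C = F --> r = measure om (C - s c ` C) - measure om (s c ` C - C)) = c F"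
    by (rule the_equality) (use val C in auto)
   thus ?thesis unfolding end_charge_hom_def using True ef by simp
  next
   case False
   thus ?thesis using c ef unfolding end_charge_hom_def charges_on_def end_charges_def extensional_def by simp
  qed
  thus ?thesis by (rule ext)
 qed
 thus ?thesis using cont s0 by (intro exI[of _ s]) blast
qed

end

theorem theorem1p1:
 fixes n :: nat and \<omega> :: "'a::metric_space measure"
 assumes "manifold_with_boundary n (euclidean :: 'a topology)"
  and "connected (UNIV :: 'a set)"
  and "\<not> compact (UNIV :: 'a set)"
  and "radon_measure \<omega>"
  and "good_measure \<omega>"
  and "emeasure \<omega> (manifold_boundary n euclidean) = 0"
 shows "\<exists>s. continuous_map (charges_on_topology \<omega>)
       (subtopology compact_open_topology (homeos_rel_boundary_1 n \<omega>)) s \<and>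
      (\<forall>c\<in>charges_on \<omega>. end_charge_hom \<omega> (s c) = c) \<and>
      s zero_charge = id"
proof -
 interpret manifold_measure n \<omega> by (rule manifold_measure.intro) (fact assms)+
 obtain K D where K: "ALL i. compact (K i)" "K (0::nat) = {}" "ALL i. K i <= interior (K (Suc i))" "ALL L. compact L --> (EX i. L <= K i)"
  and D: "ALL i. ALL U:icomps (K i). bsupp U <= interior (K (Suc i)) & compact (D i U) & D i U <= U Int I Int interior (K (Suc (Suc i))) &
   blocks (nbhd_comps U (K (Suc i))) (D i U)"
  using exhaustion by (elim exE conjE)
 interpret exhausted_manifold n \<omega> K D
 proof
  show "compact (K i)" "K 0 = {}" "K i <= interior (K (Suc i))" for i using K(1-3) by simp_all
  show "compact L ==> EX i. L <= K i" for L using K(4) by simp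
  fix i U assume "U:icomps (K i)"
  thus "bsupp U <= interior (K (Suc i))" "compact (D i U)" "D i U <= U Int I Int interior (K (Suc (Suc i)))"
   "blocks (nbhd_comps U (K (Suc i))) (D i U)" using D by simp_all
 qed
 show ?thesis by (rule section_exists)
qed

end
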